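(* Let $0<\delta<1$ and let $u_0\in L^2(\mathbb{R})\cap C^{1+\delta}(\mathbb{R})$. Suppose there exists a point $\beta_0\in\mathbb{R}$ with $$Hu_0(\beta_0)>0$$ such that $$u_0(\beta_0)\geq \left(32\pi\,\|u_0\|_{L^2(\mathbb{R})}^2\right)^{1/3}.$$ Let $u(x,t)$ be the solution of the Burgers–Hilbert equation $$u_t+uu_x=Hu,\qquad u(x,0)=u_0(x),\qquad x\in\mathbb{R},\ t\ge 0.$$ Then there is a finite time $T$ such that $$\lim_{t\to T}\|u(\cdot,t)\|_{C^{1+\delta}(\mathbb{R})}=\infty.$$
   Context: $H$ denotes the Hilbert transform on $\mathbb{R}$, $Hf(x)=\frac1\pi\,\mathrm{P.V.}\int_{\mathbb{R}}\frac{f(y)}{x-y}\,dy$. $C^{1+\delta}(\mathbb{R})$ is the usual Hölder space with its usual norm. Solutions are considered in the class $u\in C([0,T'),C^{1+\delta}(\mathbb{R}))$ on their time intervals of existence $[0,T')$, with $u(\cdot,t)\in L^2(\mathbb{R})$; the $L^2$ norm is conserved by the equation: $\|u(\cdot,t)\|_{L^2(\mathbb{R})}=\|u_0\|_{L^2(\mathbb{R})}$. *)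

theory Defs
  imports "HOL-Analysis.Analysis"
begin

definition L2_space :: "(real \<Rightarrow> real) set" where
  "L2_space = {f. f \<in> borel_measurable lborel \<and> integrable lborel (\<lambda>x. (f x)\<^sup>2)}"

definition L2_norm :: "(real \<Rightarrow> real) \<Rightarrow> real" where
  "L2_norm f = sqrt (LINT x|lborel. (f x)\<^sup>2)"

text \<open>For \<open>f\<close> in the intersection of \<open>L\<^sup>2\<close> and \<open>C\<^sup>1\<^sup>+\<^sup>\<delta>\<close> the truncated integrals are absolutely convergent
  (Cauchy--Schwarz at infinity) and the limit exists at every point, so \<open>Lim\<close> is the principal value.
  For other functions the value may be unspecified.\<close>

definition hilbert_transform :: "(real \<Rightarrow> real) \<Rightarrow> real \<Rightarrow> real" where
  "hilbert_transform f x =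
     1 / pi * Lim (at_right 0) (\<lambda>\<epsilon>. LINT y:{y. \<bar>x - y\<bar> > \<epsilon>}|lborel. f y / (x - y))"

text \<open>The space \<open>C\<^sup>1\<^sup>+\<^sup>\<delta>\<close> on the line: \<open>f\<close> and its derivative are bounded and the derivative is
  globally Hoelder continuous with exponent \<open>\<delta>\<close>.\<close>

definition C1_holder :: "real \<Rightarrow> (real \<Rightarrow> real) set" where
  "C1_holder \<delta> = {f. (\<forall>x. f differentiable (at x)) \<and> bounded (range f) \<and> bounded (range (deriv f)) \<and>
     (\<exists>C. \<forall>x y. \<bar>deriv f x - deriv f y\<bar> \<le> C * \<bar>x - y\<bar> powr \<delta>)}"

text \<open>The suprema below are suprema of real sets, hence meaningful only for functions in
  \<^term>\<open>C1_holder \<delta>\<close>, for which these sets are bounded.\<close>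

definition holder_seminorm :: "real \<Rightarrow> (real \<Rightarrow> real) \<Rightarrow> real" where
  "holder_seminorm \<delta> g = (SUP (x, y)\<in>{(x, y). x \<noteq> y}. \<bar>g x - g y\<bar> / \<bar>x - y\<bar> powr \<delta>)"

definition C1_holder_norm :: "real \<Rightarrow> (real \<Rightarrow> real) \<Rightarrow> real" where
  "C1_holder_norm \<delta> f = (SUP x. \<bar>f x\<bar>) + (SUP x. \<bar>deriv f x\<bar>) + holder_seminorm \<delta> (deriv f)"

definition time_interval :: "ereal \<Rightarrow> real set" where
  "time_interval T = {t. 0 \<le> t \<and> ereal t < T}"

text \<open>A solution on \<open>[0, T)\<close> with \<open>0 < T \<le> \<infinity>\<close>: \<open>u\<close> is in \<open>C([0, T), C\<^sup>1\<^sup>+\<^sup>\<delta>)\<close> (for the norm topology), each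
  \<open>u(\<cdot>, t)\<close> is in \<open>L\<^sup>2\<close>, and the equation holds pointwise; the time derivative at \<open>t = 0\<close> is
  one-sided. Values of \<open>u x t\<close> for \<open>t\<close> outside \<open>[0, T)\<close> are irrelevant.\<close>

definition burgers_hilbert_solution ::
    "real \<Rightarrow> (real \<Rightarrow> real) \<Rightarrow> ereal \<Rightarrow> (real \<Rightarrow> real \<Rightarrow> real) \<Rightarrow> bool" where
  "burgers_hilbert_solution \<delta> u0 T u \<longleftrightarrow>
     0 < T \<and>
     (\<forall>t\<in>time_interval T. (\<lambda>x. u x t) \<in> L2_space \<inter> C1_holder \<delta>) \<and>
     (\<forall>s\<in>time_interval T.
        ((\<lambda>t. C1_holder_norm \<delta> (\<lambda>x. u x t - u x s)) \<longlongrightarrow> 0) (at s within time_interval T)) \<and>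
     (\<forall>x. u x 0 = u0 x) \<and>
     (\<forall>t\<in>time_interval T. \<forall>x.
        ((\<lambda>\<tau>. u x \<tau>) has_real_derivative
           hilbert_transform (\<lambda>y. u y t) x - u x t * deriv (\<lambda>y. u y t) x)
          (at t within time_interval T))"

definition maximal_burgers_hilbert_solution ::
    "real \<Rightarrow> (real \<Rightarrow> real) \<Rightarrow> ereal \<Rightarrow> (real \<Rightarrow> real \<Rightarrow> real) \<Rightarrow> bool" where
  "maximal_burgers_hilbert_solution \<delta> u0 T u \<longleftrightarrow>
     burgers_hilbert_solution \<delta> u0 T u \<and>
     \<not> (\<exists>S v. T < S \<and> burgers_hilbert_solution \<delta> u0 S v \<and>
            (\<forall>t\<in>time_interval T. \<forall>x. v x t = u x t))"

end

theory Submission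
 imports Defs
begin

text \<open>
 Along a characteristic \<open>X' = u(X, t)\<close> the velocity \<open>V = u(X, t)\<close> satisfies \<open>V' = H u\<close> and
 \<open>V'' = - V + G\<close>, where \<open>G = (2 \<pi>)\<^sup>-\<^sup>1 \<parallel>(u - u(X)) / (\<cdot> - X)\<parallel>\<^sup>2\<close> in \<open>L\<^sup>2\<close>: the term \<open>- V\<close> is \<open>H (H u)\<close>,
 and \<open>G\<close> is the commutator of \<open>H\<close> with \<open>u \<partial>\<^sub>x\<close> applied to \<open>u\<close>, whose kernel is a square (\<open>characteristic_acceleration\<close>).
 A point where \<open>u\<close> is large forces \<open>G\<close> to be large, because \<open>u\<close> has the fixed \<open>L\<^sup>2\<close> norm of its
 initial value (\<open>Gfun_lower_bound\<close>, \<open>bsol_L2_conserved\<close>). The size assumption therefore gives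
 \<open>V'' \<ge> k V\<^sup>2\<close> as long as \<open>V\<close> does not drop below its initial value, and with \<open>V' > 0\<close> initially such a \<open>V\<close>
 cannot exist for all times (\<open>convex_blowup_time\<close>, \<open>lifespan_finite\<close>).

 It remains to see that at the end \<open>T\<close> of a finite maximal lifespan the norm tends to infinity, and is
 not merely unbounded. If it stayed below a bound at times arbitrarily close to \<open>T\<close>, a local solution
 with an existence time depending only on that bound (\<open>local_existence\<close>) would pass beyond \<open>T\<close>
 and agree with \<open>u\<close> before (\<open>bsol_unique\<close>).

 The delicate point is that a solution has to be continuous in time in the norm of \<open>C\<^sup>1\<^sup>+\<^sup>\<delta>\<close>. Transport
 is not continuous in this norm for general data, so the continuity before \<open>T\<close> has to be used.
 It says that the slope \<open>u\<^sub>x\<close> is little-Hoelder at scales that are small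
 compared with the distance a particle moves (\<open>flat_start\<close>). That distance is comparable, uniformly in the
 particle, with \<open>\<bar>V\<bar> + \<bar>V'\<bar> + G\<close> at the initial time (\<open>V_le_motion\<close>, \<open>displacement_ge_motion\<close>), since \<open>G\<close> varies
 at most by a factor (\<open>G_comparable\<close>). The local nature of the two-scale estimate for \<open>\<Lambda> = H \<partial>\<^sub>x\<close>
 propagates the property in time (\<open>flat_step\<close>), and it implies continuity in the norm
 (\<open>slope_continuous\<close>, \<open>bsol_norm_continuous\<close>).
\<close>

section \<open>Square-integrable functions on the line\<close>

lemma L2_space_iff:
 "f \<in> L2_space \<longleftrightarrow> f \<in> borel_measurable borel & integrable lborel (%x. (f x)\<^sup>2)"
 by (simp add: L2_space_def)

lemma L2_space_measurable [measurable_dest]: "f \<in> L2_space ==> f \<in> borel_measurable borel"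
 by (simp add: L2_space_def)

lemma L2_space_integrable: "f \<in> L2_space ==> integrable lborel (%x. (f x)\<^sup>2)"
 by (simp add: L2_space_def)

lemma L2_norm_nonneg [simp]: "0 <= L2_norm f"
 by (simp add: L2_norm_def)

lemma L2_norm_squared: "(L2_norm f)\<^sup>2 = (LINT x|lborel. (f x)\<^sup>2)"
 by (simp add: L2_norm_def)

lemma integrable_mult_L2:
 assumes "f \<in> L2_space" "g \<in> L2_space"
 shows "integrable lborel (%x. f x * g x)"
proof (rule Bochner_Integration.integrable_bound[of _ "%x. (f x)\<^sup>2 + (g x)\<^sup>2"])
 show "integrable lborel (%x. (f x)\<^sup>2 + (g x)\<^sup>2)"
  using assms by (simp add: L2_space_iff)
 show "(%x. f x * g x) \<in> borel_measurable lborel"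
  using assms by (auto simp: L2_space_iff)
 have "\<bar>a * b\<bar> <= a\<^sup>2 + b\<^sup>2" for a b :: real
 proof -
  have "0 <= (\<bar>a\<bar> - \<bar>b\<bar>)\<^sup>2 + a\<^sup>2 + b\<^sup>2" by simp
  then show ?thesis by (simp add: power2_diff abs_mult)
 qed
 then show "AE x in lborel. norm (f x * g x) <= norm ((f x)\<^sup>2 + (g x)\<^sup>2)"
  by simp
qed

lemma L2_space_cmult: "f \<in> L2_space ==> (%x. c * f x) \<in> L2_space"
 by (auto simp: L2_space_iff power_mult_distrib)

lemma L2_space_add:
 assumes "f \<in> L2_space" "g \<in> L2_space"
 shows "(%x. f x + g x) \<in> L2_space"
proof -
 have "integrable lborel (%x. (f x)\<^sup>2 + (g x)\<^sup>2 + 2 * (f x * g x))"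
  using assms integrable_mult_L2[OF assms] by (simp add: L2_space_iff)
 then show ?thesis
  using assms by (auto simp: L2_space_iff power2_sum algebra_simps)
qed

lemma L2_space_uminus: "f \<in> L2_space ==> (%x. - f x) \<in> L2_space"
 using L2_space_cmult[of f "-1"] by simp

lemma L2_space_diff:
 assumes "f \<in> L2_space" "g \<in> L2_space"
 shows "(%x. f x - g x) \<in> L2_space"
 using L2_space_add[OF assms(1) L2_space_uminus[OF assms(2)]] by simp

lemma L2_space_mult_bounded:
 assumes "f \<in> L2_space" and [measurable]: "g \<in> borel_measurable borel" and g: "!!x. \<bar>g x\<bar> <= B"
 shows "(%x. g x * f x) \<in> L2_space" and "L2_norm (%x. g x * f x) <= B * L2_norm f"
proof -
 note [measurable] = L2_space_measurable[OF assms(1)]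
 have B: "0 <= B" using g[of 0] by linarith
 have le: "(g x * f x)\<^sup>2 <= B\<^sup>2 * (f x)\<^sup>2" for x
  unfolding power_mult_distrib
  using g[of x] B by (intro mult_right_mono) (auto simp: abs_le_square_iff[symmetric])
 have i: "integrable lborel (%x. B\<^sup>2 * (f x)\<^sup>2)"
  using L2_space_integrable[OF assms(1)] by simp
 have i2: "integrable lborel (%x. (g x * f x)\<^sup>2)"
  by (rule Bochner_Integration.integrable_bound[OF i]) (use le in auto)
 then show "(%x. g x * f x) \<in> L2_space" by (simp add: L2_space_iff)
 have "(LINT x|lborel. (g x * f x)\<^sup>2) <= (LINT x|lborel. B\<^sup>2 * (f x)\<^sup>2)"
  by (rule integral_mono[OF i2 i le])
 then have "(L2_norm (%x. g x * f x))\<^sup>2 <= (B * L2_norm f)\<^sup>2"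
  by (simp add: L2_norm_squared power_mult_distrib)
 then show "L2_norm (%x. g x * f x) <= B * L2_norm f"
  by (rule power2_le_imp_le) (simp add: B)
qed

lemma L2_norm_cmult: "L2_norm (%x. c * f x) = \<bar>c\<bar> * L2_norm f"
 by (simp add: L2_norm_def power_mult_distrib real_sqrt_mult)

lemma L2_Cauchy_Schwarz:
 assumes f: "f \<in> L2_space" and g: "g \<in> L2_space"
 shows "\<bar>LINT x|lborel. f x * g x\<bar> <= L2_norm f * L2_norm g"
proof -
 define A where "A = (LINT x|lborel. (f x)\<^sup>2)"
 define B where "B = (LINT x|lborel. f x * g x)"
 define C where "C = (LINT x|lborel. (g x)\<^sup>2)"
 note i = L2_space_integrable[OF f] L2_space_integrable[OF g] integrable_mult_L2[OF f g]
 have q: "0 <= A - 2 * t * B + t\<^sup>2 * C" for t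
 proof -
  have "0 <= (LINT x|lborel. (f x - t * g x)\<^sup>2)" by simp
  also have "(%x. (f x - t * g x)\<^sup>2) = (%x. ((f x)\<^sup>2 - 2 * t * (f x * g x)) + t\<^sup>2 * (g x)\<^sup>2)"
   by (auto simp: power2_diff power_mult_distrib algebra_simps)
  also have "(LINT x|lborel. ((f x)\<^sup>2 - 2 * t * (f x * g x)) + t\<^sup>2 * (g x)\<^sup>2) = A - 2 * t * B + t\<^sup>2 * C"
   using i by (simp add: A_def B_def C_def)
  finally show ?thesis .
 qed
 have C0: "0 <= C" by (simp add: C_def)
 have "B\<^sup>2 <= A * C"
 proof (cases "C = 0")
  case True
  have "B = 0"
  proof (rule ccontr)
   assume "B ~= 0"
   then show False using q[of "(A + 1) / (2 * B)"] True by (simp add: field_simps)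
  qed
  then show ?thesis using True by simp
 next
  case False
  with C0 have C: "C > 0" by simp
  then show ?thesis using q[of "B / C"] by (simp add: field_simps power2_eq_square)
 qed
 then have "sqrt (B\<^sup>2) <= sqrt (A * C)" by (rule real_sqrt_le_mono)
 then show ?thesis by (simp add: L2_norm_def A_def B_def C_def real_sqrt_mult)
qed

lemma L2_norm_abs [simp]: "L2_norm (%x. \<bar>f x\<bar>) = L2_norm f"
 by (simp add: L2_norm_def)

lemma L2_space_abs: "f \<in> L2_space ==> (%x. \<bar>f x\<bar>) \<in> L2_space"
 by (auto simp: L2_space_iff)

lemma L2_Cauchy_Schwarz_abs:
 assumes f: "f \<in> L2_space" and g: "g \<in> L2_space"
 shows "(LINT x|lborel. \<bar>f x * g x\<bar>) <= L2_norm f * L2_norm g"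
 using L2_Cauchy_Schwarz[OF L2_space_abs[OF f] L2_space_abs[OF g]] by (simp add: abs_mult)

lemma L2_norm_triangle:
 assumes f: "f \<in> L2_space" and g: "g \<in> L2_space"
 shows "L2_norm (%x. f x + g x) <= L2_norm f + L2_norm g"
proof (rule power2_le_imp_le)
 note i = L2_space_integrable[OF f] L2_space_integrable[OF g] integrable_mult_L2[OF f g]
 have "(L2_norm (%x. f x + g x))\<^sup>2 = (LINT x|lborel. (f x)\<^sup>2 + 2 * (f x * g x) + (g x)\<^sup>2)"
  unfolding L2_norm_squared by (rule Bochner_Integration.integral_cong) (auto simp: power2_sum)
 also have "... = (L2_norm f)\<^sup>2 + 2 * (LINT x|lborel. f x * g x) + (L2_norm g)\<^sup>2"
  using i by (simp add: L2_norm_squared)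
 also have "... <= (L2_norm f + L2_norm g)\<^sup>2"
  using L2_Cauchy_Schwarz[OF f g] by (simp add: power2_sum)
 finally show "(L2_norm (%x. f x + g x))\<^sup>2 <= (L2_norm f + L2_norm g)\<^sup>2" .
qed simp

lemma L2_norm_uminus [simp]: "L2_norm (%x. - f x) = L2_norm f"
 by (simp add: L2_norm_def)

lemma L2_norm_minus_commute: "L2_norm (%x. f x - g x) = L2_norm (%x. g x - f x)"
 by (simp add: L2_norm_def power2_commute)

lemma L2_norm_triangle_diff:
 assumes f: "f \<in> L2_space" and g: "g \<in> L2_space"
 shows "L2_norm (%x. f x - g x) <= L2_norm f + L2_norm g"
 using L2_norm_triangle[OF f L2_space_uminus[OF g]] by simp

lemma L2_norm_le_diff:
 assumes f: "f \<in> L2_space" and g: "g \<in> L2_space"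
 shows "L2_norm f <= L2_norm g + L2_norm (%x. f x - g x)"
 using L2_norm_triangle[OF g L2_space_diff[OF f g]] by simp

lemma L2_nn_integral:
 assumes "f \<in> L2_space"
 shows "(\<integral>\<^sup>+x. ennreal ((f x)\<^sup>2) \<partial>lborel) = ennreal ((L2_norm f)\<^sup>2)"
 using assms by (simp add: L2_norm_squared L2_space_iff nn_integral_eq_integral)

lemma L2I_nn_integral:
 assumes [measurable]: "f \<in> borel_measurable borel" and "0 <= A"
  and "(\<integral>\<^sup>+x. ennreal ((f x)\<^sup>2) \<partial>lborel) <= ennreal (A\<^sup>2)"
 shows "f \<in> L2_space" and "L2_norm f <= A"
proof -
 have "integrable lborel (%x. (f x)\<^sup>2)"
  using assms(3) by (intro integrableI_bounded) (auto intro: le_less_trans)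
 then show f: "f \<in> L2_space" by (simp add: L2_space_iff)
 have "ennreal ((L2_norm f)\<^sup>2) <= ennreal (A\<^sup>2)" using assms(3) L2_nn_integral[OF f] by simp
 then have "(L2_norm f)\<^sup>2 <= A\<^sup>2" by simp
 then show "L2_norm f <= A" using \<open>0 <= A\<close> by (rule power2_le_imp_le)
qed

lemma L2_Fatou:
 assumes f: "!!n. f n \<in> L2_space" and bound: "!!n. L2_norm (f n) <= A"
  and lim: "AE x in lborel. (%n. f n x) \<longlonglongrightarrow> g x" and [measurable]: "g \<in> borel_measurable borel"
 shows "g \<in> L2_space" and "L2_norm g <= A"
proof -
 note [measurable] = L2_space_measurable[OF f]
 have A: "0 <= A" using bound[of 0] L2_norm_nonneg[of "f 0"] by linarith
 have "(\<integral>\<^sup>+x. ennreal ((g x)\<^sup>2) \<partial>lborel) = (\<integral>\<^sup>+x. liminf (%n. ennreal ((f n x)\<^sup>2)) \<partial>lborel)"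
 proof (rule nn_integral_cong_AE, use lim in eventually_elim)
  case (elim x)
  then have "(%n. ennreal ((f n x)\<^sup>2)) \<longlonglongrightarrow> ennreal ((g x)\<^sup>2)"
   by (intro tendsto_intros)
  then show ?case by (metis lim_imp_Liminf sequentially_bot)
 qed
 also have "... <= liminf (%n. \<integral>\<^sup>+x. ennreal ((f n x)\<^sup>2) \<partial>lborel)"
  by (rule nn_integral_liminf) simp
 also have "... <= ennreal (A\<^sup>2)"
 proof (rule Liminf_le)
  show "\<forall>\<^sub>F n in sequentially. (\<integral>\<^sup>+x. ennreal ((f n x)\<^sup>2) \<partial>lborel) <= ennreal (A\<^sup>2)"
   using bound by (simp add: L2_nn_integral[OF f] power_mono)
 qed simp
 finally show "g \<in> L2_space" "L2_norm g <= A"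
  using L2I_nn_integral[of g A] A by simp_all
qed

lemma L2_space_affine:
 assumes "f \<in> L2_space" "c ~= 0"
 shows "(%x. f (t + c * x)) \<in> L2_space" and "L2_norm (%x. f (t + c * x)) = L2_norm f / sqrt \<bar>c\<bar>"
proof -
 note [measurable] = L2_space_measurable[OF assms(1)]
 show "(%x. f (t + c * x)) \<in> L2_space"
  using assms lborel_integrable_real_affine[of "%x. (f x)\<^sup>2" c t] by (simp add: L2_space_iff)
 have "(LINT x|lborel. (f x)\<^sup>2) = \<bar>c\<bar> * (LINT x|lborel. (f (t + c * x))\<^sup>2)"
  using lborel_integral_real_affine[OF assms(2), of "%x. (f x)\<^sup>2" t] by simp
 then show "L2_norm (%x. f (t + c * x)) = L2_norm f / sqrt \<bar>c\<bar>"
  using assms(2) by (simp add: L2_norm_def real_sqrt_mult)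
qed

lemma L2_space_reflect:
 assumes "f \<in> L2_space"
 shows "(%x. f (t - x)) \<in> L2_space" and "L2_norm (%x. f (t - x)) = L2_norm f"
 using L2_space_affine[OF assms, of "-1" t] by simp_all

lemma L2_space_shift:
 assumes "f \<in> L2_space"
 shows "(%x. f (t + x)) \<in> L2_space" and "L2_norm (%x. f (t + x)) = L2_norm f"
 using L2_space_affine[OF assms, of 1 t] by simp_all

text \<open>Cutting off to a bounded interval gives an approximation in \<open>L\<^sup>2\<close> by functions that
 are also integrable, for which Fubini's theorem is directly applicable.\<close>

definition trunc :: "nat => (real => real) => real => real" where
 "trunc n f x = indicator {- real n..real n} x * f x"

lemma trunc_measurable [measurable]: "f \<in> borel_measurable borel ==> trunc n f \<in> borel_measurable borel"
 unfolding trunc_def by measurable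

lemma trunc_L2:
 assumes "f \<in> L2_space"
 shows "trunc n f \<in> L2_space" "integrable lborel (trunc n f)" "L2_norm (trunc n f) <= L2_norm f"
proof -
 note [measurable] = L2_space_measurable[OF assms]
 show "trunc n f \<in> L2_space" "L2_norm (trunc n f) <= L2_norm f"
  using L2_space_mult_bounded[OF assms, of "indicator {- real n..real n}" 1]
  unfolding trunc_def by (auto simp: indicator_def)
 have "indicator {- real n..real n} \<in> L2_space"
 proof -
  have "(%x. (indicator {- real n..real n} x)\<^sup>2 :: real) = indicator {- real n..real n}"
   by (auto simp: indicator_def)
  then show ?thesis by (simp add: L2_space_iff)
 qed
 from integrable_mult_L2[OF this assms] show "integrable lborel (trunc n f)"
  by (simp add: trunc_def[abs_def])
qed

lemma trunc_tendsto: "(%n. trunc n f x) \<longlonglongrightarrow> f x"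
proof (rule tendsto_eventually)
 obtain N :: nat where "\<bar>x\<bar> <= real N" using real_arch_simple by blast
 then show "\<forall>\<^sub>F n in sequentially. trunc n f x = f x"
  by (auto simp: eventually_sequentially trunc_def indicator_def intro!: exI[of _ N])
qed

lemma L2_norm_trunc_diff:
 assumes "f \<in> L2_space"
 shows "(%n. L2_norm (%x. trunc n f x - f x)) \<longlonglongrightarrow> 0"
proof -
 note [measurable] = L2_space_measurable[OF assms]
 have "(%n. LINT x|lborel. (trunc n f x - f x)\<^sup>2) \<longlonglongrightarrow> (LINT x::real|lborel. 0)"
 proof (rule integral_dominated_convergence[where w="%x. (f x)\<^sup>2"])
  show "AE x in lborel. (%n. (trunc n f x - f x)\<^sup>2) \<longlonglongrightarrow> 0"
  proof (rule AE_I2)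
   fix x
   have "(%n. (trunc n f x - f x)\<^sup>2) \<longlonglongrightarrow> (f x - f x)\<^sup>2"
    by (intro tendsto_intros trunc_tendsto)
   then show "(%n. (trunc n f x - f x)\<^sup>2) \<longlonglongrightarrow> 0" by simp
  qed
  show "AE x in lborel. norm ((trunc n f x - f x)\<^sup>2) <= (f x)\<^sup>2" for n
   by (auto simp: trunc_def indicator_def)
 qed (use L2_space_integrable[OF assms] in auto)
 then have "(%n. sqrt (LINT x|lborel. (trunc n f x - f x)\<^sup>2)) \<longlonglongrightarrow> sqrt 0"
  by (intro tendsto_real_sqrt) simp
 then show ?thesis by (simp add: L2_norm_def)
qed

lemma L2_inner_tendsto:
 assumes f: "f \<in> L2_space" and g: "!!n. g n \<in> L2_space" "h \<in> L2_space"
  and lim: "(%n. L2_norm (%x. g n x - h x)) \<longlonglongrightarrow> 0"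
 shows "(%n. LINT x|lborel. f x * g n x) \<longlonglongrightarrow> (LINT x|lborel. f x * h x)"
proof (rule LIM_zero_cancel, rule Lim_null_comparison)
 show "(%n. L2_norm f * L2_norm (%x. g n x - h x)) \<longlonglongrightarrow> 0"
  using tendsto_mult_right_zero[OF lim] by simp
 have "(LINT x|lborel. f x * g n x) - (LINT x|lborel. f x * h x) = (LINT x|lborel. f x * (g n x - h x))" for n
  using integrable_mult_L2[OF f] g by (simp add: right_diff_distrib)
 then show "\<forall>\<^sub>F n in sequentially. norm ((LINT x|lborel. f x * g n x) - (LINT x|lborel. f x * h x))
   <= L2_norm f * L2_norm (%x. g n x - h x)"
  using L2_Cauchy_Schwarz[OF f L2_space_diff[OF g(1,2)]] by simp
qed

section \<open>Integrals over the line\<close>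

lemma integral_FTC_line:
 fixes F f :: "real => real"
 assumes F: "!!x. (F has_real_derivative f x) (at x)" and f: "continuous_on UNIV f"
  and int: "integrable lborel f" and A: "(F \<longlongrightarrow> A) at_bot" and B: "(F \<longlongrightarrow> B) at_top"
 shows "(LINT x|lborel. f x) = B - A"
proof -
 have "(LBINT x=-\<infinity>..\<infinity>. f x) = B - A"
 proof (rule interval_integral_FTC_integrable)
  show "((F \<circ> real_of_ereal) \<longlongrightarrow> A) (at_right (-\<infinity>))"
   using A by (simp add: ereal_tendsto_simps1)
  show "((F \<circ> real_of_ereal) \<longlongrightarrow> B) (at_left \<infinity>)"
   using B by (simp add: ereal_tendsto_simps1)
  show "set_integrable lborel (einterval (- \<infinity>) \<infinity>) f"
   using int by (simp add: set_integrable_def)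
 qed (use F f in \<open>auto simp: has_real_derivative_iff_has_vector_derivative continuous_on_eq_continuous_at\<close>)
 then show ?thesis
  by (simp add: interval_lebesgue_integral_def set_lebesgue_integral_def)
qed

lemma integral_FTC_line_nonneg:
 fixes F f :: "real => real"
 assumes F: "!!x. (F has_real_derivative f x) (at x)" and f: "continuous_on UNIV f"
  and nn: "!!x. 0 <= f x" and A: "(F \<longlongrightarrow> A) at_bot" and B: "(F \<longlongrightarrow> B) at_top"
 shows "integrable lborel f" "(LINT x|lborel. f x) = B - A"
proof -
 have *: "set_integrable lborel (einterval (-\<infinity>) \<infinity>) f"
  by (rule interval_integral_FTC_nonneg(1)[where F=F and A=A and B=B])
   (use F f nn A B in \<open>auto simp: ereal_tendsto_simps1 continuous_on_eq_continuous_at\<close>)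
 then show "integrable lborel f" by (simp add: set_integrable_def)
 from integral_FTC_line[OF F f this A B] show "(LINT x|lborel. f x) = B - A" .
qed

lemma integral_even:
 fixes g :: "real => real"
 assumes i: "set_integrable lborel {0<..} g" and even: "!!z. g (- z) = g z" and g0: "g 0 = 0"
 shows "integrable lborel g" "(LINT z|lborel. g z) = 2 * (LINT z:{0<..}|lborel. g z)"
proof -
 let ?h = "%z. indicator {0<..} z * g z"
 have h: "integrable lborel ?h" using i by (simp add: set_integrable_def)
 have h': "integrable lborel (%z. ?h (0 + (-1) * z))"
  by (rule lborel_integrable_real_affine[OF h]) simp
 have e: "g z = ?h z + ?h (0 + (-1) * z)" for z
  using even g0 by (cases "z = 0") (auto simp: indicator_def)
 show "integrable lborel g"
  by (subst e[abs_def]) (rule Bochner_Integration.integrable_add[OF h h'])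
 have "(LINT z|lborel. g z) = (LINT z|lborel. ?h z) + (LINT z|lborel. ?h (0 + (-1) * z))"
  by (subst e, rule Bochner_Integration.integral_add[OF h h'])
 also have "(LINT z|lborel. ?h (0 + (-1) * z)) = (LINT z|lborel. ?h z)"
  using lborel_integral_real_affine[of "-1" ?h 0] by simp
 finally show "(LINT z|lborel. g z) = 2 * (LINT z:{0<..}|lborel. g z)"
  by (simp add: set_lebesgue_integral_def)
qed

lemma powr_integral_near:
 fixes d r :: real
 assumes "0 < d" "0 < r"
 shows "integrable lborel (%z. indicator {-r<..<r} z * \<bar>z\<bar> powr (d - 1))"
  and "(LINT z|lborel. indicator {-r<..<r} z * \<bar>z\<bar> powr (d - 1)) = 2 * r powr d / d"
proof -
 let ?g = "%z::real. indicator {-r<..<r} z * \<bar>z\<bar> powr (d - 1)"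
 note FTC = interval_integral_FTC_nonneg[where F="%z. z powr d / d" and f="%z. z powr (d - 1)"
   and a=0 and b="ereal r" and A=0 and B="r powr d / d"]
 have prem: "(0::ereal) < ereal r" using assms by simp
 have 1: "0 < ereal x ==> ereal x < ereal r ==> DERIV (%z. z powr d / d) x :> x powr (d - 1)" for x
  using assms by (auto intro!: derivative_eq_intros simp: powr_diff)
 have 2: "0 < ereal x ==> ereal x < ereal r ==> isCont (%z. z powr (d - 1)) x" for x
  by (auto intro!: continuous_intros)
 have "((%z. z powr d / d) \<longlongrightarrow> 0 powr d / d) (at_right 0)"
  using assms by (intro tendsto_divide tendsto_powr2 tendsto_intros) (auto simp: eventually_at_filter)
 then have 3: "(((%z. z powr d / d) \<circ> real_of_ereal) \<longlongrightarrow> 0) (at_right 0)"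
  using assms by (simp add: zero_ereal_def ereal_tendsto_simps1)
 have "((%z. z powr d / d) \<longlongrightarrow> r powr d / d) (at_left r)"
  using assms by (intro tendsto_divide tendsto_powr tendsto_intros) auto
 then have 4: "(((%z. z powr d / d) \<circ> real_of_ereal) \<longlongrightarrow> r powr d / d) (at_left (ereal r))"
  by (simp add: ereal_tendsto_simps1)
 have ev: "einterval 0 (ereal r) = {0<..<r}" by (auto simp: einterval_def)
 have r: "set_integrable lborel {0<..<r} (%z. z powr (d - 1))"
  "(LINT z:{0<..<r}|lborel. z powr (d - 1)) = r powr d / d"
  using FTC[OF prem 1 2 _ 3 4] prem by (auto simp: ev interval_lebesgue_integral_def)
 have eq: "(%z. indicator {0<..} z * ?g z) = (%z. indicator {0<..<r} z * z powr (d - 1))"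
  by (auto simp: indicator_def)
 have i: "set_integrable lborel {0<..} ?g"
  using r(1) unfolding set_integrable_def real_scaleR_def eq .
 have v: "(LINT z:{0<..}|lborel. ?g z) = r powr d / d"
  using r(2) unfolding set_lebesgue_integral_def real_scaleR_def eq .
 have ev: "?g (- z) = ?g z" for z by (auto simp: indicator_def)
 show "integrable lborel ?g" "(LINT z|lborel. ?g z) = 2 * r powr d / d"
  using integral_even[OF i ev] v by auto
qed

lemma powr_integral_far:
 fixes d r :: real
 assumes "d < 1" "0 < r"
 shows "integrable lborel (%z. indicator {z. r < \<bar>z\<bar>} z * \<bar>z\<bar> powr (d - 2))"
  and "(LINT z|lborel. indicator {z. r < \<bar>z\<bar>} z * \<bar>z\<bar> powr (d - 2)) = 2 * r powr (d - 1) / (1 - d)"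
proof -
 let ?g = "%z::real. indicator {z. r < \<bar>z\<bar>} z * \<bar>z\<bar> powr (d - 2)"
 note FTC = interval_integral_FTC_nonneg[where F="%z. - (z powr (d - 1) / (1 - d))" and f="%z. z powr (d - 2)"
   and a="ereal r" and b="\<infinity>" and A="- (r powr (d - 1) / (1 - d))" and B=0]
 have prem: "ereal r < \<infinity>" using assms by simp
 have 1: "ereal r < ereal x ==> ereal x < \<infinity> ==> DERIV (%z. - (z powr (d - 1) / (1 - d))) x :> x powr (d - 2)" for x
 proof -
  assume "ereal r < ereal x"
  then have "0 < x" using assms by simp
  note d = DERIV_minus[OF DERIV_cdivide[OF has_real_derivative_powr[OF this, of "d - 1"], of "1 - d"]]
  have "- ((d - 1) * x powr (d - 1 - 1) / (1 - d)) = x powr (d - 2)"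
   using assms by (simp add: field_simps)
  with d show ?thesis by simp
 qed
 have 2: "ereal r < ereal x ==> ereal x < \<infinity> ==> isCont (%z. z powr (d - 2)) x" for x
  using assms by (auto intro!: continuous_intros)
 have 3: "(((%z. - (z powr (d - 1) / (1 - d))) \<circ> real_of_ereal) \<longlongrightarrow> - (r powr (d - 1) / (1 - d))) (at_right (ereal r))"
  unfolding ereal_tendsto_simps1 using assms
  by (intro tendsto_minus tendsto_divide tendsto_powr tendsto_intros) auto
 have "((%z. - (z powr (d - 1) / (1 - d))) \<longlongrightarrow> - (0 / (1 - d))) at_top"
  using assms by (intro tendsto_minus tendsto_divide tendsto_neg_powr tendsto_intros) (auto intro: filterlim_ident)
 then have 4: "(((%z. - (z powr (d - 1) / (1 - d))) \<circ> real_of_ereal) \<longlongrightarrow> 0) (at_left \<infinity>)"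
  by (simp add: ereal_tendsto_simps1)
 have ev: "einterval (ereal r) \<infinity> = {r<..}" by (auto simp: einterval_def)
 have r: "set_integrable lborel {r<..} (%z. z powr (d - 2))"
  "(LINT z:{r<..}|lborel. z powr (d - 2)) = r powr (d - 1) / (1 - d)"
  using FTC[OF prem 1 2 _ 3 4] prem by (auto simp: ev interval_lebesgue_integral_def)
 have eq: "(%z. indicator {0<..} z * ?g z) = (%z. indicator {r<..} z * z powr (d - 2))"
  using assms by (intro ext) (auto simp: indicator_def)
 have i: "set_integrable lborel {0<..} ?g"
  using r(1) unfolding set_integrable_def real_scaleR_def eq .
 have v: "(LINT z:{0<..}|lborel. ?g z) = r powr (d - 1) / (1 - d)"
  using r(2) unfolding set_lebesgue_integral_def real_scaleR_def eq .
 have ev: "?g (- z) = ?g z" for z by (auto simp: indicator_def)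
 show "integrable lborel ?g" "(LINT z|lborel. ?g z) = 2 * r powr (d - 1) / (1 - d)"
  using integral_even[OF i ev] v assms by (auto simp: indicator_def)
qed

section \<open>The Poisson kernel and its conjugate\<close>

definition Pker :: "real => real => real" where
 "Pker e z = e / (pi * (z\<^sup>2 + e\<^sup>2))"

definition Qker :: "real => real => real" where
 "Qker e z = z / (pi * (z\<^sup>2 + e\<^sup>2))"

definition Qker' :: "real => real => real" where
 "Qker' e z = (e\<^sup>2 - z\<^sup>2) / (pi * (z\<^sup>2 + e\<^sup>2)\<^sup>2)"

lemma sum_squares_pos: "0 < e ==> 0 < z\<^sup>2 + (e::real)\<^sup>2"
 by (simp add: add_nonneg_pos)

lemma ker_measurable [measurable]:
 "Pker e \<in> borel_measurable borel" "Qker e \<in> borel_measurable borel" "Qker' e \<in> borel_measurable borel"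
 unfolding Pker_def[abs_def] Qker_def[abs_def] Qker'_def[abs_def] by measurable

lemma ker_continuous:
 assumes "0 < e"
 shows "continuous_on S (Pker e)" "continuous_on S (Qker e)" "continuous_on S (Qker' e)"
 unfolding Pker_def[abs_def] Qker_def[abs_def] Qker'_def[abs_def]
 using assms by (auto intro!: continuous_intros)

lemma Qker_has_derivative:
 assumes "0 < e"
 shows "(Qker e has_real_derivative Qker' e z) (at z)"
proof -
 define w where "w = pi * (z\<^sup>2 + e\<^sup>2)"
 have w: "w ~= 0" using assms by (simp add: w_def)
 have "((%z. z / (pi * (z\<^sup>2 + e\<^sup>2))) has_real_derivative (1 * w - z * (pi * (2 * z))) / (w * w)) (at z)"
  using w unfolding w_def by (intro DERIV_divide) (auto intro!: derivative_eq_intros)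
 also have "1 * w - z * (pi * (2 * z)) = pi * (e\<^sup>2 - z\<^sup>2)"
  by (simp add: w_def algebra_simps power2_eq_square)
 also have "pi * (e\<^sup>2 - z\<^sup>2) / (w * w) = Qker' e z"
  by (simp add: w_def Qker'_def power2_eq_square)
 finally show ?thesis by (simp add: Qker_def[abs_def])
qed

lemma Pker_nonneg: "0 < e ==> 0 <= Pker e z"
 by (simp add: Pker_def)

lemma Pker_even: "Pker e (- z) = Pker e z" and Qker_odd: "Qker e (- z) = - Qker e z"
 and Qker'_even: "Qker' e (- z) = Qker' e z"
 by (simp_all add: Pker_def Qker_def Qker'_def)

lemma Pker_integral:
 assumes "0 < e"
 shows "integrable lborel (Pker e)" "(LINT z|lborel. Pker e z) = 1"
proof -
 let ?F = "%z. arctan (z / e) / pi"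
 have 1: "(?F has_real_derivative Pker e z) (at z)" for z
 proof -
  have *: "z\<^sup>2 + e\<^sup>2 ~= 0" using assms by simp
  have "1 / (1 + (z / e)\<^sup>2) = e\<^sup>2 / (z\<^sup>2 + e\<^sup>2)"
   using assms * by (simp add: divide_simps)
  then show ?thesis
   unfolding Pker_def using assms
   by (auto intro!: derivative_eq_intros simp: inverse_eq_divide power2_eq_square)
 qed
 have "filterlim (%z. z / e) at_bot at_bot"
  using assms filterlim_tendsto_pos_mult_at_bot[OF tendsto_const[of "1/e"] _ filterlim_ident[of at_bot]] by simp
 then have 2: "(?F \<longlongrightarrow> - (pi / 2) / pi) at_bot"
  by (intro tendsto_divide filterlim_compose[OF tendsto_arctan_at_bot] tendsto_const) auto
 have "filterlim (%z. z / e) at_top at_top"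
  using assms filterlim_tendsto_pos_mult_at_top[OF tendsto_const[of "1/e"] _ filterlim_ident[of at_top]] by simp
 then have 3: "(?F \<longlongrightarrow> (pi / 2) / pi) at_top"
  by (intro tendsto_divide filterlim_compose[OF tendsto_arctan_at_top] tendsto_const) auto
 show "integrable lborel (Pker e)" "(LINT z|lborel. Pker e z) = 1"
  using integral_FTC_line_nonneg[OF 1 ker_continuous(1)[OF assms] Pker_nonneg[OF assms] 2 3] by auto
qed

lemma Qker_squared_le: "0 < e ==> (Qker e z)\<^sup>2 <= Pker e z / (pi * e)"
proof -
 assume e: "0 < e"
 have "(Qker e z)\<^sup>2 = z\<^sup>2 / (z\<^sup>2 + e\<^sup>2) * (1 / (pi\<^sup>2 * (z\<^sup>2 + e\<^sup>2)))"
  by (simp add: Qker_def power2_eq_square)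
 also have "... <= 1 * (1 / (pi\<^sup>2 * (z\<^sup>2 + e\<^sup>2)))"
  using sum_squares_pos[OF e, of z] by (intro mult_right_mono) auto
 also have "... = Pker e z / (pi * e)"
  using e by (simp add: Pker_def power2_eq_square)
 finally show ?thesis .
qed

lemma Qker_L2: assumes "0 < e" shows "Qker e \<in> L2_space"
proof -
 have "integrable lborel (%z. (Qker e z)\<^sup>2)"
 proof (rule Bochner_Integration.integrable_bound)
  show "integrable lborel (%z. Pker e z / (pi * e))" using Pker_integral[OF assms] by simp
  show "AE z in lborel. norm ((Qker e z)\<^sup>2) <= norm (Pker e z / (pi * e))"
   using Qker_squared_le[OF assms] Pker_nonneg[OF assms] assms by simp
 qed simp
 then show ?thesis by (simp add: L2_space_iff)
qed

lemma Qker'_bound: "0 < e ==> \<bar>Qker' e z\<bar> <= Pker e z / e"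
proof -
 assume e: "0 < e"
 have "\<bar>Qker' e z\<bar> = \<bar>e\<^sup>2 - z\<^sup>2\<bar> / (z\<^sup>2 + e\<^sup>2) * (1 / (pi * (z\<^sup>2 + e\<^sup>2)))"
  by (simp add: Qker'_def abs_mult power2_eq_square)
 also have "... <= 1 * (1 / (pi * (z\<^sup>2 + e\<^sup>2)))"
  using sum_squares_pos[OF e, of z] by (intro mult_right_mono) (auto simp: abs_if)
 finally show ?thesis using e by (simp add: Pker_def)
qed

lemma Qker_tendsto_0:
 assumes "0 < e" shows "(Qker e \<longlongrightarrow> 0) at_top" "(Qker e \<longlongrightarrow> 0) at_bot"
proof -
 show t: "(Qker e \<longlongrightarrow> 0) at_top"
 proof (rule Lim_null_comparison)
  have "norm (Qker e z) <= inverse z" if "1 <= z" for z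
  proof -
   have "z / (pi * (z\<^sup>2 + e\<^sup>2)) <= z / (1 * (z\<^sup>2))"
    using that pi_gt3 by (intro divide_left_mono mult_mono mult_pos_pos sum_squares_pos assms) auto
   then show ?thesis using that pi_gt_zero by (simp add: Qker_def power2_eq_square field_simps)
  qed
  then show "\<forall>\<^sub>F z in at_top. norm (Qker e z) <= inverse z"
   by (auto simp: eventually_at_top_linorder)
  show "((inverse :: real => real) \<longlongrightarrow> 0) at_top" by (rule tendsto_inverse_0_at_top[OF filterlim_ident])
 qed
 have "((%z. - Qker e (- z)) \<longlongrightarrow> - 0) at_bot"
  by (intro tendsto_minus filterlim_compose[OF t] filterlim_uminus_at_top_at_bot)
 then show "(Qker e \<longlongrightarrow> 0) at_bot" by (simp add: Qker_odd)
qed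

lemma Qker'_integral:
 assumes "0 < e"
 shows "integrable lborel (Qker' e)" "(LINT z|lborel. Qker' e z) = 0"
proof -
 show i: "integrable lborel (Qker' e)"
 proof (rule Bochner_Integration.integrable_bound)
  show "integrable lborel (%z. Pker e z / e)" using Pker_integral[OF assms] by simp
  show "AE z in lborel. norm (Qker' e z) <= norm (Pker e z / e)"
   using Qker'_bound[OF assms] Pker_nonneg[OF assms] assms by simp
 qed simp
 show "(LINT z|lborel. Qker' e z) = 0"
  using integral_FTC_line[OF Qker_has_derivative[OF assms] ker_continuous(3)[OF assms] i
    Qker_tendsto_0(2,1)[OF assms]] by simp
qed

lemma Pker_le: "0 < e ==> Pker e z <= 1 / (pi * e)"
proof -
 assume e: "0 < e"
 have "e / (pi * (z\<^sup>2 + e\<^sup>2)) <= e / (pi * e\<^sup>2)"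
  using e by (intro divide_left_mono mult_left_mono mult_pos_pos sum_squares_pos) auto
 then show ?thesis using e by (simp add: Pker_def power2_eq_square)
qed

lemma Pker_tendsto_0:
 assumes "0 < e" shows "(Pker e \<longlongrightarrow> 0) at_top" "(Pker e \<longlongrightarrow> 0) at_bot"
proof -
 show t: "(Pker e \<longlongrightarrow> 0) at_top"
 proof (rule Lim_null_comparison)
  have "norm (Pker e z) <= e * norm (Qker e z)" if "1 <= z" for z
   using that assms by (simp add: Pker_def Qker_def divide_right_mono)
  then show "\<forall>\<^sub>F z in at_top. norm (Pker e z) <= e * norm (Qker e z)"
   by (auto simp: eventually_at_top_linorder)
  show "((%z. e * norm (Qker e z)) \<longlongrightarrow> 0) at_top"
   using tendsto_mult[OF tendsto_const tendsto_norm[OF Qker_tendsto_0(1)[OF assms]], of e] by simp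
 qed
 have "((%z. Pker e (- z)) \<longlongrightarrow> 0) at_bot"
  by (intro filterlim_compose[OF t] filterlim_uminus_at_top_at_bot)
 then show "(Pker e \<longlongrightarrow> 0) at_bot" by (simp add: Pker_even)
qed

lemma has_derivative_arctan_scaled:
 fixes n :: real
 assumes "0 < n"
 shows "((%y. arctan ((y - a) / n) / n) has_real_derivative 1 / ((y - a)\<^sup>2 + n\<^sup>2)) (at y)"
proof -
 have *: "(y - a)\<^sup>2 + n\<^sup>2 ~= 0" using assms by simp
 have e: "1 / (1 + ((y - a) / n)\<^sup>2) = n\<^sup>2 / ((y - a)\<^sup>2 + n\<^sup>2)"
  using assms * by (simp add: divide_simps)
 have "((%y. arctan ((y - a) / n) / n) has_real_derivative 1 / (1 + ((y - a) / n)\<^sup>2) * (1 / n) / n) (at y)"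
  using assms by (auto intro!: derivative_eq_intros simp: inverse_eq_divide)
 then show ?thesis unfolding e using assms by (simp add: power2_eq_square)
qed

lemma filterlim_shift_real:
 fixes a :: real
 shows "filterlim (%y. y - a) at_top at_top" "filterlim (%y. y - a) at_bot at_bot"
proof -
 have *: "filterlim (%y::real. y - b) at_top at_top" for b
  using filterlim_tendsto_add_at_top[OF tendsto_const[of "-b"] filterlim_ident[of at_top]] by simp
 show "filterlim (%y. y - a) at_top at_top" by (rule *)
 show "filterlim (%y. y - a) at_bot at_bot"
  unfolding filterlim_at_bot_mirror filterlim_uminus_at_top using *[of "- a"]
  by (simp add: filterlim_uminus_at_bot add.commute)
qed

lemma arctan_scaled_tendsto:
 fixes n :: real
 assumes "0 < n"
 shows "((%y. arctan ((y - a) / n) / n) \<longlongrightarrow> pi / (2 * n)) at_top"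
  and "((%y. arctan ((y - a) / n) / n) \<longlongrightarrow> - (pi / (2 * n))) at_bot"
proof -
 have "filterlim (%y. (y - a) / n) at_top at_top"
  using assms filterlim_tendsto_pos_mult_at_top[OF tendsto_const[of "1/n"] _ filterlim_shift_real(1)] by simp
 then have "((%y. arctan ((y - a) / n) / n) \<longlongrightarrow> (pi / 2) / n) at_top"
  using assms by (intro tendsto_divide filterlim_compose[OF tendsto_arctan_at_top] tendsto_const) auto
 then show "((%y. arctan ((y - a) / n) / n) \<longlongrightarrow> pi / (2 * n)) at_top"
  by (simp add: field_simps)
 have "filterlim (%y. (y - a) / n) at_bot at_bot"
  using assms filterlim_tendsto_pos_mult_at_bot[OF tendsto_const[of "1/n"] _ filterlim_shift_real(2)] by simp
 then have "((%y. arctan ((y - a) / n) / n) \<longlongrightarrow> - (pi / 2) / n) at_bot"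
  using assms by (intro tendsto_divide filterlim_compose[OF tendsto_arctan_at_bot] tendsto_const) auto
 then show "((%y. arctan ((y - a) / n) / n) \<longlongrightarrow> - (pi / (2 * n))) at_bot"
  by (simp add: field_simps)
qed

lemma conj_poisson_partial_fractions:
 fixes a e n y :: real
 assumes S: "S = a\<^sup>2 + (e + n)\<^sup>2" and D: "D = a\<^sup>2 + (n - e)\<^sup>2"
  and A: "A = a * (S + D)" and B: "B = n * ((n - e) * S + (n + e) * D)"
  and B': "B' = e * ((e - n) * S + (n + e) * D)"
 shows "2 * D * S * (y * (a - y)) = (A * y - B) * ((y - a)\<^sup>2 + e\<^sup>2) + (A * (a - y) - B') * (y\<^sup>2 + n\<^sup>2)"
 unfolding A B B' S D by algebra

lemma Qker_conv_integrable:
 assumes "0 < e" "0 < n"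
 shows "integrable lborel (%y. Qker e (a - y) * Qker n y)"
 by (intro integrable_mult_L2 L2_space_reflect Qker_L2 assms)

text \<open>The composition of two conjugate Poisson convolutions is minus a Poisson convolution:
 this is the regularised form of \<open>H \<circ> H = - id\<close>, and everything in \<open>L\<^sup>2\<close> about the Hilbert
 transform is drawn from it. The integral is evaluated with partial fractions, which
 degenerate exactly when \<open>a = 0\<close> and the two parameters agree.\<close>

lemma Qker_conv:
 assumes e: "0 < e" and n: "0 < n"
 shows "(LINT y|lborel. Qker e (a - y) * Qker n y) = - Pker (e + n) a"
proof (cases "a = 0 & e = n")
 case True
 let ?F = "%y. (pi / 2 * Qker e y - arctan ((y - 0) / e) / e / 2) / pi\<^sup>2"
 have 1: "(?F has_real_derivative Qker e (a - y) * Qker n y) (at y)" for y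
 proof -
  define s where "s = y\<^sup>2 + e\<^sup>2"
  have s: "s ~= 0" using e by (simp add: s_def)
  have "(?F has_real_derivative (pi / 2 * Qker' e y - 1 / ((y - 0)\<^sup>2 + e\<^sup>2) / 2) / pi\<^sup>2) (at y)"
   by (intro DERIV_cdivide DERIV_diff DERIV_cmult has_derivative_arctan_scaled Qker_has_derivative e)
  also have "(pi / 2 * Qker' e y - 1 / ((y - 0)\<^sup>2 + e\<^sup>2) / 2) / pi\<^sup>2 = ((e\<^sup>2 - y\<^sup>2) / s\<^sup>2 - s / s\<^sup>2) / (2 * pi\<^sup>2)"
  proof -
   have "Qker' e y = (e\<^sup>2 - y\<^sup>2) / (pi * s\<^sup>2)" by (simp add: Qker'_def s_def)
   moreover have "1 / ((y - 0)\<^sup>2 + e\<^sup>2) = s / s\<^sup>2"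
    using s by (simp add: power2_eq_square[of s]) (simp add: s_def)
   moreover have "(pi / 2 * (N / (pi * s\<^sup>2)) - s / s\<^sup>2 / 2) / pi\<^sup>2 = (N / s\<^sup>2 - s / s\<^sup>2) / (2 * pi\<^sup>2)" for N
    using s by (simp add: field_simps)
   ultimately show ?thesis by metis
  qed
  also have "(e\<^sup>2 - y\<^sup>2) / s\<^sup>2 - s / s\<^sup>2 = - 2 * y\<^sup>2 / s\<^sup>2"
   unfolding diff_divide_distrib[symmetric] by (simp add: s_def)
  also have "- 2 * y\<^sup>2 / s\<^sup>2 / (2 * pi\<^sup>2) = Qker e (a - y) * Qker n y"
   using True by (simp add: Qker_def s_def power2_eq_square)
  finally show ?thesis .
 qed
 have 2: "(?F \<longlongrightarrow> (pi / 2 * 0 - pi / (2 * e) / 2) / pi\<^sup>2) at_top"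
  by (intro tendsto_intros Qker_tendsto_0 arctan_scaled_tendsto e) auto
 have 3: "(?F \<longlongrightarrow> (pi / 2 * 0 - (- (pi / (2 * e))) / 2) / pi\<^sup>2) at_bot"
  by (intro tendsto_intros Qker_tendsto_0 arctan_scaled_tendsto e) auto
 have c: "continuous_on UNIV (%y. Qker e (a - y) * Qker n y)"
  by (intro continuous_intros continuous_on_compose2[OF ker_continuous(2)[OF e, of UNIV]] ker_continuous n) auto
 show ?thesis
  using integral_FTC_line[OF 1 c Qker_conv_integrable[OF e n] 3 2] True e
  by (simp add: Pker_def power2_eq_square)
next
 case False
 define S where "S = a\<^sup>2 + (e + n)\<^sup>2"
 define D where "D = a\<^sup>2 + (n - e)\<^sup>2"
 define A where "A = a * (S + D)"
 define B where "B = n * ((n - e) * S + (n + e) * D)"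
 define B' where "B' = e * ((e - n) * S + (n + e) * D)"
 define C where "C = 2 * D * S * pi\<^sup>2"
 have S0: "S ~= 0" using e n by (simp add: S_def)
 have D0: "D ~= 0" using False by (auto simp: D_def)
 have C0: "C ~= 0" using S0 D0 by (simp add: C_def)
 define ratio where "ratio y = 1 + 2 * a * pi * Qker e (y - a) + (a\<^sup>2 + n\<^sup>2 - e\<^sup>2) * (pi / e) * Pker e (y - a)" for y
 let ?F = "%y. (A / 2 * (ln (y\<^sup>2 + n\<^sup>2) - ln ((y - a)\<^sup>2 + e\<^sup>2)) - B * (arctan ((y - 0) / n) / n)
   - B' * (arctan ((y - a) / e) / e)) / C"
 have 1: "(?F has_real_derivative Qker e (a - y) * Qker n y) (at y)" for y
 proof -
  define p where "p = y\<^sup>2 + n\<^sup>2"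
  define r where "r = (y - a)\<^sup>2 + e\<^sup>2"
  have pr: "0 < p" "0 < r" using sum_squares_pos e n by (auto simp: p_def r_def)
  have "(?F has_real_derivative (A / 2 * (2 * y / p - 2 * (y - a) / r) - B * (1 / ((y - 0)\<^sup>2 + n\<^sup>2))
    - B' * (1 / ((y - a)\<^sup>2 + e\<^sup>2))) / C) (at y)"
   using pr unfolding p_def r_def
   by (intro DERIV_cdivide DERIV_diff DERIV_cmult has_derivative_arctan_scaled e n)
    (auto intro!: derivative_eq_intros)
  also have "(A / 2 * (2 * y / p - 2 * (y - a) / r) - B * (1 / ((y - 0)\<^sup>2 + n\<^sup>2))
    - B' * (1 / ((y - a)\<^sup>2 + e\<^sup>2))) = (A * y - B) / p + (A * (a - y) - B') / r"
   by (simp add: p_def[symmetric] r_def[symmetric] diff_divide_distrib right_diff_distrib)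
  also have "... = ((A * y - B) * r + (A * (a - y) - B') * p) / (p * r)"
   using pr by (simp add: add_divide_distrib)
  also have "(A * y - B) * r + (A * (a - y) - B') * p = 2 * D * S * (y * (a - y))"
   unfolding r_def p_def by (rule conj_poisson_partial_fractions[OF S_def D_def A_def B_def B'_def, symmetric])
  also have "2 * D * S * (y * (a - y)) / (p * r) / C = (y * (a - y)) / (p * r) / pi\<^sup>2"
   using S0 D0 by (simp add: C_def)
  also have "... = Qker e (a - y) * Qker n y"
   by (simp add: Qker_def p_def r_def power2_eq_square algebra_simps)
  finally show ?thesis .
 qed
 have ratio: "ln (y\<^sup>2 + n\<^sup>2) - ln ((y - a)\<^sup>2 + e\<^sup>2) = ln (ratio y)" for y
 proof -
  define r where "r = (y - a)\<^sup>2 + e\<^sup>2"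
  have r: "0 < r" using sum_squares_pos e by (auto simp: r_def)
  have "ratio y = 1 + 2 * a * (y - a) / r + (a\<^sup>2 + n\<^sup>2 - e\<^sup>2) / r"
   using e by (simp add: ratio_def Qker_def Pker_def r_def[symmetric])
  also have "... = (r + 2 * a * (y - a) + (a\<^sup>2 + n\<^sup>2 - e\<^sup>2)) / r"
   using r by (simp add: add_divide_distrib)
  also have "r + 2 * a * (y - a) + (a\<^sup>2 + n\<^sup>2 - e\<^sup>2) = y\<^sup>2 + n\<^sup>2"
   by (simp add: r_def power2_eq_square algebra_simps)
  finally show ?thesis
   using ln_div[of "y\<^sup>2 + n\<^sup>2" r] r sum_squares_pos[OF n, of y]
   unfolding r_def[symmetric] using n by simp
 qed
 have lim: "(ratio \<longlongrightarrow> 1) F" if "((%y. Qker e (y - a)) \<longlongrightarrow> 0) F" "((%y. Pker e (y - a)) \<longlongrightarrow> 0) F" for F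
  using tendsto_add[OF tendsto_add[OF tendsto_const[of 1] tendsto_mult[OF tendsto_const[of "2 * a * pi"] that(1)]]
    tendsto_mult[OF tendsto_const[of "(a\<^sup>2 + n\<^sup>2 - e\<^sup>2) * (pi / e)"] that(2)]]
  by (simp add: ratio_def[abs_def])
 have "(ratio \<longlongrightarrow> 1) at_top" "(ratio \<longlongrightarrow> 1) at_bot"
  by (rule lim; rule filterlim_compose[OF _ filterlim_shift_real(1)] filterlim_compose[OF _ filterlim_shift_real(2)];
    rule Qker_tendsto_0 Pker_tendsto_0; rule e)+
 then have l: "((%y. ln (y\<^sup>2 + n\<^sup>2) - ln ((y - a)\<^sup>2 + e\<^sup>2)) \<longlongrightarrow> ln 1) at_top"
  "((%y. ln (y\<^sup>2 + n\<^sup>2) - ln ((y - a)\<^sup>2 + e\<^sup>2)) \<longlongrightarrow> ln 1) at_bot"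
  unfolding ratio by (intro tendsto_ln; simp)+
 have 2: "(?F \<longlongrightarrow> (A / 2 * ln 1 - B * (pi / (2 * n)) - B' * (pi / (2 * e))) / C) at_top"
  by (intro tendsto_divide[OF tendsto_diff[OF tendsto_diff[OF tendsto_mult[OF tendsto_const l(1)]
    tendsto_mult[OF tendsto_const arctan_scaled_tendsto(1)[OF n]]]
    tendsto_mult[OF tendsto_const arctan_scaled_tendsto(1)[OF e]]] tendsto_const] C0)
 have 3: "(?F \<longlongrightarrow> (A / 2 * ln 1 - B * (- (pi / (2 * n))) - B' * (- (pi / (2 * e)))) / C) at_bot"
  by (intro tendsto_divide[OF tendsto_diff[OF tendsto_diff[OF tendsto_mult[OF tendsto_const l(2)]
    tendsto_mult[OF tendsto_const arctan_scaled_tendsto(2)[OF n]]]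
    tendsto_mult[OF tendsto_const arctan_scaled_tendsto(2)[OF e]]] tendsto_const] C0)
 have c: "continuous_on UNIV (%y. Qker e (a - y) * Qker n y)"
  by (intro continuous_intros continuous_on_compose2[OF ker_continuous(2)[OF e, of UNIV]] ker_continuous n) auto
 have "(LINT y|lborel. Qker e (a - y) * Qker n y) = - (B / n + B' / e) * pi / C"
  unfolding integral_FTC_line[OF 1 c Qker_conv_integrable[OF e n] 3 2]
  by (simp add: add_divide_distrib diff_divide_distrib ring_distribs mult.commute)
 also have "B / n + B' / e = 2 * (n + e) * D"
 proof -
  have "B / n = (n - e) * S + (n + e) * D" "B' / e = (e - n) * S + (n + e) * D"
   using e n by (simp_all add: B_def B'_def)
  then show ?thesis by (simp add: algebra_simps)
 qed
 also have "- (2 * (n + e) * D) * pi / C = - ((e + n) / (pi * S))"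
 proof -
  have "- (2 * (n + e) * D) * pi / C = - ((2 * D * pi) * (e + n)) / ((2 * D * pi) * (pi * S))"
   by (simp add: C_def power2_eq_square algebra_simps)
  then show ?thesis using D0 by simp
 qed
 finally show ?thesis by (simp add: Pker_def S_def)
qed

section \<open>Regularised Hilbert transform on square-integrable functions\<close>

definition Hreg :: "real => (real => real) => real => real" where
 "Hreg e f x = (LINT y|lborel. Qker e (x - y) * f y)"

definition Preg :: "real => (real => real) => real => real" where
 "Preg e f x = (LINT y|lborel. Pker e (x - y) * f y)"

lemma Hreg_integrable:
 assumes "0 < e" "f \<in> L2_space"
 shows "integrable lborel (%y. Qker e (x - y) * f y)"
 by (intro integrable_mult_L2 L2_space_reflect Qker_L2 assms)

lemma reg_measurable [measurable]:
 assumes [measurable]: "f \<in> borel_measurable borel"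
 shows "Hreg e f \<in> borel_measurable borel" "Preg e f \<in> borel_measurable borel"
 unfolding Hreg_def[abs_def] Preg_def[abs_def] by measurable

lemma integral_weighted_Cauchy_Schwarz:
 fixes g \<phi> :: "real => real"
 assumes [measurable]: "g \<in> borel_measurable borel" and phi: "integrable lborel \<phi>" "!!y. 0 <= \<phi> y"
  and g: "integrable lborel (%y. (g y)\<^sup>2 * \<phi> y)"
 shows "(LINT y|lborel. g y * \<phi> y)\<^sup>2 <= (LINT y|lborel. \<phi> y) * (LINT y|lborel. (g y)\<^sup>2 * \<phi> y)"
  and "integrable lborel (%y. g y * \<phi> y)"
proof -
 have [measurable]: "\<phi> \<in> borel_measurable borel" using borel_measurable_integrable[OF phi(1)] by simp
 have 1: "(%y. sqrt (\<phi> y)) \<in> L2_space" using phi by (simp add: L2_space_iff)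
 have 2: "(%y. g y * sqrt (\<phi> y)) \<in> L2_space" using phi g by (simp add: L2_space_iff power_mult_distrib)
 have eq: "g y * sqrt (\<phi> y) * sqrt (\<phi> y) = g y * \<phi> y" for y using phi(2)[of y] by simp
 have "\<bar>LINT y|lborel. g y * \<phi> y\<bar> <= L2_norm (%y. g y * sqrt (\<phi> y)) * L2_norm (%y. sqrt (\<phi> y))"
  using L2_Cauchy_Schwarz[OF 2 1] unfolding eq .
 then have "\<bar>LINT y|lborel. g y * \<phi> y\<bar>\<^sup>2 <= (L2_norm (%y. g y * sqrt (\<phi> y)) * L2_norm (%y. sqrt (\<phi> y)))\<^sup>2"
  by (intro power_mono) auto
 then show "(LINT y|lborel. g y * \<phi> y)\<^sup>2 <= (LINT y|lborel. \<phi> y) * (LINT y|lborel. (g y)\<^sup>2 * \<phi> y)"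
  using phi by (simp add: power_mult_distrib L2_norm_squared mult.commute)
 show "integrable lborel (%y. g y * \<phi> y)" using integrable_mult_L2[OF 2 1] unfolding eq .
qed

lemma nn_integral_reflect_shift:
 fixes g :: "real => ennreal"
 assumes [measurable]: "g \<in> borel_measurable borel"
 shows "(\<integral>\<^sup>+x. g (x - y) \<partial>lborel) = (\<integral>\<^sup>+x. g x \<partial>lborel)" "(\<integral>\<^sup>+x. g (y - x) \<partial>lborel) = (\<integral>\<^sup>+x. g x \<partial>lborel)"
 using nn_integral_real_affine[of g 1 "-y"] nn_integral_real_affine[of g "-1" y] by simp_all

lemma Preg_L2:
 assumes e: "0 < e" and f: "f \<in> L2_space"
 shows "Preg e f \<in> L2_space" "L2_norm (Preg e f) <= L2_norm f"
proof -
 note [measurable] = L2_space_measurable[OF f]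
 have Pi: "integrable lborel (%y. Pker e (x - y))" "(LINT y|lborel. Pker e (x - y)) = 1" for x
  using lborel_integrable_real_affine[OF Pker_integral(1)[OF e], of "-1" x]
   lborel_integral_real_affine[of "-1" "Pker e" x] Pker_integral[OF e] by simp_all
 have i: "integrable lborel (%y. (f y)\<^sup>2 * Pker e (x - y))" for x
 proof (rule Bochner_Integration.integrable_bound)
  show "integrable lborel (%y. (f y)\<^sup>2 * (1 / (pi * e)))" using L2_space_integrable[OF f] by simp
  show "AE y in lborel. norm ((f y)\<^sup>2 * Pker e (x - y)) <= norm ((f y)\<^sup>2 * (1 / (pi * e)))"
   using Pker_le[OF e] Pker_nonneg[OF e] e by (intro AE_I2) (simp add: abs_mult mult_left_mono del: times_divide_eq_right)
 qed simp
 have le: "(Preg e f x)\<^sup>2 <= (LINT y|lborel. (f y)\<^sup>2 * Pker e (x - y))" for x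
  using integral_weighted_Cauchy_Schwarz(1)[OF _ Pi(1) Pker_nonneg[OF e] i] Pi(2)
  by (simp add: Preg_def mult.commute)
 have "(\<integral>\<^sup>+x. ennreal ((Preg e f x)\<^sup>2) \<partial>lborel) <= (\<integral>\<^sup>+x. (\<integral>\<^sup>+y. ennreal ((f y)\<^sup>2) * ennreal (Pker e (x - y)) \<partial>lborel) \<partial>lborel)"
 proof (rule nn_integral_mono)
  fix x
  have "ennreal ((Preg e f x)\<^sup>2) <= ennreal (LINT y|lborel. (f y)\<^sup>2 * Pker e (x - y))"
   by (rule ennreal_leI[OF le])
  also have "... = (\<integral>\<^sup>+y. ennreal ((f y)\<^sup>2) * ennreal (Pker e (x - y)) \<partial>lborel)"
   using nn_integral_eq_integral[OF i] Pker_nonneg[OF e] by (simp add: ennreal_mult)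
  finally show "ennreal ((Preg e f x)\<^sup>2) <= ..." .
 qed
 also have "... = (\<integral>\<^sup>+y. (\<integral>\<^sup>+x. ennreal ((f y)\<^sup>2) * ennreal (Pker e (x - y)) \<partial>lborel) \<partial>lborel)"
  by (rule lborel_pair.Fubini'[symmetric]) measurable
 also have "... = (\<integral>\<^sup>+y. ennreal ((f y)\<^sup>2) * (\<integral>\<^sup>+x. ennreal (Pker e (x - y)) \<partial>lborel) \<partial>lborel)"
  by (simp add: nn_integral_cmult)
 also have "... = (\<integral>\<^sup>+y. ennreal ((f y)\<^sup>2) \<partial>lborel)"
  using nn_integral_reflect_shift(1)[of "%x. ennreal (Pker e x)"]
   nn_integral_eq_integral[OF Pker_integral(1)[OF e]] Pker_nonneg[OF e] Pker_integral(2)[OF e] by simp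
 also have "... = ennreal ((L2_norm f)\<^sup>2)" by (rule L2_nn_integral[OF f])
 finally have *: "(\<integral>\<^sup>+x. ennreal ((Preg e f x)\<^sup>2) \<partial>lborel) <= ennreal ((L2_norm f)\<^sup>2)" .
 show "Preg e f \<in> L2_space" "L2_norm (Preg e f) <= L2_norm f"
  by (rule L2I_nn_integral[OF _ _ *]; simp)+
qed

text \<open>For an integrable function the crude bound \<open>\<parallel>Hreg e f\<parallel>\<^sub>2 \<le> \<parallel>Qker e\<parallel>\<^sub>2 \<parallel>f\<parallel>\<^sub>1\<close> is enough
 to start with; it is not uniform in \<open>e\<close>.\<close>

lemma Hreg_L2_of_integrable:
 assumes e: "0 < e" and f: "f \<in> L2_space" "integrable lborel f"
 shows "Hreg e f \<in> L2_space"
proof -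
 note [measurable] = L2_space_measurable[OF f(1)]
 let ?I = "LINT y|lborel. \<bar>f y\<bar>"
 have i: "integrable lborel (%y. (Qker e (x - y))\<^sup>2 * \<bar>f y\<bar>)" for x
 proof (rule Bochner_Integration.integrable_bound)
  show "integrable lborel (%y. (1 / (pi * e)) / (pi * e) * f y)" using f by simp
  have "(Qker e z)\<^sup>2 <= (1 / (pi * e)) / (pi * e)" for z
   by (rule order_trans[OF Qker_squared_le[OF e] divide_right_mono[OF Pker_le[OF e]]]) (use e in simp)
  then show "AE y in lborel. norm ((Qker e (x - y))\<^sup>2 * \<bar>f y\<bar>) <= norm ((1 / (pi * e)) / (pi * e) * f y)"
   using e by (intro AE_I2) (simp add: abs_mult mult_right_mono del: times_divide_eq_left times_divide_eq_right)
 qed simp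
 have le: "(Hreg e f x)\<^sup>2 <= ?I * (LINT y|lborel. (Qker e (x - y))\<^sup>2 * \<bar>f y\<bar>)" for x
 proof -
  have eq: "Qker e (x - y) * sgn (f y) * \<bar>f y\<bar> = Qker e (x - y) * f y" for y
   by (simp add: mult.assoc sgn_mult_abs)
  have eq2: "(Qker e (x - y) * sgn (f y))\<^sup>2 * \<bar>f y\<bar> = (Qker e (x - y))\<^sup>2 * \<bar>f y\<bar>" for y
   by (simp add: power_mult_distrib power2_eq_square[of "sgn _"] sgn_if)
  show ?thesis
   using integral_weighted_Cauchy_Schwarz(1)[of "%y. Qker e (x - y) * sgn (f y)" "%y. \<bar>f y\<bar>"] f i
   unfolding eq eq2 by (simp add: Hreg_def)
 qed
 have "(\<integral>\<^sup>+x. ennreal ((Hreg e f x)\<^sup>2) \<partial>lborel) <= (\<integral>\<^sup>+x. ennreal ?I * (\<integral>\<^sup>+y. ennreal \<bar>f y\<bar> * ennreal ((Qker e (x - y))\<^sup>2) \<partial>lborel) \<partial>lborel)"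
 proof (rule nn_integral_mono)
  fix x
  have "ennreal ((Hreg e f x)\<^sup>2) <= ennreal (?I * (LINT y|lborel. (Qker e (x - y))\<^sup>2 * \<bar>f y\<bar>))"
   by (rule ennreal_leI[OF le])
  also have "... = ennreal ?I * (\<integral>\<^sup>+y. ennreal \<bar>f y\<bar> * ennreal ((Qker e (x - y))\<^sup>2) \<partial>lborel)"
   using nn_integral_eq_integral[OF i] by (simp add: ennreal_mult mult.commute)
  finally show "ennreal ((Hreg e f x)\<^sup>2) <= ..." .
 qed
 also have "... = ennreal ?I * (\<integral>\<^sup>+x. (\<integral>\<^sup>+y. ennreal \<bar>f y\<bar> * ennreal ((Qker e (x - y))\<^sup>2) \<partial>lborel) \<partial>lborel)"
  by (simp add: nn_integral_cmult)
 also have "(\<integral>\<^sup>+x. (\<integral>\<^sup>+y. ennreal \<bar>f y\<bar> * ennreal ((Qker e (x - y))\<^sup>2) \<partial>lborel) \<partial>lborel)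
   = (\<integral>\<^sup>+y. (\<integral>\<^sup>+x. ennreal \<bar>f y\<bar> * ennreal ((Qker e (x - y))\<^sup>2) \<partial>lborel) \<partial>lborel)"
  by (rule lborel_pair.Fubini'[symmetric]) measurable
 also have "... = (\<integral>\<^sup>+y. ennreal \<bar>f y\<bar> * (\<integral>\<^sup>+x. ennreal ((Qker e x)\<^sup>2) \<partial>lborel) \<partial>lborel)"
  using nn_integral_reflect_shift(1)[of "%x. ennreal ((Qker e x)\<^sup>2)"] by (simp add: nn_integral_cmult)
 also have "... = ennreal ?I * ennreal ((L2_norm (Qker e))\<^sup>2)"
  using nn_integral_eq_integral[of lborel "%y. \<bar>f y\<bar>"] f
  by (simp add: nn_integral_multc L2_nn_integral[OF Qker_L2[OF e]])
 finally have *: "(\<integral>\<^sup>+x. ennreal ((Hreg e f x)\<^sup>2) \<partial>lborel) <= ennreal ((?I * L2_norm (Qker e))\<^sup>2)"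
  by (simp add: ennreal_mult[symmetric] power_mult_distrib power2_eq_square[of ?I] mult.assoc)
 show ?thesis by (rule L2I_nn_integral(1)[OF _ _ *]) auto
qed

lemma Hreg_skew_integrable:
 assumes e: "0 < e" and f: "f \<in> L2_space" "integrable lborel f" and g: "g \<in> L2_space"
 shows "(LINT x|lborel. g x * Hreg e f x) = - (LINT y|lborel. Hreg e g y * f y)"
proof -
 note [measurable] = L2_space_measurable[OF f(1)] L2_space_measurable[OF g]
 have bd: "(LINT x|lborel. \<bar>f y * (Qker e (x - y) * g x)\<bar>) <= \<bar>f y\<bar> * (L2_norm (Qker e) * L2_norm g)" for y
 proof -
  have "(%x. Qker e (x - y)) \<in> L2_space" "L2_norm (%x. Qker e (x - y)) = L2_norm (Qker e)"
   using L2_space_shift[OF Qker_L2[OF e], of "-y"] by simp_all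
  then have "(LINT x|lborel. \<bar>Qker e (x - y) * g x\<bar>) <= L2_norm (Qker e) * L2_norm g"
   using L2_Cauchy_Schwarz_abs[of "%x. Qker e (x - y)" g] g by simp
  then show ?thesis by (simp add: abs_mult mult_left_mono)
 qed
 have i: "integrable lborel (%x. Qker e (x - y) * g x)" for y
  using L2_space_shift[OF Qker_L2[OF e], of "-y"] g by (intro integrable_mult_L2) simp_all
 have I: "integrable (lborel \<Otimes>\<^sub>M lborel) (%(y, x). f y * (Qker e (x - y) * g x))"
 proof (rule lborel_pair.Fubini_integrable)
  show "integrable lborel (%y. LINT x|lborel. norm (case (y, x) of (y, x) => f y * (Qker e (x - y) * g x)))"
  proof (rule Bochner_Integration.integrable_bound)
   show "integrable lborel (%y. \<bar>f y\<bar> * (L2_norm (Qker e) * L2_norm g))" using f by simp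
   show "AE y in lborel. norm (LINT x|lborel. norm (case (y, x) of (y, x) => f y * (Qker e (x - y) * g x)))
     <= norm (\<bar>f y\<bar> * (L2_norm (Qker e) * L2_norm g))"
    using bd by (auto simp: abs_mult)
  qed simp
  show "AE y in lborel. integrable lborel (%x. case (y, x) of (y, x) => f y * (Qker e (x - y) * g x))"
   using i by simp
 qed measurable
 have "(LINT x|lborel. LINT y|lborel. f y * (Qker e (x - y) * g x)) = (LINT y|lborel. LINT x|lborel. f y * (Qker e (x - y) * g x))"
  by (rule lborel_pair.Fubini_integral[OF I])
 moreover have "(LINT y|lborel. f y * (Qker e (x - y) * g x)) = g x * Hreg e f x" for x
  unfolding Hreg_def integral_mult_right_zero[symmetric] by (rule Bochner_Integration.integral_cong) auto
 moreover have "(LINT x|lborel. f y * (Qker e (x - y) * g x)) = - (Hreg e g y * f y)" for y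
 proof -
  have "Qker e (x - y) = - Qker e (y - x)" for x using Qker_odd[of e "y - x"] by simp
  then show ?thesis by (simp add: Hreg_def)
 qed
 ultimately show ?thesis by simp
qed

lemma Hreg_Qker:
 assumes "0 < e" "0 < n"
 shows "Hreg e (%y. Qker n (x - y)) w = Pker (n + e) (x - w)"
proof -
 have "Hreg e (%y. Qker n (x - y)) w = (LINT y|lborel. Qker e (w - (x + (-1) * y)) * Qker n (x - (x + (-1) * y)))"
  unfolding Hreg_def by (subst lborel_integral_real_affine[of "-1" _ x]) simp_all
 also have "... = (LINT y|lborel. - (Qker e ((x - w) - y) * Qker n y))"
 proof (rule Bochner_Integration.integral_cong)
  fix y
  show "Qker e (w - (x + (-1) * y)) * Qker n (x - (x + (-1) * y)) = - (Qker e ((x - w) - y) * Qker n y)"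
   using Qker_odd[of e "(x - w) - y"] by (simp add: algebra_simps)
 qed simp
 also have "... = Pker (n + e) (x - w)" using Qker_conv[OF assms, of "x - w"] by (simp add: add.commute)
 finally show ?thesis .
qed

text \<open>\<open>\<parallel>Hreg e f\<parallel>\<^sup>2 = - \<langle>Hreg e (Hreg e f), f\<rangle> = \<langle>Preg (2 e) f, f\<rangle>\<close>, and Poisson averages do not
 increase the \<open>L\<^sup>2\<close> norm.\<close>

lemma Hreg_contraction_integrable:
 assumes e: "0 < e" and f: "f \<in> L2_space" "integrable lborel f"
 shows "L2_norm (Hreg e f) <= L2_norm f"
proof -
 note H = Hreg_L2_of_integrable[OF e f]
 have HH: "Hreg e (Hreg e f) x = - Preg (e + e) f x" for x
 proof -
  have "Hreg e (Hreg e f) x = (LINT y|lborel. Qker e (x - y) * Hreg e f y)" by (simp add: Hreg_def)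
  also have "... = - (LINT y|lborel. Hreg e (%y. Qker e (x - y)) y * f y)"
   by (rule Hreg_skew_integrable[OF e f]) (rule L2_space_reflect[OF Qker_L2[OF e]])
  finally show ?thesis by (simp add: Hreg_Qker[OF e e] Preg_def)
 qed
 have "(L2_norm (Hreg e f))\<^sup>2 = (LINT x|lborel. Hreg e f x * Hreg e f x)"
  unfolding L2_norm_squared by (simp add: power2_eq_square)
 also have "... = - (LINT y|lborel. Hreg e (Hreg e f) y * f y)"
  by (rule Hreg_skew_integrable[OF e f H])
 also have "... = (LINT y|lborel. Preg (e + e) f y * f y)" by (simp add: HH)
 also have "... <= L2_norm (Preg (e + e) f) * L2_norm f"
  using L2_Cauchy_Schwarz[OF Preg_L2(1) f(1), of "e + e" f] e f(1) by simp
 also have "... <= L2_norm f * L2_norm f"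
  using Preg_L2(2)[of "e + e" f] e f(1) by (intro mult_right_mono) auto
 finally show ?thesis by - (rule power2_le_imp_le, simp_all add: power2_eq_square)
qed

lemma Hreg_trunc_tendsto:
 assumes e: "0 < e" and f: "f \<in> L2_space"
 shows "(%n. Hreg e (trunc n f) x) \<longlonglongrightarrow> Hreg e f x"
 unfolding Hreg_def
 by (rule L2_inner_tendsto[OF L2_space_reflect(1)[OF Qker_L2[OF e]] trunc_L2(1)[OF f] f L2_norm_trunc_diff[OF f]])

lemma Hreg_contraction:
 assumes e: "0 < e" and f: "f \<in> L2_space"
 shows "Hreg e f \<in> L2_space" "L2_norm (Hreg e f) <= L2_norm f"
proof -
 note [measurable] = L2_space_measurable[OF f]
 note t = trunc_L2[OF f]
 note F = L2_Fatou[of "%n. Hreg e (trunc n f)" "L2_norm f" "Hreg e f"]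
 have "L2_norm (Hreg e (trunc n f)) <= L2_norm f" for n
  using Hreg_contraction_integrable[OF e t(1,2)] t(3) by (rule order_trans)
 then show "Hreg e f \<in> L2_space" "L2_norm (Hreg e f) <= L2_norm f"
  using F Hreg_L2_of_integrable[OF e t(1,2)] Hreg_trunc_tendsto[OF e f] by simp_all
qed

lemma Hreg_diff:
 assumes "0 < e" "f \<in> L2_space" "g \<in> L2_space"
 shows "Hreg e (%x. f x - g x) y = Hreg e f y - Hreg e g y"
 using Hreg_integrable[OF assms(1)] assms by (simp add: Hreg_def right_diff_distrib)

lemma Hreg_skew:
 assumes e: "0 < e" and f: "f \<in> L2_space" and g: "g \<in> L2_space"
 shows "(LINT x|lborel. g x * Hreg e f x) = - (LINT x|lborel. Hreg e g x * f x)"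
proof (rule LIMSEQ_unique)
 note t = trunc_L2[OF f]
 have "(%n. L2_norm (%x. Hreg e (trunc n f) x - Hreg e f x)) \<longlonglongrightarrow> 0"
 proof (rule Lim_null_comparison[OF _ L2_norm_trunc_diff[OF f]])
  have "L2_norm (%x. Hreg e (trunc n f) x - Hreg e f x) <= L2_norm (%x. trunc n f x - f x)" for n
  proof -
   have "(%x. Hreg e (trunc n f) x - Hreg e f x) = Hreg e (%x. trunc n f x - f x)"
    by (rule ext) (rule Hreg_diff[OF e t(1) f, symmetric])
   then show ?thesis using Hreg_contraction(2)[OF e L2_space_diff[OF t(1) f]] by metis
  qed
  then show "\<forall>\<^sub>F n in sequentially. norm (L2_norm (%x. Hreg e (trunc n f) x - Hreg e f x)) <= L2_norm (%x. trunc n f x - f x)"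
   by (intro always_eventually allI) (simp only: real_norm_def abs_of_nonneg[OF L2_norm_nonneg])
 qed
 from L2_inner_tendsto[OF g Hreg_contraction(1)[OF e t(1)] Hreg_contraction(1)[OF e f] this]
 show "(%n. LINT x|lborel. g x * Hreg e (trunc n f) x) \<longlonglongrightarrow> (LINT x|lborel. g x * Hreg e f x)" .
 from L2_inner_tendsto[OF Hreg_contraction(1)[OF e g] t(1) f L2_norm_trunc_diff[OF f]]
 show "(%n. LINT x|lborel. g x * Hreg e (trunc n f) x) \<longlonglongrightarrow> - (LINT x|lborel. Hreg e g x * f x)"
  unfolding Hreg_skew_integrable[OF e t(1,2) g] by (intro tendsto_minus)
qed

lemma Hreg_Hreg:
 assumes "0 < e" "0 < n" "f \<in> L2_space"
 shows "(LINT y|lborel. Qker n (x - y) * Hreg e f y) = - Preg (n + e) f x"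
 unfolding Hreg_skew[OF assms(1,3) L2_space_reflect(1)[OF Qker_L2[OF assms(2)]]]
  Hreg_Qker[OF assms(1,2)] Preg_def ..

section \<open>The Hilbert transform as an absolutely convergent integral\<close>

text \<open>Pairing the points \<open>x - z\<close> and \<open>x + z\<close> turns the principal value into an integral that
 converges absolutely for every function with a little regularity at \<open>x\<close> and some decay.\<close>

definition pv_kernel :: "(real => real) => real => real => real" where
 "pv_kernel f x z = (f (x - z) - f (x + z)) / z"

definition hil :: "(real => real) => real => real" where
 "hil f x = 1 / (2 * pi) * (LINT z|lborel. pv_kernel f x z)"

lemma pv_kernel_measurable [measurable]:
 assumes [measurable]: "f \<in> borel_measurable borel"
 shows "pv_kernel f x \<in> borel_measurable borel"
 unfolding pv_kernel_def[abs_def] by measurable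

lemma hil_measurable [measurable]:
 assumes [measurable]: "f \<in> borel_measurable borel"
 shows "hil f \<in> borel_measurable borel"
 unfolding hil_def[abs_def] pv_kernel_def by measurable

lemma Qker_abs_le: "0 < e ==> \<bar>Qker e z\<bar> <= 1 / (pi * \<bar>z\<bar>)"
proof (cases "z = 0")
 case False
 assume e: "0 < e"
 have "\<bar>z\<bar> / (pi * (z\<^sup>2 + e\<^sup>2)) <= \<bar>z\<bar> / (pi * z\<^sup>2)"
  using False by (intro divide_left_mono mult_left_mono mult_pos_pos) (auto simp: add_pos_nonneg)
 also have "... = 1 / (pi * \<bar>z\<bar>)" using False by (simp add: power2_eq_square abs_if)
 finally show ?thesis by (simp add: Qker_def abs_mult)
qed (simp add: Qker_def)

lemma Hreg_symmetric:
 assumes e: "0 < e" and f: "f \<in> L2_space"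
 shows "Hreg e f x = (LINT z|lborel. Qker e z * z * pv_kernel f x z) / 2"
proof -
 have i1: "integrable lborel (%z. Qker e z * f (x - z))"
  by (intro integrable_mult_L2 Qker_L2 e L2_space_reflect f)
 have i2: "integrable lborel (%z. Qker e z * f (x + z))"
  by (intro integrable_mult_L2 Qker_L2 e L2_space_shift f)
 have 1: "Hreg e f x = (LINT z|lborel. Qker e z * f (x - z))"
  unfolding Hreg_def by (subst lborel_integral_real_affine[of "-1" _ x]) simp_all
 have 2: "Hreg e f x = (LINT z|lborel. - (Qker e z * f (x + z)))"
  unfolding Hreg_def by (subst lborel_integral_real_affine[of 1 _ x]) (simp_all add: Qker_odd)
 have "Hreg e f x + Hreg e f x = (LINT z|lborel. Qker e z * f (x - z) - Qker e z * f (x + z))"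
  using 1 2 i1 i2 by simp
 also have "... = (LINT z|lborel. Qker e z * z * pv_kernel f x z)"
 proof (rule Bochner_Integration.integral_cong)
  fix z show "Qker e z * f (x - z) - Qker e z * f (x + z) = Qker e z * z * pv_kernel f x z"
   by (cases "z = 0") (simp_all add: pv_kernel_def Qker_def[of e 0] field_simps)
 qed simp
 finally show ?thesis by simp
qed

lemma Qker_pv_le: "0 < e ==> \<bar>Qker e z * z * c\<bar> <= \<bar>c\<bar> / pi"
 using mult_right_mono[OF mult_right_mono[OF Qker_abs_le, of e "\<bar>z\<bar>"], of "\<bar>c\<bar>" z]
 by (cases "z = 0") (auto simp: abs_mult)

lemma Hreg_bound:
 assumes e: "0 < e" and f: "f \<in> L2_space" and i: "integrable lborel (pv_kernel f x)"
  and B: "(LINT z|lborel. \<bar>pv_kernel f x z\<bar>) <= B"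
 shows "\<bar>Hreg e f x\<bar> <= B / (2 * pi)"
proof -
 note [measurable] = L2_space_measurable[OF f]
 have i': "integrable lborel (%z. \<bar>pv_kernel f x z\<bar> / pi)" using i by simp
 have "integrable lborel (%z. Qker e z * z * pv_kernel f x z)"
  by (rule Bochner_Integration.integrable_bound[OF i']) (use Qker_pv_le[OF e] in auto)
 then have "\<bar>LINT z|lborel. Qker e z * z * pv_kernel f x z\<bar> <= (LINT z|lborel. \<bar>pv_kernel f x z\<bar> / pi)"
  using Bochner_Integration.integral_norm_bound_integral[OF _ i', of "%z. Qker e z * z * pv_kernel f x z"]
   Qker_pv_le[OF e] by simp
 also have "... <= B / pi" using B by (simp add: divide_right_mono)
 finally show ?thesis by (simp add: Hreg_symmetric[OF e f])
qed

lemma hil_bound: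
 assumes i: "integrable lborel (pv_kernel f x)" and B: "(LINT z|lborel. \<bar>pv_kernel f x z\<bar>) <= B"
 shows "\<bar>hil f x\<bar> <= B / (2 * pi)"
proof -
 have "\<bar>LINT z|lborel. pv_kernel f x z\<bar> <= B"
  using order_trans[OF Bochner_Integration.integral_norm_bound[of lborel "pv_kernel f x"], of B] B by simp
 then show ?thesis by (simp add: hil_def abs_mult divide_right_mono)
qed

lemma Hreg_tendsto:
 assumes f: "f \<in> L2_space" and i: "integrable lborel (pv_kernel f x)"
  and e: "!!n. 0 < e n" and lim: "e \<longlonglongrightarrow> 0"
 shows "(%n. Hreg (e n) f x) \<longlonglongrightarrow> hil f x"
proof -
 note [measurable] = L2_space_measurable[OF f]
 have "(%n. LINT z|lborel. Qker (e n) z * z * pv_kernel f x z) \<longlonglongrightarrow> (LINT z|lborel. pv_kernel f x z / pi)"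
 proof (rule integral_dominated_convergence[where w="%z. \<bar>pv_kernel f x z\<bar> / pi"])
  show "integrable lborel (%z. \<bar>pv_kernel f x z\<bar> / pi)" using i by simp
  show "AE z in lborel. norm (Qker (e n) z * z * pv_kernel f x z) <= \<bar>pv_kernel f x z\<bar> / pi" for n
   using Qker_pv_le[OF e] by simp
  show "AE z in lborel. (%n. Qker (e n) z * z * pv_kernel f x z) \<longlonglongrightarrow> pv_kernel f x z / pi"
  proof (rule AE_I2)
   fix z
   show "(%n. Qker (e n) z * z * pv_kernel f x z) \<longlonglongrightarrow> pv_kernel f x z / pi"
   proof (cases "z = 0")
    case False
    have "(%n. z / (pi * (z\<^sup>2 + (e n)\<^sup>2)) * z * pv_kernel f x z) \<longlonglongrightarrow> z / (pi * (z\<^sup>2 + 0\<^sup>2)) * z * pv_kernel f x z"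
     using False by (intro tendsto_intros lim) auto
    then show ?thesis using False by (simp add: Qker_def power2_eq_square)
   qed (simp add: pv_kernel_def)
  qed
 qed simp_all
 then have "(%n. (LINT z|lborel. Qker (e n) z * z * pv_kernel f x z) / 2) \<longlonglongrightarrow> (LINT z|lborel. pv_kernel f x z / pi) / 2"
  by (intro tendsto_divide tendsto_const) auto
 then show ?thesis by (simp add: Hreg_symmetric[OF e f] hil_def field_simps)
qed

lemma hil_L2:
 assumes f: "f \<in> L2_space" and i: "AE x in lborel. integrable lborel (pv_kernel f x)"
 shows "hil f \<in> L2_space" "L2_norm (hil f) <= L2_norm f"
proof -
 note [measurable] = L2_space_measurable[OF f]
 define e where "e n = inverse (real (Suc n))" for n
 have e: "0 < e n" for n by (simp add: e_def)
 have e0: "e \<longlonglongrightarrow> 0" unfolding e_def by (rule LIMSEQ_inverse_real_of_nat)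
 have lim: "AE x in lborel. (%n. Hreg (e n) f x) \<longlonglongrightarrow> hil f x"
  using i by eventually_elim (rule Hreg_tendsto[OF f _ e e0])
 show "hil f \<in> L2_space" "L2_norm (hil f) <= L2_norm f"
  using L2_Fatou[OF Hreg_contraction(1)[OF e f] Hreg_contraction(2)[OF e f] lim] by simp_all
qed

lemma L2_weak_convergence:
 assumes g: "g \<in> L2_space" and h: "!!n. h n \<in> L2_space" "!!n. L2_norm (h n) <= A"
  and bd: "!!n x. \<bar>h n x\<bar> <= B" and lim: "!!x. (%n. h n x) \<longlonglongrightarrow> k x" and k: "k \<in> L2_space" "L2_norm k <= A"
 shows "(%n. LINT x|lborel. g x * h n x) \<longlonglongrightarrow> (LINT x|lborel. g x * k x)"
proof (rule LIMSEQ_I)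
 fix r :: real assume r: "0 < r"
 note [measurable] = L2_space_measurable[OF g] L2_space_measurable[OF h(1)] L2_space_measurable[OF k(1)]
 have A: "0 <= A" using k(2) L2_norm_nonneg[of k] by linarith
 have "0 < r / (3 * (A + 1))" using r A by simp
 from LIMSEQ_D[OF L2_norm_trunc_diff[OF g] this]
 obtain m where m: "L2_norm (%x. trunc m g x - g x) < r / (3 * (A + 1))" by auto
 have tail: "\<bar>(LINT x|lborel. trunc m g x * v x) - (LINT x|lborel. g x * v x)\<bar> <= r / 3"
  if v: "v \<in> L2_space" "L2_norm v <= A" for v
 proof -
  have "\<bar>LINT x|lborel. (trunc m g x - g x) * v x\<bar> <= L2_norm (%x. trunc m g x - g x) * L2_norm v"
   by (rule L2_Cauchy_Schwarz[OF L2_space_diff[OF trunc_L2(1)[OF g] g] v(1)])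
  also have "... <= r / (3 * (A + 1)) * A" using m v(2) A r by (intro mult_mono) auto
  also have "... <= r / 3" using A r by (simp add: field_simps)
  finally show ?thesis
   using integrable_mult_L2[OF trunc_L2(1)[OF g] v(1)] integrable_mult_L2[OF g v(1)] by (simp add: left_diff_distrib)
 qed
 have "(%n. LINT x|lborel. trunc m g x * h n x) \<longlonglongrightarrow> (LINT x|lborel. trunc m g x * k x)"
 proof (rule integral_dominated_convergence[where w="%x. B * \<bar>trunc m g x\<bar>"])
  show "integrable lborel (%x. B * \<bar>trunc m g x\<bar>)" using trunc_L2(2)[OF g] by simp
  show "AE x in lborel. (%n. trunc m g x * h n x) \<longlonglongrightarrow> trunc m g x * k x"
   by (intro AE_I2 tendsto_intros lim)
  show "AE x in lborel. norm (trunc m g x * h n x) <= B * \<bar>trunc m g x\<bar>" for n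
   using bd[of n] by (intro AE_I2) (simp add: abs_mult mult.commute[of B] mult_left_mono)
 qed simp_all
 from LIMSEQ_D[OF this, of "r / 3"] r obtain N where N: "!!n. N <= n ==>
   \<bar>(LINT x|lborel. trunc m g x * h n x) - (LINT x|lborel. trunc m g x * k x)\<bar> < r / 3" by auto
 show "\<exists>N. \<forall>n\<ge>N. norm ((LINT x|lborel. g x * h n x) - (LINT x|lborel. g x * k x)) < r"
 proof (intro exI allI impI)
  fix n assume "N <= n"
  then show "norm ((LINT x|lborel. g x * h n x) - (LINT x|lborel. g x * k x)) < r"
   using N[of n] tail[OF h, of n] tail[OF k] unfolding real_norm_def by linarith
 qed
qed

text \<open>The functions to which the Hilbert transform is applied below: square-integrable, with
 principal value integrals that are absolutely convergent, uniformly in the point.\<close>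

locale pv_bounded =
 fixes f :: "real => real" and B :: real
 assumes L2: "f \<in> L2_space" and int: "!!x. integrable lborel (pv_kernel f x)"
  and bound: "!!x. (LINT z|lborel. \<bar>pv_kernel f x z\<bar>) <= B"
begin

lemma hil_in_L2: "hil f \<in> L2_space" "L2_norm (hil f) <= L2_norm f"
 using hil_L2[OF L2] int by auto

lemma inner_Hreg_tendsto:
 assumes g: "g \<in> L2_space" and e: "!!n. 0 < e n" and e0: "e \<longlonglongrightarrow> 0"
 shows "(%n. LINT x|lborel. g x * Hreg (e n) f x) \<longlonglongrightarrow> (LINT x|lborel. g x * hil f x)"
 by (rule L2_weak_convergence[OF g Hreg_contraction[OF e L2] Hreg_bound[OF e L2 int bound] Hreg_tendsto[OF L2 int e e0] hil_in_L2])

lemma hil_orthogonal: "(LINT x|lborel. f x * hil f x) = 0"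
proof -
 define e where "e n = inverse (real (Suc n))" for n
 have e: "0 < e n" for n by (simp add: e_def)
 have e0: "e \<longlonglongrightarrow> 0" unfolding e_def by (rule LIMSEQ_inverse_real_of_nat)
 have "(LINT x|lborel. f x * Hreg (e n) f x) = 0" for n
  using Hreg_skew[OF e L2 L2, of n] by (simp add: mult.commute)
 with inner_Hreg_tendsto[OF L2 e e0] show ?thesis by (simp add: LIMSEQ_const_iff)
qed

lemma Hreg_hil:
 assumes e: "0 < e"
 shows "Hreg e (hil f) x = - Preg e f x"
proof -
 define c where "c n = inverse (real (Suc n))" for n
 have c: "0 < c n" "c n <= 1" for n by (auto simp: c_def divide_simps)
 have c0: "c \<longlonglongrightarrow> 0" unfolding c_def by (rule LIMSEQ_inverse_real_of_nat)
 note [measurable] = L2_space_measurable[OF L2]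
 have P2: "(%y. Pker e (x - y)) \<in> L2_space"
 proof -
  have "integrable lborel (%z. (Pker e z)\<^sup>2)"
  proof (rule Bochner_Integration.integrable_bound)
   show "integrable lborel (%z. 1 / (pi * e) * Pker e z)" using Pker_integral[OF e] by simp
   show "AE z in lborel. norm ((Pker e z)\<^sup>2) <= norm (1 / (pi * e) * Pker e z)"
    using mult_right_mono[OF Pker_le[OF e] Pker_nonneg[OF e]] Pker_nonneg[OF e] e
    by (intro AE_I2) (simp add: power2_eq_square)
  qed simp
  then have "Pker e \<in> L2_space" by (simp add: L2_space_iff)
  then show ?thesis by (rule L2_space_reflect)
 qed
 have "(%n. LINT y|lborel. Pker (e + c n) (x - y) * f y) \<longlonglongrightarrow> (LINT y|lborel. Pker e (x - y) * f y)"
 proof (rule integral_dominated_convergence[where w="%y. (1 + 1 / e) * \<bar>Pker e (x - y) * f y\<bar>"])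
  show "integrable lborel (%y. (1 + 1 / e) * \<bar>Pker e (x - y) * f y\<bar>)"
   using integrable_mult_L2[OF P2 L2] by simp
  have "Pker (e + c n) z <= (1 + 1 / e) * Pker e z" for n z
  proof -
   have "(e + c n) / (pi * (z\<^sup>2 + (e + c n)\<^sup>2)) <= (e + 1) / (pi * (z\<^sup>2 + e\<^sup>2))"
    using e c[of n] by (intro frac_le mult_left_mono add_left_mono power_mono mult_pos_pos sum_squares_pos) auto
   also have "... = (1 + 1 / e) * Pker e z" using e by (simp add: Pker_def distrib_right)
   finally show ?thesis by (simp add: Pker_def)
  qed
  then have "\<bar>Pker (e + c n) (x - y)\<bar> * \<bar>f y\<bar> <= (1 + 1 / e) * \<bar>Pker e (x - y)\<bar> * \<bar>f y\<bar>" for n y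
   using Pker_nonneg e c(1)[of n] by (intro mult_right_mono) (simp_all add: add_pos_pos)
  then show "AE y in lborel. norm (Pker (e + c n) (x - y) * f y) <= (1 + 1 / e) * \<bar>Pker e (x - y) * f y\<bar>" for n
   by (intro AE_I2) (simp only: real_norm_def abs_mult mult.assoc)
  show "AE y in lborel. (%n. Pker (e + c n) (x - y) * f y) \<longlonglongrightarrow> Pker e (x - y) * f y"
  proof (rule AE_I2)
   fix y
   have "(%n. (e + c n) / (pi * ((x - y)\<^sup>2 + (e + c n)\<^sup>2)) * f y) \<longlonglongrightarrow> (e + 0) / (pi * ((x - y)\<^sup>2 + (e + 0)\<^sup>2)) * f y"
    using e by (intro tendsto_intros c0) auto
   then show "(%n. Pker (e + c n) (x - y) * f y) \<longlonglongrightarrow> Pker e (x - y) * f y"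
    by (simp add: Pker_def)
  qed
 qed simp_all
 then have "(%n. - Preg (e + c n) f x) \<longlonglongrightarrow> - Preg e f x"
  unfolding Preg_def by (rule tendsto_minus)
 moreover have "(%n. - Preg (e + c n) f x) \<longlonglongrightarrow> Hreg e (hil f) x"
  using inner_Hreg_tendsto[OF L2_space_reflect(1)[OF Qker_L2[OF e]] c(1) c0, of x]
  unfolding Hreg_Hreg[OF c(1) e L2] Hreg_def[of e "hil f"] .
 ultimately show ?thesis using LIMSEQ_unique by blast
qed

end

lemma Preg_scaled:
 assumes "0 < e"
 shows "Preg e f x = (LINT z|lborel. Pker 1 z * f (x - e * z))"
proof -
 have "Preg e f x = \<bar>- e\<bar> *\<^sub>R (LINT z|lborel. Pker e (x - (x + (- e) * z)) * f (x + (- e) * z))"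
  unfolding Preg_def using assms by (intro lborel_integral_real_affine) simp
 also have "... = (LINT z|lborel. e * (Pker e (e * z) * f (x - e * z)))"
  using assms by simp
 also have "(%z. e * (Pker e (e * z) * f (x - e * z))) = (%z. Pker 1 z * f (x - e * z))"
 proof
  fix z
  have "pi * ((e * z)\<^sup>2 + e\<^sup>2) = e * e * (pi * (z\<^sup>2 + 1\<^sup>2))"
   by (simp add: power2_eq_square algebra_simps)
  then have "e * Pker e (e * z) = Pker 1 z" using assms by (simp add: Pker_def)
  then show "e * (Pker e (e * z) * f (x - e * z)) = Pker 1 z * f (x - e * z)" by simp
 qed
 finally show ?thesis .
qed

lemma Preg_bound:
 assumes e: "0 < e" and [measurable]: "f \<in> borel_measurable borel" and bd: "!!x. \<bar>f x\<bar> <= B"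
 shows "\<bar>Preg e f x\<bar> <= B"
proof -
 have i: "integrable lborel (%z. B * Pker 1 z)" using Pker_integral[of 1] by simp
 have le: "\<bar>Pker 1 z * f (x - e * z)\<bar> <= B * Pker 1 z" for z
  using mult_left_mono[OF bd Pker_nonneg[of 1 z], of "x - e * z"] Pker_nonneg[of 1 z]
  by (simp add: abs_mult mult.commute)
 have "integrable lborel (%z. Pker 1 z * f (x - e * z))"
  by (rule Bochner_Integration.integrable_bound[OF i]) (auto intro!: AE_I2 order_trans[OF le] abs_ge_self)
 from Bochner_Integration.integral_norm_bound_integral[OF this i] le show ?thesis
  using Pker_integral[of 1] by (simp add: Preg_scaled[OF e])
qed

lemma Preg_tendsto:
 assumes c: "continuous_on UNIV f" and bd: "!!x. \<bar>f x\<bar> <= B"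
  and e: "!!n. 0 < e n" and lim: "e \<longlonglongrightarrow> 0"
 shows "(%n. Preg (e n) f x) \<longlonglongrightarrow> f x"
proof -
 have [measurable]: "f \<in> borel_measurable borel" by (rule borel_measurable_continuous_onI[OF c])
 have "(%n. LINT z|lborel. Pker 1 z * f (x - e n * z)) \<longlonglongrightarrow> (LINT z|lborel. Pker 1 z * f x)"
 proof (rule integral_dominated_convergence[where w="%z. B * Pker 1 z"])
  show "integrable lborel (%z. B * Pker 1 z)" using Pker_integral[of 1] by simp
  show "AE z in lborel. norm (Pker 1 z * f (x - e n * z)) <= B * Pker 1 z" for n
  proof (rule AE_I2)
   fix z show "norm (Pker 1 z * f (x - e n * z)) <= B * Pker 1 z"
    using mult_left_mono[OF bd Pker_nonneg[of 1 z], of "x - e n * z"] Pker_nonneg[of 1 z]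
    by (simp add: abs_mult mult.commute)
  qed
  show "AE z in lborel. (%n. Pker 1 z * f (x - e n * z)) \<longlonglongrightarrow> Pker 1 z * f x"
  proof (rule AE_I2)
   fix z
   have "(%n. x - e n * z) \<longlonglongrightarrow> x - 0 * z" by (intro tendsto_intros lim)
   then have "(%n. f (x - e n * z)) \<longlonglongrightarrow> f x"
    using c by (intro isCont_tendsto_compose[of x f]) (auto simp: continuous_on_eq_continuous_at)
   then show "(%n. Pker 1 z * f (x - e n * z)) \<longlonglongrightarrow> Pker 1 z * f x" by (intro tendsto_intros)
  qed
 qed simp_all
 then show ?thesis using Pker_integral[of 1] by (simp add: Preg_scaled[OF e])
qed

text \<open>Far from the point, only the \<open>L\<^sup>2\<close> norm is used, against the square-integrable tail of
 \<open>1 / z\<close>; close to it, any integrable majorant will do.\<close>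

lemma inverse_tail_L2:
 fixes R :: real
 assumes R: "0 < R"
 shows "(%z. indicator {z. R < \<bar>z\<bar>} z / \<bar>z\<bar>) \<in> L2_space"
  and "L2_norm (%z. indicator {z. R < \<bar>z\<bar>} z / \<bar>z\<bar>) = sqrt (2 / R)"
proof -
 have eq: "(%z::real. (indicator {z. R < \<bar>z\<bar>} z / \<bar>z\<bar>)\<^sup>2 :: real) = (%z. indicator {z. R < \<bar>z\<bar>} z * \<bar>z\<bar> powr (0 - 2))"
 proof
  fix z :: real
  show "(indicator {z. R < \<bar>z\<bar>} z / \<bar>z\<bar>)\<^sup>2 = indicator {z. R < \<bar>z\<bar>} z * \<bar>z\<bar> powr (0 - 2)"
   using R by (auto simp: indicator_def powr_minus powr_numeral divide_inverse power_inverse)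
 qed
 show "(%z. indicator {z. R < \<bar>z\<bar>} z / \<bar>z\<bar>) \<in> L2_space"
  unfolding L2_space_iff eq using powr_integral_far(1)[of 0 R] R by simp
 show "L2_norm (%z. indicator {z. R < \<bar>z\<bar>} z / \<bar>z\<bar>) = sqrt (2 / R)"
  unfolding L2_norm_def eq using powr_integral_far(2)[of 0 R] R by (simp add: powr_minus divide_inverse)
qed

lemma pv_kernel_split:
 assumes f: "f \<in> L2_space" and R: "0 < R" and b: "integrable lborel b" "!!z. 0 <= b z"
  and near: "!!z. \<bar>z\<bar> <= R ==> \<bar>pv_kernel f x z\<bar> <= b z"
 shows "integrable lborel (pv_kernel f x)"
  and "(LINT z|lborel. \<bar>pv_kernel f x z\<bar>) <= (LINT z|lborel. b z) + 2 * sqrt (2 / R) * L2_norm f"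
proof -
 note [measurable] = L2_space_measurable[OF f]
 let ?k = "%z. indicator {z. R < \<bar>z\<bar>} z / \<bar>z\<bar>"
 let ?t1 = "%z. \<bar>?k z * f (x - z)\<bar>" and ?t2 = "%z. \<bar>?k z * f (x + z)\<bar>"
 note k = inverse_tail_L2[OF R]
 have i1: "integrable lborel ?t1" using integrable_mult_L2[OF k(1) L2_space_reflect(1)[OF f]] by (rule integrable_abs)
 have i2: "integrable lborel ?t2" using integrable_mult_L2[OF k(1) L2_space_shift(1)[OF f]] by (rule integrable_abs)
 have l1: "(LINT z|lborel. ?t1 z) <= sqrt (2 / R) * L2_norm f"
  using L2_Cauchy_Schwarz_abs[OF k(1) L2_space_reflect(1)[OF f], of x] unfolding k(2) L2_space_reflect(2)[OF f] .
 have l2: "(LINT z|lborel. ?t2 z) <= sqrt (2 / R) * L2_norm f"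
  using L2_Cauchy_Schwarz_abs[OF k(1) L2_space_shift(1)[OF f], of x] unfolding k(2) L2_space_shift(2)[OF f] .
 have le: "\<bar>pv_kernel f x z\<bar> <= b z + ?t1 z + ?t2 z" for z
 proof (cases "\<bar>z\<bar> <= R")
  case True
  then show ?thesis using near[OF True] by (simp add: add_increasing2)
 next
  case False
  then have "\<bar>pv_kernel f x z\<bar> <= \<bar>f (x - z)\<bar> / \<bar>z\<bar> + \<bar>f (x + z)\<bar> / \<bar>z\<bar>"
   by (simp add: pv_kernel_def add_divide_distrib[symmetric] divide_right_mono)
  also have "... = ?t1 z + ?t2 z" using False by (simp add: abs_mult)
  finally show ?thesis using b(2)[of z] by linarith
 qed
 have i: "integrable lborel (%z. b z + ?t1 z + ?t2 z)" using b i1 i2 by simp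
 show int: "integrable lborel (pv_kernel f x)"
  by (rule Bochner_Integration.integrable_bound[OF i]) (use order_trans[OF le abs_ge_self] in auto)
 have "(LINT z|lborel. \<bar>pv_kernel f x z\<bar>) <= (LINT z|lborel. b z + ?t1 z + ?t2 z)"
  using int i le by (intro integral_mono) auto
 also have "... = (LINT z|lborel. b z) + (LINT z|lborel. ?t1 z) + (LINT z|lborel. ?t2 z)"
  using b i1 i2 by simp
 finally show "(LINT z|lborel. \<bar>pv_kernel f x z\<bar>) <= (LINT z|lborel. b z) + 2 * sqrt (2 / R) * L2_norm f"
  using l1 l2 by linarith
qed

lemma hilbert_transform_eq_hil:
 assumes f: "f \<in> L2_space" and i: "integrable lborel (pv_kernel f x)"
 shows "hilbert_transform f x = hil f x"
proof -
 note [measurable] = L2_space_measurable[OF f]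
 let ?I = "%ep. LINT y:{y. \<bar>x - y\<bar> > ep}|lborel. f y / (x - y)"
 have I: "?I ep = (LINT z|lborel. indicator {z. \<bar>z\<bar> > ep} z * pv_kernel f x z) / 2" if ep: "0 < ep" for ep
 proof -
  let ?k = "%z. indicator {z. ep < \<bar>z\<bar>} z / \<bar>z\<bar>"
  have k: "(%z. indicator {z. ep < \<bar>z\<bar>} z / z) \<in> L2_space"
  proof -
   have "(%z. sgn z * ?k z) = (%z. indicator {z. ep < \<bar>z\<bar>} z / z)"
    by (auto simp: sgn_if fun_eq_iff)
   moreover have "(%z. sgn z * ?k z) \<in> L2_space"
    by (rule L2_space_mult_bounded(1)[OF inverse_tail_L2(1)[OF ep], of _ 1]) (auto simp: sgn_if)
   ultimately show ?thesis by simp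
  qed
  have i1: "integrable lborel (%z. indicator {z. ep < \<bar>z\<bar>} z / z * f (x - z))"
   by (intro integrable_mult_L2 k L2_space_reflect f)
  have i2: "integrable lborel (%z. indicator {z. ep < \<bar>z\<bar>} z / z * f (x + z))"
   by (intro integrable_mult_L2 k L2_space_shift f)
  have 1: "?I ep = (LINT z|lborel. indicator {z. ep < \<bar>z\<bar>} z / z * f (x - z))"
   unfolding set_lebesgue_integral_def
   by (subst lborel_integral_real_affine[of "-1" _ x]) (auto simp: indicator_def intro!: Bochner_Integration.integral_cong)
  have 2: "?I ep = (LINT z|lborel. - (indicator {z. ep < \<bar>z\<bar>} z / z * f (x + z)))"
   unfolding set_lebesgue_integral_def
   by (subst lborel_integral_real_affine[of 1 _ x]) (auto simp: indicator_def intro!: Bochner_Integration.integral_cong)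
  have "?I ep + ?I ep = (LINT z|lborel. indicator {z. ep < \<bar>z\<bar>} z / z * f (x - z) - indicator {z. ep < \<bar>z\<bar>} z / z * f (x + z))"
   using 1 2 i1 i2 by simp
  also have "... = (LINT z|lborel. indicator {z. \<bar>z\<bar> > ep} z * pv_kernel f x z)"
   by (rule Bochner_Integration.integral_cong) (auto simp: pv_kernel_def indicator_def diff_divide_distrib)
  finally show ?thesis by simp
 qed
 have "(?I \<longlongrightarrow> pi * hil f x) (at_right 0)"
  unfolding tendsto_at_iff_sequentially
 proof (intro allI impI)
  fix X :: "nat => real" assume X: "\<forall>i. X i \<in> {0<..} - {0}" "X \<longlonglongrightarrow> 0"
  have "(%n. LINT z|lborel. indicator {z. \<bar>z\<bar> > X n} z * pv_kernel f x z) \<longlonglongrightarrow> (LINT z|lborel. pv_kernel f x z)"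
  proof (rule integral_dominated_convergence[where w="%z. \<bar>pv_kernel f x z\<bar>"])
   show "integrable lborel (%z. \<bar>pv_kernel f x z\<bar>)" using i by simp
   show "AE z in lborel. norm (indicator {z. \<bar>z\<bar> > X n} z * pv_kernel f x z) <= \<bar>pv_kernel f x z\<bar>" for n
    by (auto simp: indicator_def)
   show "AE z in lborel. (%n. indicator {z. \<bar>z\<bar> > X n} z * pv_kernel f x z) \<longlonglongrightarrow> pv_kernel f x z"
   proof (rule AE_I2)
    fix z
    show "(%n. indicator {z. \<bar>z\<bar> > X n} z * pv_kernel f x z) \<longlonglongrightarrow> pv_kernel f x z"
    proof (cases "z = 0")
     case False
     then have "\<forall>\<^sub>F n in sequentially. X n < \<bar>z\<bar>" using order_tendstoD(2)[OF X(2), of "\<bar>z\<bar>"] by simp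
     then have "\<forall>\<^sub>F n in sequentially. indicator {z. \<bar>z\<bar> > X n} z * pv_kernel f x z = pv_kernel f x z"
      by eventually_elim simp
     then show ?thesis by (rule tendsto_eventually)
    qed (simp add: pv_kernel_def)
   qed
  qed simp_all
  from tendsto_divide[OF this tendsto_const, of 2]
  show "(?I \<circ> X) \<longlonglongrightarrow> pi * hil f x"
   using X(1) by (simp add: o_def I hil_def)
 qed
 from tendsto_Lim[OF _ this] show ?thesis by (simp add: hilbert_transform_def)
qed

section \<open>Balls of square-integrable functions with Hoelder continuous derivative\<close>

text \<open>One radius for the four quantities is enough for all estimates.\<close>

definition Hball :: "real => real => (real => real) set" where
 "Hball dl M = {f \<in> L2_space. L2_norm f <= M & (\<forall>x. f differentiable (at x)) & (\<forall>x. \<bar>f x\<bar> <= M) &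
  (\<forall>x. \<bar>deriv f x\<bar> <= M) & (\<forall>x y. \<bar>deriv f x - deriv f y\<bar> <= M * \<bar>x - y\<bar> powr dl)}"

context
 fixes dl M :: real and f :: "real => real"
 assumes f: "f \<in> Hball dl M"
begin

lemma Hball_L2: "f \<in> L2_space" and Hball_norm: "L2_norm f <= M" and Hball_bound: "\<bar>f x\<bar> <= M"
 and Hball_deriv_bound: "\<bar>deriv f x\<bar> <= M"
 and Hball_holder: "\<bar>deriv f x - deriv f y\<bar> <= M * \<bar>x - y\<bar> powr dl"
 using f by (auto simp: Hball_def)

lemma Hball_has_derivative: "(f has_real_derivative deriv f x) (at x)"
 using f by (simp add: Hball_def DERIV_deriv_iff_real_differentiable)

lemma Hball_nonneg: "0 <= M"
 using Hball_bound[of 0] by linarith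

lemma Hball_continuous: "continuous_on S f"
 using Hball_has_derivative by (meson DERIV_continuous continuous_at_imp_continuous_on)

lemma Hball_measurable: "f \<in> borel_measurable borel"
 using Hball_L2 by (rule L2_space_measurable)

lemma Hball_Lipschitz: "\<bar>f x - f y\<bar> <= M * \<bar>x - y\<bar>"
 using field_differentiable_bound[of UNIV f "deriv f" M x y] Hball_has_derivative Hball_deriv_bound
 by (auto intro: DERIV_subset)

end

lemma HballI:
 assumes "f \<in> L2_space" "L2_norm f <= M" "!!x. (f has_real_derivative f' x) (at x)" "!!x. \<bar>f x\<bar> <= M"
  "!!x. \<bar>f' x\<bar> <= M" "!!x y. \<bar>f' x - f' y\<bar> <= M * \<bar>x - y\<bar> powr dl"
 shows "f \<in> Hball dl M"
proof -
 have "deriv f = f'" using assms(3) by (auto intro: DERIV_imp_deriv)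
 moreover have "f differentiable (at x)" for x using assms(3) by (auto simp: real_differentiable_def)
 ultimately show ?thesis using assms by (simp add: Hball_def)
qed

lemma Hball_mono: "f \<in> Hball dl M ==> M <= N ==> f \<in> Hball dl N"
 unfolding Hball_def by (auto intro: order_trans mult_right_mono)
  (meson mult_right_mono order_trans powr_ge_zero)

lemma deriv_diff_Hball:
 assumes "f \<in> Hball dl M" "g \<in> Hball dl N"
 shows "deriv (%x. f x - g x) = (%x. deriv f x - deriv g x)"
 by (rule ext, rule DERIV_imp_deriv)
  (intro DERIV_diff Hball_has_derivative[OF assms(1)] Hball_has_derivative[OF assms(2)])

lemma Hball_diff:
 assumes "f \<in> Hball dl M" "g \<in> Hball dl N"
 shows "(%x. f x - g x) \<in> Hball dl (M + N)"
proof (rule HballI[where f'="%x. deriv f x - deriv g x"])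
 note L = Hball_L2[OF assms(1)] Hball_L2[OF assms(2)]
 show "(%x. f x - g x) \<in> L2_space" using L by (rule L2_space_diff)
 show "L2_norm (%x. f x - g x) <= M + N"
  using L2_norm_triangle_diff[OF L] Hball_norm[OF assms(1)] Hball_norm[OF assms(2)] by linarith
 show "((%x. f x - g x) has_real_derivative deriv f x - deriv g x) (at x)" for x
  by (intro DERIV_diff Hball_has_derivative[OF assms(1)] Hball_has_derivative[OF assms(2)])
 show "\<bar>f x - g x\<bar> <= M + N" for x
  using Hball_bound[OF assms(1), of x] Hball_bound[OF assms(2), of x] by linarith
 show "\<bar>deriv f x - deriv g x\<bar> <= M + N" for x
  using Hball_deriv_bound[OF assms(1), of x] Hball_deriv_bound[OF assms(2), of x] by linarith
 show "\<bar>(deriv f x - deriv g x) - (deriv f y - deriv g y)\<bar> <= (M + N) * \<bar>x - y\<bar> powr dl" for x y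
  using Hball_holder[OF assms(1), of x y] Hball_holder[OF assms(2), of x y] by (simp add: distrib_right)
qed

lemma mvt_real:
 assumes f: "!!x. (f has_real_derivative f' x) (at x)"
 obtains t where "\<bar>t\<bar> <= \<bar>z\<bar>" "f (x + z) - f x = z * f' (x + t)"
proof (cases z "0 :: real" rule: linorder_cases)
 case greater
 from MVT2[of x "x + z" f f'] f greater obtain s where "x < s" "s < x + z" "f (x + z) - f x = z * f' s" by auto
 then show ?thesis using that[of "s - x"] by auto
next
 case less
 from MVT2[of "x + z" x f f'] f less obtain s where "x + z < s" "s < x" "f x - f (x + z) = - z * f' s" by auto
 then show ?thesis using that[of "s - x"] by auto
qed (use that[of 0] in simp)

lemma Hball_first_order:
 assumes f: "f \<in> Hball dl M" and dl: "0 < dl"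
 shows "\<bar>f (x + z) - f x - z * deriv f x\<bar> <= M * (\<bar>z\<bar> powr dl * \<bar>z\<bar>)"
proof -
 obtain t where t: "\<bar>t\<bar> <= \<bar>z\<bar>" "f (x + z) - f x = z * deriv f (x + t)"
  using mvt_real[OF Hball_has_derivative[OF f]] by blast
 have "\<bar>f (x + z) - f x - z * deriv f x\<bar> = \<bar>z\<bar> * \<bar>deriv f (x + t) - deriv f x\<bar>"
  by (simp add: t(2) abs_mult[symmetric] right_diff_distrib)
 also have "... <= \<bar>z\<bar> * (M * \<bar>z\<bar> powr dl)"
 proof (rule mult_left_mono)
  have "M * \<bar>t\<bar> powr dl <= M * \<bar>z\<bar> powr dl"
   using t(1) dl Hball_nonneg[OF f] by (intro mult_left_mono powr_mono2) auto
  then show "\<bar>deriv f (x + t) - deriv f x\<bar> <= M * \<bar>z\<bar> powr dl"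
   using Hball_holder[OF f, of "x + t" x] by simp
 qed simp
 finally show ?thesis by (simp add: mult_ac)
qed

text \<open>Interpolation: a small function with a bounded \<open>C\<^sup>1\<^sup>+\<^sup>\<delta>\<close> norm has a small derivative.\<close>

lemma Hball_deriv_interpolate:
 assumes f: "f \<in> Hball dl M" and dl: "0 < dl" and k: "!!x. \<bar>f x\<bar> <= kp" and h: "0 < h"
 shows "\<bar>deriv f x\<bar> <= 2 * kp / h + M * h powr dl"
proof -
 have "h * \<bar>deriv f x\<bar> = \<bar>h * deriv f x\<bar>" using h by (simp add: abs_mult)
 also have "... <= 2 * kp + M * (h powr dl * h)"
  using Hball_first_order[OF f dl, of x h] k[of x] k[of "x + h"] h by simp
 also have "... = h * (2 * kp / h + M * h powr dl)" using h by (simp add: distrib_left)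
 finally show ?thesis using h by simp
qed

lemma Hball_pv:
 assumes f: "f \<in> Hball dl M" and k: "!!x. \<bar>f x\<bar> <= kp" and r: "0 < r" "r <= R"
 shows "integrable lborel (pv_kernel f x)"
  and "(LINT z|lborel. \<bar>pv_kernel f x z\<bar>) <= 4 * M * r + 4 * R * kp / r + 2 * sqrt (2 / R) * M"
proof -
 let ?b = "%z. 2 * M * indicator {-r..r} z + 2 * kp / r * indicator {-R..R} z"
 have k0: "0 <= kp" using k[of 0] by linarith
 note M0 = Hball_nonneg[OF f]
 have ind: "integrable lborel (indicator {-c..c} :: real => real)" for c
  by (rule integrable_real_indicator) (auto simp: emeasure_lborel_Icc_eq)
 have b: "integrable lborel ?b"
  by (intro Bochner_Integration.integrable_add integrable_mult_right ind)
 have b0: "0 <= ?b z" for z using k0 M0 r by simp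
 have near: "\<bar>pv_kernel f x z\<bar> <= ?b z" if z: "\<bar>z\<bar> <= R" for z
 proof (cases "\<bar>z\<bar> <= r")
  case True
  have "\<bar>pv_kernel f x z\<bar> <= 2 * M"
  proof (cases "z = 0")
   case False
   have "\<bar>f (x - z) - f (x + z)\<bar> <= M * \<bar>(x - z) - (x + z)\<bar>" by (rule Hball_Lipschitz[OF f])
   then show ?thesis using False by (simp add: pv_kernel_def divide_simps)
  qed (simp add: pv_kernel_def M0)
  also have "... <= ?b z" using True k0 r by (auto simp: indicator_def)
  finally show ?thesis .
 next
  case False
  have "\<bar>f (x - z) - f (x + z)\<bar> <= 2 * kp" using k[of "x - z"] k[of "x + z"] by linarith
  then have "\<bar>pv_kernel f x z\<bar> <= 2 * kp / r"
   using False r k0 by (simp add: pv_kernel_def abs_divide frac_le)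
  also have "... <= ?b z" using False M0 z k0 r by (auto simp: indicator_def)
  finally show ?thesis .
 qed
 have R: "0 < R" using r by simp
 note s = pv_kernel_split[OF Hball_L2[OF f] R b b0 near]
 show "integrable lborel (pv_kernel f x)" by (rule s(1))
 have "(LINT z|lborel. ?b z) = 2 * M * (LINT z|lborel. indicator {-r..r} z) + 2 * kp / r * (LINT z|lborel. indicator {-R..R} z)"
  using ind by simp
 also have "... = 4 * M * r + 4 * R * kp / r" using r by simp
 finally have "(LINT z|lborel. ?b z) = 4 * M * r + 4 * R * kp / r" .
 moreover have "2 * sqrt (2 / R) * L2_norm f <= 2 * sqrt (2 / R) * M"
  using Hball_norm[OF f] R by (intro mult_left_mono) auto
 ultimately show "(LINT z|lborel. \<bar>pv_kernel f x z\<bar>) <= 4 * M * r + 4 * R * kp / r + 2 * sqrt (2 / R) * M"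
  using s(2) by linarith
qed

lemma Hball_pv_bounded:
 assumes f: "f \<in> Hball dl M"
 shows "pv_bounded f (12 * M)"
proof
 fix x
 note p = Hball_pv[OF f Hball_bound[OF f], of 1 1 x]
 show "integrable lborel (pv_kernel f x)" using p(1) by simp
 have "sqrt 2 <= 2" using real_sqrt_le_mono[of 2 4] by simp
 then have "sqrt 2 * M <= 2 * M" using Hball_nonneg[OF f] by (intro mult_right_mono)
 then show "(LINT z|lborel. \<bar>pv_kernel f x z\<bar>) <= 12 * M" using p(2) by simp
qed (rule Hball_L2[OF f])

lemma Hball_hil_bound: assumes "f \<in> Hball dl M" shows "\<bar>hil f x\<bar> <= 2 * M"
proof -
 interpret pv_bounded f "12 * M" by (rule Hball_pv_bounded[OF assms])
 have "\<bar>hil f x\<bar> <= 12 * M / (2 * pi)" by (rule hil_bound[OF int bound])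
 also have "... <= 12 * M / (2 * 3)" using pi_gt3 Hball_nonneg[OF assms] by (intro divide_left_mono) auto
 finally show ?thesis by simp
qed

lemma hil_diff:
 assumes "f \<in> Hball dl M" "g \<in> Hball dl N"
 shows "hil (%x. f x - g x) x = hil f x - hil g x"
proof -
 interpret f: pv_bounded f "12 * M" by (rule Hball_pv_bounded[OF assms(1)])
 interpret g: pv_bounded g "12 * N" by (rule Hball_pv_bounded[OF assms(2)])
 have "pv_kernel (%x. f x - g x) x z = pv_kernel f x z - pv_kernel g x z" for z
  by (simp add: pv_kernel_def diff_divide_distrib[symmetric])
 then show ?thesis using f.int g.int by (simp add: hil_def right_diff_distrib)
qed

section \<open>The derivative of the Hilbert transform\<close>

text \<open>\<open>Lam\<close> is the operator \<open>H \<circ> d/dx\<close>, that is \<open>\<surd>(- d\<^sup>2/dx\<^sup>2)\<close>, written with second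
 differences: the derivative of \<open>f\<close> need not be square-integrable, so that its Hilbert
 transform is not given by \<^const>\<open>hil\<close>.\<close>

definition second_diff :: "(real => real) => real => real => real" where
 "second_diff f x z = f (x - z) + f (x + z) - 2 * f x"

definition Lam :: "(real => real) => real => real" where
 "Lam f x = - (1 / (2 * pi)) * (LINT z|lborel. second_diff f x z / z\<^sup>2)"

lemma second_diff_measurable [measurable]:
 assumes [measurable]: "f \<in> borel_measurable borel"
 shows "second_diff f x \<in> borel_measurable borel"
 unfolding second_diff_def[abs_def] by measurable

lemma Lam_bound:
 assumes f: "f \<in> Hball dl M" and dl: "0 < dl" and k: "!!x. \<bar>f x\<bar> <= kp" and r: "0 < r"
 shows "integrable lborel (%z. second_diff f x z / z\<^sup>2)"
  and "\<bar>Lam f x\<bar> <= (4 * M * (2 * r) powr dl / dl + 8 * kp / r) / (2 * pi)"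
proof -
 note [measurable] = Hball_measurable[OF f]
 have k0: "0 <= kp" using k[of 0] by linarith
 note M0 = Hball_nonneg[OF f]
 let ?b = "%z. 2 * M * (indicator {-(2*r)<..<2*r} z * \<bar>z\<bar> powr (dl - 1)) + 4 * kp * (indicator {z. r < \<bar>z\<bar>} z * \<bar>z\<bar> powr (0 - 2))"
 have r2: "0 < 2 * r" using r by simp
 note n = powr_integral_near[OF dl r2] and fr = powr_integral_far[of 0 r]
 have b: "integrable lborel ?b" using n(1) fr(1) r by simp
 have le: "\<bar>second_diff f x z / z\<^sup>2\<bar> <= ?b z" for z
 proof (cases "\<bar>z\<bar> <= r")
  case True
  have "\<bar>second_diff f x z\<bar> <= 2 * M * (\<bar>z\<bar> powr dl * \<bar>z\<bar>)"
   using Hball_first_order[OF f dl, of x z] Hball_first_order[OF f dl, of x "-z"] by (simp add: second_diff_def)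
  then have "\<bar>second_diff f x z / z\<^sup>2\<bar> <= 2 * M * (\<bar>z\<bar> powr dl * \<bar>z\<bar>) / z\<^sup>2"
   by (simp add: divide_right_mono)
  also have "... = 2 * M * \<bar>z\<bar> powr (dl - 1)"
   by (cases "z = 0") (auto simp: powr_diff power2_eq_square abs_if)
  also have "... <= ?b z" using True k0 r by (auto simp: indicator_def)
  finally show ?thesis .
 next
  case False
  have "\<bar>second_diff f x z\<bar> <= 4 * kp"
   using k[of x] k[of "x - z"] k[of "x + z"] by (simp add: second_diff_def)
  then have "\<bar>second_diff f x z / z\<^sup>2\<bar> <= 4 * kp / z\<^sup>2" by (simp add: divide_right_mono)
  also have "... = 4 * kp * \<bar>z\<bar> powr (0 - 2)"
   using False r by (simp add: powr_minus powr_numeral divide_inverse)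
  also have "... <= ?b z" using False M0 by (auto simp: indicator_def)
  finally show ?thesis .
 qed
 show i: "integrable lborel (%z. second_diff f x z / z\<^sup>2)"
  by (rule Bochner_Integration.integrable_bound[OF b]) (use order_trans[OF le abs_ge_self] in auto)
 have "\<bar>LINT z|lborel. second_diff f x z / z\<^sup>2\<bar> <= (LINT z|lborel. ?b z)"
  using Bochner_Integration.integral_norm_bound_integral[OF i b] le by simp
 also have "... = 2 * M * (2 * (2 * r) powr dl / dl) + 4 * kp * (2 * r powr (0 - 1) / (1 - 0))"
  using n fr r by simp
 also have "... = 4 * M * (2 * r) powr dl / dl + 8 * kp / r"
  using r by (simp add: powr_minus divide_inverse)
 finally show "\<bar>Lam f x\<bar> <= (4 * M * (2 * r) powr dl / dl + 8 * kp / r) / (2 * pi)"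
  by (simp add: Lam_def abs_mult divide_right_mono)
qed

lemma Lam_diff:
 assumes "f \<in> Hball dl M" "g \<in> Hball dl N" "0 < dl"
 shows "Lam (%x. f x - g x) x = Lam f x - Lam g x"
proof -
 have "second_diff (%x. f x - g x) x z / z\<^sup>2 = second_diff f x z / z\<^sup>2 - second_diff g x z / z\<^sup>2" for z
  by (simp add: second_diff_def diff_divide_distrib[symmetric])
 then show ?thesis
  using Lam_bound(1)[OF assms(1,3) Hball_bound[OF assms(1)], of 1] Lam_bound(1)[OF assms(2,3) Hball_bound[OF assms(2)], of 1]
  by (simp add: Lam_def right_diff_distrib)
qed

text \<open>A two-scale Hoelder modulus: the constant \<open>\<eta>\<close> up to distance \<open>\<rho>\<close>, the constant \<open>K\<close>
 beyond. It serves to show that \<open>Lam f\<close> oscillates little at scales well below \<open>\<rho>\<close> if the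
 derivative of \<open>f\<close> does so at scales up to \<open>\<rho>\<close>.\<close>

definition two_scale :: "real => real => real => real => real => real" where
 "two_scale dl et K \<rho> z = (if \<bar>z\<bar> <= \<rho> then et else K) * \<bar>z\<bar> powr dl"

lemma two_scale_nonneg: "0 <= et ==> 0 <= K ==> 0 <= two_scale dl et K \<rho> z"
 by (simp add: two_scale_def)

lemma two_scale_mono: "0 < dl ==> 0 <= et ==> et <= K ==> \<bar>t\<bar> <= \<bar>z\<bar> ==> two_scale dl et K \<rho> t <= two_scale dl et K \<rho> z"
 by (auto simp: two_scale_def intro!: mult_mono powr_mono2)

lemma two_scale_measurable [measurable]: "two_scale dl et K \<rho> \<in> borel_measurable borel"
 unfolding two_scale_def[abs_def] by measurable

definition Lam_const :: "real => real" where
 "Lam_const dl = 4 / dl + 2 / (1 - dl)"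

lemma Lam_const_pos: "0 < dl ==> dl < 1 ==> 0 < Lam_const dl"
 by (simp add: Lam_const_def add_pos_pos)

lemma two_scale_kernel_integral:
 assumes dl: "0 < dl" "dl < 1" and r: "0 < r" "r <= \<rho>" and et: "0 <= et" "0 <= K"
  and [measurable]: "k \<in> borel_measurable borel"
  and k1: "!!z. z ~= 0 ==> \<bar>k z\<bar> <= 1 / \<bar>z\<bar>" and k2: "!!z. z ~= 0 ==> \<bar>k z\<bar> <= r / z\<^sup>2"
 shows "integrable lborel (%z. \<bar>k z\<bar> * two_scale dl et K \<rho> z)"
  and "(LINT z|lborel. \<bar>k z\<bar> * two_scale dl et K \<rho> z) <= Lam_const dl * (et * r powr dl + K * r * \<rho> powr (dl - 1))"
proof -
 let ?w = "two_scale dl et K \<rho>"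
 let ?b = "%z. et * (indicator {-(2*r)<..<2*r} z * \<bar>z\<bar> powr (dl - 1)) + et * r * (indicator {z. r < \<bar>z\<bar>} z * \<bar>z\<bar> powr (dl - 2))
  + K * r * (indicator {z. \<rho> < \<bar>z\<bar>} z * \<bar>z\<bar> powr (dl - 2))"
 have r2: "0 < 2 * r" "0 < \<rho>" using r by auto
 note n = powr_integral_near[OF dl(1) r2(1)] and f1 = powr_integral_far[OF dl(2) r(1)] and f2 = powr_integral_far[OF dl(2) r2(2)]
 have b: "integrable lborel ?b" using n(1) f1(1) f2(1) by simp
 have le: "\<bar>k z\<bar> * ?w z <= ?b z" for z
 proof (cases "z = 0")
  case True
  then show ?thesis using et dl r by (simp add: two_scale_def)
 next
  case z: False
  have p1: "1 / \<bar>z\<bar> * \<bar>z\<bar> powr dl = \<bar>z\<bar> powr (dl - 1)" using z by (simp add: powr_diff)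
  have p2: "r / z\<^sup>2 * \<bar>z\<bar> powr dl = r * \<bar>z\<bar> powr (dl - 2)" using z by (simp add: powr_diff powr_numeral)
  show ?thesis
  proof (cases "\<bar>z\<bar> <= r")
   case True
   have "\<bar>k z\<bar> * ?w z <= 1 / \<bar>z\<bar> * (et * \<bar>z\<bar> powr dl)"
    using True r et k1[OF z] by (intro mult_mono) (auto simp: two_scale_def)
   also have "... = et * \<bar>z\<bar> powr (dl - 1)" using p1 by (simp add: mult.left_commute)
   also have "... <= ?b z" using True et r by (auto simp: indicator_def)
   finally show ?thesis .
  next
   case False
   have "\<bar>k z\<bar> * ?w z <= r / z\<^sup>2 * ?w z"
    using k2[OF z] two_scale_nonneg[OF et] by (intro mult_right_mono)
   also have "... = (if \<bar>z\<bar> <= \<rho> then et else K) * (r * \<bar>z\<bar> powr (dl - 2))"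
    unfolding two_scale_def p2[symmetric] by (simp only: mult_ac)
   also have "... <= ?b z" using False et r by (auto simp: indicator_def)
   finally show ?thesis .
  qed
 qed
 show i: "integrable lborel (%z. \<bar>k z\<bar> * ?w z)"
  by (rule Bochner_Integration.integrable_bound[OF b]) (use order_trans[OF le abs_ge_self] two_scale_nonneg[OF et] in \<open>auto simp: abs_mult\<close>)
 have "(LINT z|lborel. \<bar>k z\<bar> * ?w z) <= (LINT z|lborel. ?b z)"
  using i b le by (rule integral_mono)
 also have "... = et * (2 * (2 * r) powr dl / dl) + et * r * (2 * r powr (dl - 1) / (1 - dl)) + K * r * (2 * \<rho> powr (dl - 1) / (1 - dl))"
  using n f1 f2 by simp
 also have "... <= et * (4 * r powr dl / dl) + et * (2 * r powr dl / (1 - dl)) + (K * r * \<rho> powr (dl - 1)) * (2 / (1 - dl))"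
 proof -
  have "(2 * r) powr dl = 2 powr dl * r powr dl" using r by (simp add: powr_mult)
  also have "... <= 2 powr 1 * r powr dl" using dl by (intro mult_right_mono powr_mono) auto
  finally have "2 * (2 * r) powr dl / dl <= 4 * r powr dl / dl" using dl by (simp add: divide_right_mono)
  then have "et * (2 * (2 * r) powr dl / dl) <= et * (4 * r powr dl / dl)" using et by (intro mult_left_mono)
  moreover have "et * r * (2 * r powr (dl - 1) / (1 - dl)) = et * (2 * r powr dl / (1 - dl))"
   using r by (simp add: powr_diff)
  moreover have "K * r * (2 * \<rho> powr (dl - 1) / (1 - dl)) = (K * r * \<rho> powr (dl - 1)) * (2 / (1 - dl))"
   by simp
  ultimately show ?thesis by linarith
 qed
 also have "... <= Lam_const dl * (et * r powr dl + K * r * \<rho> powr (dl - 1))"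
 proof -
  have "0 <= (K * r * \<rho> powr (dl - 1)) * (4 / dl)" using et r dl by simp
  then show ?thesis unfolding Lam_const_def by (simp add: algebra_simps)
 qed
 finally show "(LINT z|lborel. \<bar>k z\<bar> * ?w z) <= Lam_const dl * (et * r powr dl + K * r * \<rho> powr (dl - 1))" .
qed

lemma mult_le_sum_squares:
 fixes r z :: real
 assumes "0 <= r"
 shows "r * \<bar>z\<bar> <= z\<^sup>2 + r\<^sup>2"
proof -
 have "0 <= (r - \<bar>z\<bar>)\<^sup>2" by simp
 then have "2 * (r * \<bar>z\<bar>) <= r\<^sup>2 + z\<^sup>2" by (simp add: power2_diff)
 moreover have "0 <= r * \<bar>z\<bar>" using assms by simp
 ultimately show ?thesis by linarith
qed

definition Dreg :: "real => (real => real) => real => real" where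
 "Dreg e f x = (LINT z|lborel. Qker' e z * f (x - z))"

lemma Qker'_mult_integrable:
 assumes e: "0 < e" and [measurable]: "g \<in> borel_measurable borel" and bd: "!!z. \<bar>g z\<bar> <= B"
 shows "integrable lborel (%z. Qker' e z * g z)"
proof (rule Bochner_Integration.integrable_bound)
 show "integrable lborel (%z. \<bar>Qker' e z\<bar> * B)" using Qker'_integral(1)[OF e] by simp
 have "0 <= B" using bd[of 0] by linarith
 then show "AE z in lborel. norm (Qker' e z * g z) <= norm (\<bar>Qker' e z\<bar> * B)"
  using bd by (intro AE_I2) (simp add: abs_mult mult_left_mono)
qed simp

text \<open>Both estimates use that \<open>Qker' e\<close> has integral zero, so that only differences of \<open>f'\<close>
 enter; the parameter of the kernel is the distance of the two points.\<close>

lemma Dreg_increment: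
 assumes dl: "0 < dl" "dl < 1" and f: "f \<in> Hball dl M" and r: "0 < r" "r <= \<rho>" and et: "0 <= et" "0 <= K"
  and osc: "!!s z. a <= s ==> s <= a + r ==> \<bar>deriv f (s - z) - deriv f s\<bar> <= two_scale dl et K \<rho> z"
 shows "\<bar>Dreg r f (a + r) - Dreg r f a\<bar> <= Lam_const dl * (et * r powr dl + K * r * \<rho> powr (dl - 1))"
proof -
 note [measurable] = Hball_measurable[OF f]
 let ?w = "two_scale dl et K \<rho>"
 define \<Delta> where "\<Delta> z = f (a + r - z) - f (a - z) - (f (a + r) - f a)" for z
 have \<Delta>: "\<bar>\<Delta> z\<bar> <= r * ?w z" for z
 proof -
  have "((%s. f (s - z) - f s) has_real_derivative deriv f (s - z) - deriv f s) (at s)" for s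
   using DERIV_shift[of f "deriv f (s - z)" s "- z"] Hball_has_derivative[OF f]
   by (intro DERIV_diff) auto
  then obtain s where s: "a < s" "s < a + r"
   "(f (a + r - z) - f (a + r)) - (f (a - z) - f a) = (a + r - a) * (deriv f (s - z) - deriv f s)"
   using MVT2[of a "a + r" "%s. f (s - z) - f s" "%s. deriv f (s - z) - deriv f s"] r(1) by force
  have "\<Delta> z = r * (deriv f (s - z) - deriv f s)" using s(3) by (simp add: \<Delta>_def)
  then show ?thesis using osc[of s z] s(1,2) r by (simp add: abs_mult)
 qed
 have k1: "\<bar>r * Qker' r z\<bar> <= 1 / \<bar>z\<bar>" and k2: "\<bar>r * Qker' r z\<bar> <= r / z\<^sup>2" if z: "z ~= 0" for z
 proof -
  have "\<bar>r * Qker' r z\<bar> <= Pker r z"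
   using mult_left_mono[OF Qker'_bound[OF r(1), of z], of r] r by (simp add: abs_mult)
  moreover have "Pker r z <= r / z\<^sup>2"
  proof -
   have "z\<^sup>2 <= 1 * (z\<^sup>2 + r\<^sup>2)" by simp
   also have "... <= pi * (z\<^sup>2 + r\<^sup>2)" using pi_gt3 by (intro mult_right_mono) auto
   finally show ?thesis unfolding Pker_def using z r
    by (intro divide_left_mono mult_pos_pos pi_gt_zero sum_squares_pos) auto
  qed
  moreover have "Pker r z <= 1 / \<bar>z\<bar>"
  proof -
   have "r * \<bar>z\<bar> <= 1 * (z\<^sup>2 + r\<^sup>2)" using mult_le_sum_squares[of r z] r by simp
   also have "... <= pi * (z\<^sup>2 + r\<^sup>2)" using pi_gt3 by (intro mult_right_mono) auto
   finally have "r * \<bar>z\<bar> <= pi * (z\<^sup>2 + r\<^sup>2)" .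
   then show ?thesis using z sum_squares_pos[OF r(1), of z] unfolding Pker_def
    by (subst pos_divide_le_eq) (auto simp: pos_le_divide_eq)
  qed
  ultimately show "\<bar>r * Qker' r z\<bar> <= 1 / \<bar>z\<bar>" "\<bar>r * Qker' r z\<bar> <= r / z\<^sup>2" by linarith+
 qed
 note K = two_scale_kernel_integral[of dl r \<rho> et K "%z. r * Qker' r z", OF dl r et _ k1 k2]
 have i: "integrable lborel (%z. Qker' r z * f (c - z))" for c
  by (rule Qker'_mult_integrable[OF r(1) _ Hball_bound[OF f]]) simp
 have i0: "integrable lborel (%z. Qker' r z * c)" for c using Qker'_integral(1)[OF r(1)] by simp
 have z0: "(LINT z|lborel. Qker' r z * c) = 0" for c using Qker'_integral[OF r(1)] by simp
 have i\<Delta>: "integrable lborel (%z. Qker' r z * \<Delta> z)"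
  unfolding \<Delta>_def right_diff_distrib by (intro Bochner_Integration.integrable_diff i i0)
 have "Dreg r f (a + r) - Dreg r f a = (LINT z|lborel. Qker' r z * \<Delta> z)"
  unfolding \<Delta>_def right_diff_distrib Dreg_def using i i0 Qker'_integral[OF r(1)] by simp
 also have "\<bar>...\<bar> <= (LINT z|lborel. \<bar>r * Qker' r z\<bar> * ?w z)"
 proof -
  have "norm (Qker' r z * \<Delta> z) <= \<bar>r * Qker' r z\<bar> * ?w z" for z
   using mult_left_mono[OF \<Delta>[of z], of "\<bar>Qker' r z\<bar>"] r by (simp add: abs_mult mult_ac)
  then show ?thesis
   using Bochner_Integration.integral_norm_bound_integral[OF i\<Delta> K(1)] by simp
 qed
 also have "... <= Lam_const dl * (et * r powr dl + K * r * \<rho> powr (dl - 1))" by (rule K(2)) simp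
 finally show ?thesis .
qed

lemma Qker'_plus_inverse_square:
 assumes r: "0 < r" and z: "z ~= 0"
 shows "0 <= Qker' r z + 1 / (pi * z\<^sup>2)" "Qker' r z + 1 / (pi * z\<^sup>2) <= r\<^sup>2 / (z\<^sup>2 * (z\<^sup>2 + r\<^sup>2))"
proof -
 define u v where "u = z\<^sup>2" and "v = r\<^sup>2"
 have uv: "0 < u" "0 < v" using r z by (auto simp: u_def v_def)
 have eq: "Qker' r z + 1 / (pi * z\<^sup>2) = (v * (3 * u + v)) / (pi * u * (u + v)\<^sup>2)"
 proof -
  have "Qker' r z + 1 / (pi * z\<^sup>2) = (v - u) / (pi * (u + v)\<^sup>2) + 1 / (pi * u)" by (simp add: Qker'_def u_def v_def)
  also have "... = ((v - u) * u + (u + v)\<^sup>2) / (pi * u * (u + v)\<^sup>2)" using uv by (simp add: field_simps)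
  also have "(v - u) * u + (u + v)\<^sup>2 = v * (3 * u + v)" by (simp add: power2_eq_square algebra_simps)
  finally show ?thesis .
 qed
 show "0 <= Qker' r z + 1 / (pi * z\<^sup>2)" unfolding eq using uv by simp
 have "(v * (3 * u + v)) / (pi * u * (u + v)\<^sup>2) <= (v * (pi * (u + v))) / (pi * u * (u + v)\<^sup>2)"
 proof (intro divide_right_mono mult_left_mono)
  have "3 * u <= pi * u" "1 * v <= pi * v" using pi_gt3 uv by (intro mult_right_mono; simp)+
  then show "3 * u + v <= pi * (u + v)" by (simp add: distrib_left)
 qed (use uv in auto)
 also have "... = v / (u * (u + v))" using uv by (simp add: power2_eq_square)
 finally show "Qker' r z + 1 / (pi * z\<^sup>2) <= r\<^sup>2 / (z\<^sup>2 * (z\<^sup>2 + r\<^sup>2))"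
  unfolding eq by (simp add: u_def v_def)
qed

lemma Dreg_approximates_Lam:
 assumes dl: "0 < dl" "dl < 1" and f: "f \<in> Hball dl M" and r: "0 < r" "r <= \<rho>" and et: "0 <= et" "et <= K"
  and osc: "!!z. \<bar>deriv f (x - z) - deriv f x\<bar> <= two_scale dl et K \<rho> z"
 shows "\<bar>Dreg r f x - Lam f x\<bar> <= Lam_const dl * (et * r powr dl + K * r * \<rho> powr (dl - 1))"
proof -
 note [measurable] = Hball_measurable[OF f]
 let ?w = "two_scale dl et K \<rho>"
 have K0: "0 <= K" using et by linarith
 define k where "k z = (Qker' r z + 1 / (pi * z\<^sup>2)) * \<bar>z\<bar>" for z
 have [measurable]: "k \<in> borel_measurable borel" unfolding k_def[abs_def] by measurable
 have k0: "0 <= k z" for z using Qker'_plus_inverse_square(1)[OF r(1), of z] by (cases "z = 0") (auto simp: k_def)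
 have k1: "\<bar>k z\<bar> <= 1 / \<bar>z\<bar>" and k2: "\<bar>k z\<bar> <= r / z\<^sup>2" if z: "z ~= 0" for z
 proof -
  have "k z <= r\<^sup>2 / (z\<^sup>2 * (z\<^sup>2 + r\<^sup>2)) * \<bar>z\<bar>"
   unfolding k_def using Qker'_plus_inverse_square(2)[OF r(1) z] by (intro mult_right_mono) auto
  also have "... = r\<^sup>2 / (z\<^sup>2 + r\<^sup>2) * (1 / \<bar>z\<bar>)" using z by (simp add: power2_eq_square abs_if)
  finally have le: "k z <= r\<^sup>2 / (z\<^sup>2 + r\<^sup>2) * (1 / \<bar>z\<bar>)" .
  have "r\<^sup>2 / (z\<^sup>2 + r\<^sup>2) <= 1" using sum_squares_pos[OF r(1), of z] by simp
  then have "r\<^sup>2 / (z\<^sup>2 + r\<^sup>2) * (1 / \<bar>z\<bar>) <= 1 * (1 / \<bar>z\<bar>)" by (intro mult_right_mono) auto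
  with le k0[of z] show "\<bar>k z\<bar> <= 1 / \<bar>z\<bar>" by simp
  have rz: "r * \<bar>z\<bar> <= z\<^sup>2 + r\<^sup>2" using mult_le_sum_squares[of r z] r by simp
  have "r\<^sup>2 / (z\<^sup>2 + r\<^sup>2) * (1 / \<bar>z\<bar>) = r * (r * \<bar>z\<bar>) / (z\<^sup>2 + r\<^sup>2) / z\<^sup>2"
   using z by (simp add: power2_eq_square abs_if)
  also have "... <= r * (z\<^sup>2 + r\<^sup>2) / (z\<^sup>2 + r\<^sup>2) / z\<^sup>2"
   using r rz by (intro divide_right_mono mult_left_mono) auto
  also have "... = r / z\<^sup>2" using sum_squares_pos[OF r(1), of z] by simp
  finally show "\<bar>k z\<bar> <= r / z\<^sup>2" using le k0[of z] by simp
 qed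
 note KI = two_scale_kernel_integral[of dl r \<rho> et K k, OF dl r et(1) K0 _ k1 k2]
 have S: "\<bar>second_diff f x z\<bar> <= 2 * \<bar>z\<bar> * ?w z" for z
 proof -
  have osc': "\<bar>deriv f (x + t) - deriv f x\<bar> <= ?w z" if "\<bar>t\<bar> <= \<bar>z\<bar>" for t
   using osc[of "- t"] two_scale_mono[OF dl(1) et, of "- t" z \<rho>] that by simp
  obtain t where t: "\<bar>t\<bar> <= \<bar>z\<bar>" "f (x + z) - f x = z * deriv f (x + t)"
   using mvt_real[OF Hball_has_derivative[OF f]] by blast
  obtain t' where t': "\<bar>t'\<bar> <= \<bar>z\<bar>" "f (x + (- z)) - f x = - z * deriv f (x + t')"
   using mvt_real[OF Hball_has_derivative[OF f], of "- z" x] by auto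
  have "second_diff f x z = z * (deriv f (x + t) - deriv f (x + t'))"
   using t(2) t'(2) by (simp add: second_diff_def right_diff_distrib)
  also have "\<bar>...\<bar> <= \<bar>z\<bar> * (?w z + ?w z)"
   unfolding abs_mult using osc'[OF t(1)] osc'[OF t'(1)] by (intro mult_left_mono) auto
  finally show ?thesis by (simp add: mult_ac)
 qed
 have i: "integrable lborel (%z. Qker' r z * f (x - z))" "integrable lborel (%z. Qker' r z * f (x + z))"
  by (rule Qker'_mult_integrable[OF r(1) _ Hball_bound[OF f]]; simp)+
 have i0: "integrable lborel (%z. Qker' r z * c)" for c using Qker'_integral(1)[OF r(1)] by simp
 have z0: "(LINT z|lborel. Qker' r z * c) = 0" for c using Qker'_integral[OF r(1)] by simp
 have "Dreg r f x = (LINT z|lborel. Qker' r z * f (x + z))"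
  unfolding Dreg_def by (subst lborel_integral_real_affine[of "-1" _ 0]) (simp_all add: Qker'_even)
 then have "2 * Dreg r f x = (LINT z|lborel. Qker' r z * second_diff f x z)"
  unfolding second_diff_def right_diff_distrib distrib_left using i i0 z0 by (simp add: Dreg_def)
 then have D: "Dreg r f x = (LINT z|lborel. Qker' r z * second_diff f x z) / 2" by simp
 have iS: "integrable lborel (%z. Qker' r z * second_diff f x z)"
  unfolding second_diff_def right_diff_distrib distrib_left
  by (intro Bochner_Integration.integrable_diff Bochner_Integration.integrable_add i i0)
 note iL = Lam_bound(1)[OF f dl(1) Hball_bound[OF f] r(1), of x]
 have L: "Lam f x = - (LINT z|lborel. second_diff f x z / z\<^sup>2 / pi) / 2"
  unfolding Lam_def integral_divide_zero by simp
 have "Dreg r f x - Lam f x = (LINT z|lborel. Qker' r z * second_diff f x z + second_diff f x z / z\<^sup>2 / pi) / 2"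
  unfolding D L Bochner_Integration.integral_add[OF iS integrable_divide_zero[of pi, OF iL]]
  by (simp only: diff_minus_eq_add minus_divide_left[symmetric] add_divide_distrib)
 also have "\<bar>...\<bar> <= (LINT z|lborel. 2 * (\<bar>k z\<bar> * ?w z)) / 2"
 proof -
  have le: "norm (Qker' r z * second_diff f x z + second_diff f x z / z\<^sup>2 / pi) <= 2 * (\<bar>k z\<bar> * ?w z)" for z
  proof (cases "z = 0")
   case False
   have "Qker' r z * second_diff f x z + second_diff f x z / z\<^sup>2 / pi = (Qker' r z + 1 / (pi * z\<^sup>2)) * second_diff f x z"
    by (simp add: distrib_right)
   also have "norm ... = (Qker' r z + 1 / (pi * z\<^sup>2)) * \<bar>second_diff f x z\<bar>"
    using Qker'_plus_inverse_square(1)[OF r(1) False] by (simp add: abs_mult)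
   also have "... <= (Qker' r z + 1 / (pi * z\<^sup>2)) * (2 * \<bar>z\<bar> * ?w z)"
    using S Qker'_plus_inverse_square(1)[OF r(1) False] by (intro mult_left_mono) auto
   also have "... = 2 * (\<bar>k z\<bar> * ?w z)" using k0[of z] by (simp add: k_def)
   finally show ?thesis .
  qed (simp add: second_diff_def two_scale_def)
  have "norm (LINT z|lborel. Qker' r z * second_diff f x z + second_diff f x z / z\<^sup>2 / pi) <= (LINT z|lborel. 2 * (\<bar>k z\<bar> * ?w z))"
   by (rule Bochner_Integration.integral_norm_bound_integral[OF Bochner_Integration.integrable_add[OF iS
      integrable_divide_zero[of pi, OF iL]] _ le]) (use KI(1) in simp)
  then show ?thesis by simp
 qed
 also have "... = (LINT z|lborel. \<bar>k z\<bar> * ?w z)" by simp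
 also have "... <= Lam_const dl * (et * r powr dl + K * r * \<rho> powr (dl - 1))" by (rule KI(2)) simp
 finally show ?thesis .
qed

lemma Lam_two_scale:
 assumes dl: "0 < dl" "dl < 1" and f: "f \<in> Hball dl M" and r: "0 < r" "r <= \<rho>" and et: "0 <= et" "et <= K"
  and osc: "!!s z. a <= s ==> s <= a + r ==> \<bar>deriv f (s - z) - deriv f s\<bar> <= two_scale dl et K \<rho> z"
 shows "\<bar>Lam f (a + r) - Lam f a\<bar> <= 3 * Lam_const dl * (et * r powr dl + K * r * \<rho> powr (dl - 1))"
proof -
 have "0 <= K" using et by linarith
 from Dreg_increment[of dl f M r \<rho> et K a, OF dl f r et(1) this osc]
  Dreg_approximates_Lam[OF dl f r et osc, of a] Dreg_approximates_Lam[OF dl f r et osc, of "a + r"] r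
 show ?thesis by simp
qed

lemma Hball_two_scale: "f \<in> Hball dl M ==> \<bar>deriv f (s - z) - deriv f s\<bar> <= two_scale dl M M \<rho> z"
 using Hball_holder[of f dl M "s - z" s] by (simp add: two_scale_def)

lemma Lam_holder:
 assumes dl: "0 < dl" "dl < 1" and f: "f \<in> Hball dl M"
 shows "\<bar>Lam f x - Lam f y\<bar> <= 6 * Lam_const dl * M * \<bar>x - y\<bar> powr dl"
proof -
 have *: "\<bar>Lam f (a + r) - Lam f a\<bar> <= 6 * Lam_const dl * M * r powr dl" if r: "0 < r" for a r
 proof -
  have "\<bar>Lam f (a + r) - Lam f a\<bar> <= 3 * Lam_const dl * (M * r powr dl + M * r * r powr (dl - 1))"
   by (rule Lam_two_scale[OF dl f r _ Hball_nonneg[OF f] _ Hball_two_scale[OF f]]) auto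
  also have "M * r * r powr (dl - 1) = M * r powr dl" using r by (simp add: powr_diff)
  finally show ?thesis by (simp add: mult_ac)
 qed
 show ?thesis
  using *[of "y - x" x] *[of "x - y" y] by (cases x y rule: linorder_cases) (auto simp: abs_minus_commute)
qed

lemma Hreg_increment:
 assumes e: "0 < e" and f: "f \<in> Hball dl M" and ab: "a <= b"
 shows "Hreg e f b - Hreg e f a = (LINT x|lborel. indicator {a..b} x * Dreg e f x)"
proof -
 note [measurable] = Hball_measurable[OF f]
 have D: "Dreg e f x = (LINT y|lborel. Qker' e (x - y) * f y)" for x
  unfolding Dreg_def by (subst lborel_integral_real_affine[of "-1" "%y. Qker' e (x - y) * f y" x]) simp_all
 have ind: "integrable lborel (indicator {a..b} :: real => real)"
  by (rule integrable_real_indicator) (auto simp: emeasure_lborel_Icc_eq)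
 let ?J = "LINT y|lborel. \<bar>Qker' e y\<bar>"
 have iQ: "integrable lborel (%y. \<bar>Qker' e (x - y)\<bar>)" "(LINT y|lborel. \<bar>Qker' e (x - y)\<bar>) = ?J" for x
  using lborel_integrable_real_affine[OF integrable_abs[OF Qker'_integral(1)[OF e]], of "-1" x]
   lborel_integral_real_affine[of "-1" "%y. \<bar>Qker' e y\<bar>" x] by simp_all
 have iQf: "integrable lborel (%y. Qker' e (x - y) * f y)" for x
 proof (rule Bochner_Integration.integrable_bound)
  show "integrable lborel (%y. \<bar>Qker' e (x - y)\<bar> * M)" using iQ(1) by simp
  show "AE y in lborel. norm (Qker' e (x - y) * f y) <= norm (\<bar>Qker' e (x - y)\<bar> * M)"
   using Hball_bound[OF f] Hball_nonneg[OF f] by (intro AE_I2) (simp add: abs_mult mult_left_mono)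
 qed simp
 have I: "integrable (lborel \<Otimes>\<^sub>M lborel) (%(x, y). indicator {a..b} x * (Qker' e (x - y) * f y))"
 proof (rule lborel_pair.Fubini_integrable)
  show "integrable lborel (%x. LINT y|lborel. norm (case (x, y) of (x, y) => indicator {a..b} x * (Qker' e (x - y) * f y)))"
  proof (rule Bochner_Integration.integrable_bound)
   show "integrable lborel (%x. indicator {a..b} x * (?J * M))" using ind by simp
   have "(LINT y|lborel. \<bar>Qker' e (x - y) * f y\<bar>) <= ?J * M" for x
   proof -
    have "(LINT y|lborel. \<bar>Qker' e (x - y) * f y\<bar>) <= (LINT y|lborel. \<bar>Qker' e (x - y)\<bar> * M)"
     by (rule integral_mono[OF integrable_abs[OF iQf]]) (use iQ(1) Hball_bound[OF f] in \<open>auto simp: abs_mult mult_left_mono\<close>)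
    then show ?thesis using iQ[of x] by simp
   qed
   moreover have "0 <= ?J * M" using Hball_nonneg[OF f] by simp
   ultimately show "AE x in lborel. norm (LINT y|lborel. norm (case (x, y) of (x, y) => indicator {a..b} x * (Qker' e (x - y) * f y)))
     <= norm (indicator {a..b} x * (?J * M))"
    using Hball_nonneg[OF f] by (auto simp: abs_mult indicator_def intro!: AE_I2)
  qed simp
  show "AE x in lborel. integrable lborel (%y. case (x, y) of (x, y) => indicator {a..b} x * (Qker' e (x - y) * f y))"
   using iQf by simp
 qed measurable
 have "(LINT x|lborel. indicator {a..b} x * Dreg e f x) = (LINT x|lborel. LINT y|lborel. indicator {a..b} x * (Qker' e (x - y) * f y))"
  by (simp add: D)
 also have "... = (LINT y|lborel. LINT x|lborel. indicator {a..b} x * (Qker' e (x - y) * f y))"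
  by (rule lborel_pair.Fubini_integral[OF I, symmetric])
 also have "... = (LINT y|lborel. Qker e (b - y) * f y - Qker e (a - y) * f y)"
 proof (rule Bochner_Integration.integral_cong)
  fix y
  have "(LINT x|lborel. indicator {a..b} x *\<^sub>R Qker' e (x - y)) = Qker e (b - y) - Qker e (a - y)"
  proof (rule integral_FTC_atLeastAtMost[OF ab])
   show "((%x. Qker e (x - y)) has_vector_derivative Qker' e (x - y)) (at x within {a..b})" for x
    using DERIV_shift[of "Qker e" "Qker' e (x - y)" x "- y"] Qker_has_derivative[OF e, of "x - y"]
    by (auto simp: has_real_derivative_iff_has_vector_derivative[symmetric] intro: has_field_derivative_at_within)
   show "continuous_on {a..b} (%x. Qker' e (x - y))"
    by (intro continuous_on_compose2[OF ker_continuous(3)[OF e, of UNIV]] continuous_intros) auto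
  qed
  moreover have "(LINT x|lborel. indicator {a..b} x * (Qker' e (x - y) * f y)) = (LINT x|lborel. indicator {a..b} x *\<^sub>R Qker' e (x - y)) * f y"
   by (simp add: mult.assoc[symmetric])
  ultimately show "(LINT x|lborel. indicator {a..b} x * (Qker' e (x - y) * f y)) = Qker e (b - y) * f y - Qker e (a - y) * f y"
   by (simp add: left_diff_distrib)
 qed simp
 also have "... = Hreg e f b - Hreg e f a"
  using Hreg_integrable[OF e Hball_L2[OF f]] by (simp add: Hreg_def)
 finally show ?thesis by simp
qed

lemma Lam_continuous:
 assumes dl: "0 < dl" "dl < 1" and f: "f \<in> Hball dl M"
 shows "continuous_on S (Lam f)"
 unfolding continuous_on_def
proof
 fix x
 have "((%y. 6 * Lam_const dl * M * \<bar>y - x\<bar> powr dl) \<longlongrightarrow> 6 * Lam_const dl * M * \<bar>x - x\<bar> powr dl) (at x within S)"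
  using dl by (intro tendsto_intros tendsto_powr2) auto
 then have "((%y. 6 * Lam_const dl * M * \<bar>y - x\<bar> powr dl) \<longlongrightarrow> 0) (at x within S)" by simp
 then have "((%y. Lam f y - Lam f x) \<longlongrightarrow> 0) (at x within S)"
  by (rule Lim_null_comparison[rotated]) (use Lam_holder[OF dl f] in auto)
 then show "(Lam f \<longlongrightarrow> Lam f x) (at x within S)" by (rule LIM_zero_cancel)
qed

lemma hil_has_derivative:
 assumes dl: "0 < dl" "dl < 1" and f: "f \<in> Hball dl M"
 shows "(hil f has_real_derivative Lam f x) (at x)"
proof -
 interpret pv_bounded f "12 * M" by (rule Hball_pv_bounded[OF f])
 define c where "c n = inverse (real (Suc n))" for n
 have c: "0 < c n" "c n <= 1" for n by (auto simp: c_def divide_simps)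
 have c0: "c \<longlonglongrightarrow> 0" unfolding c_def by (rule LIMSEQ_inverse_real_of_nat)
 have [measurable]: "Lam f \<in> borel_measurable borel" by (rule borel_measurable_continuous_onI[OF Lam_continuous[OF dl f]])
 note [measurable] = Hball_measurable[OF f]
 have [measurable]: "Dreg e f \<in> borel_measurable borel" for e unfolding Dreg_def[abs_def] by measurable
 define L where "L = Lam_const dl * (2 * M)"
 have L0: "0 <= L" using Lam_const_pos[OF dl] Hball_nonneg[OF f] by (simp add: L_def)
 have ap: "\<bar>Dreg (c n) f x - Lam f x\<bar> <= L * c n powr dl" for n x
 proof -
  have "\<bar>Dreg (c n) f x - Lam f x\<bar> <= Lam_const dl * (M * c n powr dl + M * c n * c n powr (dl - 1))"
   by (rule Dreg_approximates_Lam[OF dl f c(1) _ Hball_nonneg[OF f] _ Hball_two_scale[OF f]]) auto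
  also have "M * c n * c n powr (dl - 1) = M * c n powr dl" using c(1)[of n] by (simp add: powr_diff)
  finally show ?thesis by (simp add: L_def mult_ac)
 qed
 have cd: "(%n. L * c n powr dl) \<longlonglongrightarrow> 0"
  using tendsto_mult[OF tendsto_const tendsto_powr2[OF c0 tendsto_const], of dl L] dl c(1) by (simp add: less_imp_le)
 define B where "B = (4 * M * (2 * 1) powr dl / dl + 8 * M / 1) / (2 * pi)"
 have LB: "\<bar>Lam f x\<bar> <= B" for x unfolding B_def by (rule Lam_bound(2)[OF f dl(1) Hball_bound[OF f]]) simp
 have incr: "hil f b - hil f a = integral {a..b} (Lam f)" if ab: "a <= b" for a b
 proof -
  have "(%n. LINT x|lborel. indicator {a..b} x * Dreg (c n) f x) \<longlonglongrightarrow> (LINT x|lborel. indicator {a..b} x * Lam f x)"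
  proof (rule integral_dominated_convergence[where w="%x. indicator {a..b} x * (B + L)"])
   show "integrable lborel (%x. indicator {a..b} x * (B + L))"
    by (intro integrable_mult_left integrable_real_indicator) (auto simp: emeasure_lborel_Icc_eq)
   have "\<bar>Dreg (c n) f x\<bar> <= B + L" for n x
   proof -
    have "L * c n powr dl <= L * 1" using c[of n] dl L0 by (intro mult_left_mono powr_le1) auto
    then show ?thesis using ap[of n x] LB[of x] by linarith
   qed
   then show "AE x in lborel. norm (indicator {a..b} x * Dreg (c n) f x) <= indicator {a..b} x * (B + L)" for n
    by (auto simp: indicator_def)
   have "(%n. Dreg (c n) f x) \<longlonglongrightarrow> Lam f x" for x
    by (rule LIM_zero_cancel, rule Lim_null_comparison[OF _ cd]) (use ap in auto)
   then show "AE x in lborel. (%n. indicator {a..b} x * Dreg (c n) f x) \<longlonglongrightarrow> indicator {a..b} x * Lam f x"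
    by (intro AE_I2 tendsto_intros)
  qed simp_all
  then have 1: "(%n. Hreg (c n) f b - Hreg (c n) f a) \<longlonglongrightarrow> (LINT x|lborel. indicator {a..b} x * Lam f x)"
   by (simp add: Hreg_increment[OF c(1) f ab])
  have 2: "(%n. Hreg (c n) f b - Hreg (c n) f a) \<longlonglongrightarrow> hil f b - hil f a"
   by (intro tendsto_diff Hreg_tendsto[OF L2 int c(1) c0])
  have "hil f b - hil f a = (LINT x:{a..b}|lborel. Lam f x)"
   using LIMSEQ_unique[OF 2 1] by (simp add: set_lebesgue_integral_def)
  also have "... = integral {a..b} (Lam f)"
   by (intro set_borel_integral_eq_integral borel_integrable_atLeastAtMost' Lam_continuous[OF dl f])
  finally show ?thesis .
 qed
 have "((%y. hil f (x - 1) + integral {x - 1..y} (Lam f)) has_real_derivative 0 + Lam f x) (at x within {x - 1..x + 1})"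
  by (intro DERIV_add DERIV_const integral_has_real_derivative Lam_continuous[OF dl f]) auto
 then have d: "((%y. hil f (x - 1) + integral {x - 1..y} (Lam f)) has_real_derivative Lam f x) (at x within {x - 1..x + 1})"
  by simp
 have "(hil f has_real_derivative Lam f x) (at x within {x - 1..x + 1})"
 proof (rule has_field_derivative_transform_within[OF d zero_less_one])
  fix y assume "y \<in> {x - 1..x + 1}"
  then show "hil f (x - 1) + integral {x - 1..y} (Lam f) = hil f y" using incr[of "x - 1" y] by simp
 qed simp
 then show ?thesis by (simp add: at_within_Icc_at)
qed

lemma hil_Hball:
 assumes dl: "0 < dl" "dl < 1" and f: "f \<in> Hball dl M"
 shows "hil f \<in> Hball dl (6 * Lam_const dl * M)" "deriv (hil f) = Lam f"
proof -
 interpret pv_bounded f "12 * M" by (rule Hball_pv_bounded[OF f])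
 note M0 = Hball_nonneg[OF f]
 have "2 <= 2 / (1 - dl)" "4 <= 4 / dl" using dl by (auto simp: divide_simps)
 moreover have "2 / dl <= 4 / dl" using dl by (simp add: divide_right_mono)
 ultimately have C: "2 / dl + 2 <= Lam_const dl" "6 <= Lam_const dl" unfolding Lam_const_def by linarith+
 have big: "x <= 6 * Lam_const dl * M" if "x <= c * M" "c <= 6 * Lam_const dl" for x c
  using that mult_right_mono[OF that(2) M0] by linarith
 show "deriv (hil f) = Lam f" by (rule ext, rule DERIV_imp_deriv, rule hil_has_derivative[OF dl f])
 show "hil f \<in> Hball dl (6 * Lam_const dl * M)"
 proof (rule HballI[OF hil_in_L2(1) _ hil_has_derivative[OF dl f] _ _ Lam_holder[OF dl f]])
  show "L2_norm (hil f) <= 6 * Lam_const dl * M"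
   by (rule big[of _ 1]) (use hil_in_L2(2) Hball_norm[OF f] C in auto)
  show "\<bar>hil f x\<bar> <= 6 * Lam_const dl * M" for x
   by (rule big[of _ 2]) (use Hball_hil_bound[OF f] C in auto)
  have "\<bar>Lam f x\<bar> <= (2 / dl + 2) * M" for x
  proof -
   have "\<bar>Lam f x\<bar> <= (4 * M * (2 * 1) powr dl / dl + 8 * M / 1) / (2 * pi)"
    by (rule Lam_bound(2)[OF f dl(1) Hball_bound[OF f]]) simp
   also have "... <= (4 * M * 2 powr 1 / dl + 8 * M) / (2 * 3)"
    using dl M0 pi_gt3 powr_mono[of dl 1 2] by (intro frac_le add_mono divide_right_mono mult_left_mono) auto
   also have "... = (8 / dl + 8) / 6 * M" by (simp add: field_simps)
   also have "... <= (2 / dl + 2) * M" using M0 dl by (intro mult_right_mono) (auto simp: field_simps)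
   finally show ?thesis .
  qed
  then show "\<bar>Lam f x\<bar> <= 6 * Lam_const dl * M" for x
   by (rule big) (use C in auto)
 qed
qed

text \<open>On a ball, the derivative, the Hilbert transform and its derivative are uniformly
 continuous with respect to the supremum norm.\<close>

lemma Hball_small:
 assumes dl: "0 < dl" and M: "0 <= M" and e: "0 < e"
 obtains kp where "0 < kp" "!!w x. w \<in> Hball dl M ==> (!!x. \<bar>w x\<bar> <= kp) ==>
  \<bar>deriv w x\<bar> <= e & \<bar>hil w x\<bar> <= e & \<bar>Lam w x\<bar> <= e"
proof -
 have pw: "c * ((e' / (c + 1)) powr (1 / dl)) powr dl <= e'" if "0 <= c" "0 < e'" for c e' :: real
  using that dl by (simp add: powr_powr field_simps)
 define h where "h = (e / 2 / (M + 1)) powr (1 / dl)"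
 have h: "0 < h" "M * h powr dl <= e / 2" using pw[of M "e / 2"] M e by (auto simp: h_def)
 define R where "R = 1 + 8 * M\<^sup>2 / e\<^sup>2"
 have R: "1 <= R" using e by (simp add: R_def)
 have RM: "2 * sqrt (2 / R) * M <= e"
 proof -
  have "8 * M\<^sup>2 <= e\<^sup>2 * R" using e by (simp add: R_def distrib_left)
  moreover have "(2 * sqrt (2 / R) * M)\<^sup>2 = 8 * M\<^sup>2 / R" using R by (simp add: power_mult_distrib)
  ultimately have "(2 * sqrt (2 / R) * M)\<^sup>2 <= e\<^sup>2" using R by (simp add: divide_le_eq)
  then show ?thesis by (rule power2_le_imp_le) (use e in simp)
 qed
 define r where "r = min 1 (e / (4 * M + 1))"
 have r: "0 < r" "r <= R" using M e R by (auto simp: r_def)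
 have rM: "4 * M * r <= e"
 proof -
  have "4 * M * r <= (4 * M) * (e / (4 * M + 1))" using M by (intro mult_left_mono) (auto simp: r_def)
  also have "... <= e" using M e by (simp add: field_simps)
  finally show ?thesis .
 qed
 define s where "s = (e / (4 * M / dl + 1)) powr (1 / dl) / 2"
 have s: "0 < s" "4 * M * (2 * s) powr dl / dl <= e" proof -
  have "0 < 4 * M / dl + 1" using M dl by (intro add_nonneg_pos) auto
  then show "0 < s" using e by (simp add: s_def)
  show "4 * M * (2 * s) powr dl / dl <= e" using pw[of "4 * M / dl" e] M e dl by (simp add: s_def)
 qed
 define kp where "kp = min (e * h / 4) (min (e * r / (4 * R)) (e * s / 8))"
 show ?thesis
 proof (rule that[of kp])
  show "0 < kp" using e h r s R by (simp add: kp_def)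
  fix w x assume w: "w \<in> Hball dl M" and k: "!!x. \<bar>w x\<bar> <= kp"
  have k1: "\<bar>w x\<bar> <= e * h / 4" "\<bar>w x\<bar> <= e * r / (4 * R)" "\<bar>w x\<bar> <= e * s / 8" for x
   using k[of x] by (auto simp: kp_def)
  have "\<bar>deriv w x\<bar> <= 2 * (e * h / 4) / h + M * h powr dl"
   by (rule Hball_deriv_interpolate[OF w dl k1(1) h(1)])
  then have 1: "\<bar>deriv w x\<bar> <= e" using h by simp
  note p = Hball_pv[OF w k1(2) r, of x]
  have "\<bar>hil w x\<bar> <= (4 * M * r + 4 * R * (e * r / (4 * R)) / r + 2 * sqrt (2 / R) * M) / (2 * pi)"
   by (rule hil_bound[OF p])
  also have "... <= (e + e + e) / (2 * pi)" using rM RM r R by (intro divide_right_mono add_mono) auto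
  also have "... <= e" using e pi_gt3 by (simp add: field_simps)
  finally have 2: "\<bar>hil w x\<bar> <= e" .
  have "\<bar>Lam w x\<bar> <= (4 * M * (2 * s) powr dl / dl + 8 * (e * s / 8) / s) / (2 * pi)"
   by (rule Lam_bound(2)[OF w dl k1(3) s(1)])
  also have "... <= (e + e) / (2 * pi)" using s by (intro divide_right_mono add_mono) auto
  also have "... <= e" using e pi_gt3 by (simp add: field_simps)
  finally have 3: "\<bar>Lam w x\<bar> <= e" .
  show "\<bar>deriv w x\<bar> <= e & \<bar>hil w x\<bar> <= e & \<bar>Lam w x\<bar> <= e" using 1 2 3 by simp
 qed
qed

section \<open>Difference quotients with a fixed base point\<close>

text \<open>\<open>dq f a\<close> is the difference quotient of \<open>f\<close> based at \<open>a\<close>. The Hilbert transform commutes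
 with this operation because \<open>1 / ((x - w) (w - a)) = (1 / (x - w) + 1 / (w - a)) / (x - a)\<close>;
 hence its \<open>L\<^sup>2\<close> norm does not increase under the Hilbert transform.\<close>

definition dq :: "(real => real) => real => real => real" where
 "dq f a x = (f x - f a) / (x - a)"

lemma dq_measurable [measurable]:
 assumes [measurable]: "f \<in> borel_measurable borel"
 shows "dq f a \<in> borel_measurable borel"
 unfolding dq_def[abs_def] by measurable

context
 fixes dl M :: real and f :: "real => real"
 assumes f: "f \<in> Hball dl M"
begin

lemma dq_bound: "\<bar>dq f a x\<bar> <= M"
proof (cases "x = a")
 case False
 then show ?thesis using Hball_Lipschitz[OF f, of x a] by (simp add: dq_def divide_le_eq)
qed (simp add: dq_def Hball_nonneg[OF f])

lemma dq_decay: "\<bar>dq f a x\<bar> <= 2 * M / \<bar>x - a\<bar>"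
proof -
 have "\<bar>f x - f a\<bar> <= 2 * M" using Hball_bound[OF f, of x] Hball_bound[OF f, of a] by linarith
 then show ?thesis by (simp add: dq_def divide_right_mono)
qed

lemma dq_square_le: "(dq f a x)\<^sup>2 <= 5 * M\<^sup>2 * pi * Pker 1 (x - a)"
proof -
 have "\<bar>dq f a x\<bar>\<^sup>2 <= M\<^sup>2" using dq_bound by (intro power_mono) auto
 moreover have "(dq f a x)\<^sup>2 * (x - a)\<^sup>2 <= 4 * M\<^sup>2"
 proof (cases "x = a")
  case False
  have "\<bar>dq f a x\<bar> * \<bar>x - a\<bar> <= 2 * M" using dq_decay[of a x] False by (simp add: pos_le_divide_eq)
  then have "(\<bar>dq f a x\<bar> * \<bar>x - a\<bar>)\<^sup>2 <= (2 * M)\<^sup>2" by (intro power_mono) auto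
  then show ?thesis by (simp add: power_mult_distrib)
 qed simp
 ultimately have "(dq f a x)\<^sup>2 * ((x - a)\<^sup>2 + 1) <= 5 * M\<^sup>2" by (simp add: distrib_left)
 then have "(dq f a x)\<^sup>2 <= 5 * M\<^sup>2 / ((x - a)\<^sup>2 + 1)" by (subst pos_le_divide_eq) (auto intro: add_nonneg_pos)
 also have "... = 5 * M\<^sup>2 * pi * Pker 1 (x - a)" by (simp add: Pker_def)
 finally show ?thesis .
qed

lemma Pker_shift_integrable: "integrable lborel (%x. c * Pker 1 (x - a))"
 using lborel_integrable_real_affine[OF Pker_integral(1)[of 1], of 1 "- a"] by simp

lemma dq_L2: "dq f a \<in> L2_space"
proof -
 note [measurable] = Hball_measurable[OF f]
 have "integrable lborel (%x. (dq f a x)\<^sup>2)"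
  by (rule Bochner_Integration.integrable_bound[OF Pker_shift_integrable[of "5 * M\<^sup>2 * pi" a]])
   (use order_trans[OF dq_square_le abs_ge_self] in auto)
 then show ?thesis by (simp add: L2_space_iff)
qed

lemma dq_pv_integrable:
 assumes "x ~= a"
 shows "integrable lborel (pv_kernel (dq f a) x)"
proof (rule pv_kernel_split(1)[OF dq_L2])
 define R where "R = \<bar>x - a\<bar> / 2"
 show R: "0 < R" using assms by (simp add: R_def)
 note M0 = Hball_nonneg[OF f]
 let ?B = "2 * M / R + 4 * M / R\<^sup>2"
 show "integrable lborel (%z. ?B * indicator {-R..R} z)"
  by (intro integrable_mult_right integrable_real_indicator) (auto simp: emeasure_lborel_Icc_eq)
 show "0 <= ?B * indicator {-R..R} z" for z using M0 R by simp
 fix z assume z: "\<bar>z\<bar> <= R"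
 have "\<bar>pv_kernel (dq f a) x z\<bar> <= ?B"
 proof (cases "z = 0")
  case False
  let ?p = "x - z - a" and ?q = "x + z - a"
  have "2 * R = \<bar>x - a\<bar>" by (simp add: R_def)
  then have pq: "R <= \<bar>?p\<bar>" "R <= \<bar>?q\<bar>" using z by linarith+
  have nz: "?p ~= 0" "?q ~= 0" using pq R by auto
  have eq: "dq f a (x - z) - dq f a (x + z) = (f (x - z) - f (x + z)) / ?p + (f (x + z) - f a) * (2 * z) / (?p * ?q)"
  proof -
   have "(f (x + z) - f a) * (2 * z) / (?p * ?q) = (f (x + z) - f a) / ?p - (f (x + z) - f a) / ?q"
    using nz by (simp add: divide_simps) (simp add: algebra_simps)
   moreover have "(f (x - z) - f a) / ?p = (f (x - z) - f (x + z)) / ?p + (f (x + z) - f a) / ?p"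
    unfolding add_divide_distrib[symmetric] by simp
   ultimately show ?thesis by (simp add: dq_def)
  qed
  have "\<bar>(f (x - z) - f (x + z)) / ?p\<bar> <= 2 * M * \<bar>z\<bar> / R"
   unfolding abs_divide using Hball_Lipschitz[OF f, of "x - z" "x + z"] pq R M0
   by (intro frac_le) auto
  moreover have "\<bar>(f (x + z) - f a) * (2 * z) / (?p * ?q)\<bar> <= (2 * M) * (2 * \<bar>z\<bar>) / (R * R)"
   unfolding abs_divide abs_mult using Hball_bound[OF f, of "x + z"] Hball_bound[OF f, of a] pq R M0
   by (intro frac_le mult_mono mult_pos_pos) auto
  ultimately have "\<bar>dq f a (x - z) - dq f a (x + z)\<bar> <= 2 * M * \<bar>z\<bar> / R + (2 * M) * (2 * \<bar>z\<bar>) / (R * R)"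
   unfolding eq by linarith
  also have "... = ?B * \<bar>z\<bar>" by (simp add: power2_eq_square distrib_right)
  finally show ?thesis using False by (simp add: pv_kernel_def divide_le_eq)
 next
  case True
  have "0 <= ?B" using M0 R by simp
  then show ?thesis using True by (simp only: pv_kernel_def) simp
 qed
 moreover have "z \<in> {-R..R}" using z by auto
 ultimately show "\<bar>pv_kernel (dq f a) x z\<bar> <= ?B * indicator {-R..R} z" by simp
qed

lemma dq_symmetric_tail:
 "(%n. (LINT z|lborel. indicator {-real n..real n} z * (dq f a (x - z) + dq f a (x + z)))
  - (LINT z|lborel. indicator {-real n..real n} z * (dq f a (a - z) + dq f a (a + z)))) \<longlonglongrightarrow> 0"
proof -
 note [measurable] = Hball_measurable[OF f]
 let ?q = "dq f a"
 have iq: "integrable lborel (%w. indicator {c..d} w * ?q w)" for c d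
 proof (rule Bochner_Integration.integrable_bound)
  show "integrable lborel (%w. indicator {c..d} w * M)"
   by (intro integrable_mult_left integrable_real_indicator) (auto simp: emeasure_lborel_Icc_eq)
  show "AE w in lborel. norm (indicator {c..d} w * ?q w) <= norm (indicator {c..d} w * M)"
   using dq_bound Hball_nonneg[OF f] by (auto simp: abs_mult indicator_def intro!: AE_I2)
 qed simp
 have W: "(LINT z|lborel. indicator {-R..R} z * (?q (y - z) + ?q (y + z))) = 2 * (LINT w|lborel. indicator {y - R..y + R} w * ?q w)" for y R :: real
 proof -
  have ind1: "indicator {y - R..y + R} (y + (-1) * z) = (indicator {-R..R} z :: real)" for z
   by (auto simp: indicator_def)
  have ind2: "indicator {y - R..y + R} (y + 1 * z) = (indicator {-R..R} z :: real)" for z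
   by (auto simp: indicator_def)
  have 1: "integrable lborel (%z. indicator {-R..R} z * ?q (y - z))"
   "(LINT w|lborel. indicator {y - R..y + R} w * ?q w) = (LINT z|lborel. indicator {-R..R} z * ?q (y - z))"
   using lborel_integrable_real_affine[OF iq, of "-1" "y - R" "y + R" y]
    lborel_integral_real_affine[of "-1" "%w. indicator {y - R..y + R} w * ?q w" y]
   unfolding ind1 by simp_all
  have 2: "integrable lborel (%z. indicator {-R..R} z * ?q (y + z))"
   "(LINT w|lborel. indicator {y - R..y + R} w * ?q w) = (LINT z|lborel. indicator {-R..R} z * ?q (y + z))"
   using lborel_integrable_real_affine[OF iq, of 1 "y - R" "y + R" y]
    lborel_integral_real_affine[of 1 "%w. indicator {y - R..y + R} w * ?q w" y]
   unfolding ind2 by simp_all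
  show ?thesis using 1 2 by (simp add: distrib_left)
 qed
 define d where "d = \<bar>x - a\<bar>"
 have bd: "\<bar>(LINT w|lborel. indicator {x - R..x + R} w * ?q w) - (LINT w|lborel. indicator {a - R..a + R} w * ?q w)\<bar>
   <= 2 * M / (R - d) * (4 * d)" if R: "d < R" for R
 proof -
  let ?J = "%w. 2 * M / (R - d) * (indicator {a + R - d..a + R + d} w + indicator {a - R - d..a - R + d} w)"
  have iJ: "integrable lborel (indicator {c..e} :: real => real)" for c e
   by (rule integrable_real_indicator) (auto simp: emeasure_lborel_Icc_eq)
  have M0: "0 <= 2 * M / (R - d)" using Hball_nonneg[OF f] R by simp
  have le: "norm (indicator {x - R..x + R} w * ?q w - indicator {a - R..a + R} w * ?q w) <= ?J w" for w
  proof (cases "w \<in> {x - R..x + R} \<longleftrightarrow> w \<in> {a - R..a + R}")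
   case True
   then have "norm (indicator {x - R..x + R} w * ?q w - indicator {a - R..a + R} w * ?q w) = 0"
    by (auto simp: indicator_def)
   moreover have "0 <= ?J w" by (intro mult_nonneg_nonneg M0 add_nonneg_nonneg) auto
   ultimately show ?thesis by linarith
  next
   case False
   then have eq: "norm (indicator {x - R..x + R} w * ?q w - indicator {a - R..a + R} w * ?q w) = \<bar>?q w\<bar>"
    by (auto simp: indicator_def)
   have "R - d <= \<bar>w - a\<bar>" using False unfolding d_def atLeastAtMost_iff by linarith
   then have "\<bar>?q w\<bar> <= 2 * M / (R - d)"
    using dq_decay[of a w] R Hball_nonneg[OF f] by (elim order_trans) (intro divide_left_mono mult_pos_pos, auto)
   moreover have "w \<in> {a + R - d..a + R + d} \<or> w \<in> {a - R - d..a - R + d}"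
    using False unfolding d_def atLeastAtMost_iff by linarith
   then have "1 <= indicator {a + R - d..a + R + d} w + (indicator {a - R - d..a - R + d} w :: real)"
    by (auto simp: indicator_def)
   from mult_left_mono[OF this M0] have "2 * M / (R - d) <= ?J w" by simp
   ultimately show ?thesis unfolding eq by linarith
  qed
  have "norm (LINT w|lborel. indicator {x - R..x + R} w * ?q w - indicator {a - R..a + R} w * ?q w) <= (LINT w|lborel. ?J w)"
   by (rule Bochner_Integration.integral_norm_bound_integral)
    (intro Bochner_Integration.integrable_diff iq integrable_mult_right Bochner_Integration.integrable_add iJ le)+
  also have "(LINT w|lborel. ?J w) = 2 * M / (R - d) * (4 * d)"
   using iJ by (simp add: d_def)
  finally show ?thesis using iq by simp
 qed
 have "(%n. 2 * (2 * M / (real n - d) * (4 * d))) \<longlonglongrightarrow> 2 * (0 * (4 * d))"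
 proof (intro tendsto_mult[OF tendsto_const tendsto_mult[OF real_tendsto_divide_at_top[OF tendsto_const] tendsto_const]])
  show "filterlim (%n. real n - d) at_top sequentially"
   using filterlim_tendsto_add_at_top[OF tendsto_const[of "- d"] filterlim_real_sequentially] by simp
 qed
 then have lim: "(%n. 2 * (2 * M / (real n - d) * (4 * d))) \<longlonglongrightarrow> 0" by simp
 show ?thesis
 proof (rule Lim_null_comparison[OF _ lim])
  obtain N :: nat where "d < real N" using reals_Archimedean2 by blast
  then show "\<forall>\<^sub>F n in sequentially. norm ((LINT z|lborel. indicator {-real n..real n} z * (?q (x - z) + ?q (x + z)))
  - (LINT z|lborel. indicator {-real n..real n} z * (?q (a - z) + ?q (a + z)))) <= 2 * (2 * M / (real n - d) * (4 * d))"
   unfolding W eventually_sequentially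
  proof (intro exI[of _ N] allI impI)
   fix n assume "N <= n"
   then have "d < real n" using \<open>d < real N\<close> by linarith
   from bd[OF this] show "norm (2 * (LINT w|lborel. indicator {x - real n..x + real n} w * ?q w)
     - 2 * (LINT w|lborel. indicator {a - real n..a + real n} w * ?q w)) <= 2 * (2 * M / (real n - d) * (4 * d))"
    unfolding real_norm_def by linarith
  qed
 qed
qed

lemma hil_dq:
 assumes xa: "x ~= a"
 shows "hil (dq f a) x = dq (hil f) a x"
proof -
 note [measurable] = Hball_measurable[OF f]
 interpret pv_bounded f "12 * M" by (rule Hball_pv_bounded[OF f])
 let ?q = "dq f a"
 let ?s = "%y z. ?q (y - z) + ?q (y + z)"
 have nz: "AE z in lborel. z ~= (0::real)" by (rule AE_lborel_singleton)
 \<comment> \<open>the partial fraction, on both sides of \<open>x\<close>; at \<open>w = a\<close> all terms vanish\<close>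
 have pf: "?q w / (x - w) = ((f w - f a) / (x - w) + ?q w) / (x - a)" if "x ~= w" for w
 proof (cases "w = a")
  case False
  then show ?thesis using that xa by (simp add: dq_def divide_simps) (simp add: algebra_simps)
 qed (simp add: dq_def)
 have split: "pv_kernel ?q x z = (pv_kernel f x z + ?s x z) / (x - a)" if z: "z ~= 0" for z
 proof -
  have "pv_kernel ?q x z = ?q (x - z) / (x - (x - z)) + ?q (x + z) / (x - (x + z))"
   using z by (simp add: pv_kernel_def diff_divide_distrib)
  also have "... = ((f (x - z) - f a) / z + ?q (x - z)) / (x - a) + ((f (x + z) - f a) / (- z) + ?q (x + z)) / (x - a)"
   using pf[of "x - z"] pf[of "x + z"] z by simp
  also have "... = (pv_kernel f x z + ?s x z) / (x - a)"
   by (simp add: pv_kernel_def add_divide_distrib diff_divide_distrib)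
  finally show ?thesis .
 qed
 have sx: "AE z in lborel. (x - a) * pv_kernel ?q x z - pv_kernel f x z = ?s x z"
  using nz by eventually_elim (use xa in \<open>simp add: split\<close>)
 have isx: "integrable lborel (?s x)"
  by (rule integrable_cong_AE_imp[OF _ _ sx]) (use dq_pv_integrable[OF xa] int in auto)
 have sa: "AE z in lborel. - pv_kernel f a z = ?s a z"
  using nz by eventually_elim (simp add: pv_kernel_def dq_def diff_divide_distrib)
 have isa: "integrable lborel (?s a)"
  by (rule integrable_cong_AE_imp[OF _ _ sa]) (use int in auto)
 have lim: "(%n. LINT z|lborel. indicator {-real n..real n} z * g z) \<longlonglongrightarrow> (LINT z|lborel. g z)"
  if g: "integrable lborel g" for g :: "real => real"
 proof (rule integral_dominated_convergence[where w="%z. \<bar>g z\<bar>"])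
  note [measurable] = borel_measurable_integrable[OF g]
  show "g \<in> borel_measurable lborel" "(%z. indicator {-real n..real n} z * g z) \<in> borel_measurable lborel" for n
   by measurable
  show "integrable lborel (%z. \<bar>g z\<bar>)" using g by simp
  show "AE z in lborel. (%n. indicator {-real n..real n} z * g z) \<longlonglongrightarrow> g z"
   using trunc_tendsto[of g] by (simp add: trunc_def)
  show "AE z in lborel. norm (indicator {-real n..real n} z * g z) <= \<bar>g z\<bar>" for n
   by (auto simp: indicator_def)
 qed
 have "(LINT z|lborel. ?s x z) - (LINT z|lborel. ?s a z) = 0"
  using LIMSEQ_unique[OF tendsto_diff[OF lim[OF isx] lim[OF isa]] dq_symmetric_tail] .
 moreover have "(LINT z|lborel. ?s x z) = (LINT z|lborel. (x - a) * pv_kernel ?q x z - pv_kernel f x z)"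
  by (rule integral_cong_AE[OF _ _ AE_symmetric[OF sx]]) auto
 moreover have "(LINT z|lborel. (x - a) * pv_kernel ?q x z - pv_kernel f x z) = 2 * pi * ((x - a) * hil ?q x - hil f x)"
  using dq_pv_integrable[OF xa] int by (simp add: hil_def right_diff_distrib)
 moreover have "(LINT z|lborel. ?s a z) = - 2 * pi * hil f a"
  using integral_cong_AE[OF _ _ AE_symmetric[OF sa]] by (simp add: hil_def)
 ultimately have "2 * pi * ((x - a) * hil ?q x - hil f x + hil f a) = 0" by (simp add: distrib_left)
 then have "(x - a) * hil ?q x = hil f x - hil f a" by simp
 then show ?thesis using xa by (simp add: dq_def field_simps)
qed

lemma dq_hil_L2: "dq (hil f) a \<in> L2_space" "L2_norm (dq (hil f) a) <= L2_norm (dq f a)"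
proof -
 note [measurable] = Hball_measurable[OF f]
 have na: "AE x in lborel. x ~= a" by (rule AE_lborel_singleton)
 have "AE x in lborel. integrable lborel (pv_kernel (dq f a) x)"
  using na by eventually_elim (rule dq_pv_integrable)
 note h = hil_L2[OF dq_L2 this]
 have eq: "AE x in lborel. hil (dq f a) x = dq (hil f) a x"
  using na by eventually_elim (rule hil_dq)
 have "AE x in lborel. (%n::nat. hil (dq f a) x) \<longlonglongrightarrow> dq (hil f) a x"
  using eq by eventually_elim simp
 from L2_Fatou[OF h this] show "dq (hil f) a \<in> L2_space" "L2_norm (dq (hil f) a) <= L2_norm (dq f a)"
  by simp_all
qed

end

text \<open>The nonnegative quantity that drives the acceleration along characteristics.\<close>

definition Gfun :: "(real => real) => real => real" where
 "Gfun f a = (L2_norm (dq f a))\<^sup>2 / (2 * pi)"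

lemma Gfun_nonneg: "0 <= Gfun f a"
 by (simp add: Gfun_def)

lemma Gfun_bound:
 assumes f: "f \<in> Hball dl M"
 shows "Gfun f a <= 5 * M\<^sup>2 / 2"
proof -
 have P: "(LINT x|lborel. Pker 1 (x - a)) = 1"
  using lborel_integral_real_affine[of 1 "Pker 1" "- a"] Pker_integral[of 1] by simp
 have "(LINT x|lborel. (dq f a x)\<^sup>2) <= (LINT x|lborel. 5 * M\<^sup>2 * pi * Pker 1 (x - a))"
  by (rule integral_mono[OF L2_space_integrable[OF dq_L2[OF f]] Pker_shift_integrable[OF f] dq_square_le[OF f]])
 then have "(L2_norm (dq f a))\<^sup>2 <= 5 * M\<^sup>2 * pi" using P by (simp add: L2_norm_squared)
 then show ?thesis by (simp add: Gfun_def divide_le_eq)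
qed

section \<open>Time-dependent families\<close>

definition hfam :: "real => real => real => real => (real => real => real) => bool" where
 "hfam dl M a b u \<longleftrightarrow> (\<forall>t\<in>{a..b}. (%x. u x t) \<in> Hball dl M) &
  (\<forall>t\<in>{a..b}. \<forall>e>0. \<exists>d>0. \<forall>s\<in>{a..b}. \<bar>s - t\<bar> < d --> (\<forall>x. \<bar>u x s - u x t\<bar> <= e))"

abbreviation ux :: "(real => real => real) => real => real => real" where
 "ux u x t \<equiv> deriv (%y. u y t) x"

abbreviation uH :: "(real => real => real) => real => real => real" where
 "uH u x t \<equiv> hil (%y. u y t) x"

abbreviation uL :: "(real => real => real) => real => real => real" where
 "uL u x t \<equiv> Lam (%y. u y t) x"

lemma hfam_Hball: "hfam dl M a b u ==> t \<in> {a..b} ==> (%x. u x t) \<in> Hball dl M"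
 by (simp add: hfam_def)

lemma hfam_subinterval: "hfam dl M a b u ==> a <= c ==> d <= b ==> hfam dl M c d u"
 unfolding hfam_def by (meson atLeastAtMost_iff order_trans)

lemma hfam_small:
 assumes dl: "0 < dl" and u: "hfam dl M a b u" and t: "t \<in> {a..b}" and e: "0 < e"
 obtains d where "0 < d" "!!s x. s \<in> {a..b} ==> \<bar>s - t\<bar> < d ==>
  \<bar>u x s - u x t\<bar> <= e & \<bar>ux u x s - ux u x t\<bar> <= e & \<bar>uH u x s - uH u x t\<bar> <= e & \<bar>uL u x s - uL u x t\<bar> <= e"
proof -
 have "0 <= M" using Hball_nonneg[OF hfam_Hball[OF u t]] .
 then have M: "0 <= M + M" by simp
 obtain kp where kp: "0 < kp" "!!w x. w \<in> Hball dl (M + M) ==> (!!x. \<bar>w x\<bar> <= kp) ==>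
  \<bar>deriv w x\<bar> <= e & \<bar>hil w x\<bar> <= e & \<bar>Lam w x\<bar> <= e"
  using Hball_small[OF dl M e] by metis
 have "0 < min kp e" using kp(1) e by simp
 then obtain d where d: "0 < d" "!!s x. s \<in> {a..b} ==> \<bar>s - t\<bar> < d ==> \<bar>u x s - u x t\<bar> <= min kp e"
  using u t unfolding hfam_def by meson
 show ?thesis
 proof (rule that[OF d(1)])
  fix s x assume s: "s \<in> {a..b}" "\<bar>s - t\<bar> < d"
  note B = hfam_Hball[OF u s(1)] hfam_Hball[OF u t]
  have "\<bar>deriv (%y. u y s - u y t) x\<bar> <= e & \<bar>hil (%y. u y s - u y t) x\<bar> <= e & \<bar>Lam (%y. u y s - u y t) x\<bar> <= e"
   by (rule kp(2)[OF Hball_diff[OF B]]) (use d(2)[OF s] in simp)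
  then show "\<bar>u x s - u x t\<bar> <= e & \<bar>ux u x s - ux u x t\<bar> <= e & \<bar>uH u x s - uH u x t\<bar> <= e & \<bar>uL u x s - uL u x t\<bar> <= e"
   using d(2)[OF s, of x] by (simp add: deriv_diff_Hball[OF B] hil_diff[OF B] Lam_diff[OF B dl])
 qed
qed

lemma Hball_deriv_continuous:
 assumes f: "f \<in> Hball dl M" and dl: "0 < dl"
 shows "continuous_on S (deriv f)"
 unfolding continuous_on_def
proof
 fix x
 have "((%y. M * \<bar>y - x\<bar> powr dl) \<longlongrightarrow> M * \<bar>x - x\<bar> powr dl) (at x within S)"
  using dl by (intro tendsto_intros tendsto_powr2) auto
 then have "((%y. M * \<bar>y - x\<bar> powr dl) \<longlongrightarrow> 0) (at x within S)" by simp
 then have "((%y. deriv f y - deriv f x) \<longlongrightarrow> 0) (at x within S)"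
  by (rule Lim_null_comparison[rotated]) (use Hball_holder[OF f] in auto)
 then show "(deriv f \<longlongrightarrow> deriv f x) (at x within S)" by (rule LIM_zero_cancel)
qed

lemma Hball_deriv_measurable:
 assumes "f \<in> Hball dl M" "0 < dl"
 shows "deriv f \<in> borel_measurable borel"
 by (rule borel_measurable_continuous_onI[OF Hball_deriv_continuous[OF assms]])

lemma continuous_on_pair_uniform:
 fixes g :: "real => real => real"
 assumes x: "!!t. t \<in> S ==> continuous_on UNIV (%x. g x t)"
  and t: "!!t e. t \<in> S ==> 0 < e ==> \<exists>d>0. \<forall>s\<in>S. \<bar>s - t\<bar> < d --> (\<forall>x. \<bar>g x s - g x t\<bar> <= e)"
 shows "continuous_on (UNIV \<times> S) (%(x, t). g x t)"
 unfolding continuous_on_iff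
proof (intro ballI allI impI)
 fix p :: "real \<times> real" and e :: real assume p: "p \<in> UNIV \<times> S" and e: "0 < e"
 obtain x0 t0 where p0: "p = (x0, t0)" "t0 \<in> S" using p by auto
 from t[OF p0(2), of "e / 2"] e obtain d1 where d1: "0 < d1" "!!s x. s \<in> S ==> \<bar>s - t0\<bar> < d1 ==> \<bar>g x s - g x t0\<bar> <= e / 2"
  by auto
 from x[OF p0(2)] e obtain d2 where d2: "0 < d2" "!!x. \<bar>x - x0\<bar> < d2 ==> \<bar>g x t0 - g x0 t0\<bar> < e / 2"
  unfolding continuous_on_iff dist_real_def by (metis UNIV_I half_gt_zero)
 show "\<exists>d>0. \<forall>q\<in>UNIV \<times> S. dist q p < d --> dist (case q of (x, t) => g x t) (case p of (x, t) => g x t) < e"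
 proof (intro exI[of _ "min d1 d2"] conjI ballI impI)
  fix q assume q: "q \<in> UNIV \<times> S" "dist q p < min d1 d2"
  obtain x s where qs: "q = (x, s)" "s \<in> S" using q by auto
  have "dist x x0 <= dist q p" "dist s t0 <= dist q p"
   using dist_fst_le[of q p] dist_snd_le[of q p] by (auto simp: qs p0)
  then have "\<bar>x - x0\<bar> < d2" "\<bar>s - t0\<bar> < d1" using q by (auto simp: dist_real_def)
  with d1(2)[OF qs(2), of x] d2(2)[of x] have "\<bar>g x s - g x t0\<bar> <= e / 2" "\<bar>g x t0 - g x0 t0\<bar> < e / 2" by auto
  then show "dist (case q of (x, t) => g x t) (case p of (x, t) => g x t) < e"
   unfolding qs p0 dist_real_def prod.case by linarith
 qed (use d1 d2 in auto)
qed

lemma hfam_continuous: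
 assumes dl: "0 < dl" "dl < 1" and u: "hfam dl M a b u"
 shows "continuous_on (UNIV \<times> {a..b}) (%(x, t). u x t)"
  and "continuous_on (UNIV \<times> {a..b}) (%(x, t). ux u x t)"
  and "continuous_on (UNIV \<times> {a..b}) (%(x, t). uH u x t)"
  and "continuous_on (UNIV \<times> {a..b}) (%(x, t). uL u x t)"
proof -
 have c: "continuous_on UNIV (%x. u x t)" "continuous_on UNIV (%x. ux u x t)" "continuous_on UNIV (%x. uH u x t)"
  "continuous_on UNIV (%x. uL u x t)" if t: "t \<in> {a..b}" for t
 proof -
  note B = hfam_Hball[OF u t]
  show "continuous_on UNIV (%x. u x t)" by (rule Hball_continuous[OF B])
  show "continuous_on UNIV (%x. uL u x t)" by (rule Lam_continuous[OF dl B])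
  show "continuous_on UNIV (%x. uH u x t)" by (rule Hball_continuous[OF hil_Hball(1)[OF dl B]])
  show "continuous_on UNIV (%x. ux u x t)" by (rule Hball_deriv_continuous[OF B dl(1)])
 qed
 note s = hfam_small[OF dl(1) u]
 show "continuous_on (UNIV \<times> {a..b}) (%(x, t). u x t)"
  by (rule continuous_on_pair_uniform[OF c(1)]) (auto, metis s atLeastAtMost_iff)
 show "continuous_on (UNIV \<times> {a..b}) (%(x, t). ux u x t)"
  by (rule continuous_on_pair_uniform[OF c(2)]) (auto, metis s atLeastAtMost_iff)
 show "continuous_on (UNIV \<times> {a..b}) (%(x, t). uH u x t)"
  by (rule continuous_on_pair_uniform[OF c(3)]) (auto, metis s atLeastAtMost_iff)
 show "continuous_on (UNIV \<times> {a..b}) (%(x, t). uL u x t)"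
  by (rule continuous_on_pair_uniform[OF c(4)]) (auto, metis s atLeastAtMost_iff)
qed

lemma hfam_hil:
 assumes dl: "0 < dl" "dl < 1" and u: "hfam dl M a b u"
 shows "hfam dl (6 * Lam_const dl * M) a b (uH u)"
 unfolding hfam_def
proof (intro conjI ballI allI impI)
 fix t assume t: "t \<in> {a..b}"
 show "(%x. uH u x t) \<in> Hball dl (6 * Lam_const dl * M)"
  using hil_Hball(1)[OF dl hfam_Hball[OF u t]] by simp
 fix e :: real assume "0 < e"
 from hfam_small[OF dl(1) u t this]
 show "\<exists>d>0. \<forall>s\<in>{a..b}. \<bar>s - t\<bar> < d --> (\<forall>x. \<bar>uH u x s - uH u x t\<bar> <= e)" by metis
qed

lemma ux_uH:
 assumes dl: "0 < dl" "dl < 1" and u: "hfam dl M a b u" and t: "t \<in> {a..b}"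
 shows "ux (uH u) x t = uL u x t"
 using hil_Hball(2)[OF dl hfam_Hball[OF u t]] by simp

lemma continuous_on_along:
 fixes g :: "real => real => real"
 assumes "continuous_on (UNIV \<times> S) (%(x, t). g x t)" "continuous_on S Y"
 shows "continuous_on S (%t. g (Y t) t)"
proof -
 have "continuous_on S (%t. (%(x, t). g x t) (Y t, t))"
  by (rule continuous_on_compose2[OF assms(1)]) (intro continuous_intros assms(2), auto)
 then show ?thesis by simp
qed

text \<open>The contribution of the moving point to the derivative of \<open>f (Y t) t\<close>; the other part
 is the partial derivative in time, in whichever direction it is needed.\<close>

lemma moving_point_derivative:
 fixes f f' :: "real => real => real"
 assumes f: "!!x s. s \<in> S ==> ((%y. f y s) has_real_derivative f' x s) (at x)"
  and c: "continuous_on (UNIV \<times> S) (%(x, t). f' x t)"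
  and Y: "(Y has_real_derivative Y') (at t within S)" and t: "t \<in> S"
 shows "((%s. f (Y s) s - f (Y t) s) has_real_derivative f' (Y t) t * Y') (at t within S)"
proof -
 have "\<exists>\<xi>. \<bar>\<xi>\<bar> <= \<bar>Y s - Y t\<bar> & f (Y s) s - f (Y t) s = (Y s - Y t) * f' (Y t + \<xi>) s" if "s \<in> S" for s
  using mvt_real[OF f[OF that], of "Y s - Y t" "Y t"] by (metis add.commute diff_add_cancel)
 then obtain \<xi> where \<xi>: "!!s. s \<in> S ==> \<bar>\<xi> s\<bar> <= \<bar>Y s - Y t\<bar>"
  "!!s. s \<in> S ==> f (Y s) s - f (Y t) s = (Y s - Y t) * f' (Y t + \<xi> s) s" by metis
 have Yc: "(Y \<longlongrightarrow> Y t) (at t within S)" using DERIV_continuous[OF Y] by (simp add: continuous_within)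
 have "((%s. \<bar>Y s - Y t\<bar>) \<longlongrightarrow> 0) (at t within S)"
  using tendsto_rabs[OF tendsto_diff[OF Yc tendsto_const[of "Y t"]]] by simp
 then have "(\<xi> \<longlongrightarrow> 0) (at t within S)"
  by (rule Lim_null_comparison[rotated]) (use \<xi>(1) in \<open>auto simp: eventually_at_filter\<close>)
 then have x: "((%s. Y t + \<xi> s) \<longlongrightarrow> Y t + 0) (at t within S)" by (intro tendsto_intros)
 have h1: "((%s. (Y t + \<xi> s, s)) \<longlongrightarrow> (Y t, t)) (at t within S)"
  using x by (intro tendsto_Pair tendsto_ident_at) simp
 have h2: "continuous (at (Y t, t) within UNIV \<times> S) (%(x, t). f' x t)"
  using c t by (simp add: continuous_on_eq_continuous_within)
 have h3: "\<forall>\<^sub>F s in at t within S. (Y t + \<xi> s, s) \<in> UNIV \<times> S" by (auto simp: eventually_at_filter)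
 have "((%s. (%(x, t). f' x t) (Y t + \<xi> s, s)) \<longlongrightarrow> (%(x, t). f' x t) (Y t, t)) (at t within S)"
  by (rule continuous_within_tendsto_compose[OF h2 h3 h1])
 then have f': "((%s. f' (Y t + \<xi> s) s) \<longlongrightarrow> f' (Y t) t) (at t within S)" by simp
 have "((%s. f' (Y t + \<xi> s) s * ((Y s - Y t) / (s - t))) \<longlongrightarrow> f' (Y t) t * Y') (at t within S)"
  using Y by (intro tendsto_mult f') (simp add: has_field_derivative_iff)
 then show ?thesis
  unfolding has_field_derivative_iff
  by (rule Lim_transform_eventually) (auto simp: eventually_at_filter \<xi>(2))
qed

section \<open>Characteristics\<close>

text \<open>Picard's theorem on a compact interval of any length: with the weight
 \<open>exp (2 K (t - a))\<close> the integral operator is a contraction with constant \<open>1/2\<close>.\<close>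

lemma global_ode_solution:
 fixes v :: "real => real => real"
 assumes ab: "a <= b" and c: "continuous_on (UNIV \<times> {a..b}) (%(x, t). v x t)"
  and bd: "!!x t. t \<in> {a..b} ==> \<bar>v x t\<bar> <= B" and K: "0 < K"
  and lip: "!!x y t. t \<in> {a..b} ==> \<bar>v x t - v y t\<bar> <= K * \<bar>x - y\<bar>"
 obtains X where "X a = al" "!!t. t \<in> {a..b} ==> (X has_real_derivative v (X t) t) (at t within {a..b})"
proof -
 define cl where "cl t = max a (min b t)" for t :: real
 have cl: "cl t \<in> {a..b}" "a <= cl t" "cl t <= b" for t using ab by (auto simp: cl_def)
 have clc: "continuous_on S cl" for S unfolding cl_def[abs_def] by (intro continuous_intros)
 define E where "E t = exp (2 * K * (t - a))" for t
 have E: "0 < E t" for t by (simp add: E_def)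
 have Ec: "continuous_on S E" for S unfolding E_def[abs_def] by (intro continuous_intros)
 define g where "g be s = v (al + E s * apply_bcontfun be s) s" for be s
 have gc: "continuous_on {a..b} (g be)" for be
  unfolding g_def[abs_def]
  by (rule continuous_on_along[OF c]) (intro continuous_intros Ec, simp)
 have gi: "g be integrable_on {a..cl t}" for be t
  by (rule integrable_continuous_interval[OF continuous_on_subset[OF gc]]) (use cl in auto)
 define \<Phi>0 where "\<Phi>0 be t = integral {a..cl t} (g be) / E (cl t)" for be t
 have B0: "0 <= B" using bd[of a 0] ab by auto
 have \<Phi>0: "\<Phi>0 be \<in> bcontfun" for be
  unfolding bcontfun_def
 proof (intro CollectI conjI)
  have "continuous_on {a..b} (%t. integral {a..t} (g be))"
   by (rule indefinite_integral_continuous_1) (rule integrable_continuous_interval[OF gc])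
  then have "continuous_on UNIV (%t. integral {a..cl t} (g be))"
   by (rule continuous_on_compose2[OF _ clc]) (use cl in auto)
  moreover have "continuous_on UNIV (%t. E (cl t))"
   by (rule continuous_on_compose2[OF Ec[of UNIV] clc]) auto
  moreover have "E (cl t) ~= 0" for t using E[of "cl t"] by simp
  ultimately show "continuous_on UNIV (\<Phi>0 be)"
   unfolding \<Phi>0_def[abs_def] by (intro continuous_intros) auto
  have "\<bar>\<Phi>0 be t\<bar> <= B * (b - a)" for t
  proof -
   have "\<bar>integral {a..cl t} (g be)\<bar> <= B * (cl t - a)"
    using integral_bound[of a "cl t" "g be" B] cl[of t] continuous_on_subset[OF gc[of be]] bd
    by (auto simp: g_def)
   also have "... <= B * (b - a)" using B0 cl[of t] by (intro mult_left_mono) auto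
   finally have "\<bar>integral {a..cl t} (g be)\<bar> / E (cl t) <= B * (b - a) / 1"
    using cl(2)[of t] K by (intro frac_le) (auto simp: E_def)
   then show ?thesis using E[of "cl t"] by (simp add: \<Phi>0_def abs_divide)
  qed
  then show "bounded (range (\<Phi>0 be))" unfolding bounded_iff by auto
 qed
 define \<Phi> where "\<Phi> be = Bcontfun (\<Phi>0 be)" for be
 have \<Phi>: "apply_bcontfun (\<Phi> be) = \<Phi>0 be" for be unfolding \<Phi>_def by (rule Bcontfun_inverse[OF \<Phi>0])
 have contr: "dist (\<Phi> be) (\<Phi> ga) <= 1 / 2 * dist be ga" for be ga
 proof (rule dist_bound)
  fix t
  define D where "D = dist be ga"
  have D0: "0 <= D" by (simp add: D_def)
  have I: "((%s. K * (E s * D)) has_integral (E (cl t) * D / 2 - E a * D / 2)) {a..cl t}"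
   by (rule fundamental_theorem_of_calculus[OF cl(2)])
    (auto simp: E_def has_real_derivative_iff_has_vector_derivative[symmetric] intro!: derivative_eq_intros)
  have le: "norm (g be s - g ga s) <= K * (E s * D)" if s: "s \<in> {a..cl t}" for s
  proof -
   have sab: "s \<in> {a..b}" using s cl[of t] by auto
   have "norm (g be s - g ga s) <= K * \<bar>E s * apply_bcontfun be s - E s * apply_bcontfun ga s\<bar>"
    using lip[OF sab, of "al + E s * apply_bcontfun be s" "al + E s * apply_bcontfun ga s"] by (simp add: g_def)
   also have "\<bar>E s * apply_bcontfun be s - E s * apply_bcontfun ga s\<bar> = E s * dist (apply_bcontfun be s) (apply_bcontfun ga s)"
    using E[of s] by (simp add: dist_real_def abs_mult right_diff_distrib[symmetric])
   also have "K * ... <= K * (E s * D)"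
    using K E[of s] dist_bounded[of be s ga] by (intro mult_left_mono) (auto simp: D_def)
   finally show ?thesis .
  qed
  have "norm (integral {a..cl t} (%s. g be s - g ga s)) <= integral {a..cl t} (%s. K * (E s * D))"
   by (rule integral_norm_bound_integral[OF Henstock_Kurzweil_Integration.integrable_diff[OF gi gi] has_integral_integrable[OF I] le])
  also have "... = E (cl t) * D / 2 - E a * D / 2" by (rule integral_unique[OF I])
  also have "... <= E (cl t) * (D / 2)" using E[of a] D0 by simp
  finally have "norm (integral {a..cl t} (g be) - integral {a..cl t} (g ga)) <= E (cl t) * (D / 2)"
   by (simp add: Henstock_Kurzweil_Integration.integral_diff[OF gi gi])
  then have "\<bar>integral {a..cl t} (g be) - integral {a..cl t} (g ga)\<bar> / E (cl t) <= D / 2"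
   using E[of "cl t"] by (simp add: divide_le_eq mult.commute)
  then show "dist (apply_bcontfun (\<Phi> be) t) (apply_bcontfun (\<Phi> ga) t) <= 1 / 2 * dist be ga"
   unfolding \<Phi> \<Phi>0_def dist_real_def diff_divide_distrib[symmetric] abs_divide using E[of "cl t"] by (simp add: D_def)
 qed
 then obtain be where fixpoint: "\<Phi> be = be" using banach_fix_type[of "1/2" \<Phi>] by auto
 define X where "X t = al + integral {a..t} (g be)" for t
 have X: "X t = al + E t * apply_bcontfun be t" if "t \<in> {a..b}" for t
 proof -
  have "cl t = t" using that by (auto simp: cl_def)
  then have "apply_bcontfun be t = integral {a..t} (g be) / E t" using \<Phi>[of be] unfolding fixpoint by (simp add: \<Phi>0_def)
  then show ?thesis using E[of t] by (simp add: X_def)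
 qed
 show ?thesis
 proof (rule that[of X])
  show "X a = al" by (simp add: X_def)
  fix t assume t: "t \<in> {a..b}"
  have "((%t. al + integral {a..t} (g be)) has_real_derivative 0 + g be t) (at t within {a..b})"
   by (intro DERIV_add DERIV_const integral_has_real_derivative gc t)
  then show "(X has_real_derivative v (X t) t) (at t within {a..b})"
   by (simp add: X_def[abs_def, symmetric] g_def X[OF t])
 qed
qed

definition is_flow :: "real => real => (real => real => real) => (real => real => real) => bool" where
 "is_flow a b u X \<longleftrightarrow> (\<forall>al. X al a = al & (\<forall>t\<in>{a..b}. (X al has_real_derivative u (X al t) t) (at t within {a..b})))"

lemma characteristic_exists:
 assumes dl: "0 < dl" "dl < 1" and ab: "a <= b" and u: "hfam dl M a b u"
 obtains X where "X a = al" "!!t. t \<in> {a..b} ==> (X has_real_derivative u (X t) t) (at t within {a..b})"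
proof (rule global_ode_solution[OF ab hfam_continuous(1)[OF dl u], of M "M + 1" al])
 have a: "a \<in> {a..b}" using ab by simp
 show "0 < M + 1" using Hball_nonneg[OF hfam_Hball[OF u a]] by simp
 fix x y t assume t: "t \<in> {a..b}"
 note B = hfam_Hball[OF u t]
 show "\<bar>u x t\<bar> <= M" by (rule Hball_bound[OF B])
 have "\<bar>u x t - u y t\<bar> <= M * \<bar>x - y\<bar>" by (rule Hball_Lipschitz[OF B])
 also have "... <= (M + 1) * \<bar>x - y\<bar>" by (intro mult_right_mono) auto
 finally show "\<bar>u x t - u y t\<bar> <= (M + 1) * \<bar>x - y\<bar>" .
qed (use that in auto)

lemma flow_exists:
 assumes dl: "0 < dl" "dl < 1" and ab: "a <= b" and u: "hfam dl M a b u"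
 obtains X where "is_flow a b u X"
proof -
 have "\<exists>X. X a = al & (\<forall>t\<in>{a..b}. (X has_real_derivative u (X t) t) (at t within {a..b}))" for al
  using characteristic_exists[OF assms, of al] by metis
 then obtain X where "!!al. X al a = al & (\<forall>t\<in>{a..b}. (X al has_real_derivative u (X al t) t) (at t within {a..b}))"
  by metis
 then show ?thesis using that unfolding is_flow_def by blast
qed

section \<open>Integrals depending on time\<close>

lemma measurable_strip:
 fixes g :: "real => real => real"
 assumes c: "continuous_on (UNIV \<times> {s..t}) (%(x, r). g x r)"
 shows "(%(x, r). indicator {s..t} r * g x r) \<in> borel_measurable (lborel \<Otimes>\<^sub>M lborel)"
proof -
 have "(%p. indicator (UNIV \<times> {s..t}) p *\<^sub>R (case p of (x, r) => g x r)) \<in> borel_measurable (borel :: (real \<times> real) measure)"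
  by (rule borel_measurable_continuous_on_indicator[OF _ c]) (auto intro!: borel_closed closed_Times)
 also have "(%p. indicator (UNIV \<times> {s..t}) p *\<^sub>R (case p of (x, r) => g x r)) = (%(x, r). indicator {s..t} r * g x r)"
  by (auto simp: indicator_def fun_eq_iff)
 also have "borel_measurable (borel :: (real \<times> real) measure) = borel_measurable (lborel \<Otimes>\<^sub>M lborel)"
  by (intro measurable_cong_sets) (auto simp: borel_prod[symmetric] intro!: sets_pair_measure_cong)
 finally show ?thesis .
qed

lemma time_Fubini:
 fixes g :: "real => real => real"
 assumes c: "continuous_on (UNIV \<times> {s..t}) (%(x, r). g x r)"
  and i: "!!r. r \<in> {s..t} ==> integrable lborel (%x. g x r)"
  and bd: "!!r. r \<in> {s..t} ==> (LINT x|lborel. \<bar>g x r\<bar>) <= A"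
 shows "(LINT x|lborel. LINT r|lborel. indicator {s..t} r * g x r) = (LINT r|lborel. indicator {s..t} r * (LINT x|lborel. g x r))"
  and "integrable lborel (%x. LINT r|lborel. indicator {s..t} r * g x r)"
proof -
 have ind: "integrable lborel (indicator {s..t} :: real => real)"
  by (rule integrable_real_indicator) (auto simp: emeasure_lborel_Icc_eq)
 note m = measurable_strip[OF c]
 have m': "(%(r, x). indicator {s..t} r * g x r) \<in> borel_measurable (lborel \<Otimes>\<^sub>M lborel)"
  using measurable_pair_swap[OF m] by (simp add: case_prod_beta')
 have I: "integrable (lborel \<Otimes>\<^sub>M lborel) (%(r, x). indicator {s..t} r * g x r)"
 proof (rule lborel_pair.Fubini_integrable[OF m'])
  show "integrable lborel (%r. LINT x|lborel. norm (case (r, x) of (r, x) => indicator {s..t} r * g x r))"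
  proof (rule Bochner_Integration.integrable_bound)
   show "integrable lborel (%r. indicator {s..t} r * A)" using ind by simp
   have "(%p. norm (case p of (r, x) => indicator {s..t} r * g x r)) \<in> borel_measurable (lborel \<Otimes>\<^sub>M lborel)"
    by (rule measurable_compose[OF m' borel_measurable_norm])
   then show "(%r. LINT x|lborel. norm (case (r, x) of (r, x) => indicator {s..t} r * g x r)) \<in> borel_measurable lborel"
    by (intro lborel.borel_measurable_lebesgue_integral) (simp add: case_prod_beta')
   show "AE r in lborel. norm (LINT x|lborel. norm (case (r, x) of (r, x) => indicator {s..t} r * g x r)) <= norm (indicator {s..t} r * A)"
   proof (rule AE_I2)
    fix r show "norm (LINT x|lborel. norm (case (r, x) of (r, x) => indicator {s..t} r * g x r)) <= norm (indicator {s..t} r * A)"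
     using bd[of r] by (cases "r \<in> {s..t}") auto
   qed
  qed
  show "AE r in lborel. integrable lborel (%x. case (r, x) of (r, x) => indicator {s..t} r * g x r)"
   using i by (intro AE_I2) (auto simp: indicator_def)
 qed
 have "(LINT x|lborel. LINT r|lborel. indicator {s..t} r * g x r) = (LINT r|lborel. LINT x|lborel. indicator {s..t} r * g x r)"
  by (rule lborel_pair.Fubini_integral[OF I])
 then show "(LINT x|lborel. LINT r|lborel. indicator {s..t} r * g x r) = (LINT r|lborel. indicator {s..t} r * (LINT x|lborel. g x r))"
  by simp
 show "integrable lborel (%x. LINT r|lborel. indicator {s..t} r * g x r)"
  using lborel_pair.integrable_snd[OF I] by simp
qed

text \<open>If \<open>F\<close> and \<open>F'\<close> are integrable, then \<open>F'\<close> has integral zero: average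
 \<open>F (x + 1) - F x\<close> over \<open>x\<close>.\<close>

lemma integral_deriv_eq_0:
 fixes F f :: "real => real"
 assumes F: "!!x. (F has_real_derivative f x) (at x)" and c: "continuous_on UNIV f"
  and i: "integrable lborel F" "integrable lborel f"
 shows "(LINT x|lborel. f x) = 0"
proof -
 have sh: "integrable lborel (%x. h (x + r))" "(LINT x|lborel. h (x + r)) = (LINT x|lborel. h x)"
  if "integrable lborel h" for h :: "real => real" and r
  using lborel_integrable_real_affine[OF that, of 1 r] lborel_integral_real_affine[of 1 h r] by (simp_all add: add.commute)
 have cc: "continuous_on (UNIV \<times> {0..1}) (%(x, r). f (x + r))"
  unfolding case_prod_beta' by (intro continuous_on_compose2[OF c] continuous_intros) auto
 have "(LINT x|lborel. LINT r|lborel. indicator {0..1} r * f (x + r)) = (LINT r|lborel. indicator {0..1} r * (LINT x|lborel. f (x + r)))"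
  by (rule time_Fubini(1)[OF cc sh(1)[OF i(2)], of "LINT x|lborel. \<bar>f x\<bar>"])
   (use sh(2)[OF integrable_abs[OF i(2)]] in simp)
 also have "... = (LINT x|lborel. f x)" by (simp add: sh(2)[OF i(2)])
 finally have 1: "(LINT x|lborel. LINT r|lborel. indicator {0..1} r * f (x + r)) = (LINT x|lborel. f x)" .
 have "(LINT r|lborel. indicator {0..1} r *\<^sub>R f (x + r)) = F (x + 1) - F (x + 0)" for x
 proof (rule integral_FTC_atLeastAtMost)
  fix r :: real
  have "((%r. F (r + x)) has_real_derivative f (r + x)) (at r)" using DERIV_shift[of F "f (r + x)" r x] F by simp
  then show "((%r. F (x + r)) has_vector_derivative f (x + r)) (at r within {0..1})"
   by (simp add: add.commute has_real_derivative_iff_has_vector_derivative[symmetric] has_field_derivative_at_within)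
  show "continuous_on {0..1} (%r. f (x + r))" by (intro continuous_on_compose2[OF c] continuous_intros) auto
 qed simp
 then have "(LINT x|lborel. LINT r|lborel. indicator {0..1} r * f (x + r)) = (LINT x|lborel. F (x + 1) - F x)" by simp
 also have "... = 0" using sh[OF i(1), of 1] i(1) by simp
 finally show ?thesis using 1 by simp
qed

text \<open>Minkowski's inequality for an integral over time, in the form of a Lipschitz estimate.\<close>

lemma L2_time_Lipschitz:
 fixes f g :: "real => real => real"
 assumes st: "s <= t" and f: "!!x r. r \<in> {s..t} ==> (f x has_real_derivative g x r) (at r within {s..t})"
  and c: "continuous_on (UNIV \<times> {s..t}) (%(x, r). g x r)"
  and g: "!!r. r \<in> {s..t} ==> (%x. g x r) \<in> L2_space" "!!r. r \<in> {s..t} ==> L2_norm (%x. g x r) <= A"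
  and [measurable]: "(%x. f x t - f x s) \<in> borel_measurable borel"
 shows "(%x. f x t - f x s) \<in> L2_space" "L2_norm (%x. f x t - f x s) <= A * (t - s)"
proof -
 have "L2_norm (%x. g x s) <= A" using g(2)[of s] st by simp
 then have A: "0 <= A" using L2_norm_nonneg[of "%x. g x s"] by linarith
 have ind: "integrable lborel (indicator {s..t} :: real => real)" "(LINT r|lborel. indicator {s..t} r) = t - s"
  using st by (auto intro!: integrable_real_indicator simp: emeasure_lborel_Icc_eq)
 have gx: "continuous_on {s..t} (g x)" for x
  using continuous_on_along[OF c, of "%_. x"] by simp
 have iv: "integrable lborel (%r. indicator {s..t} r * (g x r)^k)" for x k
  using borel_integrable_atLeastAtMost'[OF continuous_on_power[OF gx[of x], of k]] by (simp add: set_integrable_def)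
 have ftc: "f x t - f x s = (LINT r|lborel. g x r * indicator {s..t} r)" for x
  using integral_FTC_atLeastAtMost[of s t "f x" "g x", OF st _ gx] f
  by (simp add: has_real_derivative_iff_has_vector_derivative mult.commute)
 have cs: "(f x t - f x s)\<^sup>2 <= (t - s) * (LINT r|lborel. indicator {s..t} r * (g x r)\<^sup>2)" for x
 proof -
  have m: "(%r. g x r * indicator {s..t} r) \<in> borel_measurable borel"
   using borel_measurable_integrable[OF iv[of x 1]] by (simp add: mult.commute)
  have eq: "(g x r * indicator {s..t} r) * indicator {s..t} r = g x r * indicator {s..t} r"
   "(g x r * indicator {s..t} r)\<^sup>2 * indicator {s..t} r = indicator {s..t} r * (g x r)\<^sup>2" for r
   by (auto simp: indicator_def)
  show ?thesis
   using integral_weighted_Cauchy_Schwarz(1)[OF m ind(1)] iv[of x 2] unfolding eq ftc ind(2) by simp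
 qed
 have "(\<integral>\<^sup>+x. ennreal ((f x t - f x s)\<^sup>2) \<partial>lborel) <= (\<integral>\<^sup>+x. ennreal (t - s) * (\<integral>\<^sup>+r. ennreal (indicator {s..t} r * (g x r)\<^sup>2) \<partial>lborel) \<partial>lborel)"
 proof (rule nn_integral_mono)
  fix x
  have "ennreal ((f x t - f x s)\<^sup>2) <= ennreal ((t - s) * (LINT r|lborel. indicator {s..t} r * (g x r)\<^sup>2))"
   by (rule ennreal_leI[OF cs])
  also have "... = ennreal (t - s) * (\<integral>\<^sup>+r. ennreal (indicator {s..t} r * (g x r)\<^sup>2) \<partial>lborel)"
   using st nn_integral_eq_integral[OF iv[of x 2]] by (simp add: ennreal_mult)
  finally show "ennreal ((f x t - f x s)\<^sup>2) <= ..." .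
 qed
 also have "... = ennreal (t - s) * (\<integral>\<^sup>+r. (\<integral>\<^sup>+x. ennreal (indicator {s..t} r * (g x r)\<^sup>2) \<partial>lborel) \<partial>lborel)"
 proof -
  have "continuous_on (UNIV \<times> {s..t}) (%(x, r). (g x r)\<^sup>2)"
   using continuous_on_power[OF c, of 2] by (simp add: case_prod_beta')
  from measurable_strip[OF this]
  have m: "(%(x, r). ennreal (indicator {s..t} r * (g x r)\<^sup>2)) \<in> borel_measurable (lborel \<Otimes>\<^sub>M lborel)"
   unfolding case_prod_beta' by measurable
  then have "(%x. \<integral>\<^sup>+r. ennreal (indicator {s..t} r * (g x r)\<^sup>2) \<partial>lborel) \<in> borel_measurable lborel"
   by (rule lborel.borel_measurable_nn_integral)
  then show ?thesis
   unfolding lborel_pair.Fubini'[OF m] by (simp add: nn_integral_cmult)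
 qed
 also have "... <= ennreal (t - s) * (\<integral>\<^sup>+r. ennreal (A\<^sup>2) * indicator {s..t} r \<partial>lborel)"
 proof (intro mult_left_mono nn_integral_mono)
  fix r
  show "(\<integral>\<^sup>+x. ennreal (indicator {s..t} r * (g x r)\<^sup>2) \<partial>lborel) <= ennreal (A\<^sup>2) * indicator {s..t} r"
  proof (cases "r \<in> {s..t}")
   case True
   then show ?thesis using g(2)[OF True] by (simp add: L2_nn_integral[OF g(1)[OF True]] power_mono)
  qed simp
 qed simp
 also have "... = ennreal ((A * (t - s))\<^sup>2)"
  using st A by (simp add: nn_integral_cmult_indicator ennreal_mult[symmetric] power_mult_distrib power2_eq_square mult_ac)
 finally have *: "(\<integral>\<^sup>+x. ennreal ((f x t - f x s)\<^sup>2) \<partial>lborel) <= ennreal ((A * (t - s))\<^sup>2)" .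
 show "(%x. f x t - f x s) \<in> L2_space" "L2_norm (%x. f x t - f x s) <= A * (t - s)"
  using L2I_nn_integral[OF _ _ *] A st by simp_all
qed

section \<open>Bounded solutions on compact time intervals\<close>

definition bsol :: "real => real => real => real => (real => real => real) => bool" where
 "bsol dl M a b u \<longleftrightarrow> (\<forall>t\<in>{a..b}. (%x. u x t) \<in> Hball dl M) &
  (\<forall>t\<in>{a..b}. \<forall>x. (u x has_real_derivative uH u x t - u x t * ux u x t) (at t within {a..b}))"

lemma bsol_Hball: "bsol dl M a b u ==> t \<in> {a..b} ==> (%x. u x t) \<in> Hball dl M"
 by (simp add: bsol_def)

lemma bsol_derivative:
 "bsol dl M a b u ==> t \<in> {a..b} ==> (u x has_real_derivative uH u x t - u x t * ux u x t) (at t within {a..b})"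
 by (simp add: bsol_def)

lemma bsol_subinterval:
 assumes "bsol dl M a b u" "a <= c" "d <= b"
 shows "bsol dl M c d u"
proof -
 have "{c..d} \<subseteq> {a..b}" using assms by auto
 with assms show ?thesis unfolding bsol_def by (meson DERIV_subset subsetD)
qed

lemma bsol_time_Lipschitz:
 assumes u: "bsol dl M a b u" and s: "s \<in> {a..b}" and t: "t \<in> {a..b}"
 shows "\<bar>u x t - u x s\<bar> <= (2 * M + M * M) * \<bar>t - s\<bar>"
proof -
 have "norm (uH u x r - u x r * ux u x r) <= 2 * M + M * M" if r: "r \<in> {a..b}" for r
 proof -
  note B = bsol_Hball[OF u r]
  have "\<bar>u x r * ux u x r\<bar> <= M * M"
   unfolding abs_mult using Hball_bound[OF B] Hball_deriv_bound[OF B] Hball_nonneg[OF B] by (intro mult_mono) auto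
  then show ?thesis using Hball_hil_bound[OF B, of x] by simp
 qed
 from field_differentiable_bound[of "{a..b}" "u x", OF _ bsol_derivative[OF u] this t s]
 show ?thesis by simp
qed

lemma bsol_hfam:
 assumes u: "bsol dl M a b u"
 shows "hfam dl M a b u"
 unfolding hfam_def
proof (intro conjI ballI allI impI)
 fix t e :: real assume t: "t \<in> {a..b}" and e: "0 < e"
 define L where "L = 2 * M + M * M + 1"
 have L: "0 < L" using Hball_nonneg[OF bsol_Hball[OF u t]] by (simp add: L_def add_nonneg_pos)
 show "\<exists>d>0. \<forall>s\<in>{a..b}. \<bar>s - t\<bar> < d --> (\<forall>x. \<bar>u x s - u x t\<bar> <= e)"
 proof (intro exI[of _ "e / L"] conjI ballI impI allI)
  fix s x assume s: "s \<in> {a..b}" "\<bar>s - t\<bar> < e / L"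
  have "\<bar>u x s - u x t\<bar> <= L * \<bar>s - t\<bar>"
   using bsol_time_Lipschitz[OF u t s(1), of x] by (elim order_trans) (intro mult_right_mono, auto simp: L_def)
  also have "... <= e" using s(2) L by (simp add: pos_less_divide_eq mult.commute less_imp_le)
  finally show "\<bar>u x s - u x t\<bar> <= e" .
 qed (use e L in auto)
qed (use u in \<open>simp add: bsol_def\<close>)

lemma bsol_rate_continuous:
 assumes dl: "0 < dl" "dl < 1" and u: "bsol dl M a b u"
 shows "continuous_on (UNIV \<times> {a..b}) (%(x, t). uH u x t - u x t * ux u x t)"
 using hfam_continuous[OF dl bsol_hfam[OF u]] unfolding case_prod_beta' by (intro continuous_intros) auto

lemma Hball_product_L2:
 assumes f: "f \<in> Hball dl M" and dl: "0 < dl" and K: "!!x. \<bar>deriv f x\<bar> <= K"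
 shows "(%x. hil f x - f x * deriv f x) \<in> L2_space" "L2_norm (%x. hil f x - f x * deriv f x) <= (1 + K) * L2_norm f"
proof -
 interpret pv_bounded f "12 * M" by (rule Hball_pv_bounded[OF f])
 note p = L2_space_mult_bounded[OF L2 Hball_deriv_measurable[OF f dl] K]
 have *: "(%x. hil f x - f x * deriv f x) = (%x. hil f x - deriv f x * f x)" by (simp add: mult.commute)
 show "(%x. hil f x - f x * deriv f x) \<in> L2_space"
  unfolding * by (rule L2_space_diff[OF hil_in_L2(1) p(1)])
 show "L2_norm (%x. hil f x - f x * deriv f x) <= (1 + K) * L2_norm f"
  unfolding * using L2_norm_triangle_diff[OF hil_in_L2(1) p(1)] hil_in_L2(2) p(2) by (simp add: distrib_right)
qed

lemma bsol_L2_Lipschitz: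
 assumes dl: "0 < dl" "dl < 1" and u: "bsol dl M a b u" and K: "!!r x. r \<in> {a..b} ==> \<bar>ux u x r\<bar> <= K"
  and N: "!!r. r \<in> {a..b} ==> L2_norm (%x. u x r) <= N" and st: "a <= s" "s <= t" "t <= b" and K0: "0 <= K"
 shows "L2_norm (%x. u x t - u x s) <= (1 + K) * N * (t - s)"
proof (rule L2_time_Lipschitz(2)[OF st(2), where g="%x r. uH u x r - u x r * ux u x r"])
 note u' = bsol_subinterval[OF u st(1,3)]
 show "(u x has_real_derivative uH u x r - u x r * ux u x r) (at r within {s..t})" if "r \<in> {s..t}" for x r
  by (rule bsol_derivative[OF u' that])
 show "continuous_on (UNIV \<times> {s..t}) (%(x, r). uH u x r - u x r * ux u x r)"
  by (rule bsol_rate_continuous[OF dl u'])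
 fix r assume r: "r \<in> {s..t}"
 have r': "r \<in> {a..b}" using r st by auto
 show "(%x. uH u x r - u x r * ux u x r) \<in> L2_space"
  by (rule Hball_product_L2(1)[OF bsol_Hball[OF u r'] dl(1) K[OF r']])
 have "L2_norm (%x. uH u x r - u x r * ux u x r) <= (1 + K) * L2_norm (%x. u x r)"
  by (rule Hball_product_L2(2)[OF bsol_Hball[OF u r'] dl(1) K[OF r']])
 also have "... <= (1 + K) * N" using N[OF r'] K0 by (intro mult_left_mono) auto
 finally show "L2_norm (%x. uH u x r - u x r * ux u x r) <= (1 + K) * N" .
next
 have "s \<in> {a..b}" "t \<in> {a..b}" using st by auto
 then show "(%x. u x t - u x s) \<in> borel_measurable borel"
  using Hball_measurable[OF bsol_Hball[OF u]] by (intro borel_measurable_diff) auto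
qed

text \<open>The \<open>L\<^sup>2\<close> norm is conserved because \<open>H\<close> is skew and \<open>u\<^sup>2 u\<^sub>x\<close> is a derivative.\<close>

lemma bsol_L2_conserved:
 assumes dl: "0 < dl" "dl < 1" and u: "bsol dl M a b u" and st: "a <= s" "s <= t" "t <= b"
 shows "L2_norm (%x. u x t) = L2_norm (%x. u x s)"
proof -
 note u' = bsol_subinterval[OF u st(1,3)]
 let ?d = "%x r. uH u x r - u x r * ux u x r"
 let ?g = "%x r. 2 * (u x r * ?d x r)"
 have c: "continuous_on (UNIV \<times> {s..t}) (%(x, r). ?g x r)"
  using hfam_continuous(1-3)[OF dl bsol_hfam[OF u']]
  unfolding case_prod_beta' by (intro continuous_intros) auto
 have M0: "0 <= M" using Hball_nonneg[OF bsol_Hball[OF u', of s]] st by simp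
 have i: "integrable lborel (%x. ?g x r)" and bd: "(LINT x|lborel. \<bar>?g x r\<bar>) <= 2 * (M * ((1 + M) * M))"
  and z: "(LINT x|lborel. ?g x r) = 0" if r: "r \<in> {s..t}" for r
 proof -
  note B = bsol_Hball[OF u' r]
  interpret pv_bounded "%x. u x r" "12 * M" by (rule Hball_pv_bounded[OF B])
  note p = Hball_product_L2[OF B dl(1) Hball_deriv_bound[OF B]]
  show "integrable lborel (%x. ?g x r)" using integrable_mult_L2[OF L2 p(1)] by simp
  have "(LINT x|lborel. \<bar>u x r * ?d x r\<bar>) <= L2_norm (%x. u x r) * L2_norm (%x. ?d x r)"
   by (rule L2_Cauchy_Schwarz_abs[OF L2 p(1)])
  also have "... <= M * ((1 + M) * M)"
   using Hball_norm[OF B] p(2) M0 by (intro mult_mono order_trans[OF p(2)] mult_left_mono) auto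
  finally show "(LINT x|lborel. \<bar>?g x r\<bar>) <= 2 * (M * ((1 + M) * M))" by (simp add: abs_mult)
  note m = Hball_deriv_measurable[OF B dl(1)]
  have uu: "integrable lborel (%x. (u x r)\<^sup>2)" by (rule L2_space_integrable[OF L2])
  have i3: "integrable lborel (%x. u x r ^ 3)"
  proof (rule Bochner_Integration.integrable_bound)
   show "integrable lborel (%x. M * (u x r)\<^sup>2)" using uu by simp
   have "\<bar>u x r ^ 3\<bar> = \<bar>u x r\<bar> * (u x r)\<^sup>2" for x by (simp add: power3_eq_cube power2_eq_square abs_mult)
   then show "AE x in lborel. norm (u x r ^ 3) <= norm (M * (u x r)\<^sup>2)"
    using Hball_bound[OF B] M0 by (intro AE_I2) (simp add: abs_mult mult_right_mono)
  qed (use Hball_measurable[OF B] in simp)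
  have i4: "integrable lborel (%x. 3 * (u x r)\<^sup>2 * ux u x r)"
  proof (rule Bochner_Integration.integrable_bound)
   show "integrable lborel (%x. 3 * M * (u x r)\<^sup>2)" using uu by simp
   show "AE x in lborel. norm (3 * (u x r)\<^sup>2 * ux u x r) <= norm (3 * M * (u x r)\<^sup>2)"
   proof (rule AE_I2)
    fix x
    have "3 * (u x r)\<^sup>2 * \<bar>ux u x r\<bar> <= 3 * (u x r)\<^sup>2 * M"
     by (rule mult_left_mono[OF Hball_deriv_bound[OF B]]) simp
    then show "norm (3 * (u x r)\<^sup>2 * ux u x r) <= norm (3 * M * (u x r)\<^sup>2)" using M0 by (simp add: abs_mult mult_ac)
   qed
  qed (use Hball_measurable[OF B] m in measurable)
  have "(LINT x|lborel. 3 * (u x r)\<^sup>2 * ux u x r) = 0"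
  proof (rule integral_deriv_eq_0[OF _ _ i3 i4])
   show "((%x. u x r ^ 3) has_real_derivative 3 * (u x r)\<^sup>2 * ux u x r) (at x)" for x
    using DERIV_power[OF Hball_has_derivative[OF B], of 3 x] by (simp add: mult_ac)
   show "continuous_on UNIV (%x. 3 * (u x r)\<^sup>2 * ux u x r)"
    by (intro continuous_intros Hball_continuous[OF B] Hball_deriv_continuous[OF B dl(1)])
  qed
  then have 0: "(LINT x|lborel. (u x r)\<^sup>2 * ux u x r) = 0" by (simp add: mult.assoc)
  have i4': "integrable lborel (%x. (u x r)\<^sup>2 * ux u x r)" using i4 by (simp add: mult.assoc)
  have "(LINT x|lborel. u x r * ?d x r) = (LINT x|lborel. u x r * uH u x r - (u x r)\<^sup>2 * ux u x r)"
   by (simp add: right_diff_distrib power2_eq_square mult.assoc)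
  also have "... = 0" using hil_orthogonal 0 integrable_mult_L2[OF L2 hil_in_L2(1)] i4' by simp
  finally show "(LINT x|lborel. ?g x r) = 0" by simp
 qed
 have ftc: "(u x t)\<^sup>2 - (u x s)\<^sup>2 = (LINT r|lborel. indicator {s..t} r * ?g x r)" for x
 proof -
  have "(LINT r|lborel. indicator {s..t} r *\<^sub>R ?g x r) = (u x t)\<^sup>2 - (u x s)\<^sup>2"
  proof (rule integral_FTC_atLeastAtMost[OF st(2)])
   fix r assume "s <= r" "r <= t"
   then have r: "r \<in> {s..t}" by simp
   show "((%r. (u x r)\<^sup>2) has_vector_derivative ?g x r) (at r within {s..t})"
    using DERIV_power[OF bsol_derivative[OF u' r], of x 2]
    by (simp add: has_real_derivative_iff_has_vector_derivative mult_ac)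
  next
   show "continuous_on {s..t} (?g x)" using continuous_on_along[OF c, of "%_. x"] by simp
  qed
  then show ?thesis by simp
 qed
 have "(LINT x|lborel. LINT r|lborel. indicator {s..t} r * ?g x r) = (LINT r|lborel. indicator {s..t} r * (LINT x|lborel. ?g x r))"
  by (rule time_Fubini(1)[OF c i bd])
 also have "... = (LINT r::real|lborel. 0)"
  by (rule Bochner_Integration.integral_cong) (use z in \<open>auto simp: indicator_def\<close>)
 finally have "(LINT x|lborel. (u x t)\<^sup>2 - (u x s)\<^sup>2) = 0" unfolding ftc by simp
 moreover have "integrable lborel (%x. (u x t)\<^sup>2)" "integrable lborel (%x. (u x s)\<^sup>2)"
  using Hball_L2[OF bsol_Hball[OF u', of t]] Hball_L2[OF bsol_Hball[OF u', of s]] st by (auto simp: L2_space_iff)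
 ultimately show ?thesis by (simp add: L2_norm_def)
qed

section \<open>Acceleration along characteristics\<close>

text \<open>The identity \<open>d/dt Hu(X, t) = - u(X, t) + Gfun u(X)\<close> is first proved for the regularised
 transform. There, all terms can be integrated by parts, \<open>H\<^sup>2 = - 1\<close> appears as
 \<open>Hreg (hil u) = - Preg u\<close>, and the transport terms add up to a square.\<close>

definition Greg :: "real => (real => real) => real => real" where
 "Greg e f x = - (1 / 2) * (LINT z|lborel. Qker' e z * (f x - f (x - z))\<^sup>2)"

lemma Gfun_eq:
 assumes f: "f \<in> Hball dl M"
 shows "Gfun f x = (LINT z|lborel. (dq f x (x - z))\<^sup>2) / (2 * pi)"
  and "integrable lborel (%z. (dq f x (x - z))\<^sup>2)"
proof -
 note r = L2_space_reflect[OF dq_L2[OF f], of x x]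
 show "integrable lborel (%z. (dq f x (x - z))\<^sup>2)" by (rule L2_space_integrable[OF r(1)])
 show "Gfun f x = (LINT z|lborel. (dq f x (x - z))\<^sup>2) / (2 * pi)"
  unfolding Gfun_def r(2)[symmetric] L2_norm_squared ..
qed

lemma Greg_integrand_bound:
 assumes e: "0 < e"
 shows "\<bar>Qker' e z * (f x - f (x - z))\<^sup>2\<bar> <= (dq f x (x - z))\<^sup>2 / pi"
proof (cases "z = 0")
 case False
 have "\<bar>e\<^sup>2 - z\<^sup>2\<bar> / (pi * (z\<^sup>2 + e\<^sup>2)\<^sup>2) <= (z\<^sup>2 + e\<^sup>2) / (pi * (z\<^sup>2 + e\<^sup>2)\<^sup>2)"
  by (intro divide_right_mono) (auto simp: abs_le_iff)
 also have "... = 1 / (pi * (z\<^sup>2 + e\<^sup>2))" using sum_squares_pos[OF e, of z] by (simp add: power2_eq_square)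
 also have "... <= 1 / (pi * z\<^sup>2)"
  using False e by (intro divide_left_mono mult_left_mono mult_pos_pos sum_squares_pos) auto
 finally have "\<bar>Qker' e z\<bar> <= 1 / (pi * z\<^sup>2)" by (simp add: Qker'_def)
 from mult_right_mono[OF this, of "(f x - f (x - z))\<^sup>2"]
 have "\<bar>Qker' e z * (f x - f (x - z))\<^sup>2\<bar> <= (f x - f (x - z))\<^sup>2 / z\<^sup>2 / pi" by (simp add: abs_mult mult.commute)
 also have "(f x - f (x - z))\<^sup>2 / z\<^sup>2 = (dq f x (x - z))\<^sup>2"
  by (simp add: dq_def power_divide power2_commute)
 finally show ?thesis .
qed simp

lemma Greg_bound:
 assumes e: "0 < e" and f: "f \<in> Hball dl M"
 shows "\<bar>Greg e f x\<bar> <= Gfun f x"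
proof -
 note [measurable] = Hball_measurable[OF f]
 have i: "integrable lborel (%z. (dq f x (x - z))\<^sup>2 / pi)" using Gfun_eq(2)[OF f] by simp
 have "integrable lborel (%z. Qker' e z * (f x - f (x - z))\<^sup>2)"
  by (rule Bochner_Integration.integrable_bound[OF i])
   (use order_trans[OF Greg_integrand_bound[OF e] abs_ge_self] in auto)
 then have "\<bar>LINT z|lborel. Qker' e z * (f x - f (x - z))\<^sup>2\<bar> <= (LINT z|lborel. (dq f x (x - z))\<^sup>2 / pi)"
  using Bochner_Integration.integral_norm_bound_integral[OF _ i, of "%z. Qker' e z * (f x - f (x - z))\<^sup>2"]
   Greg_integrand_bound[OF e] by simp
 then show ?thesis by (simp add: Greg_def Gfun_eq(1)[OF f] abs_mult)
qed

lemma Greg_tendsto: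
 assumes f: "f \<in> Hball dl M" and e: "!!n. 0 < e n" and e0: "e \<longlonglongrightarrow> 0"
 shows "(%n. Greg (e n) f x) \<longlonglongrightarrow> Gfun f x"
proof -
 note [measurable] = Hball_measurable[OF f]
 have "(%n. LINT z|lborel. Qker' (e n) z * (f x - f (x - z))\<^sup>2) \<longlonglongrightarrow> (LINT z|lborel. - (dq f x (x - z))\<^sup>2 / pi)"
 proof (rule integral_dominated_convergence[where w="%z. (dq f x (x - z))\<^sup>2 / pi"])
  show "AE z in lborel. (%n. Qker' (e n) z * (f x - f (x - z))\<^sup>2) \<longlonglongrightarrow> - (dq f x (x - z))\<^sup>2 / pi"
  proof (rule AE_I2)
   fix z show "(%n. Qker' (e n) z * (f x - f (x - z))\<^sup>2) \<longlonglongrightarrow> - (dq f x (x - z))\<^sup>2 / pi"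
   proof (cases "z = 0")
    case False
    have "(%n. ((e n)\<^sup>2 - z\<^sup>2) / (pi * (z\<^sup>2 + (e n)\<^sup>2)\<^sup>2) * (f x - f (x - z))\<^sup>2)
      \<longlonglongrightarrow> (0\<^sup>2 - z\<^sup>2) / (pi * (z\<^sup>2 + 0\<^sup>2)\<^sup>2) * (f x - f (x - z))\<^sup>2"
     using False by (intro tendsto_intros e0) auto
    also have "(0\<^sup>2 - z\<^sup>2) / (pi * (z\<^sup>2 + 0\<^sup>2)\<^sup>2) * (f x - f (x - z))\<^sup>2 = - ((f x - f (x - z)) / z)\<^sup>2 / pi"
     using False by (simp add: power2_eq_square)
    also have "((f x - f (x - z)) / z)\<^sup>2 = (dq f x (x - z))\<^sup>2"
     by (simp add: dq_def power_divide power2_commute)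
    finally show ?thesis by (simp add: Qker'_def)
   qed (simp add: dq_def)
  qed
  show "AE z in lborel. norm (Qker' (e n) z * (f x - f (x - z))\<^sup>2) <= (dq f x (x - z))\<^sup>2 / pi" for n
   using Greg_integrand_bound[OF e] by simp
  show "integrable lborel (%z. (dq f x (x - z))\<^sup>2 / pi)" using Gfun_eq(2)[OF f] by simp
 qed simp_all
 from tendsto_mult[OF tendsto_const[of "- (1/2)"] this]
 show ?thesis by (simp add: Greg_def Gfun_eq(1)[OF f])
qed

lemma Qker_shift_derivative:
 assumes "0 < e"
 shows "((%y. Qker e (c - y)) has_real_derivative - Qker' e (c - y)) (at y within S)"
  and "(Y has_real_derivative Y') (at t within S) ==>
   ((%t. Qker e (Y t - y)) has_real_derivative Qker' e (Y t - y) * Y') (at t within S)"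
proof -
 have "((%y. c - y) has_real_derivative - 1) (at y within S)" by (auto intro!: derivative_eq_intros)
 from DERIV_chain2[OF Qker_has_derivative[OF assms] this]
 show "((%y. Qker e (c - y)) has_real_derivative - Qker' e (c - y)) (at y within S)" by simp
 assume "(Y has_real_derivative Y') (at t within S)"
 then have "((%t. Y t - y) has_real_derivative Y') (at t within S)" by (auto intro!: derivative_eq_intros)
 from DERIV_chain2[OF Qker_has_derivative[OF assms] this]
 show "((%t. Qker e (Y t - y)) has_real_derivative Qker' e (Y t - y) * Y') (at t within S)" .
qed

lemma Qker_bounded: "0 < e ==> \<bar>Qker e z\<bar> <= 1 / (pi * e)"
proof -
 assume e: "0 < e"
 have "(Qker e z)\<^sup>2 <= (1 / (pi * e)) / (pi * e)"
  by (rule order_trans[OF Qker_squared_le[OF e] divide_right_mono[OF Pker_le[OF e]]]) (use e in simp)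
 then have "\<bar>Qker e z\<bar>\<^sup>2 <= (1 / (pi * e))\<^sup>2" by (simp add: power2_eq_square)
 then show ?thesis by (rule power2_le_imp_le) (use e in simp)
qed

text \<open>At a fixed time: the time derivative of the regularised transform at a point that moves
 with velocity \<open>f x\<close>.\<close>

lemma regularised_acceleration:
 assumes dl: "0 < dl" "dl < 1" and f: "f \<in> Hball dl M" and e: "0 < e"
 shows "integrable lborel (%y. Qker' e (x - y) * f x * f y + Qker e (x - y) * (hil f y - f y * deriv f y))"
  and "(LINT y|lborel. Qker' e (x - y) * f x * f y + Qker e (x - y) * (hil f y - f y * deriv f y)) = - Preg e f x + Greg e f x"
  and "(LINT y|lborel. \<bar>Qker' e (x - y) * f x * f y + Qker e (x - y) * (hil f y - f y * deriv f y)\<bar>)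
   <= M * M * (LINT y|lborel. \<bar>Qker' e y\<bar>) + L2_norm (Qker e) * ((1 + M) * M)"
proof -
 interpret pv_bounded f "12 * M" by (rule Hball_pv_bounded[OF f])
 note [measurable] = Hball_measurable[OF f] Hball_deriv_measurable[OF f dl(1)]
 note M0 = Hball_nonneg[OF f]
 note Qx = L2_space_reflect[OF Qker_L2[OF e], of x]
 note p = Hball_product_L2[OF f dl(1) Hball_deriv_bound[OF f]]
 have sh: "integrable lborel (%y. h (x - y))" "(LINT y|lborel. h (x - y)) = (LINT y|lborel. h y)"
  if "integrable lborel h" for h :: "real => real"
  using lborel_integrable_real_affine[OF that, of "-1" x] lborel_integral_real_affine[of "-1" h x] by simp_all
 have iq: "integrable lborel (%y. Qker' e (x - y) * g y)" if g: "g \<in> borel_measurable borel" "!!y. \<bar>g y\<bar> <= B" for g B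
 proof -
  have "(%z. g (x - z)) \<in> borel_measurable borel" using g(1) by measurable
  from sh(1)[OF Qker'_mult_integrable[OF e this g(2)]] show ?thesis by simp
 qed
 have i1: "integrable lborel (%y. Qker' e (x - y) * f y)" by (rule iq[OF _ Hball_bound[OF f]]) simp
 have i2: "integrable lborel (%y. Qker e (x - y) * hil f y)" by (rule integrable_mult_L2[OF Qx(1) hil_in_L2(1)])
 have id: "integrable lborel (%y. Qker e (x - y) * (hil f y - f y * deriv f y))" by (rule integrable_mult_L2[OF Qx(1) p(1)])
 have i3: "integrable lborel (%y. Qker e (x - y) * (f y * deriv f y))"
  using Bochner_Integration.integrable_diff[OF i2 id] by (simp add: right_diff_distrib)
 have "\<bar>(f y)\<^sup>2\<bar> <= M\<^sup>2" for y using Hball_bound[OF f, of y] power_mono[of "\<bar>f y\<bar>" M 2] by simp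
 then have i4: "integrable lborel (%y. Qker' e (x - y) * (f y)\<^sup>2)" by (intro iq) auto
 have i5: "integrable lborel (%y. Qker' e (x - y))" by (rule sh(1)[OF Qker'_integral(1)[OF e]])
 have z5: "(LINT y|lborel. Qker' e (x - y)) = 0" using sh(2)[OF Qker'_integral(1)[OF e]] Qker'_integral(2)[OF e] by simp
 have i6: "integrable lborel (%y. Qker e (x - y) * (f y)\<^sup>2 / 2)"
 proof (rule Bochner_Integration.integrable_bound)
  show "integrable lborel (%y. 1 / (pi * e) * (f y)\<^sup>2)" using L2_space_integrable[OF L2] by simp
  show "AE y in lborel. norm (Qker e (x - y) * (f y)\<^sup>2 / 2) <= norm (1 / (pi * e) * (f y)\<^sup>2)"
  proof (rule AE_I2)
   fix y
   have "\<bar>Qker e (x - y)\<bar> * (f y)\<^sup>2 <= 1 / (pi * e) * (f y)\<^sup>2" by (rule mult_right_mono[OF Qker_bounded[OF e]]) simp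
   moreover have "0 <= \<bar>Qker e (x - y)\<bar> * (f y)\<^sup>2" by simp
   ultimately show "norm (Qker e (x - y) * (f y)\<^sup>2 / 2) <= norm (1 / (pi * e) * (f y)\<^sup>2)"
   proof -
    have "norm (Qker e (x - y) * (f y)\<^sup>2 / 2) = \<bar>Qker e (x - y)\<bar> * (f y)\<^sup>2 / 2" by (simp add: abs_mult)
    moreover have "norm (1 / (pi * e) * (f y)\<^sup>2) = 1 / (pi * e) * (f y)\<^sup>2" using e by (simp add: abs_mult)
    ultimately show ?thesis
     using \<open>\<bar>Qker e (x - y)\<bar> * (f y)\<^sup>2 <= 1 / (pi * e) * (f y)\<^sup>2\<close> \<open>0 <= \<bar>Qker e (x - y)\<bar> * (f y)\<^sup>2\<close> by linarith
   qed
  qed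
 qed simp
 have parts: "(LINT y|lborel. - (Qker' e (x - y) * (f y)\<^sup>2) / 2 + Qker e (x - y) * (f y * deriv f y)) = 0"
 proof (rule integral_deriv_eq_0[OF _ _ i6])
  show "((%y. Qker e (x - y) * (f y)\<^sup>2 / 2) has_real_derivative - (Qker' e (x - y) * (f y)\<^sup>2) / 2 + Qker e (x - y) * (f y * deriv f y)) (at y)" for y
   using DERIV_cdivide[OF DERIV_mult[OF Qker_shift_derivative(1)[OF e] DERIV_power[OF Hball_has_derivative[OF f], of 2]], of x 2 y]
   by (simp add: field_simps)
  show "continuous_on UNIV (%y. - (Qker' e (x - y) * (f y)\<^sup>2) / 2 + Qker e (x - y) * (f y * deriv f y))"
   by (intro continuous_intros Hball_continuous[OF f] Hball_deriv_continuous[OF f dl(1)]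
     continuous_on_compose2[OF ker_continuous(3)[OF e, of UNIV]] continuous_on_compose2[OF ker_continuous(2)[OF e, of UNIV]]) auto
  show "integrable lborel (%y. - (Qker' e (x - y) * (f y)\<^sup>2) / 2 + Qker e (x - y) * (f y * deriv f y))"
   using i4 i3 by simp
 qed
 have parts': "(LINT y|lborel. Qker e (x - y) * (f y * deriv f y)) = (LINT y|lborel. Qker' e (x - y) * (f y)\<^sup>2) / 2"
  using parts i3 i4 by simp
 have i7: "integrable lborel (%y. Qker' e (x - y) * f x * f y)"
  using integrable_mult_right[OF i1, of "f x"] by (simp add: mult_ac)
 show "integrable lborel (%y. Qker' e (x - y) * f x * f y + Qker e (x - y) * (hil f y - f y * deriv f y))"
  using i7 id by simp
 have "(LINT y|lborel. Qker' e (x - y) * f x * f y + Qker e (x - y) * (hil f y - f y * deriv f y))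
  = (LINT y|lborel. f x * (Qker' e (x - y) * f y)) + (LINT y|lborel. Qker e (x - y) * hil f y) - (LINT y|lborel. Qker e (x - y) * (f y * deriv f y))"
  using i7 i2 i3 by (simp add: right_diff_distrib mult_ac)
 also have "... = - Preg e f x + (f x * (LINT y|lborel. Qker' e (x - y) * f y) - (LINT y|lborel. Qker' e (x - y) * (f y)\<^sup>2) / 2)"
  using Hreg_hil[OF e, of x] i1 by (simp add: Hreg_def parts')
 also have "f x * (LINT y|lborel. Qker' e (x - y) * f y) - (LINT y|lborel. Qker' e (x - y) * (f y)\<^sup>2) / 2 = Greg e f x"
 proof -
  have "(LINT z|lborel. Qker' e z * (f x - f (x - z))\<^sup>2) = (LINT y|lborel. Qker' e (x - y) * (f x - f y)\<^sup>2)"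
   by (subst lborel_integral_real_affine[of "-1" _ x]) simp_all
  also have "... = (LINT y|lborel. (f x)\<^sup>2 * Qker' e (x - y) - 2 * f x * (Qker' e (x - y) * f y) + Qker' e (x - y) * (f y)\<^sup>2)"
   by (rule Bochner_Integration.integral_cong) (auto simp: power2_diff algebra_simps)
  also have "... = - 2 * f x * (LINT y|lborel. Qker' e (x - y) * f y) + (LINT y|lborel. Qker' e (x - y) * (f y)\<^sup>2)"
   using i1 i4 i5 z5 by simp
  finally show ?thesis by (simp add: Greg_def diff_divide_distrib)
 qed
 finally show "(LINT y|lborel. Qker' e (x - y) * f x * f y + Qker e (x - y) * (hil f y - f y * deriv f y)) = - Preg e f x + Greg e f x" .
 have "(LINT y|lborel. \<bar>Qker' e (x - y) * f x * f y + Qker e (x - y) * (hil f y - f y * deriv f y)\<bar>)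
   <= (LINT y|lborel. M * M * \<bar>Qker' e (x - y)\<bar> + \<bar>Qker e (x - y) * (hil f y - f y * deriv f y)\<bar>)"
 proof (rule integral_mono)
  fix y
  have "\<bar>f x\<bar> * \<bar>f y\<bar> <= M * M" using Hball_bound[OF f] M0 by (intro mult_mono) auto
  from mult_right_mono[OF this, of "\<bar>Qker' e (x - y)\<bar>"]
  have "\<bar>Qker' e (x - y) * f x * f y\<bar> <= M * M * \<bar>Qker' e (x - y)\<bar>" by (simp add: abs_mult mult_ac)
  then show "\<bar>Qker' e (x - y) * f x * f y + Qker e (x - y) * (hil f y - f y * deriv f y)\<bar>
   <= M * M * \<bar>Qker' e (x - y)\<bar> + \<bar>Qker e (x - y) * (hil f y - f y * deriv f y)\<bar>" by linarith
 qed (use i7 id i5 in auto)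
 also have "... = M * M * (LINT y|lborel. \<bar>Qker' e y\<bar>) + (LINT y|lborel. \<bar>Qker e (x - y) * (hil f y - f y * deriv f y)\<bar>)"
  using i5 id sh(2)[OF integrable_abs[OF Qker'_integral(1)[OF e]]] by simp
 also have "(LINT y|lborel. \<bar>Qker e (x - y) * (hil f y - f y * deriv f y)\<bar>) <= L2_norm (Qker e) * ((1 + M) * M)"
 proof -
  have "(LINT y|lborel. \<bar>Qker e (x - y) * (hil f y - f y * deriv f y)\<bar>) <= L2_norm (Qker e) * L2_norm (%y. hil f y - f y * deriv f y)"
   using L2_Cauchy_Schwarz_abs[OF Qx(1) p(1)] Qx(2) by simp
  also have "... <= L2_norm (Qker e) * ((1 + M) * M)"
   using Hball_norm[OF f] M0 by (intro mult_left_mono order_trans[OF p(2)] mult_left_mono) auto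
  finally show ?thesis .
 qed
 finally show "(LINT y|lborel. \<bar>Qker' e (x - y) * f x * f y + Qker e (x - y) * (hil f y - f y * deriv f y)\<bar>)
   <= M * M * (LINT y|lborel. \<bar>Qker' e y\<bar>) + L2_norm (Qker e) * ((1 + M) * M)" by simp
qed

lemma Gfun_continuous_along:
 assumes dl: "0 < dl" "dl < 1" and u: "hfam dl M a b u" and X: "continuous_on {a..b} X"
 shows "continuous_on {a..b} (%r. Gfun (%y. u y r) (X r))"
 unfolding continuous_on_sequentially
proof (intro allI ballI impI, elim conjE)
 fix x :: "nat => real" and t assume t: "t \<in> {a..b}" and x: "\<forall>n. x n \<in> {a..b}" "x \<longlonglongrightarrow> t"
 have eq: "Gfun (%y. u y r) (X r) = (LINT z|lborel. ((u (X r - z) r - u (X r) r) / z)\<^sup>2) / (2 * pi)" if "r \<in> {a..b}" for r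
  using Gfun_eq(1)[OF hfam_Hball[OF u that], of "X r"] by (simp add: dq_def power_divide)
 have cu: "continuous_on {a..b} (%r. u (X r - z) r)" for z
  by (intro continuous_on_along[OF hfam_continuous(1)[OF dl u]] continuous_intros X)
 have "(%n. LINT z|lborel. ((u (X (x n) - z) (x n) - u (X (x n)) (x n)) / z)\<^sup>2) \<longlonglongrightarrow> (LINT z|lborel. ((u (X t - z) t - u (X t) t) / z)\<^sup>2)"
 proof (rule integral_dominated_convergence[where w="%z. 5 * M\<^sup>2 * pi * Pker 1 z"])
  show "integrable lborel (%z. 5 * M\<^sup>2 * pi * Pker 1 z)" using Pker_integral(1)[of 1] by simp
  have bd: "((u (X r - z) r - u (X r) r) / z)\<^sup>2 <= 5 * M\<^sup>2 * pi * Pker 1 z" if "r \<in> {a..b}" for r z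
   using dq_square_le[OF hfam_Hball[OF u that], of "X r" "X r - z"] Pker_even[of 1 z] by (simp add: dq_def power_divide)
  show "AE z in lborel. norm (((u (X (x n) - z) (x n) - u (X (x n)) (x n)) / z)\<^sup>2) <= 5 * M\<^sup>2 * pi * Pker 1 z" for n
   using bd x(1) by (intro AE_I2) simp
  show "AE z in lborel. (%n. ((u (X (x n) - z) (x n) - u (X (x n)) (x n)) / z)\<^sup>2) \<longlonglongrightarrow> ((u (X t - z) t - u (X t) t) / z)\<^sup>2"
  proof (rule AE_I2)
   fix z show "(%n. ((u (X (x n) - z) (x n) - u (X (x n)) (x n)) / z)\<^sup>2) \<longlonglongrightarrow> ((u (X t - z) t - u (X t) t) / z)\<^sup>2"
   proof (cases "z = 0")
    case False
    have "(%n. u (X (x n) - z) (x n)) \<longlonglongrightarrow> u (X t - z) t" for z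
     using cu[of z] x t unfolding continuous_on_sequentially by (auto simp: o_def)
    from this[of z] this[of 0] show ?thesis using False by (auto intro!: tendsto_intros)
   qed simp
  qed
  have m: "(%z. ((u (X r - z) r - u (X r) r) / z)\<^sup>2) \<in> borel_measurable lborel" if "r \<in> {a..b}" for r
   using Hball_measurable[OF hfam_Hball[OF u that]] by measurable
  show "(%z. ((u (X t - z) t - u (X t) t) / z)\<^sup>2) \<in> borel_measurable lborel" by (rule m[OF t])
  show "(%z. ((u (X (x n) - z) (x n) - u (X (x n)) (x n)) / z)\<^sup>2) \<in> borel_measurable lborel" for n
   using m x(1) by blast
 qed
 then have "(%n. (LINT z|lborel. ((u (X (x n) - z) (x n) - u (X (x n)) (x n)) / z)\<^sup>2) / (2 * pi)) \<longlonglongrightarrow> (LINT z|lborel. ((u (X t - z) t - u (X t) t) / z)\<^sup>2) / (2 * pi)"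
  by (intro tendsto_divide tendsto_const) auto
 then show "((%r. Gfun (%y. u y r) (X r)) \<circ> x) \<longlonglongrightarrow> Gfun (%y. u y t) (X t)"
  using x(1) t by (simp add: o_def eq)
qed

theorem characteristic_acceleration:
 assumes dl: "0 < dl" "dl < 1" and u: "bsol dl M a b u"
  and X: "!!t. t \<in> {a..b} ==> (X has_real_derivative u (X t) t) (at t within {a..b})" and t: "t \<in> {a..b}"
 shows "((%r. uH u (X r) r) has_real_derivative - u (X t) t + Gfun (%y. u y t) (X t)) (at t within {a..b})"
proof -
 note hf = bsol_hfam[OF u]
 have Xc: "continuous_on {a..b} X" by (rule DERIV_continuous_on[OF X])
 define c where "c n = inverse (real (Suc n))" for n
 have c: "0 < c n" for n by (simp add: c_def)
 have c0: "c \<longlonglongrightarrow> 0" unfolding c_def by (rule LIMSEQ_inverse_real_of_nat)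
 define k where "k r = - u (X r) r + Gfun (%y. u y r) (X r)" for r
 have kc: "continuous_on {a..b} k"
  unfolding k_def[abs_def] by (intro continuous_intros continuous_on_along[OF hfam_continuous(1)[OF dl hf]]
   Gfun_continuous_along[OF dl hf] Xc)
 have incr: "uH u (X t) t - uH u (X a) a = integral {a..t} k" if t: "t \<in> {a..b}" for t
 proof -
  have at: "a <= t" "t <= b" using t by auto
  have sub: "r \<in> {a..b}" if "r \<in> {a..t}" for r using that at by auto
  define h where "h n r = - Preg (c n) (%y. u y r) (X r) + Greg (c n) (%y. u y r) (X r)" for n r
  define g where "g n y r = Qker' (c n) (X r - y) * u (X r) r * u y r + Qker (c n) (X r - y) * (uH u y r - u y r * ux u y r)" for n y r
  have gc: "continuous_on (UNIV \<times> {a..t}) (%(y, r). g n y r)" for n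
   proof -
    have *: "continuous_on (UNIV \<times> {a..t}) (%p. X (snd p))"
     by (rule continuous_on_compose2[OF Xc]) (use at in \<open>auto intro!: continuous_intros\<close>)
    have **: "continuous_on (UNIV \<times> {a..t}) (%p. u (X (snd p)) (snd p))"
     by (rule continuous_on_compose2[OF continuous_on_along[OF hfam_continuous(1)[OF dl hf] Xc]])
      (use at in \<open>auto intro!: continuous_intros\<close>)
    note h' = hfam_continuous[OF dl hfam_subinterval[OF hf order_refl at(2)]]
    show ?thesis
     using h'(1-3) unfolding g_def case_prod_beta'
     by (intro continuous_intros * ** continuous_on_compose2[OF ker_continuous(3)[OF c, of UNIV]]
       continuous_on_compose2[OF ker_continuous(2)[OF c, of UNIV]]) auto
   qed
  have 1: "Hreg (c n) (%y. u y t) (X t) - Hreg (c n) (%y. u y a) (X a) = (LINT r|lborel. indicator {a..t} r * h n r)" for n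
  proof -
   have ra: "integrable lborel (%y. g n y r)" "(LINT y|lborel. g n y r) = h n r"
    "(LINT y|lborel. \<bar>g n y r\<bar>) <= M * M * (LINT y|lborel. \<bar>Qker' (c n) y\<bar>) + L2_norm (Qker (c n)) * ((1 + M) * M)"
    if "r \<in> {a..t}" for r
    using regularised_acceleration[OF dl bsol_Hball[OF u sub[OF that]] c, of n "X r"] by (simp_all add: g_def h_def)
   have "(LINT y|lborel. LINT r|lborel. indicator {a..t} r * g n y r) = (LINT r|lborel. indicator {a..t} r * (LINT y|lborel. g n y r))"
    by (rule time_Fubini(1)[OF gc ra(1) ra(3)])
   also have "... = (LINT r|lborel. indicator {a..t} r * h n r)"
    by (rule Bochner_Integration.integral_cong) (use ra(2) in \<open>auto simp: indicator_def\<close>)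
   finally have F: "(LINT y|lborel. LINT r|lborel. indicator {a..t} r * g n y r) = (LINT r|lborel. indicator {a..t} r * h n r)" .
   have ftc: "Qker (c n) (X t - y) * u y t - Qker (c n) (X a - y) * u y a = (LINT r|lborel. indicator {a..t} r * g n y r)" for y
   proof -
    have "(LINT r|lborel. indicator {a..t} r *\<^sub>R g n y r) = Qker (c n) (X t - y) * u y t - Qker (c n) (X a - y) * u y a"
    proof (rule integral_FTC_atLeastAtMost[OF at(1)])
     fix r assume "a <= r" "r <= t"
     then have r: "r \<in> {a..b}" using at by auto
     have "((%r. Qker (c n) (X r - y) * u y r) has_real_derivative g n y r) (at r within {a..b})"
      using DERIV_mult[OF Qker_shift_derivative(2)[OF c X[OF r]] bsol_derivative[OF u r], of n y y] by (simp add: g_def mult_ac)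
     then show "((%r. Qker (c n) (X r - y) * u y r) has_vector_derivative g n y r) (at r within {a..t})"
      unfolding has_real_derivative_iff_has_vector_derivative
      by (rule has_vector_derivative_within_subset) (use at in auto)
    next
     show "continuous_on {a..t} (g n y)" using continuous_on_along[OF gc, of "%_. y"] by simp
    qed
    then show ?thesis by simp
   qed
   have "a \<in> {a..b}" using at by auto
   then show ?thesis
    using F Hreg_integrable[OF c Hball_L2[OF bsol_Hball[OF u]]] t
    unfolding ftc[symmetric] by (simp add: Hreg_def)
  qed
  have "a \<in> {a..b}" using at by auto
  then have 2: "(%n. Hreg (c n) (%y. u y t) (X t) - Hreg (c n) (%y. u y a) (X a)) \<longlonglongrightarrow> uH u (X t) t - uH u (X a) a"
   using t by (intro tendsto_diff Hreg_tendsto[OF Hball_L2[OF bsol_Hball[OF u]] _ c c0]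
     pv_bounded.int[OF Hball_pv_bounded[OF bsol_Hball[OF u]]]) auto
  have ki: "set_integrable lborel {a..t} k"
   by (rule borel_integrable_atLeastAtMost'[OF continuous_on_subset[OF kc]]) (use at in auto)
  have 3: "(%n. LINT r|lborel. indicator {a..t} r * h n r) \<longlonglongrightarrow> (LINT r|lborel. indicator {a..t} r * k r)"
  proof (rule integral_dominated_convergence[where w="%r. indicator {a..t} r * (M + 5 * M\<^sup>2 / 2)"])
   show "integrable lborel (%r. indicator {a..t} r * (M + 5 * M\<^sup>2 / 2))"
    by (intro integrable_mult_left integrable_real_indicator) (auto simp: emeasure_lborel_Icc_eq)
   show "(%r. indicator {a..t} r * k r) \<in> borel_measurable lborel"
    using borel_measurable_integrable[OF ki[unfolded set_integrable_def]] by simp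
   show "AE r in lborel. (%n. indicator {a..t} r * h n r) \<longlonglongrightarrow> indicator {a..t} r * k r"
   proof (rule AE_I2)
    fix r show "(%n. indicator {a..t} r * h n r) \<longlonglongrightarrow> indicator {a..t} r * k r"
    proof (cases "r \<in> {a..t}")
     case True
     note B = bsol_Hball[OF u sub[OF True]]
     have "(%n. h n r) \<longlonglongrightarrow> k r"
      unfolding h_def k_def
      by (intro tendsto_intros Preg_tendsto[OF Hball_continuous[OF B] Hball_bound[OF B] c c0] Greg_tendsto[OF B c c0])
     then show ?thesis by (intro tendsto_intros)
    qed simp
   qed
   show "AE r in lborel. norm (indicator {a..t} r * h n r) <= indicator {a..t} r * (M + 5 * M\<^sup>2 / 2)" for n
   proof (rule AE_I2)
    fix r show "norm (indicator {a..t} r * h n r) <= indicator {a..t} r * (M + 5 * M\<^sup>2 / 2)"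
    proof (cases "r \<in> {a..t}")
     case True
     note B = bsol_Hball[OF u sub[OF True]]
     have "\<bar>h n r\<bar> <= M + 5 * M\<^sup>2 / 2"
      using Preg_bound[OF c Hball_measurable[OF B] Hball_bound[OF B], of n "X r"] Greg_bound[OF c B, of n "X r"] Gfun_bound[OF B, of "X r"]
      unfolding h_def by linarith
     then show ?thesis using True by simp
    qed simp
   qed
   show "(%r. indicator {a..t} r * h n r) \<in> borel_measurable lborel" for n
   proof -
    have "(%(r, y). indicator {a..t} r * g n y r) \<in> borel_measurable (lborel \<Otimes>\<^sub>M lborel)"
     using measurable_pair_swap[OF measurable_strip[OF gc]] by (simp add: case_prod_beta')
    then have "(%r. LINT y|lborel. indicator {a..t} r * g n y r) \<in> borel_measurable lborel"
     by (rule lborel.borel_measurable_lebesgue_integral)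
    moreover have "(LINT y|lborel. indicator {a..t} r * g n y r) = indicator {a..t} r * h n r" for r
     using regularised_acceleration(2)[OF dl bsol_Hball[OF u sub] c, of r n "X r"]
     by (cases "r \<in> {a..t}") (simp_all add: h_def g_def)
    ultimately show ?thesis by (simp only:)
   qed
  qed
  have "uH u (X t) t - uH u (X a) a = (LINT r:{a..t}|lborel. k r)"
   using LIMSEQ_unique[OF 2] 3 unfolding 1 by (simp add: set_lebesgue_integral_def)
  then show ?thesis using set_borel_integral_eq_integral(2)[OF ki] by simp
 qed
 have "((%t. uH u (X a) a + integral {a..t} k) has_real_derivative 0 + k t) (at t within {a..b})"
  by (intro DERIV_add DERIV_const integral_has_real_derivative kc t)
 then have d: "((%t. uH u (X a) a + integral {a..t} k) has_real_derivative k t) (at t within {a..b})" by simp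
 have "((%r. uH u (X r) r) has_real_derivative k t) (at t within {a..b})"
 proof (rule has_field_derivative_transform_within[OF d zero_less_one t])
  fix r assume "r \<in> {a..b}"
  from incr[OF this] show "uH u (X a) a + integral {a..r} k = uH u (X r) r" by simp
 qed
 then show ?thesis by (simp add: k_def)
qed

lemma velocity_derivative:
 assumes dl: "0 < dl" "dl < 1" and u: "bsol dl M a b u"
  and X: "(X has_real_derivative u (X t) t) (at t within {a..b})" and t: "t \<in> {a..b}"
 shows "((%r. u (X r) r) has_real_derivative uH u (X t) t) (at t within {a..b})"
proof -
 have "((%s. u (X s) s - u (X t) s) has_real_derivative ux u (X t) t * u (X t) t) (at t within {a..b})"
  by (rule moving_point_derivative[OF Hball_has_derivative[OF bsol_Hball[OF u]] hfam_continuous(2)[OF dl bsol_hfam[OF u]] X t])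
 from DERIV_add[OF this bsol_derivative[OF u t, of "X t"]] show ?thesis by (simp add: mult.commute)
qed

section \<open>The Hoelder norm and balls\<close>

lemma C1_holder_bounds:
 assumes f: "f \<in> C1_holder dl"
 shows "bdd_above (range (%x. \<bar>f x\<bar>))" "bdd_above (range (%x. \<bar>deriv f x\<bar>))"
  "bdd_above ((%(x, y). \<bar>deriv f x - deriv f y\<bar> / \<bar>x - y\<bar> powr dl) ` {(x, y). x ~= y})"
proof -
 show "bdd_above (range (%x. \<bar>f x\<bar>))"
  using f unfolding C1_holder_def bounded_iff by (auto simp: bdd_above_def)
 show "bdd_above (range (%x. \<bar>deriv f x\<bar>))"
  using f unfolding C1_holder_def bounded_iff by (auto simp: bdd_above_def)
 obtain C where C: "!!x y. \<bar>deriv f x - deriv f y\<bar> <= C * \<bar>x - y\<bar> powr dl" using f unfolding C1_holder_def by auto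
 show "bdd_above ((%(x, y). \<bar>deriv f x - deriv f y\<bar> / \<bar>x - y\<bar> powr dl) ` {(x, y). x ~= y})"
  unfolding bdd_above_def using C by (intro exI[of _ C]) (auto simp: divide_le_eq)
qed

lemma C1_holder_pointwise:
 assumes f: "f \<in> C1_holder dl"
 shows "\<bar>f x\<bar> <= (SUP x. \<bar>f x\<bar>)" "\<bar>deriv f x\<bar> <= (SUP x. \<bar>deriv f x\<bar>)"
  "\<bar>deriv f x - deriv f y\<bar> <= holder_seminorm dl (deriv f) * \<bar>x - y\<bar> powr dl"
  "0 <= (SUP x. \<bar>f x\<bar>)" "0 <= (SUP x. \<bar>deriv f x\<bar>)" "0 <= holder_seminorm dl (deriv f)"
proof -
 note b = C1_holder_bounds[OF f]
 show 1: "\<bar>f x\<bar> <= (SUP x. \<bar>f x\<bar>)" for x by (rule cSUP_upper[OF UNIV_I b(1)])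
 show 2: "\<bar>deriv f x\<bar> <= (SUP x. \<bar>deriv f x\<bar>)" for x by (rule cSUP_upper[OF UNIV_I b(2)])
 show "0 <= (SUP x. \<bar>f x\<bar>)" "0 <= (SUP x. \<bar>deriv f x\<bar>)"
  using 1[of 0] 2[of 0] by linarith+
 have q: "\<bar>deriv f x - deriv f y\<bar> / \<bar>x - y\<bar> powr dl <= holder_seminorm dl (deriv f)" if "x ~= y" for x y
  using cSUP_upper[OF _ b(3), of "(x, y)"] that by (simp add: holder_seminorm_def)
 show "\<bar>deriv f x - deriv f y\<bar> <= holder_seminorm dl (deriv f) * \<bar>x - y\<bar> powr dl"
 proof (cases "x = y")
  case False
  then show ?thesis using q[OF False] by (simp add: divide_le_eq)
 qed simp
 have "0 <= \<bar>deriv f 0 - deriv f 1\<bar> / \<bar>0 - 1\<bar> powr dl" by simp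
 also have "... <= holder_seminorm dl (deriv f)" by (rule q) simp
 finally show "0 <= holder_seminorm dl (deriv f)" .
qed

lemma C1_holder_norm_le:
 assumes "!!x. \<bar>f x\<bar> <= A" "!!x. \<bar>deriv f x\<bar> <= B" "!!x y. \<bar>deriv f x - deriv f y\<bar> <= C * \<bar>x - y\<bar> powr dl"
 shows "C1_holder_norm dl f <= A + B + C"
 unfolding C1_holder_norm_def holder_seminorm_def
proof (intro add_mono)
 show "(SUP x. \<bar>f x\<bar>) <= A" by (rule cSUP_least) (use assms in auto)
 show "(SUP x. \<bar>deriv f x\<bar>) <= B" by (rule cSUP_least) (use assms in auto)
 have "(0::real, 1::real) \<in> {(x, y). x ~= y}" by simp
 then show "(SUP (x, y)\<in>{(x, y). x ~= y}. \<bar>deriv f x - deriv f y\<bar> / \<bar>x - y\<bar> powr dl) <= C"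
  by (intro cSUP_least) (use assms(3) in \<open>auto simp: divide_le_eq\<close>)
qed

lemma C1_holder_norm_bounds:
 assumes f: "f \<in> C1_holder dl" and N: "C1_holder_norm dl f <= N"
 shows "\<bar>f x\<bar> <= N" "\<bar>deriv f x\<bar> <= N" "\<bar>deriv f x - deriv f y\<bar> <= N * \<bar>x - y\<bar> powr dl"
proof -
 note p = C1_holder_pointwise[OF f]
 have le: "(SUP x. \<bar>f x\<bar>) <= N" "(SUP x. \<bar>deriv f x\<bar>) <= N" "holder_seminorm dl (deriv f) <= N"
  using p(4-6) N unfolding C1_holder_norm_def by linarith+
 show "\<bar>f x\<bar> <= N" "\<bar>deriv f x\<bar> <= N" using p(1,2)[of x] le by linarith+
 have "holder_seminorm dl (deriv f) * \<bar>x - y\<bar> powr dl <= N * \<bar>x - y\<bar> powr dl" by (rule mult_right_mono[OF le(3)]) simp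
 then show "\<bar>deriv f x - deriv f y\<bar> <= N * \<bar>x - y\<bar> powr dl" using p(3)[of x y] by linarith
qed

lemma C1_holder_deriv_diff:
 assumes "f \<in> C1_holder dl" "g \<in> C1_holder dl"
 shows "deriv (%x. f x - g x) x = deriv f x - deriv g x"
 using assms by (intro DERIV_imp_deriv DERIV_diff) (auto simp: C1_holder_def DERIV_deriv_iff_real_differentiable)

lemma C1_holder_diff:
 assumes "f \<in> C1_holder dl" "g \<in> C1_holder dl"
 shows "(%x. f x - g x) \<in> C1_holder dl"
proof -
 note p = C1_holder_pointwise[OF assms(1)] and q = C1_holder_pointwise[OF assms(2)]
 note d = C1_holder_deriv_diff[OF assms]
 have 1: "bounded (range (%x. f x - g x))"
  unfolding bounded_iff using p(1) q(1) by (intro exI[of _ "(SUP x. \<bar>f x\<bar>) + (SUP x. \<bar>g x\<bar>)"])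
   (auto intro!: order_trans[OF abs_triangle_ineq4] add_mono)
 have 2: "bounded (range (deriv (%x. f x - g x)))"
  unfolding bounded_iff d using p(2) q(2) by (intro exI[of _ "(SUP x. \<bar>deriv f x\<bar>) + (SUP x. \<bar>deriv g x\<bar>)"])
   (auto simp: d intro!: order_trans[OF abs_triangle_ineq4] add_mono)
 have 3: "\<bar>deriv (%x. f x - g x) x - deriv (%x. f x - g x) y\<bar> <= (holder_seminorm dl (deriv f) + holder_seminorm dl (deriv g)) * \<bar>x - y\<bar> powr dl" for x y
  using p(3)[of x y] q(3)[of x y] unfolding d distrib_right by linarith
 have 4: "(%x. f x - g x) differentiable (at x)" for x
  using assms by (auto simp: C1_holder_def)
 show ?thesis unfolding C1_holder_def using 1 2 3 4 by blast
qed

lemma C1_holder_norm_triangle: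
 assumes f: "f \<in> C1_holder dl" and g: "g \<in> C1_holder dl"
 shows "C1_holder_norm dl f <= C1_holder_norm dl g + C1_holder_norm dl (%x. f x - g x)"
proof -
 let ?h = "%x. f x - g x"
 note p = C1_holder_pointwise[OF g] and q = C1_holder_pointwise[OF C1_holder_diff[OF f g]]
 note d = C1_holder_deriv_diff[OF f g]
 have "C1_holder_norm dl f <= ((SUP x. \<bar>g x\<bar>) + (SUP x. \<bar>?h x\<bar>)) + ((SUP x. \<bar>deriv g x\<bar>) + (SUP x. \<bar>deriv ?h x\<bar>))
   + (holder_seminorm dl (deriv g) + holder_seminorm dl (deriv ?h))"
 proof (rule C1_holder_norm_le)
  show "\<bar>f x\<bar> <= (SUP x. \<bar>g x\<bar>) + (SUP x. \<bar>?h x\<bar>)" for x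
   using p(1)[of x] q(1)[of x] by linarith
  show "\<bar>deriv f x\<bar> <= (SUP x. \<bar>deriv g x\<bar>) + (SUP x. \<bar>deriv ?h x\<bar>)" for x
   using p(2)[of x] q(2)[of x] d[of x] by linarith
  show "\<bar>deriv f x - deriv f y\<bar> <= (holder_seminorm dl (deriv g) + holder_seminorm dl (deriv ?h)) * \<bar>x - y\<bar> powr dl" for x y
   using p(3)[of x y] q(3)[of x y] d[of x] d[of y] unfolding distrib_right by linarith
 qed
 then show ?thesis by (simp add: C1_holder_norm_def)
qed

lemma C1_holder_norm_minus_commute:
 assumes f: "f \<in> C1_holder dl" and g: "g \<in> C1_holder dl"
 shows "C1_holder_norm dl (%x. f x - g x) = C1_holder_norm dl (%x. g x - f x)"
 by (simp add: C1_holder_norm_def holder_seminorm_def C1_holder_deriv_diff[OF f g] C1_holder_deriv_diff[OF g f] abs_minus_commute)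
  (metis (no_types, lifting) abs_minus_commute minus_diff_minus minus_diff_eq)

lemma Hball_of_norms:
 assumes f: "f \<in> L2_space \<inter> C1_holder dl" and "C1_holder_norm dl f <= M" "L2_norm f <= M"
 shows "f \<in> Hball dl M"
proof -
 have f': "f \<in> C1_holder dl" using f by simp
 show ?thesis
  using f assms(3) C1_holder_norm_bounds[OF f' assms(2)] by (simp add: Hball_def C1_holder_def)
qed

lemma Hball_C1_holder:
 assumes f: "f \<in> Hball dl M"
 shows "f \<in> L2_space \<inter> C1_holder dl" "C1_holder_norm dl f <= 3 * M"
proof -
 show "f \<in> L2_space \<inter> C1_holder dl"
  using f unfolding Hball_def C1_holder_def bounded_iff by auto
 show "C1_holder_norm dl f <= 3 * M"
  using C1_holder_norm_le[OF Hball_bound[OF f] Hball_deriv_bound[OF f] Hball_holder[OF f]] by simp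
qed

section \<open>Boundedness of the square norm in time\<close>

text \<open>A solution is only assumed to be square-integrable at each time, with no uniformity. Any
 uniform bound on an interval improves itself to a comparison of all values there. The set
 of times without a locally uniform bound is closed; by Baire's theorem the norm would be
 bounded on a relatively open part of it, and by comparison also on the gaps.\<close>

lemma locally_bounded_imp_bounded:
 fixes n :: "real => real"
 assumes "!!t. t \<in> {c..e} ==> \<exists>d>0. \<exists>B. \<forall>r\<in>{c..e}. \<bar>r - t\<bar> < d --> n r <= B"
 shows "\<exists>B. \<forall>r\<in>{c..e}. n r <= B"
proof (rule ccontr)
 assume "\<not> ?thesis"
 then have "\<forall>k::nat. \<exists>r\<in>{c..e}. real k < n r" by (meson not_le)
 then obtain x where x: "!!k. x k \<in> {c..e}" "!!k. real k < n (x k)" by metis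
 have "compact {c..e}" by simp
 then obtain l f where l: "l \<in> {c..e}" "strict_mono f" "(x \<circ> f) \<longlonglongrightarrow> l"
  using x(1) unfolding compact_def by metis
 obtain d B where d: "d > 0" "!!r. r \<in> {c..e} ==> \<bar>r - l\<bar> < d ==> n r <= B" using assms[OF l(1)] by blast
 obtain k0 where k0: "!!k. k >= k0 ==> \<bar>x (f k) - l\<bar> < d"
  using LIMSEQ_D[OF l(3) d(1)] by auto
 obtain k1 where k1: "B < real k1" using reals_Archimedean2 by blast
 define k where "k = max k0 k1"
 have "real k1 <= real (f k)" using seq_suble[OF l(2), of k] by (simp add: k_def)
 then show False using d(2)[OF x(1) k0, of k] x(2)[of "f k"] k1 by (simp add: k_def)
qed

lemma bounded_by_Baire:
 fixes n :: "real => real"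
 assumes lsc: "!!N. closed {t \<in> {0..T}. n t <= N}" and h: "0 < h"
  and H: "!!s t B x y. 0 <= s ==> t <= T ==> t - s <= h ==> (!!r. r \<in> {s..t} ==> n r <= B) ==>
   x \<in> {s..t} ==> y \<in> {s..t} ==> n x <= 2 * n y"
 shows "\<exists>B. \<forall>t\<in>{0..T}. n t <= B"
proof -
 define good where "good t \<longleftrightarrow> (\<exists>d>0. \<exists>B. \<forall>r\<in>{0..T}. \<bar>r - t\<bar> < d --> n r <= B)" for t
 define K where "K = {t \<in> {0..T}. \<not> good t}"
 have good_bdd: "\<exists>B. \<forall>r\<in>{c..e}. n r <= B" if "0 <= c" "e <= T" "{c..e} \<inter> K = {}" for c e
 proof (rule locally_bounded_imp_bounded)
  fix t assume t: "t \<in> {c..e}"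
  then have "good t" using that by (auto simp: K_def)
  then obtain d B where "d > 0" "\<forall>r\<in>{0..T}. \<bar>r - t\<bar> < d --> n r <= B" by (auto simp: good_def)
  then show "\<exists>d>0. \<exists>B. \<forall>r\<in>{c..e}. \<bar>r - t\<bar> < d --> n r <= B"
   using that by (intro exI[of _ d] conjI exI[of _ B]) auto
 qed
 have "open {t. good t}"
  unfolding open_dist
 proof (intro ballI)
  fix t assume "t \<in> {t. good t}"
  then obtain d B where d: "d > 0" "\<forall>r\<in>{0..T}. \<bar>r - t\<bar> < d --> n r <= B" by (auto simp: good_def)
  show "\<exists>e>0. \<forall>y. dist y t < e --> y \<in> {t. good t}"
  proof (intro exI[of _ "d / 2"] conjI allI impI)
   fix y assume "dist y t < d / 2"
   then have "\<bar>r - t\<bar> < d" if "\<bar>r - y\<bar> < d / 2" for r using that unfolding dist_real_def by linarith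
   then have "\<forall>r\<in>{0..T}. \<bar>r - y\<bar> < d / 2 --> n r <= B" using d(2) by blast
   moreover have "0 < d / 2" using d(1) by simp
   ultimately show "y \<in> {t. good t}" unfolding good_def mem_Collect_eq by blast
  qed (use d in simp)
 qed
 moreover have "K = {0..T} \<inter> - {t. good t}" by (auto simp: K_def)
 ultimately have Kc: "closed K" by (auto intro!: closed_Int)
 have "K = {}"
 proof (rule ccontr)
  assume "K ~= {}"
  let ?G = "range (%N::nat. {t \<in> K. real N < n t})"
  have "\<Inter>?G = {}"
  proof -
   have "\<exists>N::nat. \<not> real N < n t" for t using real_arch_simple[of "n t"] by (auto simp: not_less)
   then show ?thesis by blast
  qed
  then have "\<not> K \<subseteq> closure (\<Inter>?G)" using \<open>K ~= {}\<close> by simp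
  moreover have "openin (top_of_set K) {t \<in> K. real N < n t}" for N :: nat
  proof -
   have "{t \<in> K. real N < n t} = K \<inter> - {t \<in> {0..T}. n t <= real N}" by (auto simp: K_def not_le)
   then show ?thesis using lsc[of "real N"] by (simp add: openin_open_Int open_Compl)
  qed
  ultimately obtain N :: nat where "\<not> K \<subseteq> closure {t \<in> K. real N < n t}"
   using Baire[OF Kc, of ?G] by blast
  then obtain k where k: "k \<in> K" "k \<notin> closure {t \<in> K. real N < n t}" by blast
  obtain d0 where d0: "d0 > 0" "!!t. t \<in> K ==> \<bar>t - k\<bar> < d0 ==> n t <= real N"
   using k(2) unfolding closure_approachable dist_real_def by (force simp: not_less)
  define d where "d = min d0 h"
  have d: "d > 0" "d <= h" "!!t. t \<in> K ==> \<bar>t - k\<bar> < d ==> n t <= real N" using d0 h by (auto simp: d_def)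
  have kT: "0 <= k" "k <= T" using k by (auto simp: K_def)
  have bound: "n r <= 2 * real N" if r: "r \<in> {0..T}" "\<bar>r - k\<bar> < d" for r
  proof (cases "r \<in> K")
   case True
   then show ?thesis using d(3)[OF True r(2)] by linarith
  next
   case False
   then have rk: "r ~= k" using k by auto
   show ?thesis
   proof (cases "k < r")
    case True
    define S where "S = K \<inter> {k..r}"
    have S: "compact S" "S ~= {}" using Kc k True by (auto simp: S_def closed_Int_compact)
    obtain a where a: "a \<in> S" "!!s. s \<in> S ==> s <= a" using compact_attains_sup[OF S] by blast
    have ar: "k <= a" "a < r" "a \<in> K" using a(1) False by (auto simp: S_def less_le)
    have y: "n y <= 2 * n r" if y: "a < y" "y <= r" for y
    proof -
     have disj: "{y..r} \<inter> K = {}" using a(2) y ar by (force simp: S_def)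
     have "0 <= y" "r <= T" using y ar kT r by auto
     from good_bdd[OF this disj] obtain B where B: "\<forall>q\<in>{y..r}. n q <= B" by blast
     show ?thesis by (rule H[of y r B]) (use B y ar kT r d in auto)
    qed
    have "n a <= real N" using d(3)[OF ar(3)] ar r by auto
    moreover have "n r <= 2 * n a"
     by (rule H[of a r "max (real N) (2 * n r)"]) (use y calculation ar kT r d in \<open>force simp: less_le\<close>)+
    ultimately show ?thesis by linarith
   next
    case F: False
    define S where "S = K \<inter> {r..k}"
    have S: "compact S" "S ~= {}" using Kc k F rk by (auto simp: S_def closed_Int_compact)
    obtain a where a: "a \<in> S" "!!s. s \<in> S ==> a <= s" using compact_attains_inf[OF S] by blast
    have ar: "a <= k" "r < a" "a \<in> K" using a(1) False by (auto simp: S_def less_le)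
    have y: "n y <= 2 * n r" if y: "y < a" "r <= y" for y
    proof -
     have disj: "{r..y} \<inter> K = {}" using a(2) y ar by (force simp: S_def)
     have "0 <= r" "y <= T" using y ar kT r by auto
     from good_bdd[OF this disj] obtain B where B: "\<forall>q\<in>{r..y}. n q <= B" by blast
     show ?thesis by (rule H[of r y B]) (use B y ar kT r d in auto)
    qed
    have "n a <= real N" using d(3)[OF ar(3)] ar r by auto
    moreover have "n r <= 2 * n a"
     by (rule H[of r a "max (real N) (2 * n r)"]) (use y calculation ar kT r d in \<open>force simp: less_le\<close>)+
    ultimately show ?thesis by linarith
   qed
  qed
  then have "good k" unfolding good_def using d(1) by blast
  then show False using k by (simp add: K_def)
 qed
 then show ?thesis using good_bdd[of 0 T] by simp
qed

section \<open>Solutions restricted to compact time intervals\<close>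

lemma time_interval_Icc: "0 <= t ==> ereal t < T ==> {0..t} \<subseteq> time_interval T"
 unfolding time_interval_def by (auto intro: le_less_trans[of "ereal _" "ereal t"])

context
 fixes dl :: real and u0 :: "real => real" and T :: ereal and u :: "real => real => real"
 assumes dl: "0 < dl" "dl < 1" and u: "burgers_hilbert_solution dl u0 T u"
begin

lemma solution_slice: "t \<in> time_interval T ==> (%x. u x t) \<in> L2_space \<inter> C1_holder dl"
 using u by (simp add: burgers_hilbert_solution_def)

lemma solution_derivative:
 assumes t: "t \<in> time_interval T"
 shows "(u x has_real_derivative uH u x t - u x t * ux u x t) (at t within time_interval T)"
proof -
 note s = solution_slice[OF t]
 have "(%y. u y t) \<in> Hball dl (max (C1_holder_norm dl (%x. u x t)) (L2_norm (%x. u x t)))"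
  by (rule Hball_of_norms[OF s]) auto
 then interpret pv_bounded "%y. u y t" "12 * max (C1_holder_norm dl (%x. u x t)) (L2_norm (%x. u x t))"
  by (rule Hball_pv_bounded)
 have "(u x has_real_derivative hilbert_transform (%y. u y t) x - u x t * ux u x t) (at t within time_interval T)"
  using u t unfolding burgers_hilbert_solution_def by blast
 then show ?thesis using hilbert_transform_eq_hil[OF L2 int] by simp
qed

lemma solution_norm_continuous: "continuous_on (time_interval T) (%t. C1_holder_norm dl (%x. u x t))"
 unfolding continuous_on_def
proof
 fix s assume s: "s \<in> time_interval T"
 have lim: "((%t. C1_holder_norm dl (%x. u x t - u x s)) \<longlongrightarrow> 0) (at s within time_interval T)"
  using u s by (simp add: burgers_hilbert_solution_def)
 have "\<bar>C1_holder_norm dl (%x. u x t) - C1_holder_norm dl (%x. u x s)\<bar> <= C1_holder_norm dl (%x. u x t - u x s)"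
  if t: "t \<in> time_interval T" for t
 proof -
  have c: "(%x. u x t) \<in> C1_holder dl" "(%x. u x s) \<in> C1_holder dl"
   using solution_slice[OF t] solution_slice[OF s] by auto
  show ?thesis
   using C1_holder_norm_triangle[OF c] C1_holder_norm_triangle[OF c(2,1)] C1_holder_norm_minus_commute[OF c] by linarith
 qed
 then have "((%t. C1_holder_norm dl (%x. u x t) - C1_holder_norm dl (%x. u x s)) \<longlongrightarrow> 0) (at s within time_interval T)"
  by (intro Lim_null_comparison[OF _ lim]) (auto simp: eventually_at_filter)
 then show "((%t. C1_holder_norm dl (%x. u x t)) \<longlongrightarrow> C1_holder_norm dl (%x. u x s)) (at s within time_interval T)"
  by (rule LIM_zero_cancel)
qed

lemma bsol_of_bounds:
 assumes "0 <= s" "ereal t < T" and "!!r. r \<in> {s..t} ==> C1_holder_norm dl (%x. u x r) <= M"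
  and "!!r. r \<in> {s..t} ==> L2_norm (%x. u x r) <= M"
 shows "bsol dl M s t u"
proof -
 have sub: "{s..t} \<subseteq> time_interval T"
  using assms(1,2) unfolding time_interval_def by (auto intro: le_less_trans[of "ereal _" "ereal t"])
 show ?thesis
  unfolding bsol_def
 proof (intro conjI ballI allI)
  fix r assume r: "r \<in> {s..t}"
  show "(%x. u x r) \<in> Hball dl M"
   by (rule Hball_of_norms[OF solution_slice]) (use r sub assms in auto)
  show "(u x has_real_derivative uH u x r - u x r * ux u x r) (at r within {s..t})" for x
   by (rule DERIV_subset[OF solution_derivative sub]) (use r sub in auto)
 qed
qed

lemma solution_C1_bounded:
 assumes "0 <= t1" "ereal t1 < T"
 obtains N where "0 <= N" "!!t. t \<in> {0..t1} ==> C1_holder_norm dl (%x. u x t) <= N"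
proof -
 have "compact ((%t. C1_holder_norm dl (%x. u x t)) ` {0..t1})"
  by (rule compact_continuous_image[OF continuous_on_subset[OF solution_norm_continuous time_interval_Icc[OF assms]]]) simp
 from compact_imp_bounded[OF this] obtain N where N: "\<forall>t\<in>{0..t1}. \<bar>C1_holder_norm dl (%x. u x t)\<bar> <= N"
  unfolding bounded_iff by auto
 show ?thesis
 proof (rule that[of "max 0 N"])
  fix t assume "t \<in> {0..t1}"
  from bspec[OF N this] show "C1_holder_norm dl (%x. u x t) <= max 0 N" by linarith
 qed simp
qed

lemma solution_L2_bounded:
 assumes t1: "0 <= t1" "ereal t1 < T"
 shows "\<exists>B. \<forall>t\<in>{0..t1}. L2_norm (%x. u x t) <= B"
proof -
 note sub = time_interval_Icc[OF t1]
 obtain N where N: "0 <= N" "!!t. t \<in> {0..t1} ==> C1_holder_norm dl (%x. u x t) <= N"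
  using solution_C1_bounded[OF t1] by blast
 define h where "h = 1 / (2 * (1 + N))"
 have h: "0 < h" "(1 + N) * h = 1 / 2" using N by (auto simp: h_def)
 show ?thesis
 proof (rule bounded_by_Baire[OF _ h(1)])
  fix S :: real
  show "closed {t \<in> {0..t1}. L2_norm (%x. u x t) <= S}"
   unfolding closed_sequential_limits
  proof (intro allI impI, elim conjE)
   fix x l assume x: "\<forall>n. x n \<in> {t \<in> {0..t1}. L2_norm (%x. u x t) <= S}" "x \<longlonglongrightarrow> l"
   have xi: "x n \<in> {0..t1}" for n using x(1) by simp
   from closed_sequentially[OF closed_atLeastAtMost xi x(2)] have l: "l \<in> {0..t1}" .
   have "(%n. u y (x n)) \<longlonglongrightarrow> u y l" for y
   proof -
    have "continuous_on {0..t1} (u y)"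
     by (rule continuous_on_subset[OF DERIV_continuous_on[OF solution_derivative] sub])
    then show ?thesis using x l unfolding continuous_on_sequentially by (auto simp: o_def)
   qed
   then have lim: "AE y in lborel. (%n. u y (x n)) \<longlonglongrightarrow> u y l" by simp
   have sl: "(%y. u y (x n)) \<in> L2_space" for n using solution_slice[OF subsetD[OF sub xi]] by simp
   have ms: "(%y. u y l) \<in> borel_measurable borel" using solution_slice[OF subsetD[OF sub l]] by (simp add: L2_space_iff)
   have nb: "L2_norm (%y. u y (x n)) <= S" for n using x(1) by simp
   have "L2_norm (%y. u y l) <= S" by (rule L2_Fatou(2)[OF sl nb lim ms])
   then show "l \<in> {t \<in> {0..t1}. L2_norm (%x. u x t) <= S}" using l by simp
  qed
 next
  fix s t B x y assume st: "0 <= s" "t <= t1" "t - s <= h" and B: "!!r. r \<in> {s..t} ==> L2_norm (%x. u x r) <= B"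
   and xy: "x \<in> {s..t}" "y \<in> {s..t}"
  have tT: "ereal t < T" using st(2) t1(2) by (meson ereal_less_eq(3) le_less_trans)
  have b: "bsol dl (max N B) s t u"
   by (rule bsol_of_bounds[OF st(1) tT]) (use N B st in \<open>auto simp: le_max_iff_disj\<close>)
  have K: "\<bar>ux u x r\<bar> <= N" if "r \<in> {s..t}" for x r
  proof -
   have "r \<in> {0..t1}" using that st by auto
   from C1_holder_norm_bounds(2)[OF _ N(2)[OF this]] solution_slice[OF subsetD[OF sub this]] show ?thesis by simp
  qed
  define S where "S = (SUP r\<in>{s..t}. L2_norm (%x. u x r))"
  have bdd: "bdd_above ((%r. L2_norm (%x. u x r)) ` {s..t})" by (rule bdd_aboveI2) (rule B)
  have S: "L2_norm (%x. u x r) <= S" if "r \<in> {s..t}" for r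
   unfolding S_def by (rule cSUP_upper[OF that bdd])
  have S0: "0 <= S" using S[OF xy(1)] L2_norm_nonneg order_trans by blast
  have L: "L2_norm (%x. u x q - u x p) <= S / 2" if pq: "p \<in> {s..t}" "q \<in> {s..t}" "p <= q" for p q
  proof -
   have "L2_norm (%x. u x q - u x p) <= (1 + N) * S * (q - p)"
    by (rule bsol_L2_Lipschitz[OF dl b K S]) (use pq N in auto)
   also have "... <= (1 + N) * S * h" using pq st N S0 by (intro mult_left_mono) auto
   also have "... = ((1 + N) * h) * S" by simp
   finally show ?thesis using h by simp
  qed
  have close: "L2_norm (%x. u x p) <= L2_norm (%x. u x y) + S / 2" if p: "p \<in> {s..t}" for p
  proof -
   have "L2_norm (%x. u x p - u x y) <= S / 2"
    using L[OF p xy(2)] L[OF xy(2) p] L2_norm_minus_commute[of "%x. u x p" "%x. u x y"] by (cases "p <= y") auto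
   moreover have "(%x. u x p) \<in> L2_space" "(%x. u x y) \<in> L2_space"
    using Hball_L2[OF bsol_Hball[OF b p]] Hball_L2[OF bsol_Hball[OF b xy(2)]] by auto
   ultimately show ?thesis using L2_norm_le_diff[of "%x. u x p" "%x. u x y"] by linarith
  qed
  have "S <= L2_norm (%x. u x y) + S / 2"
   unfolding S_def by (rule cSUP_least) (use xy close in \<open>auto simp: S_def\<close>)
  then show "L2_norm (%v. u v x) <= 2 * L2_norm (%x. u x y)" using S[OF xy(1)] by simp
 qed
qed

lemma solution_bsol:
 assumes t1: "0 <= t1" "ereal t1 < T"
 obtains M where "bsol dl M 0 t1 u"
proof -
 obtain N where N: "0 <= N" "!!t. t \<in> {0..t1} ==> C1_holder_norm dl (%x. u x t) <= N"
  using solution_C1_bounded[OF t1] by blast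
 obtain B where B: "!!t. t \<in> {0..t1} ==> L2_norm (%x. u x t) <= B" using solution_L2_bounded[OF t1] by blast
 have "bsol dl (max N B) 0 t1 u"
  by (rule bsol_of_bounds) (use t1 N B in \<open>auto simp: le_max_iff_disj\<close>)
 then show ?thesis by (rule that)
qed

lemma solution_initial: "(%x. u x 0) = u0"
 using u by (auto simp: burgers_hilbert_solution_def)

lemma solution_L2_norm:
 assumes t: "0 <= t" "ereal t < T"
 shows "L2_norm (%x. u x t) = L2_norm u0"
proof -
 obtain M where "bsol dl M 0 t u" by (rule solution_bsol[OF t])
 from bsol_L2_conserved[OF dl this, of 0 t] t show ?thesis by (simp add: solution_initial)
qed

end

section \<open>Finite lifespan\<close>

lemma nondecreasing_within:
 fixes f f' :: "real => real"
 assumes f: "!!t. t \<in> {a..b} ==> (f has_real_derivative f' t) (at t within {a..b})"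
  and nn: "!!r. r \<in> {s..t} ==> 0 <= f' r" and st: "a <= s" "s <= t" "t <= b"
 shows "f s <= f t"
proof -
 have m: "\<exists>x\<in>{s..t}. f t - f s = f' x * (t - s)"
 proof (rule mvt_very_simple[OF st(2)])
  fix x assume "s <= x" "x <= t"
  then show "(f has_derivative (%h. f' x * h)) (at x within {s..t})"
   using DERIV_subset[OF f[of x], of "{s..t}"] st by (auto simp: has_field_derivative_def)
 qed
 from m obtain x where x: "x \<in> {s..t}" "f t - f s = f' x * (t - s)" by blast
 moreover have "0 <= f' x * (t - s)" using nn[OF x(1)] st(2) by (intro mult_nonneg_nonneg) auto
 ultimately show ?thesis by linarith
qed

text \<open>A solution of \<open>y'' \<ge> k y\<^sup>2\<close> starting upwards from a positive value: multiplying by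
 \<open>y'\<close> gives \<open>y' \<ge> c y\<^sup>3\<^sup>/\<^sup>2\<close>, so that \<open>1 / \<surd>y\<close> decreases at least linearly.\<close>

lemma convex_blowup_time:
 fixes y y' y'' :: "real => real"
 assumes y: "!!t. t \<in> {0..T} ==> (y has_real_derivative y' t) (at t within {0..T})"
  and y': "!!t. t \<in> {0..T} ==> (y' has_real_derivative y'' t) (at t within {0..T})"
  and y0: "0 < y 0" and p: "0 < y' 0" and k: "0 < k"
  and ineq: "!!t. t \<in> {0..T} ==> y 0 <= y t ==> k * (y t)\<^sup>2 <= y'' t"
  and T0: "0 <= T"
 shows "T <= y 0 / y' 0 + 2 / sqrt (k / 3) / sqrt (2 * y 0)"
proof -
 have y'c: "continuous_on {0..T} y'" by (rule DERIV_continuous_on[OF y'])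
 have pos: "0 < y' t" if t: "t \<in> {0..T}" for t
 proof (rule ccontr)
  assume neg: "\<not> 0 < y' t"
  define Z where "Z = {0..T} \<inter> y' -` {..0}"
  have "closed Z" unfolding Z_def by (rule continuous_closed_preimage[OF y'c]) auto
  moreover have "bounded Z" by (rule bounded_subset[of "{0..T}"]) (auto simp: Z_def)
  ultimately have Z: "compact Z" "Z ~= {}" using t neg by (auto simp: Z_def compact_eq_bounded_closed)
  obtain z where z: "z \<in> Z" "!!s. s \<in> Z ==> z <= s" using compact_attains_inf[OF Z] by blast
  have z': "z \<in> {0..T}" "y' z <= 0" using z(1) by (auto simp: Z_def)
  have before: "0 <= y' s" if "s \<in> {0..z}" "s ~= z" for s using z(2)[of s] that z' by (force simp: Z_def)

  have mono: "y 0 <= y s" if s: "s \<in> {0..z}" for s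
  proof (cases "s = z")
   case False
   show ?thesis by (rule nondecreasing_within[OF y]) (use before s False z' in auto)
  next
   case True
   show ?thesis
   proof (cases "z = 0")
    case False
    then have z0: "0 < z" using z' by auto
    have "continuous_on {0..z} y" by (rule continuous_on_subset[OF DERIV_continuous_on[OF y]]) (use z' in auto)
    then have "(y \<longlongrightarrow> y z) (at z within {0..z})" using z0 by (auto simp: continuous_on_def)
    then have lim: "(y \<longlongrightarrow> y z) (at_left z)" using z0 by (simp add: at_within_Icc_at_left)
    have "eventually (%s. y 0 <= y s) (at_left z)"
     unfolding eventually_at_left[OF z0]
    proof (intro exI[of _ 0] conjI z0 allI impI)
     fix s assume "0 < s" "s < z"
     then show "y 0 <= y s"
      by (intro nondecreasing_within[OF y]) (use before z' in auto)
    qed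
    then show ?thesis unfolding True by (rule tendsto_lowerbound[OF lim]) simp
   qed (use True in simp)
  qed
  have "y' 0 <= y' z"
  proof (rule nondecreasing_within[OF y'])
   fix s assume s: "s \<in> {0..z}"
   have "0 <= k * (y s)\<^sup>2" using k by simp
   also have "... <= y'' s" using ineq[OF _ mono[OF s]] s z' by auto
   finally show "0 <= y'' s" .
  qed (use z' in auto)
  then show False using p z' by linarith
 qed
 have mono: "y s <= y t" if "0 <= s" "s <= t" "t <= T" for s t
  by (rule nondecreasing_within[OF y]) (use that pos in \<open>auto simp: less_imp_le\<close>)
 have ge: "y 0 <= y t" if "t \<in> {0..T}" for t using mono[of 0 t] that by auto
 have y'mono: "y' 0 <= y' t" if t: "t \<in> {0..T}" for t
 proof (rule nondecreasing_within[OF y'])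
  fix s assume s: "s \<in> {0..t}"
  have "0 <= k * (y s)\<^sup>2" using k by simp
  also have "... <= y'' s" using ineq[OF _ ge] s t by auto
  finally show "0 <= y'' s" .
 qed (use t in auto)
 have lin: "y 0 + y' 0 * t <= y t" if t: "t \<in> {0..T}" for t
 proof -
  have "y 0 - y' 0 * 0 <= y t - y' 0 * t"
  proof (rule nondecreasing_within[where f="%t. y t - y' 0 * t" and f'="%t. y' t - y' 0 * 1"])
   show "((%t. y t - y' 0 * t) has_real_derivative y' t - y' 0 * 1) (at t within {0..T})" if "t \<in> {0..T}" for t
    by (intro DERIV_diff y that DERIV_cmult DERIV_ident)
  qed (use t y'mono in auto)
  then show ?thesis by simp
 qed
 have energy: "(y' 0)\<^sup>2 - 2 * k / 3 * (y 0) ^ 3 <= (y' t)\<^sup>2 - 2 * k / 3 * (y t) ^ 3" if t: "t \<in> {0..T}" for t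
 proof (rule nondecreasing_within[where f'="%t. 2 * y' t * (y'' t - k * (y t)\<^sup>2)" and f="%t. (y' t)\<^sup>2 - 2 * k / 3 * (y t) ^ 3"])
  fix s assume s: "s \<in> {0..T}"
  show "((%t. (y' t)\<^sup>2 - 2 * k / 3 * (y t) ^ 3) has_real_derivative 2 * y' s * (y'' s - k * (y s)\<^sup>2)) (at s within {0..T})"
   using DERIV_diff[OF DERIV_power[OF y'[OF s], of 2] DERIV_cmult[OF DERIV_power[OF y[OF s], of 3], of "2 * k / 3"]]
   by (simp add: algebra_simps power2_eq_square)
 next
  fix s assume "s \<in> {0..t}"
  then have s: "s \<in> {0..T}" using t by auto
  show "0 <= 2 * y' s * (y'' s - k * (y s)\<^sup>2)" using pos[OF s] ineq[OF s ge[OF s]] by simp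
 qed (use t in auto)
 define t2 where "t2 = y 0 / y' 0"
 have t20: "0 < t2" using y0 p by (simp add: t2_def)
 define c where "c = sqrt (k / 3)"
 have c: "0 < c" "c\<^sup>2 = k / 3" using k by (auto simp: c_def)
 show ?thesis
 proof (cases "T <= t2")
  case True
  moreover have "0 <= 2 / sqrt (k / 3) / sqrt (2 * y 0)" using k y0 by simp
  ultimately show ?thesis unfolding t2_def by linarith
 next
  case False
  have big: "2 * y 0 <= y t" if t: "t \<in> {t2..T}" for t
  proof -
   have "y' 0 * t2 <= y' 0 * t" using t p by simp
   then show ?thesis using lin[of t] t t20 p by (auto simp: t2_def)
  qed
  have grow: "c * (sqrt (y t) * y t) <= y' t" if t: "t \<in> {t2..T}" for t
  proof -
   have tT: "t \<in> {0..T}" using t t20 by auto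
   have yt: "0 < y t" using big[OF t] y0 by linarith
   have "(2 * y 0) ^ 3 <= y t ^ 3" using big[OF t] y0 by (intro power_mono) auto
   then have "8 * y 0 ^ 3 <= y t ^ 3" by (simp add: power_mult_distrib)
   moreover have "0 < y 0 ^ 3" using y0 by simp
   ultimately have "y 0 ^ 3 <= y t ^ 3 / 2" by linarith
   from mult_left_mono[OF this, of "2 * k / 3"] k
   have "2 * k / 3 * y 0 ^ 3 <= k / 3 * y t ^ 3" by simp
   moreover have "2 * k / 3 * y t ^ 3 = k / 3 * y t ^ 3 + k / 3 * y t ^ 3" by simp
   moreover have "0 <= (y' 0)\<^sup>2" by simp
   ultimately have "k / 3 * y t ^ 3 <= (y' t)\<^sup>2" using energy[OF tT] by linarith
   moreover have "(c * (sqrt (y t) * y t))\<^sup>2 = k / 3 * y t ^ 3"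
    using yt by (simp add: power_mult_distrib c) (simp add: power2_eq_square power3_eq_cube)
   ultimately have "(c * (sqrt (y t) * y t))\<^sup>2 <= (y' t)\<^sup>2" by simp
   then show ?thesis by (rule power2_le_imp_le) (use pos[OF tT] in simp)
  qed
  have "- (1 / sqrt (y t2)) - c / 2 * t2 <= - (1 / sqrt (y T)) - c / 2 * T"
  proof (rule nondecreasing_within[where a=t2 and b=T and f="%t. - (1 / sqrt (y t)) - c / 2 * t"
     and f'="%t. (y' t / (sqrt (y t) * y t) - c) / 2"])
   fix t assume t: "t \<in> {t2..T}"
   have yt: "0 < y t" using big[OF t] y0 by linarith
   have d: "(y has_real_derivative y' t) (at t within {t2..T})"
    by (rule DERIV_subset[OF y]) (use t t20 in auto)
   have "((%t. sqrt (y t)) has_real_derivative inverse (sqrt (y t)) / 2 * y' t) (at t within {t2..T})"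
    by (rule DERIV_chain2[OF DERIV_real_sqrt[OF yt] d])
   from DERIV_inverse'[OF this] yt
   have "((%t. inverse (sqrt (y t))) has_real_derivative - (inverse (sqrt (y t)) * (inverse (sqrt (y t)) / 2 * y' t) * inverse (sqrt (y t)))) (at t within {t2..T})"
    by simp
   note dd = DERIV_diff[OF DERIV_minus[OF this] DERIV_cmult[OF DERIV_ident, of "c / 2"]]
   define s where "s = sqrt (y t)"
   have s: "s ~= 0" "y t = s * s" using yt by (auto simp: s_def)
   have "- (- (inverse s * (inverse s / 2 * y' t) * inverse s)) - c / 2 * 1 = (y' t / (s * y t) - c) / 2"
    by (simp add: s(2) inverse_eq_divide diff_divide_distrib)
   with dd show "((%t. - (1 / sqrt (y t)) - c / 2 * t) has_real_derivative (y' t / (sqrt (y t) * y t) - c) / 2) (at t within {t2..T})"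
    unfolding s_def[symmetric] by (simp only: inverse_eq_divide)
   have "c <= y' t / (sqrt (y t) * y t)" using grow[OF t] yt by (simp add: pos_le_divide_eq)
   then show "0 <= (y' t / (sqrt (y t) * y t) - c) / 2" by simp
  qed (use False in auto)
  moreover have "0 < y T" using big[of T] False y0 by simp
  then have "0 < 1 / sqrt (y T)" by simp
  moreover have "1 / sqrt (y t2) <= 1 / sqrt (2 * y 0)"
   using big[of t2] False y0 by (intro divide_left_mono mult_pos_pos) auto
  ultimately have "c / 2 * (T - t2) <= 1 / sqrt (2 * y 0)" unfolding right_diff_distrib by linarith
  moreover have "(T - t2) * c = 2 * (c / 2 * (T - t2))" by simp
  ultimately have "(T - t2) * c <= 2 * (1 / sqrt (2 * y 0))" by linarith
  then have "T - t2 <= 2 * (1 / sqrt (2 * y 0)) / c" using c(1) by (simp only: pos_le_divide_eq)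
  then show ?thesis by (simp add: t2_def c_def mult.commute)
 qed
qed

text \<open>Minimising \<open>(f a - s)\<^sup>2 / z\<^sup>2 + s\<^sup>2 / e\<^sup>2\<close> over the value \<open>s\<close> of \<open>f\<close> at distance \<open>z\<close>
 from \<open>a\<close> gives \<open>(f a)\<^sup>2 / (z\<^sup>2 + e\<^sup>2)\<close>; the parameter \<open>e\<close> is then chosen optimally.\<close>

lemma Gfun_lower_bound:
 assumes f: "f \<in> Hball dl M" and fa: "0 < f a" and L: "0 < L2_norm f"
 shows "pi * (f a) ^ 4 / (8 * (L2_norm f)\<^sup>2) <= Gfun f a"
proof -
 define A where "A = f a"
 define e where "e = 2 * (L2_norm f)\<^sup>2 / (pi * A\<^sup>2)"
 have e: "0 < e" using fa L by (simp add: e_def A_def)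
 have le: "A\<^sup>2 * (pi / e) * Pker e (x - a) <= (dq f a x)\<^sup>2 + (f x)\<^sup>2 / e\<^sup>2" if x: "x ~= a" for x
 proof -
  let ?z = "x - a" and ?p = "dq f a x" and ?q = "f x / e"
  have z: "?z ~= 0" using x by simp
  have A: "A = ?q * e - ?p * ?z" using z e by (simp add: dq_def A_def)
  have cs: "(q * e - p * z)\<^sup>2 <= (p\<^sup>2 + q\<^sup>2) * (z\<^sup>2 + e\<^sup>2)" for p q z :: real
  proof -
   have "0 <= (p * e + q * z)\<^sup>2" by simp
   then show ?thesis by (simp add: power2_eq_square algebra_simps)
  qed
  have "A\<^sup>2 <= (?p\<^sup>2 + ?q\<^sup>2) * (?z\<^sup>2 + e\<^sup>2)" by (subst A) (rule cs)
  then have "A\<^sup>2 / (?z\<^sup>2 + e\<^sup>2) <= ?p\<^sup>2 + ?q\<^sup>2" using sum_squares_pos[OF e, of ?z] by (simp add: pos_divide_le_eq)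
  moreover have "A\<^sup>2 * (pi / e) * Pker e ?z = A\<^sup>2 / (?z\<^sup>2 + e\<^sup>2)" using e by (simp add: Pker_def)
  ultimately show ?thesis by (simp add: power_divide)
 qed
 have P: "integrable lborel (%x. Pker e (x - a))" "(LINT x|lborel. Pker e (x - a)) = 1"
  using lborel_integrable_real_affine[OF Pker_integral(1)[OF e], of 1 "- a"]
   lborel_integral_real_affine[of 1 "Pker e" "- a"] Pker_integral[OF e] by simp_all
 note i = L2_space_integrable[OF dq_L2[OF f]] L2_space_integrable[OF Hball_L2[OF f]]
 have "(LINT x|lborel. A\<^sup>2 * (pi / e) * Pker e (x - a)) <= (LINT x|lborel. (dq f a x)\<^sup>2 + (f x)\<^sup>2 / e\<^sup>2)"
 proof (rule integral_mono_AE)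
  have "AE x in lborel. x ~= a" by (rule AE_lborel_singleton)
  then show "AE x in lborel. A\<^sup>2 * (pi / e) * Pker e (x - a) <= (dq f a x)\<^sup>2 + (f x)\<^sup>2 / e\<^sup>2"
   by eventually_elim (rule le)
 qed (use P i in auto)
 then have "A\<^sup>2 * (pi / e) <= (L2_norm (dq f a))\<^sup>2 + (L2_norm f)\<^sup>2 / e\<^sup>2"
  using P i by (simp add: L2_norm_squared)
 moreover have "A\<^sup>2 * (pi / e) - (L2_norm f)\<^sup>2 / e\<^sup>2 = pi\<^sup>2 * A ^ 4 / (4 * (L2_norm f)\<^sup>2)"
 proof -
  define l where "l = (L2_norm f)\<^sup>2"
  have l: "0 < l" using L by (simp add: l_def)
  have A0: "0 < A" using fa by (simp add: A_def)
  have e': "e = 2 * l / (pi * A\<^sup>2)" by (simp add: e_def l_def)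
  have "A\<^sup>2 * (pi / e) = pi\<^sup>2 * A ^ 4 / (2 * l)" unfolding e' using l A0 by (simp add: power2_eq_square power4_eq_xxxx)
  moreover have "l / e\<^sup>2 = pi\<^sup>2 * A ^ 4 / (4 * l)" unfolding e' using l A0 by (simp add: power2_eq_square power4_eq_xxxx)
  ultimately show ?thesis unfolding l_def[symmetric] by (simp add: field_simps)
 qed
 ultimately have "pi\<^sup>2 * A ^ 4 / (4 * (L2_norm f)\<^sup>2) <= (L2_norm (dq f a))\<^sup>2" by linarith
 then have "pi\<^sup>2 * A ^ 4 / (4 * (L2_norm f)\<^sup>2) / (2 * pi) <= Gfun f a"
  unfolding Gfun_def by (intro divide_right_mono) auto
 also have "pi\<^sup>2 * A ^ 4 / (4 * (L2_norm f)\<^sup>2) / (2 * pi) = pi * A ^ 4 / (8 * (L2_norm f)\<^sup>2)"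
  by (simp add: power2_eq_square)
 finally show ?thesis by (simp add: A_def)
qed

text \<open>A Lipschitz function that is large at a point is large on an interval around it.\<close>

lemma Hball_sup_le_L2:
 assumes f: "f \<in> Hball dl M"
 shows "\<bar>f x\<bar> ^ 3 <= 4 * M * (L2_norm f)\<^sup>2"
proof (cases "f x = 0")
 case True
 then show ?thesis using Hball_nonneg[OF f] by simp
next
 case False
 define kp where "kp = \<bar>f x\<bar>"
 have kp: "0 < kp" using False by (simp add: kp_def)
 have M: "0 < M" using Hball_bound[OF f, of x] kp by (simp add: kp_def)
 define r where "r = kp / (2 * M)"
 have r: "0 < r" using kp M by (simp add: r_def)
 have le: "indicator {x - r..x + r} y * (kp\<^sup>2 / 4) <= (f y)\<^sup>2" for y
 proof (cases "y \<in> {x - r..x + r}")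
  case True
  have "\<bar>f x - f y\<bar> <= M * \<bar>x - y\<bar>" by (rule Hball_Lipschitz[OF f])
  also have "... <= M * r" using True M by (intro mult_left_mono) auto
  also have "... = kp / 2" using M by (simp add: r_def)
  finally have "kp / 2 <= \<bar>f y\<bar>" unfolding kp_def by linarith
  then have "(kp / 2)\<^sup>2 <= \<bar>f y\<bar>\<^sup>2" using kp by (intro power_mono) auto
  then show ?thesis using True by (simp add: power_divide)
 qed simp
 have ind: "integrable lborel (indicator {x - r..x + r} :: real => real)"
  by (rule integrable_real_indicator) (auto simp: emeasure_lborel_Icc_eq)
 have "(LINT y|lborel. indicator {x - r..x + r} y * (kp\<^sup>2 / 4)) <= (LINT y|lborel. (f y)\<^sup>2)"
  by (rule integral_mono[OF _ L2_space_integrable[OF Hball_L2[OF f]] le]) (use ind in simp)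
 then have "2 * r * (kp\<^sup>2 / 4) <= (L2_norm f)\<^sup>2" using r by (simp add: L2_norm_squared)
 moreover have "2 * r * (kp\<^sup>2 / 4) = kp ^ 3 / (4 * M)" using M by (simp add: r_def power2_eq_square power3_eq_cube)
 ultimately show ?thesis using M by (simp add: kp_def pos_divide_le_eq mult.commute)
qed

theorem lifespan_finite:
 assumes dl: "0 < dl" "dl < 1" and u0: "u0 \<in> L2_space \<inter> C1_holder dl"
  and pos: "hilbert_transform u0 be > 0" and big: "u0 be >= (32 * pi * (L2_norm u0)\<^sup>2) powr (1 / 3)"
  and u: "burgers_hilbert_solution dl u0 T u"
 shows "T ~= \<infinity>"
proof
 assume T: "T = \<infinity>"
 have B0: "u0 \<in> Hball dl (max (C1_holder_norm dl u0) (L2_norm u0))" by (rule Hball_of_norms[OF u0]) auto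
 interpret pv_bounded u0 "12 * max (C1_holder_norm dl u0) (L2_norm u0)" by (rule Hball_pv_bounded[OF B0])
 have pos': "0 < hil u0 be" using pos hilbert_transform_eq_hil[OF L2 int] by simp
 define L where "L = (L2_norm u0)\<^sup>2"
 have L: "0 < L"
 proof (rule ccontr)
  assume "\<not> 0 < L"
  then have "L2_norm u0 = 0" by (simp add: L_def)
  then have "L2_norm (hil u0) = 0" using hil_in_L2(2) L2_norm_nonneg[of "hil u0"] by linarith
  then show False using Hball_sup_le_L2[OF hil_Hball(1)[OF dl B0], of be] pos' by simp
 qed
 have "0 < (32 * pi * L) powr (1 / 3)" using L by simp
 then have V0: "0 < u0 be" using big unfolding L_def by linarith
 have V03: "32 * pi * L <= u0 be ^ 3"
 proof -
  have "((32 * pi * L) powr (1 / 3)) ^ 3 <= u0 be ^ 3" using big by (intro power_mono) (auto simp: L_def)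
  moreover have "((32 * pi * L) powr (1 / 3)) ^ 3 = 32 * pi * L"
   using L by (simp add: powr_realpow[symmetric] powr_powr)
  ultimately show ?thesis by simp
 qed
 define k where "k = pi * (u0 be)\<^sup>2 / (16 * L)"
 have k: "0 < k" using V0 L by (simp add: k_def)
 define T1 where "T1 = u0 be / hil u0 be + 2 / sqrt (k / 3) / sqrt (2 * u0 be) + 1"
 have "0 <= u0 be / hil u0 be" "0 <= 2 / sqrt (k / 3) / sqrt (2 * u0 be)" using V0 pos' k by auto
 then have T1: "0 <= T1" "ereal t < T" for t using T by (auto simp: T1_def)
 obtain M where b: "bsol dl M 0 T1 u" by (rule solution_bsol[OF dl u T1(1,2)])
 obtain X' where "is_flow 0 T1 u X'" by (rule flow_exists[OF dl T1(1) bsol_hfam[OF b]])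
 then have X': "X' be 0 = be" "\<forall>t\<in>{0..T1}. (X' be has_real_derivative u (X' be t) t) (at t within {0..T1})"
  unfolding is_flow_def by (rule spec[of _ be, THEN conjunct1], rule spec[of _ be, THEN conjunct2])
 define X where "X = X' be"
 have X: "X 0 = be" "!!t. t \<in> {0..T1} ==> (X has_real_derivative u (X t) t) (at t within {0..T1})"
  by (rule X'(1)[folded X_def], rule X'(2)[folded X_def, rule_format])
 note init = solution_initial[OF dl u]
 have y0: "u (X 0) 0 = u0 be" "uH u (X 0) 0 = hil u0 be"
  using fun_cong[OF init, of be] arg_cong[OF init, of "%f. hil f be"] by (simp_all only: X(1))
 have "T1 <= u (X 0) 0 / uH u (X 0) 0 + 2 / sqrt (k / 3) / sqrt (2 * u (X 0) 0)"
 proof (rule convex_blowup_time[where y="%t. u (X t) t" and y'="%t. uH u (X t) t"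
    and y''="%t. - u (X t) t + Gfun (%y. u y t) (X t)"])
  fix t assume t: "t \<in> {0..T1}"
  show "((%t. u (X t) t) has_real_derivative uH u (X t) t) (at t within {0..T1})"
   by (rule velocity_derivative[OF dl b X(2)[OF t] t])
  show "((%t. uH u (X t) t) has_real_derivative - u (X t) t + Gfun (%y. u y t) (X t)) (at t within {0..T1})"
   by (rule characteristic_acceleration[OF dl b X(2) t])
  assume "u (X 0) 0 <= u (X t) t"
  then have V: "u0 be <= u (X t) t" by (simp add: y0)
  define v where "v = u (X t) t"
  have v: "u0 be <= v" "0 < v" using V V0 by (auto simp: v_def)
  have Lt: "L2_norm (%x. u x t) = L2_norm u0" by (rule solution_L2_norm[OF dl u _ T1(2)]) (use t in auto)
  have "pi * v ^ 4 / (8 * L) <= Gfun (%y. u y t) (X t)"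
   using Gfun_lower_bound[OF bsol_Hball[OF b t], of "X t"] v L L2_norm_nonneg[of u0]
   by (simp add: Lt L_def v_def order_less_le)
  moreover have "2 * v <= pi * v ^ 4 / (8 * L)"
  proof -
   have "u0 be ^ 3 <= v ^ 3" using v V0 by (intro power_mono) auto
   then have "32 * pi * L <= v ^ 3" using V03 by linarith
   then have "pi * (32 * pi * L) <= pi * v ^ 3" by (intro mult_left_mono) auto
   moreover have "16 * L <= pi * (32 * pi * L)"
   proof -
    have "1 * 1 <= pi * pi" using pi_gt3 by (intro mult_mono) auto
    from mult_right_mono[OF this, of "32 * L"] L show ?thesis by (simp add: mult_ac)
   qed
   ultimately have "16 * L <= pi * v ^ 3" by (rule order_trans[rotated])
   then have "16 * L * v <= pi * v ^ 3 * v" using v by (intro mult_right_mono) auto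
   then show ?thesis using L by (simp add: pos_le_divide_eq power4_eq_xxxx power3_eq_cube mult_ac)
  qed
  moreover have "k * v\<^sup>2 <= pi * v ^ 4 / (16 * L)"
  proof -
   have "(u0 be)\<^sup>2 * v\<^sup>2 <= v\<^sup>2 * v\<^sup>2" using v V0 by (intro mult_right_mono power_mono) auto
   then have "pi * ((u0 be)\<^sup>2 * v\<^sup>2) / (16 * L) <= pi * (v\<^sup>2 * v\<^sup>2) / (16 * L)"
    using L by (intro divide_right_mono mult_left_mono) auto
   then show ?thesis by (simp add: k_def power4_eq_xxxx power2_eq_square mult_ac)
  qed
  moreover have "pi * v ^ 4 / (8 * L) = 2 * (pi * v ^ 4 / (16 * L))" by simp
  ultimately show "k * (u (X t) t)\<^sup>2 <= - u (X t) t + Gfun (%y. u y t) (X t)"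
   unfolding v_def[symmetric] by linarith
 qed (use V0 pos' k T1 y0 in auto)
 then show False by (simp add: T1_def y0)
qed

section \<open>The flow of a bounded family over a short time\<close>

lemma short_growth:
 fixes y y' :: "real => real"
 assumes y: "!!t. t \<in> {a..b} ==> (y has_real_derivative y' t) (at t within {a..b})"
  and bd: "!!t. t \<in> {a..b} ==> \<bar>y' t\<bar> <= B + M * \<bar>y t\<bar>"
  and c: "0 <= B" "0 <= M" "M * (b - a) <= 1 / 4" and s: "s \<in> {a..b}" and t: "t \<in> {a..b}"
 shows "\<bar>y t\<bar> <= 4 / 3 * (\<bar>y a\<bar> + B * (b - a))"
  and "\<bar>y t - y s\<bar> <= (B + M * (4 / 3 * (\<bar>y a\<bar> + B * (b - a)))) * \<bar>t - s\<bar>"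
proof -
 have a: "a \<in> {a..b}" using t by auto
 have "\<exists>m\<in>{a..b}. \<forall>r\<in>{a..b}. \<bar>y r\<bar> <= \<bar>y m\<bar>"
  using a by (intro continuous_attains_sup continuous_intros DERIV_continuous_on[OF y]) auto
 then obtain m where m: "m \<in> {a..b}" "!!r. r \<in> {a..b} ==> \<bar>y r\<bar> <= \<bar>y m\<bar>" by blast
 have L: "\<bar>y q - y p\<bar> <= (B + M * \<bar>y m\<bar>) * \<bar>q - p\<bar>" if "p \<in> {a..b}" "q \<in> {a..b}" for p q
 proof -
  have "norm (y' r) <= B + M * \<bar>y m\<bar>" if "r \<in> {a..b}" for r
   using bd[OF that] mult_left_mono[OF m(2)[OF that] c(2)] by simp
  from field_differentiable_bound[of "{a..b}" y, OF _ y this that(2,1)] show ?thesis by simp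
 qed
 have "\<bar>y m - y a\<bar> <= (B + M * \<bar>y m\<bar>) * (b - a)"
  using L[OF a m(1)] m(1) c by (elim order_trans) (intro mult_left_mono, auto)
 also have "... = B * (b - a) + M * (b - a) * \<bar>y m\<bar>" by (simp add: algebra_simps)
 also have "M * (b - a) * \<bar>y m\<bar> <= 1 / 4 * \<bar>y m\<bar>" using c(3) by (intro mult_right_mono) auto
 finally have S: "\<bar>y m\<bar> <= 4 / 3 * (\<bar>y a\<bar> + B * (b - a))" by (simp add: algebra_simps)
 then show "\<bar>y t\<bar> <= 4 / 3 * (\<bar>y a\<bar> + B * (b - a))" using m(2)[OF t] by linarith
 have "(B + M * \<bar>y m\<bar>) * \<bar>t - s\<bar> <= (B + M * (4 / 3 * (\<bar>y a\<bar> + B * (b - a)))) * \<bar>t - s\<bar>"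
  using S c by (intro mult_right_mono add_left_mono mult_left_mono) auto
 then show "\<bar>y t - y s\<bar> <= (B + M * (4 / 3 * (\<bar>y a\<bar> + B * (b - a)))) * \<bar>t - s\<bar>"
  using L[OF s t] by linarith
qed

lemma linear_ode:
 fixes k g :: "real => real"
 assumes c: "continuous_on {a..b} k" "continuous_on {a..b} g"
 shows "\<exists>W. W a = w0 & (\<forall>t\<in>{a..b}. (W has_real_derivative g t - k t * W t) (at t within {a..b}))"
proof -
 define p where "p t = integral {a..t} k" for t
 define W where "W t = exp (- p t) * (w0 + integral {a..t} (%s. g s * exp (p s)))" for t
 have p: "(p has_real_derivative k t) (at t within {a..b})" if "t \<in> {a..b}" for t
  unfolding p_def[abs_def] by (rule integral_has_real_derivative[OF c(1) that])
 have pc: "continuous_on {a..b} (%s. g s * exp (p s))" by (intro continuous_intros c DERIV_continuous_on[OF p])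
 have "(W has_real_derivative g t - k t * W t) (at t within {a..b})" if t: "t \<in> {a..b}" for t
 proof -
  note d1 = DERIV_chain2[OF DERIV_exp DERIV_minus[OF p[OF t]]]
  note d2 = DERIV_add[OF DERIV_const[of w0] integral_has_real_derivative[OF pc t]]
  have "exp (- p t) * (g t * exp (p t)) = g t" by (simp add: exp_minus)
  with DERIV_mult[OF d1 d2] show ?thesis
   unfolding W_def[abs_def] by (elim DERIV_cong) (simp add: algebra_simps)
 qed
 moreover have "W a = w0" by (simp add: W_def p_def)
 ultimately show ?thesis by blast
qed

lemma first_order_imp_derivative:
 fixes f :: "real => real"
 assumes dl: "0 < dl" and f: "!!z. \<bar>f (x + z) - f x - z * c\<bar> <= K * (\<bar>z\<bar> powr dl * \<bar>z\<bar>)"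
 shows "(f has_real_derivative c) (at x)"
proof -
 have "((%h. (f (x + h) - f x) / h - c) \<longlongrightarrow> 0) (at 0)"
 proof (rule Lim_null_comparison)
  have "((%h. K * \<bar>h\<bar> powr dl) \<longlongrightarrow> K * \<bar>0\<bar> powr dl) (at 0)"
   using dl by (intro tendsto_mult tendsto_const tendsto_powr' tendsto_rabs tendsto_ident_at) auto
  then show "((%h. K * \<bar>h\<bar> powr dl) \<longlongrightarrow> 0) (at (0 :: real))" by simp
  have "norm ((f (x + h) - f x) / h - c) <= K * \<bar>h\<bar> powr dl" if "h ~= 0" for h
  proof -
   have "(f (x + h) - f x) / h - c = (f (x + h) - f x - h * c) / h" using that by (simp add: field_simps)
   then show ?thesis using f[of h] that by (simp add: abs_divide divide_le_eq mult.assoc)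
  qed
  then show "\<forall>\<^sub>F h in at 0. norm ((f (x + h) - f x) / h - c) <= K * \<bar>h\<bar> powr dl"
   by (simp add: eventually_at_filter)
 qed
 then show ?thesis unfolding DERIV_def by (rule LIM_zero_cancel)
qed

lemma powr_scale_le: "1 <= c ==> 0 <= r ==> dl < 1 ==> (c * r) powr dl <= c * r powr dl" for c r dl :: real
 using powr_mono[of dl 1 c] by (simp add: powr_mult mult_right_mono)

locale short_flow =
 fixes dl M a b :: real and u X :: "real => real => real"
 assumes dl: "0 < dl" "dl < 1" and ab: "a <= b" and u: "hfam dl M a b u" and X: "is_flow a b u X"
  and short: "M * (b - a) <= 1 / 4"
begin

lemma flow_start [simp]: "X al a = al" using X by (simp add: is_flow_def)

lemma flow_derivative: "t \<in> {a..b} ==> (X al has_real_derivative u (X al t) t) (at t within {a..b})"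
 using X by (simp add: is_flow_def)

lemma a_mem: "a \<in> {a..b}" using ab by simp

lemma M0: "0 <= M" by (rule Hball_nonneg[OF hfam_Hball[OF u a_mem]])

lemma flow_continuous: "continuous_on {a..b} (X al)" by (rule DERIV_continuous_on[OF flow_derivative])

lemma along_flow:
 "continuous_on (UNIV \<times> {a..b}) (%(x, t). g x t) ==> continuous_on {a..b} (%t. g (X al t) t)"
 for g :: "real => real => real"
 by (rule continuous_on_along[OF _ flow_continuous])

lemma flow_time:
 assumes "s \<in> {a..b}" "t \<in> {a..b}"
 shows "\<bar>X al t - X al s\<bar> <= M * \<bar>t - s\<bar>"
proof -
 have "norm (u (X al r) r) <= M" if "r \<in> {a..b}" for r using Hball_bound[OF hfam_Hball[OF u that]] by simp
 from field_differentiable_bound[of "{a..b}" "X al", OF _ flow_derivative this assms(2,1)] show ?thesis by simp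
qed

lemma flow_difference:
 assumes s: "s \<in> {a..b}" and t: "t \<in> {a..b}"
 shows "\<bar>X al t - X be t\<bar> <= 4 / 3 * \<bar>al - be\<bar>"
  and "\<bar>(X al t - X be t) - (X al s - X be s)\<bar> <= 4 / 3 * M * \<bar>al - be\<bar> * \<bar>t - s\<bar>"
proof -
 have d: "((%t. X al t - X be t) has_real_derivative u (X al t) t - u (X be t) t) (at t within {a..b})" if "t \<in> {a..b}" for t
  by (rule DERIV_diff[OF flow_derivative[OF that] flow_derivative[OF that]])
 have bd: "\<bar>u (X al t) t - u (X be t) t\<bar> <= 0 + M * \<bar>X al t - X be t\<bar>" if "t \<in> {a..b}" for t
  using Hball_Lipschitz[OF hfam_Hball[OF u that]] by simp
 note g = short_growth[OF d bd order.refl M0 short s t]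
 show "\<bar>X al t - X be t\<bar> <= 4 / 3 * \<bar>al - be\<bar>" using g(1) by simp
 show "\<bar>(X al t - X be t) - (X al s - X be s)\<bar> <= 4 / 3 * M * \<bar>al - be\<bar> * \<bar>t - s\<bar>"
  using g(2) by (simp add: mult_ac)
qed

lemma flow_near_start: "t \<in> {a..b} ==> \<bar>(X al t - X be t) - (al - be)\<bar> <= 1 / 3 * \<bar>al - be\<bar>"
proof -
 assume t: "t \<in> {a..b}"
 have "M * (t - a) * \<bar>al - be\<bar> <= 1 / 4 * \<bar>al - be\<bar>"
  using short mult_left_mono[of "t - a" "b - a" M] M0 t by (intro mult_right_mono) auto
 moreover have "\<bar>(X al t - X be t) - (al - be)\<bar> <= 4 / 3 * (M * (t - a) * \<bar>al - be\<bar>)"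
  using flow_difference(2)[OF a_mem t, of al be] t by (simp add: algebra_simps)
 ultimately show ?thesis by linarith
qed

lemma flow_lower: "t \<in> {a..b} ==> 2 / 3 * \<bar>al - be\<bar> <= \<bar>X al t - X be t\<bar>"
 by (drule flow_near_start[of t al be]) (simp add: abs_if split: if_splits)

lemma flow_mono: "t \<in> {a..b} ==> al < be ==> X al t < X be t"
 by (drule flow_near_start[of t al be]) (simp add: abs_if split: if_splits)

lemma flow_inj: "t \<in> {a..b} ==> inj (%al. X al t)"
proof (rule injI)
 fix al be assume "t \<in> {a..b}" "X al t = X be t"
 then show "al = be" using flow_lower[of t al be] by simp
qed

lemma flow_continuous_label: "t \<in> {a..b} ==> continuous_on S (%al. X al t)"
proof -
 assume t: "t \<in> {a..b}"
 have "(4 / 3)-lipschitz_on S (%al. X al t)"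
  by (rule lipschitz_onI) (use flow_difference(1)[OF t t] in \<open>auto simp: dist_real_def\<close>)
 then show ?thesis by (rule lipschitz_on_continuous_on)
qed

lemma flow_surj:
 assumes t: "t \<in> {a..b}"
 shows "\<exists>al. X al t = x"
proof -
 have "\<bar>X al t - al\<bar> <= 1 / 4" for al
  using flow_time[OF a_mem t, of al] short mult_left_mono[of "t - a" "b - a" M] M0 t by auto
 from this[of "x - 1"] this[of "x + 1"] have "X (x - 1) t <= x" "x <= X (x + 1) t" by linarith+
 then show ?thesis using IVT'[of "%al. X al t" "x - 1" x "x + 1"] flow_continuous_label[OF t] by auto
qed

lemma flow_range: "t \<in> {a..b} ==> range (%al. X al t) = UNIV"
 using flow_surj[of t] by (auto simp: image_def) metis

lemma flow_continuous_pair: "continuous_on (UNIV \<times> {a..b}) (%(al, t). X al t)"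
proof (rule continuous_on_pair_uniform)
 fix t e :: real assume t: "t \<in> {a..b}" and e: "0 < e"
 show "\<exists>d>0. \<forall>s\<in>{a..b}. \<bar>s - t\<bar> < d --> (\<forall>x. \<bar>X x s - X x t\<bar> <= e)"
 proof (intro exI[of _ "e / (M + 1)"] conjI ballI impI allI)
  fix s al assume s: "s \<in> {a..b}" "\<bar>s - t\<bar> < e / (M + 1)"
  have "M * \<bar>s - t\<bar> <= (M + 1) * \<bar>s - t\<bar>" by (intro mult_right_mono) auto
  also have "... <= e" using s M0 by (simp add: pos_less_divide_eq mult.commute)
  finally show "\<bar>X al s - X al t\<bar> <= e" using flow_time[OF t s(1), of al] by linarith
 qed (use e M0 in auto)
qed (rule flow_continuous_label)

lemma flow_powr:
 assumes t: "t \<in> {a..b}"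
 shows "\<bar>X al t - X be t\<bar> powr dl <= 4 / 3 * \<bar>al - be\<bar> powr dl"
  and "\<bar>al - be\<bar> powr dl <= 3 / 2 * \<bar>X al t - X be t\<bar> powr dl"
proof -
 have "\<bar>X al t - X be t\<bar> powr dl <= (4 / 3 * \<bar>al - be\<bar>) powr dl"
  using flow_difference(1)[OF t t] dl by (intro powr_mono2) auto
 also have "... <= 4 / 3 * \<bar>al - be\<bar> powr dl" by (rule powr_scale_le) (use dl in auto)
 finally show "\<bar>X al t - X be t\<bar> powr dl <= 4 / 3 * \<bar>al - be\<bar> powr dl" .
 have "\<bar>al - be\<bar> powr dl <= (3 / 2 * \<bar>X al t - X be t\<bar>) powr dl"
  using flow_lower[OF t, of al be] dl by (intro powr_mono2) auto
 also have "... <= 3 / 2 * \<bar>X al t - X be t\<bar> powr dl" by (rule powr_scale_le) (use dl in auto)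
 finally show "\<bar>al - be\<bar> powr dl <= 3 / 2 * \<bar>X al t - X be t\<bar> powr dl" .
qed

lemma flow_first_order:
 assumes h: "hfam dl A a b h" and t: "t \<in> {a..b}"
 shows "\<bar>h (X be t) t - h (X al t) t - (X be t - X al t) * ux h (X al t) t\<bar> <= 2 * A * (\<bar>be - al\<bar> powr dl * \<bar>be - al\<bar>)"
proof -
 note B = hfam_Hball[OF h t]
 have "\<bar>h (X be t) t - h (X al t) t - (X be t - X al t) * ux h (X al t) t\<bar>
   <= A * (\<bar>X be t - X al t\<bar> powr dl * \<bar>X be t - X al t\<bar>)"
  using Hball_first_order[OF B dl(1), of "X al t" "X be t - X al t"] by simp
 also have "... <= A * ((4 / 3 * \<bar>be - al\<bar> powr dl) * (4 / 3 * \<bar>be - al\<bar>))"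
  using flow_powr(1)[OF t] flow_difference(1)[OF t t] Hball_nonneg[OF B] by (intro mult_left_mono mult_mono) auto
 also have "... = 16 / 9 * (A * (\<bar>be - al\<bar> powr dl * \<bar>be - al\<bar>))" by simp
 also have "... <= 2 * A * (\<bar>be - al\<bar> powr dl * \<bar>be - al\<bar>)" using Hball_nonneg[OF B] by simp
 finally show ?thesis .
qed

text \<open>The flow is differentiable in the label, since the solution \<open>J\<close> of the linearised
 equation satisfies the same first-order expansion up to a Gronwall factor.\<close>

lemma flow_label_derivative:
 assumes t: "t \<in> {a..b}"
 shows "\<exists>j. ((%al. X al t) has_real_derivative j) (at al) & 2 / 3 <= j & j <= 4 / 3"
proof -
 let ?k = "%s. ux u (X al s) s"
 have "continuous_on {a..b} (%s. - ?k s)"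
  by (intro continuous_intros along_flow[of "ux u"] hfam_continuous(2)[OF dl u])
 from linear_ode[OF this continuous_on_const[of _ 0], of 1] obtain J where J0: "J a = 1"
  and J: "!!s. s \<in> {a..b} ==> (J has_real_derivative 0 - - ?k s * J s) (at s within {a..b})" by blast
 have k: "\<bar>?k s\<bar> <= M" if "s \<in> {a..b}" for s using Hball_deriv_bound[OF hfam_Hball[OF u that]] .
 have Jb: "\<bar>J s - 1\<bar> <= 1 / 3" if s: "s \<in> {a..b}" for s
 proof -
  have "\<bar>0 - - ?k r * J r\<bar> <= 0 + M * \<bar>J r\<bar>" if "r \<in> {a..b}" for r
   using mult_right_mono[OF k[OF that], of "\<bar>J r\<bar>"] by (simp add: abs_mult)
  from short_growth(2)[OF J this order.refl M0 short a_mem s]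
  have "\<bar>J s - 1\<bar> <= 4 / 3 * (M * (s - a))" using s by (simp add: J0)
  also have "... <= 4 / 3 * (M * (b - a))" using M0 s by (intro mult_left_mono) auto
  finally show ?thesis using short by simp
 qed
 have "((%al. X al t) has_real_derivative J t) (at al)"
 proof (rule first_order_imp_derivative[OF dl(1)])
  fix z
  define r where "r = \<bar>z\<bar> powr dl * \<bar>z\<bar>"
  let ?e = "%s. X (al + z) s - X al s - z * J s"
  have d: "(?e has_real_derivative u (X (al + z) s) s - u (X al s) s - z * (0 - - ?k s * J s)) (at s within {a..b})"
   if s: "s \<in> {a..b}" for s
   by (intro DERIV_diff flow_derivative DERIV_cmult J s)
  have bd: "\<bar>u (X (al + z) s) s - u (X al s) s - z * (0 - - ?k s * J s)\<bar> <= 2 * M * r + M * \<bar>?e s\<bar>" if s: "s \<in> {a..b}" for s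
  proof -
   have "u (X (al + z) s) s - u (X al s) s - z * (0 - - ?k s * J s)
    = (u (X (al + z) s) s - u (X al s) s - (X (al + z) s - X al s) * ?k s) + ?k s * ?e s" by (simp add: algebra_simps)
   moreover have "\<bar>?k s * ?e s\<bar> <= M * \<bar>?e s\<bar>" using k[OF s] by (simp add: abs_mult mult_right_mono)
   ultimately show ?thesis using flow_first_order[OF u s, of "al + z" al] by (simp add: r_def)
  qed
  have r0: "0 <= 2 * M * r" using M0 by (simp add: r_def)
  show "\<bar>X (al + z) t - X al t - z * J t\<bar> <= 4 / 3 * (2 * M * (b - a)) * (\<bar>z\<bar> powr dl * \<bar>z\<bar>)"
   using short_growth(1)[OF d bd r0 M0 short a_mem t] by (simp add: J0 r_def algebra_simps)
 qed
 moreover have "2 / 3 <= J t" "J t <= 4 / 3" using Jb[OF t] by linarith+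
 ultimately show ?thesis by blast
qed

text \<open>Composition with the flow changes \<open>L\<^sup>2\<close> norms at most by a factor, because the Jacobian
 is close to one.\<close>

lemma L2_flow:
 assumes t: "t \<in> {a..b}" and [measurable]: "g \<in> borel_measurable borel"
 shows "g \<in> L2_space \<longleftrightarrow> (%al. g (X al t)) \<in> L2_space"
  and "g \<in> L2_space ==> L2_norm g <= 2 * L2_norm (%al. g (X al t))"
  and "g \<in> L2_space ==> L2_norm (%al. g (X al t)) <= 2 * L2_norm g"
proof -
 obtain J where J: "!!al. ((%al. X al t) has_real_derivative J al) (at al)" "!!al. 2 / 3 <= J al" "!!al. J al <= 4 / 3"
  using flow_label_derivative[OF t] by metis
 have Xm [measurable]: "(%al. X al t) \<in> borel_measurable borel"
  by (rule borel_measurable_continuous_onI[OF flow_continuous_label[OF t]])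
 have Jm [measurable]: "J \<in> borel_measurable borel"
 proof (rule borel_measurable_LIMSEQ_real)
  fix al :: real
  have "((%h. (X (al + h) t - X al t) / h) \<longlongrightarrow> J al) (at 0)" using J(1) unfolding DERIV_def .
  then show "(%n. (X (al + 1 / real (Suc n)) t - X al t) / (1 / real (Suc n))) \<longlonglongrightarrow> J al"
   by (rule filterlim_compose)
    (rule filterlim_atI[OF LIMSEQ_Suc[OF lim_1_over_n]], simp)
  show "(%al. (X (al + 1 / real (Suc n)) t - X al t) / (1 / real (Suc n))) \<in> borel_measurable borel" for n
   by measurable
 qed
 have J0: "\<bar>J al\<bar> = J al" for al using J(2)[of al] by simp
 let ?q = "%x. (g x)\<^sup>2"
 let ?p = "%al. J al * (g (X al t))\<^sup>2"
 have li: "f absolutely_integrable_on UNIV \<longleftrightarrow> integrable lborel f" if "f \<in> borel_measurable borel" for f :: "real => real"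
  using that by (simp add: set_integrable_def integrable_completion)
 have lv: "integral UNIV f = (LINT x|lborel. f x)" if "integrable lborel f" for f :: "real => real"
  using that by (intro integral_unique has_integral_integral_real)
 have pm: "?p \<in> borel_measurable borel" "?q \<in> borel_measurable borel" by measurable
 have cv: "?p absolutely_integrable_on UNIV & integral UNIV ?p = c \<longleftrightarrow> ?q absolutely_integrable_on UNIV & integral UNIV ?q = c" for c
  using has_absolute_integral_change_of_variables_1'[of UNIV "%al. X al t" J ?q c] J(1) flow_inj[OF t]
  unfolding flow_range[OF t] J0 by simp
 have e1: "integrable lborel ?p \<longleftrightarrow> integrable lborel ?q" using cv li[OF pm(1)] li[OF pm(2)] by blast
 have e2: "(LINT al|lborel. ?p al) = (LINT x|lborel. ?q x)" if "integrable lborel ?q"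
  using cv li[OF pm(1)] li[OF pm(2)] e1 lv that by metis
 let ?r = "%al. (g (X al t))\<^sup>2"
 have b1: "?p al <= 4 * ?r al" for al using J(3)[of al] by (intro mult_right_mono) auto
 have b2: "?r al <= 4 * ?p al" for al using mult_right_mono[OF J(2)[of al], of "?r al"] zero_le_power2[of "g (X al t)"] by linarith
 have p0: "0 <= ?p al" for al using J(2)[of al] by simp
 have e3: "integrable lborel ?p \<longleftrightarrow> integrable lborel ?r"
 proof
  assume "integrable lborel ?p"
  then have "integrable lborel (%al. 4 * ?p al)" by simp
  then show "integrable lborel ?r" by (rule Bochner_Integration.integrable_bound) (use b2 p0 in auto)
 next
  assume "integrable lborel ?r"
  then have "integrable lborel (%al. 4 * ?r al)" by simp
  then show "integrable lborel ?p" by (rule Bochner_Integration.integrable_bound) (use b1 p0 in auto)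
 qed
 show iff: "g \<in> L2_space \<longleftrightarrow> (%al. g (X al t)) \<in> L2_space" using e1 e3 by (simp add: L2_space_iff)
 assume "g \<in> L2_space"
 then have i: "integrable lborel ?q" "integrable lborel ?p" "integrable lborel ?r" using e1 e3 by (simp_all add: L2_space_iff)
 have s4: "sqrt (4 * x) = 2 * sqrt x" for x :: real by (simp add: real_sqrt_mult)
 have "(LINT x|lborel. ?q x) <= (LINT al|lborel. 4 * ?r al)"
  unfolding e2[OF i(1), symmetric] by (rule integral_mono[OF i(2) integrable_mult_right[OF i(3)] b1])
 then show "L2_norm g <= 2 * L2_norm (%al. g (X al t))"
  unfolding L2_norm_def s4[symmetric] by (intro real_sqrt_le_mono) simp
 have "(LINT al|lborel. ?r al) <= (LINT al|lborel. 4 * ?p al)"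
  by (rule integral_mono[OF i(3) integrable_mult_right[OF i(2)] b2])
 then show "L2_norm (%al. g (X al t)) <= 2 * L2_norm g"
  unfolding L2_norm_def s4[symmetric] using e2[OF i(1)] by (intro real_sqrt_le_mono) simp
qed

section \<open>Transport along the flow\<close>

text \<open>If \<open>V\<close> solves \<open>dV/dt = h\<close> along the flow, its derivative in space solves the linear
 equation \<open>dW/dt = h\<^sub>x - u\<^sub>x W\<close>. The expansion of \<open>V\<close> to first order in the displacement
 is propagated directly, without differentiating the flow.\<close>

lemma transport_derivative:
 assumes h: "hfam dl A a b h" and u0: "u0 \<in> Hball dl M0" and V0: "!!al. V al a = u0 al"
  and V: "!!al t. t \<in> {a..b} ==> (V al has_real_derivative h (X al t) t) (at t within {a..b})"
 shows "\<exists>W. \<forall>al. W al a = deriv u0 al &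
  (\<forall>t\<in>{a..b}. (W al has_real_derivative ux h (X al t) t - ux u (X al t) t * W al t) (at t within {a..b}) &
    (\<forall>v. (\<forall>be. v (X be t) = V be t) --> (v has_real_derivative W al t) (at (X al t))))"
proof (rule choice, rule allI)
 fix al
 let ?k = "%s. ux u (X al s) s"
 have c: "continuous_on {a..b} ?k" "continuous_on {a..b} (%s. ux h (X al s) s)"
  by (intro along_flow[of "ux u"] along_flow[of "ux h"] hfam_continuous(2)[OF dl u] hfam_continuous(2)[OF dl h])+
 from linear_ode[OF this, of "deriv u0 al"] obtain W where W0: "W a = deriv u0 al"
  and W: "!!s. s \<in> {a..b} ==> (W has_real_derivative ux h (X al s) s - ?k s * W s) (at s within {a..b})" by blast
 have "bounded (W ` {a..b})" by (intro compact_imp_bounded compact_continuous_image DERIV_continuous_on[OF W]) auto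
 then obtain C where C: "!!s. s \<in> {a..b} ==> \<bar>W s\<bar> <= C" unfolding bounded_iff by fastforce
 have C0: "0 <= C" using C[OF a_mem] by linarith
 have "(v has_real_derivative W t) (at (X al t))" if t: "t \<in> {a..b}" and v: "\<forall>be. v (X be t) = V be t" for t v
 proof (rule first_order_imp_derivative[OF dl(1)])
  fix z
  obtain be where be: "X be t = X al t + z" using flow_surj[OF t] by blast
  define r where "r = \<bar>be - al\<bar> powr dl * \<bar>be - al\<bar>"
  let ?e = "%s. V be s - V al s - W s * (X be s - X al s)"
  let ?d = "%s. h (X be s) s - h (X al s) s - ((ux h (X al s) s - ?k s * W s) * (X be s - X al s) + (u (X be s) s - u (X al s) s) * W s)"
  have d: "(?e has_real_derivative ?d s) (at s within {a..b})" if s: "s \<in> {a..b}" for s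
   by (intro DERIV_diff DERIV_mult flow_derivative V W s)
  have bd: "norm (?d s) <= (2 * A + C * (2 * M)) * r" if s: "s \<in> {a..b}" for s
  proof -
   let ?E = "u (X be s) s - u (X al s) s - (X be s - X al s) * ?k s"
   have "?d s = (h (X be s) s - h (X al s) s - (X be s - X al s) * ux h (X al s) s) - W s * ?E" by (simp add: algebra_simps)
   moreover have "\<bar>W s * ?E\<bar> <= C * (2 * M * r)"
    unfolding abs_mult r_def by (rule mult_mono[OF C[OF s] flow_first_order[OF u s] C0]) simp
   moreover have "\<bar>h (X be s) s - h (X al s) s - (X be s - X al s) * ux h (X al s) s\<bar> <= 2 * A * r"
    using flow_first_order[OF h s, of be al] by (simp add: r_def)
   ultimately have "norm (?d s) <= 2 * A * r + C * (2 * M * r)" unfolding real_norm_def by linarith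
   then show ?thesis by (simp add: distrib_right mult.assoc)
  qed
  have "norm (?e t - ?e a) <= (2 * A + C * (2 * M)) * r * norm (t - a)"
   by (rule field_differentiable_bound[of "{a..b}" ?e, OF _ d bd t a_mem]) simp
  moreover have "\<bar>?e a\<bar> <= M0 * r"
   using Hball_first_order[OF u0 dl(1), of al "be - al"] by (simp add: V0 W0 r_def mult.commute)
  ultimately have e: "\<bar>?e t\<bar> <= (M0 + (2 * A + C * (2 * M)) * (t - a)) * r" using t by (simp add: algebra_simps)
  have r: "r <= 9 / 4 * (\<bar>z\<bar> powr dl * \<bar>z\<bar>)"
  proof -
   have "r <= (3 / 2 * \<bar>z\<bar> powr dl) * (3 / 2 * \<bar>z\<bar>)"
    using flow_powr(2)[OF t, of be al] flow_lower[OF t, of be al] unfolding r_def by (intro mult_mono) (auto simp: be)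
   then show ?thesis by simp
  qed
  have z: "z = X be t - X al t" using be by simp
  have A0: "0 <= A" "0 <= M0" using Hball_nonneg[OF hfam_Hball[OF h a_mem]] Hball_nonneg[OF u0] .
  have "\<bar>v (X al t + z) - v (X al t) - z * W t\<bar> = \<bar>?e t\<bar>" using v by (simp add: z mult.commute)
  also have "... <= (M0 + (2 * A + C * (2 * M)) * (t - a)) * (9 / 4 * (\<bar>z\<bar> powr dl * \<bar>z\<bar>))"
   using A0 C0 M0 t by (intro order_trans[OF e] mult_left_mono r add_nonneg_nonneg mult_nonneg_nonneg) auto
  finally show "\<bar>v (X al t + z) - v (X al t) - z * W t\<bar> <= (M0 + (2 * A + C * (2 * M)) * (t - a)) * (9 / 4) * (\<bar>z\<bar> powr dl * \<bar>z\<bar>)"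
   by (simp add: mult_ac)
 qed
 with W0 W show "\<exists>W. W a = deriv u0 al &
  (\<forall>t\<in>{a..b}. (W has_real_derivative ux h (X al t) t - ux u (X al t) t * W t) (at t within {a..b}) &
    (\<forall>v. (\<forall>be. v (X be t) = V be t) --> (v has_real_derivative W t) (at (X al t))))" by blast
qed

end

context short_flow
begin

lemma material_derivative:
 assumes v: "hfam dl N a b v" and t: "t \<in> {a..b}"
  and q: "!!x. (v x has_real_derivative q x) (at t within {a..b})"
 shows "((%s. v (X al s) s) has_real_derivative q (X al t) + ux v (X al t) t * u (X al t) t) (at t within {a..b})"
proof -
 have "((%s. v (X al s) s - v (X al t) s) has_real_derivative ux v (X al t) t * u (X al t) t) (at t within {a..b})"
  by (rule moving_point_derivative[OF _ hfam_continuous(2)[OF dl v] flow_derivative[OF t] t])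
   (rule Hball_has_derivative[OF hfam_Hball[OF v]])
 from DERIV_add[OF q[of "X al t"] this] show ?thesis by simp
qed

lemma flow_strip_continuous:
 fixes g :: "real => real => real"
 assumes "continuous_on (UNIV \<times> {a..b}) (%(x, t). g x t)"
 shows "continuous_on (UNIV \<times> {a..b}) (%(al, t). g (X al t) t)"
proof -
 have "continuous_on (UNIV \<times> {a..b}) (%p. (%(x, t). g x t) (case p of (al, t) => X al t, snd p))"
  by (rule continuous_on_compose2[OF assms]) (intro continuous_intros flow_continuous_pair, auto)
 then show ?thesis by (simp add: case_prod_beta')
qed

text \<open>The \<open>L\<^sup>2\<close> estimate for transport: Minkowski in time along the flow, then two changes of
 variables.\<close>

lemma flow_L2_Lipschitz:
 fixes V g :: "real => real => real"
 assumes V: "!!al t. t \<in> {a..b} ==> (V al has_real_derivative g (X al t) t) (at t within {a..b})"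
  and c: "continuous_on (UNIV \<times> {a..b}) (%(x, t). g x t)"
  and g: "!!t. t \<in> {a..b} ==> (%x. g x t) \<in> L2_space" "!!t. t \<in> {a..b} ==> L2_norm (%x. g x t) <= K"
  and m: "(%al. V al t - V al a) \<in> borel_measurable borel" and t: "t \<in> {a..b}"
 shows "(%al. V al t - V al a) \<in> L2_space" "L2_norm (%al. V al t - V al a) <= 2 * K * (b - a)"
proof -
 have s: "{a..t} \<subseteq> {a..b}" using t by auto
 have K: "0 <= K" using g(2)[OF a_mem] L2_norm_nonneg[of "%x. g x a"] by linarith
 have V': "(V al has_real_derivative g (X al r) r) (at r within {a..t})" if "r \<in> {a..t}" for al r
  using DERIV_subset[OF V s] s that by blast
 have c': "continuous_on (UNIV \<times> {a..t}) (%(al, t). g (X al t) t)"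
  by (rule continuous_on_subset[OF flow_strip_continuous[OF c]]) (use s in auto)
 have g': "(%al. g (X al r) r) \<in> L2_space" "L2_norm (%al. g (X al r) r) <= 2 * K" if "r \<in> {a..t}" for r
 proof -
  have r: "r \<in> {a..b}" using that s by auto
  note L = L2_flow[OF r L2_space_measurable[OF g(1)[OF r]]]
  show "(%al. g (X al r) r) \<in> L2_space" using L(1) g(1)[OF r] by blast
  show "L2_norm (%al. g (X al r) r) <= 2 * K" using L(3)[OF g(1)[OF r]] g(2)[OF r] by linarith
 qed
 have at: "a <= t" using t by simp
 note L = L2_time_Lipschitz[OF at V' c' g' m]
 show "(%al. V al t - V al a) \<in> L2_space" by (rule L(1))
 have "2 * K * (t - a) <= 2 * K * (b - a)" using K t by (intro mult_left_mono) auto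
 then show "L2_norm (%al. V al t - V al a) <= 2 * K * (b - a)" using L(2) by linarith
qed

text \<open>One linear transport step costs at most a factor slightly above the initial size, if the
 time is short in terms of the sizes of the velocity and of the source.\<close>

lemma transport_bounds:
 assumes h: "hfam dl A a b h" and u0: "u0 \<in> Hball dl N" and time: "(b - a) * (A + M * (2 * N + 1)) <= 1 / 4"
  and V0: "!!al. V al a = u0 al" and v: "!!al t. t \<in> {a..b} ==> v (X al t) t = V al t"
  and V: "!!al t. t \<in> {a..b} ==> (V al has_real_derivative h (X al t) t) (at t within {a..b})"
 shows "hfam dl (2 * N + 1) a b v"
  and "t \<in> {a..b} ==> (v x has_real_derivative h x t - u x t * ux v x t) (at t within {a..b})"
proof -
 obtain W where W0: "!!al. W al a = deriv u0 al"
  and W: "!!al t. t \<in> {a..b} ==> (W al has_real_derivative ux h (X al t) t - ux u (X al t) t * W al t) (at t within {a..b})"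
  and vW: "!!al t f. t \<in> {a..b} ==> (\<forall>be. f (X be t) = V be t) ==> (f has_real_derivative W al t) (at (X al t))"
  using transport_derivative[OF h u0 V0 V] by metis
 have A0: "0 <= A" by (rule Hball_nonneg[OF hfam_Hball[OF h a_mem]])
 have N0: "0 <= N" by (rule Hball_nonneg[OF u0])
 have "0 <= (b - a) * A" "0 <= (b - a) * (M * (2 * N + 1))" using A0 N0 M0 ab by auto
 with time have tA: "A * (b - a) <= 1 / 4" by (simp add: algebra_simps)
 have Vb: "\<bar>V al t\<bar> <= N + 1 / 4" if t: "t \<in> {a..b}" for al t
 proof -
  have "norm (h (X al r) r) <= A" if "r \<in> {a..b}" for r using Hball_bound[OF hfam_Hball[OF h that]] by simp
  from field_differentiable_bound[of "{a..b}" "V al", OF _ V this t a_mem] have "\<bar>V al t - u0 al\<bar> <= A * (t - a)" using t by (simp add: V0)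
  also have "... <= A * (b - a)" using A0 t by (intro mult_left_mono) auto
  finally show ?thesis using tA Hball_bound[OF u0, of al] by linarith
 qed
 have kb: "\<bar>ux u (X al t) t\<bar> <= M" "\<bar>ux h (X al t) t\<bar> <= A" if "t \<in> {a..b}" for al t
  using Hball_deriv_bound[OF hfam_Hball[OF u that]] Hball_deriv_bound[OF hfam_Hball[OF h that]] by auto
 have Wb: "\<bar>W al t\<bar> <= 2 * N + 1" if t: "t \<in> {a..b}" for al t
 proof -
  have "\<bar>ux h (X al s) s - ux u (X al s) s * W al s\<bar> <= A + M * \<bar>W al s\<bar>" if s: "s \<in> {a..b}" for s
   using kb[OF s, of al] mult_right_mono[OF kb(1)[OF s, of al], of "\<bar>W al s\<bar>"] abs_triangle_ineq4[of "ux h (X al s) s" "ux u (X al s) s * W al s"]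
   by (simp add: abs_mult)
  from short_growth(1)[OF W this A0 M0 short a_mem t] have "\<bar>W al t\<bar> <= 4 / 3 * (\<bar>deriv u0 al\<bar> + A * (b - a))" by (simp add: W0)
  also have "... <= 4 / 3 * (N + 1 / 4)" by (intro mult_left_mono add_mono Hball_deriv_bound[OF u0] tA) auto
  also have "... <= 2 * N + 1" using N0 by simp
  finally show ?thesis .
 qed
 have Wh: "\<bar>W al t - W be t\<bar> <= (2 * N + 1) * \<bar>X al t - X be t\<bar> powr dl" if t: "t \<in> {a..b}" for al be t
 proof -
  define r where "r = \<bar>al - be\<bar> powr dl"
  have r0: "0 <= r" by (simp add: r_def)
  define B where "B = 4 / 3 * (A + M * (2 * N + 1)) * r"
  have B0: "0 <= B" using A0 M0 N0 r0 by (simp add: B_def)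
  let ?d = "%s. (ux h (X al s) s - ux u (X al s) s * W al s) - (ux h (X be s) s - ux u (X be s) s * W be s)"
  have d: "((%s. W al s - W be s) has_real_derivative ?d s) (at s within {a..b})" if "s \<in> {a..b}" for s
   by (rule DERIV_diff[OF W[OF that] W[OF that]])
  have bd: "\<bar>?d s\<bar> <= B + M * \<bar>W al s - W be s\<bar>" if s: "s \<in> {a..b}" for s
  proof -
   have hd: "\<bar>ux g (X al s) s - ux g (X be s) s\<bar> <= C * (4 / 3 * r)" if g: "hfam dl C a b g" for g C
    unfolding r_def using Hball_nonneg[OF hfam_Hball[OF g s]]
    by (intro order_trans[OF Hball_holder[OF hfam_Hball[OF g s]]] mult_left_mono flow_powr(1)[OF s])
   have "?d s = (ux h (X al s) s - ux h (X be s) s) - (ux u (X al s) s - ux u (X be s) s) * W al s - ux u (X be s) s * (W al s - W be s)"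
    by (simp add: algebra_simps)
   moreover have "\<bar>(ux u (X al s) s - ux u (X be s) s) * W al s\<bar> <= M * (4 / 3 * r) * (2 * N + 1)"
    unfolding abs_mult using M0 r0 by (intro mult_mono hd[OF u] Wb[OF s]) auto
   moreover have "\<bar>ux u (X be s) s * (W al s - W be s)\<bar> <= M * \<bar>W al s - W be s\<bar>"
    unfolding abs_mult by (intro mult_right_mono kb(1)[OF s]) auto
   moreover have "B = A * (4 / 3 * r) + M * (4 / 3 * r) * (2 * N + 1)" by (simp add: B_def algebra_simps)
   ultimately show ?thesis using hd[OF h] by linarith
  qed
  have "\<bar>W al t - W be t\<bar> <= 4 / 3 * (\<bar>deriv u0 al - deriv u0 be\<bar> + B * (b - a))"
   using short_growth(1)[OF d bd B0 M0 short a_mem t] by (simp add: W0)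
  moreover have "\<bar>deriv u0 al - deriv u0 be\<bar> <= N * r" unfolding r_def by (rule Hball_holder[OF u0])
  moreover have "B * (b - a) <= r * (1 / 3)"
   using mult_left_mono[OF time, of "4 / 3 * r"] r0 by (simp add: B_def mult_ac)
  ultimately have "\<bar>W al t - W be t\<bar> <= 4 / 3 * (N * r + r * (1 / 3))" by (elim order_trans) simp
  also have "... = (4 / 3 * N + 4 / 9) * r" by (simp add: algebra_simps)
  also have "... <= (4 / 3 * N + 4 / 9) * (3 / 2 * \<bar>X al t - X be t\<bar> powr dl)"
   unfolding r_def using N0 by (intro mult_left_mono flow_powr(2)[OF t]) auto
  also have "... <= (2 * N + 1) * \<bar>X al t - X be t\<bar> powr dl"
  proof -
   have "(4 / 3 * N + 4 / 9) * (3 / 2 * p) = (2 * N + 2 / 3) * p" for p by (simp add: algebra_simps)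
   then show ?thesis by (simp only:) (rule mult_right_mono, auto)
  qed
  finally show ?thesis .
 qed
 have H: "(%x. v x t) \<in> Hball dl (2 * N + 1)" if t: "t \<in> {a..b}" for t
 proof -
  define Y where "Y x = (SOME al. X al t = x)" for x
  have Y: "X (Y x) t = x" for x unfolding Y_def by (rule someI_ex[OF flow_surj[OF t]])
  have vd: "((%x. v x t) has_real_derivative W (Y x) t) (at x)" for x
   using vW[OF t, of "%x. v x t" "Y x"] v[OF t] by (simp add: Y)
  have vm: "(%x. v x t) \<in> borel_measurable borel"
   by (rule borel_measurable_continuous_onI, rule DERIV_continuous_on) (rule has_field_derivative_at_within[OF vd])
  have Vm: "(%al. V al t) \<in> borel_measurable borel"
   using measurable_compose[OF borel_measurable_continuous_onI[OF flow_continuous_label[OF t]] vm] by (simp add: v[OF t])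
  have mm: "(%al. V al t - V al a) \<in> borel_measurable borel"
   unfolding V0 using Vm Hball_measurable[OF u0] by (rule borel_measurable_diff)
  note L = flow_L2_Lipschitz[OF V hfam_continuous(1)[OF dl h] Hball_L2[OF hfam_Hball[OF h]] Hball_norm[OF hfam_Hball[OF h]] mm t]
  have VL: "(%al. V al t) \<in> L2_space" using L2_space_add[OF L(1) Hball_L2[OF u0]] by (simp add: V0)
  have "L2_norm (%al. V al t) <= L2_norm u0 + L2_norm (%al. V al t - u0 al)"
   by (rule L2_norm_le_diff[OF VL Hball_L2[OF u0]])
  also have "... <= N + 1 / 2" using L(2) Hball_norm[OF u0] tA by (simp add: V0)
  finally have Vn: "L2_norm (%al. V al t) <= N + 1 / 2" .
  have vL: "(%x. v x t) \<in> L2_space" using L2_flow(1)[OF t vm] VL by (simp add: v[OF t])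
  show ?thesis
  proof (rule HballI[OF vL _ vd])
   show "L2_norm (%x. v x t) <= 2 * N + 1" using L2_flow(2)[OF t vm vL] Vn by (simp add: v[OF t])
   show "\<bar>v x t\<bar> <= 2 * N + 1" for x using Vb[OF t, of "Y x"] v[OF t, of "Y x"] N0 by (simp add: Y)
   show "\<bar>W (Y x) t\<bar> <= 2 * N + 1" for x by (rule Wb[OF t])
   show "\<bar>W (Y x) t - W (Y y) t\<bar> <= (2 * N + 1) * \<bar>x - y\<bar> powr dl" for x y
    using Wh[OF t, of "Y x" "Y y"] by (simp add: Y)
  qed
 qed
 have tc: "\<bar>v x s - v x t\<bar> <= (A + (2 * N + 1) * M) * \<bar>s - t\<bar>" if s: "s \<in> {a..b}" and t: "t \<in> {a..b}" for x s t
 proof -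
  obtain al where al: "X al s = x" using flow_surj[OF s] by blast
  have "norm (h (X al r) r) <= A" if "r \<in> {a..b}" for r using Hball_bound[OF hfam_Hball[OF h that]] by simp
  from field_differentiable_bound[of "{a..b}" "V al", OF _ V this s t] have "\<bar>V al s - V al t\<bar> <= A * \<bar>s - t\<bar>" by simp
  moreover have "\<bar>v (X al t) t - v x t\<bar> <= (2 * N + 1) * (M * \<bar>s - t\<bar>)"
   using flow_time[OF s t, of al] N0
   by (intro order_trans[OF Hball_Lipschitz[OF H[OF t]]] mult_left_mono) (auto simp: al abs_minus_commute)
  ultimately show ?thesis using v[OF s, of al] v[OF t, of al] by (simp add: al algebra_simps)
 qed
 show hv: "hfam dl (2 * N + 1) a b v"
  unfolding hfam_def
 proof (intro conjI ballI allI impI H)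
  fix t e :: real assume t: "t \<in> {a..b}" and e: "0 < e"
  define L where "L = A + (2 * N + 1) * M + 1"
  have L: "0 < L" using A0 N0 M0 by (simp add: L_def add_nonneg_pos)
  show "\<exists>d>0. \<forall>s\<in>{a..b}. \<bar>s - t\<bar> < d --> (\<forall>x. \<bar>v x s - v x t\<bar> <= e)"
  proof (intro exI[of _ "e / L"] conjI ballI impI allI)
   fix s x assume s: "s \<in> {a..b}" "\<bar>s - t\<bar> < e / L"
   have "\<bar>v x s - v x t\<bar> <= L * \<bar>s - t\<bar>"
    using tc[OF s(1) t, of x] by (elim order_trans) (intro mult_right_mono, auto simp: L_def)
   also have "... <= e" using s(2) L by (simp add: pos_less_divide_eq mult.commute less_imp_le)
   finally show "\<bar>v x s - v x t\<bar> <= e" .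
  qed (use e L in auto)
 qed
 show "(v x has_real_derivative h x t - u x t * ux v x t) (at t within {a..b})" if t: "t \<in> {a..b}"
 proof -
  obtain al where al: "X al t = x" using flow_surj[OF t] by blast
  have "((%s. v (X al s) s - v (X al t) s) has_real_derivative ux v (X al t) t * u (X al t) t) (at t within {a..b})"
   by (rule moving_point_derivative[OF _ hfam_continuous(2)[OF dl hv] flow_derivative[OF t] t])
    (rule Hball_has_derivative[OF H])
  from DERIV_diff[OF V[OF t, of al] this]
  have "((%s. V al s - (v (X al s) s - v x s)) has_real_derivative h x t - u x t * ux v x t) (at t within {a..b})"
   by (simp add: al mult.commute)
  then show ?thesis by (rule has_field_derivative_transform_within[OF _ zero_less_one t]) (simp add: v)
 qed
qed

lemma transport_exists:
 assumes h: "hfam dl A a b h" and u0: "u0 \<in> Hball dl N" and time: "(b - a) * (A + M * (2 * N + 1)) <= 1 / 4"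
 shows "\<exists>v. hfam dl (2 * N + 1) a b v & (\<forall>x. v x a = u0 x) &
  (\<forall>t\<in>{a..b}. \<forall>x. (v x has_real_derivative h x t - u x t * ux v x t) (at t within {a..b}))"
proof -
 define V where "V al t = u0 al + integral {a..t} (%s. h (X al s) s)" for al t
 have V: "(V al has_real_derivative h (X al t) t) (at t within {a..b})" if t: "t \<in> {a..b}" for al t
  using DERIV_add[OF DERIV_const[of "u0 al"] integral_has_real_derivative[OF along_flow[OF hfam_continuous(1)[OF dl h], of al] t]]
  unfolding V_def[abs_def] by simp
 define v where "v x t = V (SOME al. X al t = x) t" for x t
 have v: "v (X al t) t = V al t" if t: "t \<in> {a..b}" for al t
 proof -
  have "X (SOME be. X be t = X al t) t = X al t" by (rule someI_ex) blast
  then have "(SOME be. X be t = X al t) = al" using injD[OF flow_inj[OF t]] by blast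
  then show ?thesis by (simp add: v_def)
 qed
 have V0: "V al a = u0 al" for al by (simp add: V_def)
 have "v x a = u0 x" for x using v[OF a_mem, of x] V0[of x] by simp
 then show ?thesis using transport_bounds[OF h u0 time V0 v V] by blast
qed

text \<open>The difference \<open>w\<close> of two transported functions solves
 \<open>w\<^sub>t + u w\<^sub>x = H d - d v\<^sub>x\<close>, where \<open>d\<close> is the difference of the velocities; no derivative is lost.\<close>

lemma difference_estimate:
 assumes u2: "hfam dl M a b u2" and v1: "hfam dl N a b v1" and v2: "hfam dl N a b v2"
  and e1: "!!t x. t \<in> {a..b} ==> (v1 x has_real_derivative uH u x t - u x t * ux v1 x t) (at t within {a..b})"
  and e2: "!!t x. t \<in> {a..b} ==> (v2 x has_real_derivative uH u2 x t - u2 x t * ux v2 x t) (at t within {a..b})"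
  and start: "!!x. v1 x a = v2 x a" and D: "!!t. t \<in> {a..b} ==> L2_norm (%x. u x t - u2 x t) <= D"
  and t: "t \<in> {a..b}"
 shows "L2_norm (%x. v1 x t - v2 x t) <= 4 * (1 + N) * D * (b - a)"
proof -
 define w where "w x t = v1 x t - v2 x t" for x t
 define g where "g x t = (uH u x t - uH u2 x t) - (u x t - u2 x t) * ux v2 x t" for x t
 have N0: "0 <= N" by (rule Hball_nonneg[OF hfam_Hball[OF v1 a_mem]])
 have V: "((%s. w (X al s) s) has_real_derivative g (X al t) t) (at t within {a..b})" if t: "t \<in> {a..b}" for al t
  using DERIV_diff[OF material_derivative[OF v1 t e1[OF t], of al] material_derivative[OF v2 t e2[OF t], of al]]
  unfolding w_def g_def by (elim DERIV_cong) (simp add: algebra_simps)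
 have c: "continuous_on (UNIV \<times> {a..b}) (%(x, t). g x t)"
  using hfam_continuous(1-3)[OF dl u] hfam_continuous(1-3)[OF dl u2] hfam_continuous(2)[OF dl v2]
  unfolding g_def case_prod_beta' by (intro continuous_intros) auto
 have g: "(%x. g x t) \<in> L2_space & L2_norm (%x. g x t) <= (1 + N) * D" if t: "t \<in> {a..b}" for t
 proof -
  note B = Hball_diff[OF hfam_Hball[OF u t] hfam_Hball[OF u2 t]]
  interpret pv_bounded "%x. u x t - u2 x t" "12 * (M + M)" by (rule Hball_pv_bounded[OF B])
  note V2 = hfam_Hball[OF v2 t]
  note p = L2_space_mult_bounded[OF L2 Hball_deriv_measurable[OF V2 dl(1)] Hball_deriv_bound[OF V2]]
  have eq: "(%x. g x t) = (%x. hil (%x. u x t - u2 x t) x - ux v2 x t * (u x t - u2 x t))"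
   by (simp add: g_def hil_diff[OF hfam_Hball[OF u t] hfam_Hball[OF u2 t]] mult.commute)
  have "L2_norm (%x. g x t) <= L2_norm (%x. u x t - u2 x t) + N * L2_norm (%x. u x t - u2 x t)"
   unfolding eq using L2_norm_triangle_diff[OF hil_in_L2(1) p(1)] hil_in_L2(2) p(2) by linarith
  also have "... = (1 + N) * L2_norm (%x. u x t - u2 x t)" by (simp add: distrib_right)
  also have "... <= (1 + N) * D" using N0 by (intro mult_left_mono D t) auto
  finally show ?thesis unfolding eq using L2_space_diff[OF hil_in_L2(1) p(1)] by simp
 qed
 note B = Hball_diff[OF hfam_Hball[OF v1 t] hfam_Hball[OF v2 t]]
 have wm: "(%x. w x t) \<in> borel_measurable borel" unfolding w_def by (rule Hball_measurable[OF B])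
 have wL: "(%x. w x t) \<in> L2_space" unfolding w_def by (rule Hball_L2[OF B])
 have w0: "w x a = 0" for x by (simp add: w_def start)
 have m: "(%al. w (X al t) t - w (X al a) a) \<in> borel_measurable borel"
  using measurable_compose[OF borel_measurable_continuous_onI[OF flow_continuous_label[OF t]] wm] by (simp add: w0)
 have "L2_norm (%al. w (X al t) t) <= 2 * ((1 + N) * D) * (b - a)"
  using flow_L2_Lipschitz(2)[OF V c _ _ m t, of "(1 + N) * D"] g by (simp add: w0)
 then have "2 * L2_norm (%al. w (X al t) t) <= 4 * (1 + N) * D * (b - a)" by (simp add: algebra_simps)
 then show ?thesis using L2_flow(2)[OF t wm wL] by (simp add: w_def)
qed

end

section \<open>Local existence and uniqueness\<close>

definition short_time :: "real => real => real" where
 "short_time dl N = 1 / (8 * (1 + 6 * Lam_const dl * (2 * N + 1) + (2 * N + 1) * (2 * N + 1)))"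

lemma short_time:
 assumes dl: "0 < dl" "dl < 1" and N: "0 <= N" and ab: "a <= b" "b - a <= short_time dl N"
 defines "M \<equiv> 2 * N + 1"
 shows "0 < short_time dl N" "(b - a) * (6 * Lam_const dl * M + M * M) <= 1 / 4" "M * (b - a) <= 1 / 4"
  "4 * (1 + M) * (b - a) <= 1 / 2"
proof -
 define S where "S = 1 + 6 * Lam_const dl * M + M * M"
 have M: "1 <= M" using N by (simp add: M_def)
 have L: "0 <= 6 * Lam_const dl * M" using M Lam_const_pos[OF dl] by simp
 have MM: "M <= M * M" using mult_right_mono[OF M, of M] M by simp
 have S: "0 < S" using L M MM unfolding S_def by linarith
 show "0 < short_time dl N" using S by (simp add: short_time_def S_def M_def)
 have "(b - a) * S <= short_time dl N * S" using ab S by (intro mult_right_mono) auto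
 also have "... = 1 / 8" using S by (simp add: short_time_def S_def M_def)
 finally have S8: "(b - a) * S <= 1 / 8" .
 have *: "(b - a) * p <= 1 / 8" if "p <= S" for p
  using mult_left_mono[OF that, of "b - a"] ab S8 by simp
 show "(b - a) * (6 * Lam_const dl * M + M * M) <= 1 / 4" using *[of "6 * Lam_const dl * M + M * M"] by (simp add: S_def)
 show "M * (b - a) <= 1 / 4" using *[of M] L MM by (simp add: S_def mult.commute)
 show "4 * (1 + M) * (b - a) <= 1 / 2" using *[of "1 + M"] L MM by (simp add: S_def mult_ac)
qed

lemma Hball_small_ex:
 assumes "0 < dl" "0 <= M" "0 < e"
 shows "\<exists>k>0. \<forall>w\<in>Hball dl M. (\<forall>x. \<bar>w x\<bar> <= k) --> (\<forall>x. \<bar>deriv w x\<bar> <= e & \<bar>hil w x\<bar> <= e)"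
proof (rule Hball_small[OF assms])
 fix k assume "0 < k" and "!!w x. w \<in> Hball dl M ==> (!!x. \<bar>w x\<bar> <= k) ==> \<bar>deriv w x\<bar> <= e & \<bar>hil w x\<bar> <= e & \<bar>Lam w x\<bar> <= e"
 then show ?thesis by (intro exI[of _ k]) simp
qed

lemma Hball_uniform_limit:
 assumes dl: "0 < dl" and f: "!!n. f n \<in> Hball dl M" and l: "!!n x. \<bar>f n x - g x\<bar> <= e n" and e: "e \<longlonglongrightarrow> 0"
 shows "g \<in> Hball dl M"
proof -
 have M: "0 <= M" by (rule Hball_nonneg[OF f])
 have fl: "(%n. f n x) \<longlonglongrightarrow> g x" for x
  using Lim_null_comparison[OF always_eventually e, of "%n. f n x - g x"] l by (simp add: LIM_zero_cancel)
 have "Cauchy (%n. deriv (f n) x)" for x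
 proof (rule metric_CauchyI)
  fix r :: real assume r: "0 < r"
  have "0 <= M + M" "0 < r / 2" using M r by auto
  from Hball_small_ex[OF dl this] obtain k where k: "0 < k"
   "!!w x. w \<in> Hball dl (M + M) ==> (\<forall>x. \<bar>w x\<bar> <= k) ==> \<bar>deriv w x\<bar> <= r / 2" by auto
  have "\<forall>\<^sub>F n in sequentially. e n < k / 2" by (rule order_tendstoD(2)[OF e]) (use k(1) in simp)
  then obtain n0 where n0: "!!n. n >= n0 ==> e n < k / 2" unfolding eventually_sequentially by blast
  have "dist (deriv (f n) x) (deriv (f m) x) < r" if "n >= n0" "m >= n0" for n m
  proof -
   have "\<bar>f n y - f m y\<bar> <= k" for y using l[of n y] l[of m y] n0[OF that(1)] n0[OF that(2)] by linarith
   then have "\<forall>y. \<bar>f n y - f m y\<bar> <= k" by blast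
   from k(2)[OF Hball_diff[OF f f] this, of x] show ?thesis
    using r by (simp add: deriv_diff_Hball[OF f f] dist_real_def)
  qed
  then show "\<exists>n0. \<forall>m\<ge>n0. \<forall>n\<ge>n0. dist (deriv (f m) x) (deriv (f n) x) < r" by blast
 qed
 then have "\<exists>d. (%n. deriv (f n) x) \<longlonglongrightarrow> d" for x by (simp add: Cauchy_convergent_iff convergent_def)
 then obtain g' where g': "!!x. (%n. deriv (f n) x) \<longlonglongrightarrow> g' x" by metis
 have d: "(g has_real_derivative g' x) (at x)" for x
 proof (rule first_order_imp_derivative[OF dl])
  fix z
  have "(%n. \<bar>f n (x + z) - f n x - z * deriv (f n) x\<bar>) \<longlonglongrightarrow> \<bar>g (x + z) - g x - z * g' x\<bar>"
   by (intro tendsto_rabs tendsto_diff tendsto_mult tendsto_const fl g')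
  then show "\<bar>g (x + z) - g x - z * g' x\<bar> <= M * (\<bar>z\<bar> powr dl * \<bar>z\<bar>)"
   by (rule LIMSEQ_le_const2) (use Hball_first_order[OF f dl] in blast)
 qed
 have gm: "g \<in> borel_measurable borel"
  by (rule borel_measurable_LIMSEQ_real[OF fl]) (rule Hball_measurable[OF f])
 note F = L2_Fatou[OF Hball_L2[OF f] Hball_norm[OF f] AE_I2[OF fl] gm]
 show ?thesis
 proof (rule HballI[OF F d])
  fix x y
  show "\<bar>g x\<bar> <= M" by (rule LIMSEQ_le_const2[OF tendsto_rabs[OF fl]]) (use Hball_bound[OF f] in blast)
  show "\<bar>g' x\<bar> <= M" by (rule LIMSEQ_le_const2[OF tendsto_rabs[OF g']]) (use Hball_deriv_bound[OF f] in blast)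
  show "\<bar>g' x - g' y\<bar> <= M * \<bar>x - y\<bar> powr dl"
   by (rule LIMSEQ_le_const2[OF tendsto_rabs[OF tendsto_diff[OF g' g']]]) (use Hball_holder[OF f] in blast)
 qed
qed

lemma uniform_limit_derivative:
 fixes f f' :: "nat => real => real"
 assumes f: "!!n t. t \<in> {a..b} ==> (f n has_real_derivative f' n t) (at t within {a..b})"
  and u: "!!e. 0 < e ==> \<forall>\<^sub>F n in sequentially. \<forall>t\<in>{a..b}. \<bar>f' n t - g' t\<bar> <= e"
  and l: "!!t. t \<in> {a..b} ==> (%n. f n t) \<longlonglongrightarrow> g t" and t: "t \<in> {a..b}"
 shows "(g has_real_derivative g' t) (at t within {a..b})"
proof -
 have d: "(f n has_derivative (%h. f' n t * h)) (at t within {a..b})" if "t \<in> {a..b}" for n t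
  using f[OF that] by (simp add: has_field_derivative_def)
 have e: "\<forall>\<^sub>F n in sequentially. \<forall>x\<in>{a..b}. \<forall>h. norm (f' n x * h - g' x * h) <= e * norm h" if "0 < e" for e
  using u[OF that]
 proof (rule eventually_mono)
  fix n assume "\<forall>t\<in>{a..b}. \<bar>f' n t - g' t\<bar> <= e"
  then show "\<forall>x\<in>{a..b}. \<forall>h. norm (f' n x * h - g' x * h) <= e * norm h"
   by (simp add: left_diff_distrib[symmetric] abs_mult mult_right_mono)
 qed
 have "\<exists>G. \<forall>t\<in>{a..b}. (%n. f n t) \<longlonglongrightarrow> G t & (G has_derivative (%h. g' t * h)) (at t within {a..b})"
  by (rule has_derivative_sequence[of "{a..b}" f "%n t h. f' n t * h" "%t h. g' t * h" t "g t", OF _ d e t l[OF t]]) simp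
 then obtain G where "\<forall>t\<in>{a..b}. (%n. f n t) \<longlonglongrightarrow> G t & (G has_derivative (%h. g' t * h)) (at t within {a..b})" ..
 then have G: "!!t. t \<in> {a..b} ==> (%n. f n t) \<longlonglongrightarrow> G t" "(G has_real_derivative g' t) (at t within {a..b})"
  using t by (auto simp: has_field_derivative_def)
 have "G s = g s" if "s \<in> {a..b}" for s by (rule LIMSEQ_unique[OF G(1)[OF that] l[OF that]])
 then show ?thesis by (intro has_field_derivative_transform_within[OF G(2) zero_less_one t])
qed

lemma geometric_limit:
 fixes s :: "nat => real"
 assumes s: "!!n. \<bar>s (Suc n) - s n\<bar> <= C * q ^ n" and q: "0 <= q" "q < 1"
 shows "\<exists>l. \<forall>n. \<bar>s n - l\<bar> <= C * q ^ n / (1 - q)"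
proof -
 define r where "r n = C * q ^ n / (1 - q)" for n
 have r: "C * q ^ n = r n - r (Suc n)" for n
  unfolding r_def diff_divide_distrib[symmetric] using q by (simp add: eq_divide_eq algebra_simps)
 have C: "0 <= C" using s[of 0] by simp
 have r0: "0 <= r n" for n using C q by (simp add: r_def)
 have "r \<longlonglongrightarrow> C * 0 / (1 - q)" unfolding r_def[abs_def] using q by (intro tendsto_intros LIMSEQ_realpow_zero) auto
 then have r': "r \<longlonglongrightarrow> 0" by simp
 have lo: "s n - r n <= s (Suc n) - r (Suc n)" for n using s[of n] r[of n] by linarith
 have hi: "s (Suc n) + r (Suc n) <= s n + r n" for n using s[of n] r[of n] by linarith
 have "(%n. (s n - r n) - (s n + r n)) \<longlonglongrightarrow> 0" using tendsto_mult[OF tendsto_const[of "-2"] r'] by simp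
 from nested_sequence_unique[of "%n. s n - r n" "%n. s n + r n", OF _ _ _ this] lo hi r0
 obtain l where "!!n. s n - r n <= l" "!!n. l <= s n + r n" by auto
 then have "\<bar>s n - l\<bar> <= r n" for n by (smt (verit))
 then show ?thesis unfolding r_def by blast
qed

lemma Hball_L2_small_imp_sup_small:
 assumes f: "f \<in> Hball dl M" and n: "L2_norm f <= M * (1 / 2) ^ n"
 shows "\<bar>f x\<bar> <= 2 * M * (2 / 3) ^ n"
proof (rule power_le_imp_le_base)
 have M: "0 <= M" by (rule Hball_nonneg[OF f])
 have q: "((1 / 2) ^ n)\<^sup>2 <= ((2 / 3 :: real) ^ n) ^ 3"
  using power_mono[of "1 / 4 :: real" "8 / 27" n] by (simp add: power_mult[symmetric] power_mult[of _ _ n] mult.commute[of n] power2_eq_square power3_eq_cube power_mult_distrib[symmetric])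
 have "\<bar>f x\<bar> ^ 3 <= 4 * M * (L2_norm f)\<^sup>2" by (rule Hball_sup_le_L2[OF f])
 also have "... <= 4 * M * (M * (1 / 2) ^ n)\<^sup>2" using n L2_norm_nonneg M by (intro mult_left_mono power_mono) auto
 also have "... = 4 * M ^ 3 * ((1 / 2) ^ n)\<^sup>2" by (simp only: power_mult_distrib) (simp add: power3_eq_cube power2_eq_square)
 also have "... <= 8 * M ^ 3 * ((2 / 3) ^ n) ^ 3" using M by (intro mult_mono q) auto
 also have "... = (2 * M * (2 / 3) ^ n) ^ 3" by (simp only: power_mult_distrib) simp
 finally show "\<bar>f x\<bar> ^ Suc 2 <= (2 * M * (2 / 3) ^ n) ^ Suc 2" by (simp add: numeral_3_eq_3)
qed (use Hball_nonneg[OF f] in simp)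

text \<open>Picard iteration: every step solves a linear transport equation with the previous velocity
 and the previous source, within one fixed ball of \<open>C\<^sup>1\<^sup>+\<^sup>\<delta> \<inter> L\<^sup>2\<close>. It contracts in \<open>L\<^sup>2\<close>, and by
 interpolation the convergence is uniform up to first derivatives.\<close>

lemma local_existence:
 assumes dl: "0 < dl" "dl < 1" and u0: "u0 \<in> Hball dl N" and ab: "a <= b" "b - a <= short_time dl N"
 shows "\<exists>u. bsol dl (2 * N + 1) a b u & (\<forall>x. u x a = u0 x)"
proof -
 define M where "M = 2 * N + 1"
 have N0: "0 <= N" by (rule Hball_nonneg[OF u0])
 have M0: "0 <= M" using N0 by (simp add: M_def)
 note st = short_time[OF dl N0 ab, folded M_def]
 have sf: "short_flow dl M a b p X" if "hfam dl M a b p" "is_flow a b p X" for p X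
  by unfold_locales (use dl ab that st in auto)
 have fe: "\<exists>X. is_flow a b p X" if "hfam dl M a b p" for p
  using flow_exists[OF dl ab(1) that] by blast
 let ?P = "%p. hfam dl M a b p & (\<forall>x. p x a = u0 x)"
 let ?Q = "%p v. \<forall>t\<in>{a..b}. \<forall>x. (v x has_real_derivative uH p x t - p x t * ux v x t) (at t within {a..b})"
 have "\<exists>U. \<forall>n. ?P (U n) & ?Q (U n) (U (Suc n))"
 proof (rule dependent_nat_choice)
  have "(%x. u0 x) \<in> Hball dl M" using Hball_mono[OF u0] N0 by (simp add: M_def)
  then show "\<exists>p. ?P p" by (intro exI[of _ "%x t. u0 x"]) (auto simp: hfam_def intro: exI[of _ 1])
  fix p :: "real => real => real" assume p: "?P p"
  then obtain X where X: "is_flow a b p X" using fe by blast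
  interpret short_flow dl M a b p X by (rule sf) (use p X in auto)
  from transport_exists[OF hfam_hil[OF dl conjunct1[OF p]] u0, folded M_def, OF st(2)]
  show "\<exists>v. ?P v & ?Q p v" by blast
 qed
 then obtain U where U: "!!n. hfam dl M a b (U n)" "!!n x. U n x a = u0 x"
  and PDE: "!!n t x. t \<in> {a..b} ==> (U (Suc n) x has_real_derivative uH (U n) x t - U n x t * ux (U (Suc n)) x t) (at t within {a..b})"
  by metis
 have D: "L2_norm (%x. U (Suc n) x t - U n x t) <= (M + M) * (1 / 2) ^ n" if t: "t \<in> {a..b}" for n t
  using t
 proof (induction n arbitrary: t)
  case 0
  then show ?case using Hball_norm[OF Hball_diff[OF hfam_Hball[OF U(1)[of 1]] hfam_Hball[OF U(1)[of 0]]], of t t] by simp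
 next
  case (Suc n)
  obtain X where X: "is_flow a b (U (Suc n)) X" using fe[OF U(1)] by blast
  interpret short_flow dl M a b "U (Suc n)" X by (rule sf[OF U(1) X])
  have "L2_norm (%x. U (Suc (Suc n)) x t - U (Suc n) x t) <= 4 * (1 + M) * ((M + M) * (1 / 2) ^ n) * (b - a)"
   by (rule difference_estimate[OF U(1) U(1) U(1) PDE PDE _ Suc.IH Suc.prems]) (auto simp: U(2))
  also have "... = 4 * (1 + M) * (b - a) * ((M + M) * (1 / 2) ^ n)" by simp
  also have "... <= 1 / 2 * ((M + M) * (1 / 2) ^ n)" using st(4) M0 by (intro mult_right_mono) auto
  finally show ?case by simp
 qed
 define E where "E n = 2 * (M + M) * (2 / 3) ^ n / (1 - 2 / 3)" for n
 have "\<exists>l. \<forall>n. \<bar>U n x t - l\<bar> <= E n" if t: "t \<in> {a..b}" for x t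
  unfolding E_def
  by (rule geometric_limit, rule Hball_L2_small_imp_sup_small[OF Hball_diff[OF hfam_Hball[OF U(1) t] hfam_Hball[OF U(1) t]] D[OF t]]) auto
 note ex = this
 define u where "u x t = (SOME l. \<forall>n. \<bar>U n x t - l\<bar> <= E n)" for x t
 have u: "\<bar>U n x t - u x t\<bar> <= E n" if "t \<in> {a..b}" for x t n
  unfolding u_def using someI_ex[OF ex[OF that]] by blast
 have "E \<longlonglongrightarrow> 2 * (M + M) * 0 / (1 - 2 / 3)" unfolding E_def[abs_def] by (intro tendsto_intros LIMSEQ_realpow_zero) auto
 then have E0: "E \<longlonglongrightarrow> 0" by simp
 have uB: "(%x. u x t) \<in> Hball dl M" if t: "t \<in> {a..b}" for t
  by (rule Hball_uniform_limit[OF dl(1) hfam_Hball[OF U(1) t] u[OF t] E0])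
 have lim: "(%n. U n x t) \<longlonglongrightarrow> u x t" if t: "t \<in> {a..b}" for x t
  using Lim_null_comparison[OF always_eventually E0, of "%n. U n x t - u x t"] u[OF t] by (simp add: LIM_zero_cancel)
 have close: "\<forall>\<^sub>F n in sequentially. \<forall>t\<in>{a..b}. \<forall>x. \<bar>U n x t - u x t\<bar> <= e & \<bar>ux (U n) x t - ux u x t\<bar> <= e & \<bar>uH (U n) x t - uH u x t\<bar> <= e"
  if e: "0 < e" for e
 proof -
  have "0 <= M + M" using M0 by simp
  from Hball_small_ex[OF dl(1) this e] obtain k where k: "0 < k"
   "!!w x. w \<in> Hball dl (M + M) ==> (\<forall>x. \<bar>w x\<bar> <= k) ==> \<bar>deriv w x\<bar> <= e & \<bar>hil w x\<bar> <= e" by auto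
  have "\<forall>\<^sub>F n in sequentially. E n < min k e" by (rule order_tendstoD(2)[OF E0]) (use k(1) e in simp)
  then show ?thesis
  proof eventually_elim
   case (elim n)
   show ?case
   proof (intro ballI allI)
    fix t x assume t: "t \<in> {a..b}"
    have b: "\<bar>U n y t - u y t\<bar> <= min k e" for y using u[OF t, of n y] elim by linarith
    note B = hfam_Hball[OF U(1) t] uB[OF t]
    have "\<forall>y. \<bar>U n y t - u y t\<bar> <= k" using b by simp
    from k(2)[OF Hball_diff[OF B] this, of x] b[of x]
    show "\<bar>U n x t - u x t\<bar> <= e & \<bar>ux (U n) x t - ux u x t\<bar> <= e & \<bar>uH (U n) x t - uH u x t\<bar> <= e"
     by (simp add: deriv_diff_Hball[OF B] hil_diff[OF B])
   qed
  qed
 qed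
 have "(u x has_real_derivative uH u x t - u x t * ux u x t) (at t within {a..b})" if t: "t \<in> {a..b}" for x t
 proof (rule uniform_limit_derivative[OF PDE _ _ t])
  fix e :: real assume e: "0 < e"
  define d where "d = e / (1 + 2 * M)"
  have d: "0 < d" using e M0 by (simp add: d_def)
  have de: "d * (1 + 2 * M) = e" using M0 by (simp add: d_def)
  have "\<forall>\<^sub>F n in sequentially. \<forall>t\<in>{a..b}. \<forall>x. \<bar>ux (U (Suc n)) x t - ux u x t\<bar> <= d"
   using eventually_sequentially_Suc[THEN iffD2, OF close[OF d]] by (rule eventually_mono) blast
  with close[OF d] show "\<forall>\<^sub>F n in sequentially. \<forall>t\<in>{a..b}. \<bar>(uH (U n) x t - U n x t * ux (U (Suc n)) x t) - (uH u x t - u x t * ux u x t)\<bar> <= e"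
  proof eventually_elim
   case (elim n)
   show ?case
   proof
    fix t assume t: "t \<in> {a..b}"
    have "\<bar>(U n x t - u x t) * ux (U (Suc n)) x t\<bar> <= d * M"
     unfolding abs_mult using elim(1) t d Hball_deriv_bound[OF hfam_Hball[OF U(1) t]] by (intro mult_mono) auto
    moreover have "\<bar>u x t * (ux (U (Suc n)) x t - ux u x t)\<bar> <= M * d"
     unfolding abs_mult using elim(2) t M0 Hball_bound[OF uB[OF t]] by (intro mult_mono) auto
    moreover have "\<bar>uH (U n) x t - uH u x t\<bar> <= d" using elim(1) t by blast
    moreover have "(uH (U n) x t - U n x t * ux (U (Suc n)) x t) - (uH u x t - u x t * ux u x t)
     = (uH (U n) x t - uH u x t) - (U n x t - u x t) * ux (U (Suc n)) x t - u x t * (ux (U (Suc n)) x t - ux u x t)"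
     by (simp add: algebra_simps)
    moreover have "e = d + d * M + M * d" using de by (simp add: algebra_simps)
    ultimately show "\<bar>(uH (U n) x t - U n x t * ux (U (Suc n)) x t) - (uH u x t - u x t * ux u x t)\<bar> <= e" by linarith
   qed
  qed
 next
  show "(%n. U (Suc n) x t) \<longlonglongrightarrow> u x t" if "t \<in> {a..b}" for t by (rule LIMSEQ_Suc[OF lim[OF that]])
 qed
 moreover have "u x a = u0 x" for x
  using LIMSEQ_unique[OF lim[of a x]] tendsto_const[of "u0 x"] ab(1) by (simp add: U(2))
 ultimately show ?thesis using uB unfolding bsol_def M_def by blast
qed

lemma bsol_unique:
 assumes dl: "0 < dl" "dl < 1" and u: "bsol dl M a b u" and v: "bsol dl M a b v" and start: "!!x. u x a = v x a"
  and t: "t \<in> {a..b}"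
 shows "u x t = v x t"
proof -
 have M0: "0 <= M" by (rule Hball_nonneg[OF bsol_Hball[OF u t]])
 have l: "0 < short_time dl M" by (rule short_time(1)[OF dl M0 order.refl, of 0]) (simp add: short_time_def M0 Lam_const_pos[OF dl] less_imp_le)
 have short: "u x t = v x t" if c: "bsol dl M c d u" "bsol dl M c d v" "!!x. u x c = v x c" "d - c <= short_time dl M" "t \<in> {c..d}" for c d x t
 proof -
  have cd: "c <= d" using c(5) by simp
  note st = short_time[OF dl M0 cd c(4)]
  obtain X where X: "is_flow c d u X" by (rule flow_exists[OF dl cd bsol_hfam[OF c(1)]])
  have "M * (d - c) <= (2 * M + 1) * (d - c)" using M0 cd by (intro mult_right_mono) auto
  then interpret short_flow dl M c d u X by unfold_locales (use dl cd bsol_hfam[OF c(1)] X st in auto)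
  have "L2_norm (%x. u x t - v x t) <= (M + M) * (1 / 2) ^ n" if "t \<in> {c..d}" for n t
   using that
  proof (induction n arbitrary: t)
   case 0
   then show ?case using Hball_norm[OF Hball_diff[OF bsol_Hball[OF c(1)] bsol_Hball[OF c(2)]], of t t] by simp
  next
   case (Suc n)
   have "L2_norm (%x. u x t - v x t) <= 4 * (1 + M) * ((M + M) * (1 / 2) ^ n) * (d - c)"
    by (rule difference_estimate[OF bsol_hfam[OF c(2)] bsol_hfam[OF c(1)] bsol_hfam[OF c(2)]
     bsol_derivative[OF c(1)] bsol_derivative[OF c(2)] c(3) Suc.IH Suc.prems])
   also have "... = 4 * (1 + M) * (d - c) * ((M + M) * (1 / 2) ^ n)" by simp
   also have "... <= 4 * (1 + (2 * M + 1)) * (d - c) * ((M + M) * (1 / 2) ^ n)" using M0 cd by (intro mult_right_mono) auto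
   also have "... <= 1 / 2 * ((M + M) * (1 / 2) ^ n)" using st(4) M0 by (intro mult_right_mono) auto
   finally show ?case by simp
  qed
  from Hball_L2_small_imp_sup_small[OF Hball_diff[OF bsol_Hball[OF c(1)] bsol_Hball[OF c(2)]] this] c(5)
  have "\<bar>u x t - v x t\<bar> <= 2 * (M + M) * (2 / 3) ^ n" for n by blast
  moreover have "(%n. 2 * (M + M) * (2 / 3) ^ n) \<longlonglongrightarrow> 2 * (M + M) * 0" by (intro tendsto_intros LIMSEQ_realpow_zero) auto
  ultimately have "\<bar>u x t - v x t\<bar> <= 0" by (intro LIMSEQ_le_const[of _ 0]) auto
  then show ?thesis by simp
 qed
 have "u x t = v x t" if "t \<in> {a..a + real n * short_time dl M}" "t \<in> {a..b}" for n t x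
  using that
 proof (induction n arbitrary: t x)
  case 0
  then show ?case using start by simp
 next
  case (Suc n)
  define c where "c = a + real n * short_time dl M"
  show ?case
  proof (cases "t <= c")
   case True
   then show ?thesis using Suc by (simp add: c_def)
  next
   case False
   have ac: "a <= c" using l by (simp add: c_def)
   have "u y c = v y c" for y using Suc.IH[of c y] ac False Suc.prems by (auto simp: c_def)
   then show ?thesis
    using short[of c t t x] bsol_subinterval[OF u ac, of t] bsol_subinterval[OF v ac, of t] False Suc.prems
    by (auto simp: c_def distrib_right)
  qed
 qed
 note * = this
 obtain n where "t - a <= real n * short_time dl M"
  using reals_Archimedean3[OF l] less_imp_le by blast
 then show ?thesis using t by (intro *[of t n]) auto
qed

section \<open>Displacement along characteristics\<close>

locale short_solution = short_flow +
 assumes sol: "bsol dl M a b u" and length: "b - a <= 1 / 32" "(b - a) * (6 * Lam_const dl + 2 * M) <= 1 / 2"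
begin

abbreviation "V al t \<equiv> u (X al t) t"
abbreviation "V' al t \<equiv> uH u (X al t) t"
abbreviation "F al t \<equiv> ux u (X al t) t"
abbreviation "G al t \<equiv> Gfun (%y. u y t) (X al t)"

text \<open>The size of the motion of a particle, read off from the initial data alone.\<close>

definition motion :: "real => real" where
 "motion al = \<bar>V al a\<bar> + \<bar>V' al a\<bar> + G al a"

lemma G_nonneg: "0 <= G al t" by (rule Gfun_nonneg)

lemma motion_nonneg: "0 <= motion al" unfolding motion_def using G_nonneg[where al=al and t=a] by simp

lemma V_derivative: "t \<in> {a..b} ==> (V al has_real_derivative V' al t) (at t within {a..b})"
 by (rule velocity_derivative[OF dl sol flow_derivative])

lemma V'_derivative: "t \<in> {a..b} ==> (V' al has_real_derivative - V al t + G al t) (at t within {a..b})"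
 by (rule characteristic_acceleration[OF dl sol flow_derivative])

lemma u_Hball: "t \<in> {a..b} ==> (%x. u x t) \<in> Hball dl M" by (rule bsol_Hball[OF sol])

lemma L2_contract:
 fixes m h :: "real => real"
 assumes "h \<in> L2_space" "m \<in> borel_measurable borel" "!!x. \<bar>m x\<bar> <= B" "!!x. g x = m x * h x"
 shows "g \<in> L2_space" "L2_norm g <= B * L2_norm h"
proof -
 have "g = (%x. m x * h x)" using assms(4) by (rule ext)
 then show "g \<in> L2_space" "L2_norm g <= B * L2_norm h" using L2_space_mult_bounded[OF assms(1-3)] by simp_all
qed

text \<open>The quotients of \<open>V\<close> in label space are comparable in \<open>L\<^sup>2\<close> to those of \<open>u\<close>, and their time
 derivative is controlled by themselves: \<open>H\<close> is bounded on difference quotients. Hence \<open>G\<close> varies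
 along a characteristic at most by a factor.\<close>

lemma G_comparable:
 assumes s: "s \<in> {a..b}" and t: "t \<in> {a..b}"
 shows "G al t <= 324 * G al s"
proof -
 define Q where "Q f t be = (f (X be t) t - f (X al t) t) / (be - al)" for f :: "real => real => real" and t be
 have fm: "(%be. f (X be t) t) \<in> borel_measurable borel" if "hfam dl C a b f" "t \<in> {a..b}" for f t C
  by (rule measurable_compose[OF borel_measurable_continuous_onI[OF flow_continuous_label[OF that(2)]]
   Hball_measurable[OF hfam_Hball[OF that]]])
 have cmp: "Q f t \<in> L2_space & L2_norm (Q f t) <= 3 * L2_norm (dq (%x. f x t) (X al t))
   & L2_norm (dq (%x. f x t) (X al t)) <= 3 * L2_norm (Q f t)" if f: "hfam dl C a b f" and t: "t \<in> {a..b}" for f t C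
 proof -
  let ?d = "dq (%x. f x t) (X al t)"
  let ?m = "%be. (X be t - X al t) / (be - al)" and ?m' = "%be. (be - al) / (X be t - X al t)"
  have d: "?d \<in> L2_space" by (rule dq_L2[OF hfam_Hball[OF f t]])
  note fl = L2_flow[OF t L2_space_measurable[OF d]]
  have dX: "(%be. ?d (X be t)) \<in> L2_space" using fl(1) d by blast
  have Xm [measurable]: "(%be. X be t) \<in> borel_measurable borel"
   by (rule borel_measurable_continuous_onI[OF flow_continuous_label[OF t]])
  have nz: "X be t - X al t = 0 \<longleftrightarrow> be - al = 0" for be using flow_lower[OF t, of be al] by auto
  have m: "\<bar>?m be\<bar> <= 3 / 2" for be
  proof -
   have "\<bar>X be t - X al t\<bar> <= 3 / 2 * \<bar>be - al\<bar>" using flow_difference(1)[OF t t, of be al] abs_ge_zero[of "be - al"] by linarith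
   then show ?thesis by (cases "be = al") (auto simp: abs_divide divide_le_eq)
  qed
  have m': "\<bar>?m' be\<bar> <= 3 / 2" for be
   using flow_lower[OF t, of be al] nz[of be] by (cases "be = al") (auto simp: abs_divide divide_le_eq)
  have e: "Q f t be = ?m be * ?d (X be t)" "?d (X be t) = ?m' be * Q f t be" for be
   using nz[of be] by (auto simp: Q_def dq_def)
  have q: "Q f t \<in> L2_space" "L2_norm (Q f t) <= 3 / 2 * L2_norm (%be. ?d (X be t))"
   using L2_contract[OF dX _ m e(1)] by simp_all
  have "L2_norm (%be. ?d (X be t)) <= 3 / 2 * L2_norm (Q f t)"
   using L2_contract(2)[OF q(1) _ m' e(2)] by simp
  then show ?thesis using q fl(2,3)[OF d] by simp
 qed
 let ?q = "%t. L2_norm (Q u t)"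
 note qq = cmp[OF u]
 have H: "Q (uH u) t \<in> L2_space" "L2_norm (Q (uH u) t) <= 9 * ?q t" if t: "t \<in> {a..b}" for t
  using cmp[OF hfam_hil[OF dl u] t] qq[OF t] dq_hil_L2(2)[OF u_Hball[OF t], of "X al t"] by linarith+
 have bdd: "bdd_above (?q ` {a..b})"
 proof (rule bdd_aboveI2)
  fix t assume t: "t \<in> {a..b}"
  have "(L2_norm (dq (%x. u x t) (X al t)))\<^sup>2 <= 5 * M\<^sup>2 / 2 * (2 * pi)"
   using Gfun_bound[OF u_Hball[OF t], of "X al t"] by (simp add: Gfun_def divide_le_eq mult_ac)
  then have "L2_norm (dq (%x. u x t) (X al t)) <= sqrt (5 * M\<^sup>2 / 2 * (2 * pi))" by (rule real_le_rsqrt)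
  with qq[OF t] show "?q t <= 3 * sqrt (5 * M\<^sup>2 / 2 * (2 * pi))" by linarith
 qed
 define S where "S = (SUP t\<in>{a..b}. ?q t)"
 have S: "?q t <= S" if "t \<in> {a..b}" for t unfolding S_def by (rule cSUP_upper[OF that bdd])
 have S0: "0 <= S" using S[OF a_mem] L2_norm_nonneg[of "Q u a"] by linarith
 have step: "L2_norm (%be. Q u t be - Q u s be) <= 9 * S * (t - s)" if st: "s \<in> {a..b}" "t \<in> {a..b}" "s <= t" for s t
 proof -
  define m where "m n be = (be - al)\<^sup>2 / ((be - al)\<^sup>2 + 1 / real (Suc n))" for n be
  define w where "w n be = (be - al) / ((be - al)\<^sup>2 + 1 / real (Suc n))" for n be
  have pos: "0 < (be - al)\<^sup>2 + 1 / real (Suc n)" for n be by (intro add_nonneg_pos) auto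
  have m: "\<bar>m n be\<bar> <= 1" for n be using pos[of be n] by (simp add: m_def abs_divide)
  have wm: "w n be * (f (X be r) r - f (X al r) r) = m n be * Q f r be" for n be f r
   by (simp add: w_def m_def Q_def power2_eq_square)
  have mm: "m n \<in> borel_measurable borel" for n unfolding m_def[abs_def] by measurable
  have sub: "{s..t} \<subseteq> {a..b}" using st by auto
  have L: "L2_norm (%be. m n be * Q u t be - m n be * Q u s be) <= 9 * S * (t - s)"
   and Lm: "(%be. m n be * Q u t be - m n be * Q u s be) \<in> L2_space" for n
  proof -
   let ?f = "%be r. w n be * (V be r - V al r)" and ?g = "%be r. w n be * (V' be r - V' al r)"
   have d: "(?f be has_real_derivative ?g be r) (at r within {s..t})" if "r \<in> {s..t}" for be r
    using sub that by (intro DERIV_cmult DERIV_diff DERIV_subset[OF V_derivative sub]) auto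
   have "continuous_on (UNIV \<times> {a..b}) (%(be, r). V' be r)" "continuous_on {a..b} (V' al)"
    by (intro flow_strip_continuous[of "uH u"] hfam_continuous(3)[OF dl u] DERIV_continuous_on[OF V'_derivative])+
   then have "continuous_on (UNIV \<times> {a..b}) (%(be, r). ?g be r)"
    using pos unfolding case_prod_beta' w_def
    by (intro continuous_intros continuous_on_compose2[OF _ continuous_on_snd[OF continuous_on_id]]) (auto simp: less_imp_neq[symmetric])
   then have c: "continuous_on (UNIV \<times> {s..t}) (%(be, r). ?g be r)" by (rule continuous_on_subset) (use sub in auto)
   have g: "(%be. ?g be r) \<in> L2_space" "L2_norm (%be. ?g be r) <= 9 * S" if "r \<in> {s..t}" for r
   proof -
    have r: "r \<in> {a..b}" using that sub by auto
    note c = L2_contract[OF H(1)[OF r] mm m wm[where f="uH u" and n=n]]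
    show "(%be. ?g be r) \<in> L2_space" by (rule c(1))
    show "L2_norm (%be. ?g be r) <= 9 * S" using c(2) H(2)[OF r] S[OF r] by linarith
   qed
   have "(%be. ?f be r) \<in> borel_measurable borel" if "r \<in> {a..b}" for r
    using fm[OF u that] mm[of n] unfolding w_def by measurable
   then have "(%be. ?f be t - ?f be s) \<in> borel_measurable borel" using st by (intro borel_measurable_diff) auto
   note * = L2_time_Lipschitz[OF st(3) d c g this]
   show "L2_norm (%be. m n be * Q u t be - m n be * Q u s be) <= 9 * S * (t - s)" using *(2) unfolding wm .
   show "(%be. m n be * Q u t be - m n be * Q u s be) \<in> L2_space" using *(1) unfolding wm .
  qed
  have lim: "(%n. m n be * Q u t be - m n be * Q u s be) \<longlonglongrightarrow> Q u t be - Q u s be" for be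
  proof (cases "be = al")
   case False
   have "(%n. m n be) \<longlonglongrightarrow> (be - al)\<^sup>2 / ((be - al)\<^sup>2 + 0)" unfolding m_def
    by (rule tendsto_divide[OF tendsto_const tendsto_add[OF tendsto_const LIMSEQ_Suc[OF lim_1_over_n]]]) (use False in simp)
   then have "(%n. m n be) \<longlonglongrightarrow> 1" using False by simp
   then have "(%n. m n be * Q u t be - m n be * Q u s be) \<longlonglongrightarrow> 1 * Q u t be - 1 * Q u s be"
    by (intro tendsto_diff tendsto_mult tendsto_const)
   then show ?thesis by simp
  qed (simp add: Q_def)
  show ?thesis
   by (rule L2_Fatou(2)[OF Lm L AE_I2[OF lim]])
    (intro borel_measurable_diff L2_space_measurable conjunct1[OF qq] st)
 qed
 have near: "?q t <= ?q s + 9 / 32 * S" if s: "s \<in> {a..b}" and t: "t \<in> {a..b}" for s t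
 proof -
  have L: "Q u s \<in> L2_space" "Q u t \<in> L2_space" using qq s t by blast+
  have "\<bar>t - s\<bar> <= 1 / 32" using s t length(1) unfolding atLeastAtMost_iff by linarith
  then have "9 * S * \<bar>t - s\<bar> <= 9 * S * (1 / 32)" using S0 by (intro mult_left_mono) auto
  moreover have "L2_norm (%be. Q u t be - Q u s be) <= 9 * S * \<bar>t - s\<bar>"
   using step[OF s t] step[OF t s] L2_norm_minus_commute[of "Q u t" "Q u s"] by (cases "s <= t") auto
  ultimately show ?thesis using L2_norm_le_diff[OF L(2,1)] by simp
 qed
 have "S <= ?q s + 9 / 32 * S" unfolding S_def
  by (rule cSUP_least) (use a_mem near[OF s] in \<open>auto simp: S_def\<close>)
 then have "?q t <= 2 * ?q s" using S[OF t] S0 by linarith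
 then have "L2_norm (dq (%x. u x t) (X al t)) <= 18 * L2_norm (dq (%x. u x s) (X al s))"
  using qq[OF t] qq[OF s] by linarith
 then have "(L2_norm (dq (%x. u x t) (X al t)))\<^sup>2 <= (18 * L2_norm (dq (%x. u x s) (X al s)))\<^sup>2"
  by (intro power_mono L2_norm_nonneg)
 then show ?thesis by (simp add: Gfun_def power_mult_distrib divide_right_mono field_simps)
qed

lemma V_le_motion:
 assumes t: "t \<in> {a..b}"
 shows "\<bar>V al t\<bar> <= 2 * motion al"
proof -
 have "\<exists>m\<in>{a..b}. \<forall>r\<in>{a..b}. \<bar>V al r\<bar> <= \<bar>V al m\<bar>"
  using a_mem by (intro continuous_attains_sup continuous_intros DERIV_continuous_on[OF V_derivative]) auto
 then obtain m where m: "m \<in> {a..b}" "!!r. r \<in> {a..b} ==> \<bar>V al r\<bar> <= \<bar>V al m\<bar>" by blast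
 define B where "B = \<bar>V al m\<bar> + 324 * G al a"
 have B0: "0 <= B" using G_nonneg[where al=al and t=a] by (simp add: B_def)
 have len: "x * \<bar>r - a\<bar> <= x * (1 / 32)" if "r \<in> {a..b}" "0 <= x" for r x
  using that length(1) by (intro mult_left_mono) auto
 have "norm (- V al r + G al r) <= B" if r: "r \<in> {a..b}" for r
  using m(2)[OF r] G_comparable[OF a_mem r, of al] G_nonneg[where al=al and t=r] by (simp add: B_def)
 from field_differentiable_bound[of "{a..b}" "V' al", OF _ V'_derivative this _ a_mem]
 have V': "norm (V' al r) <= \<bar>V' al a\<bar> + B / 32" if r: "r \<in> {a..b}" for r
  using len[OF r B0] r by (auto simp: abs_le_iff) fastforce+
 have "norm (V al m - V al a) <= (\<bar>V' al a\<bar> + B / 32) * norm (m - a)"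
  by (rule field_differentiable_bound[of "{a..b}" "V al", OF _ V_derivative V' m(1) a_mem]) simp
 also have "... <= (\<bar>V' al a\<bar> + B / 32) * (1 / 32)"
  using len[OF m(1), of "\<bar>V' al a\<bar> + B / 32"] B0 by simp
 finally have "\<bar>V al m\<bar> <= \<bar>V al a\<bar> + (\<bar>V' al a\<bar> + B / 32) * (1 / 32)" unfolding real_norm_def by linarith
 then have "\<bar>V al m\<bar> <= 2 * motion al" using G_nonneg[where al=al and t=a] by (simp add: motion_def B_def field_simps)
 then show ?thesis using m(2)[OF t] by linarith
qed

text \<open>Testing \<open>V'' + V = G\<close> against a polynomial that vanishes to third order at the end of a
 time interval expresses the initial values through the displacement on that interval.\<close>

lemma test_identity:
 fixes p :: "real poly"
 assumes e: "a < e" "e <= b" and p: "p = [:e - a, -1:] * [:e - a, -1:] * [:e - a, -1:] * q"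
 defines "I \<equiv> %al t. V' al t * poly p (t - a) - V al t * poly (pderiv p) (t - a)
   + (X al t - al) * poly (pderiv (pderiv p)) (t - a) + (X al t - al) * poly p (t - a)"
 shows "I al e = 0"
  and "I al a = V' al a * ((e - a) ^ 3 * poly q 0) - V al a * ((e - a) ^ 3 * poly (pderiv q) 0 - 3 * (e - a)\<^sup>2 * poly q 0)"
  and "t \<in> {a..e} ==> (I al has_real_derivative G al t * poly p (t - a)
   + (X al t - al) * (poly (pderiv (pderiv (pderiv p))) (t - a) + poly (pderiv p) (t - a))) (at t within {a..e})"
proof -
 define L where "L = [:e - a, -1:]"
 have L: "poly L (e - a) = 0" "poly L 0 = e - a" "poly (pderiv L) x = -1" for x by (simp_all add: L_def pderiv_pCons)
 show "I al e = 0" by (simp add: I_def p L_def[symmetric] pderiv_mult pderiv_add L)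
 show "I al a = V' al a * ((e - a) ^ 3 * poly q 0) - V al a * ((e - a) ^ 3 * poly (pderiv q) 0 - 3 * (e - a)\<^sup>2 * poly q 0)"
  by (simp add: I_def p L_def[symmetric] pderiv_mult pderiv_add L power3_eq_cube power2_eq_square algebra_simps)
 assume t: "t \<in> {a..e}"
 have tb: "t \<in> {a..b}" "{a..e} \<subseteq> {a..b}" using t e by auto
 have pd: "((%t. poly r (t - a)) has_real_derivative poly (pderiv r) (t - a)) (at t within {a..e})" for r :: "real poly"
  using DERIV_chain2[OF poly_DERIV DERIV_diff[OF DERIV_ident DERIV_const]] by simp
 have Xd: "((%t. X al t - al) has_real_derivative V al t) (at t within {a..e})"
  using DERIV_diff[OF DERIV_subset[OF flow_derivative[OF tb(1)] tb(2)] DERIV_const[of al]] by simp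
 note d = DERIV_add[OF DERIV_add[OF DERIV_diff[OF
   DERIV_mult[OF DERIV_subset[OF V'_derivative[OF tb(1)] tb(2)] pd[of p]]
   DERIV_mult[OF DERIV_subset[OF V_derivative[OF tb(1)] tb(2)] pd[of "pderiv p"]]]
   DERIV_mult[OF Xd pd[of "pderiv (pderiv p)"]]] DERIV_mult[OF Xd pd[of p]], of al]
 show "(I al has_real_derivative G al t * poly p (t - a)
   + (X al t - al) * (poly (pderiv (pderiv (pderiv p))) (t - a) + poly (pderiv p) (t - a))) (at t within {a..e})"
  unfolding I_def by (rule DERIV_cong[OF d]) (simp add: algebra_simps)
qed

lemma displacement_ge_motion:
 assumes e: "a < e" "e <= b"
 shows "\<exists>c>0. \<forall>al. \<exists>t\<in>{a..e}. c * motion al <= \<bar>X al t - al\<bar>"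
proof -
 define l where "l = e - a"
 have l: "0 < l" using e by (simp add: l_def)
 define P :: "real poly => real poly" where "P q = [:l, -1:] * [:l, -1:] * [:l, -1:] * q" for q
 let ?k = "%q s. poly (pderiv (pderiv (pderiv (P q)))) s + poly (pderiv (P q)) s"
 have Kex: "\<exists>K. \<forall>s\<in>{0..l}. \<bar>poly (P q) s\<bar> <= K & \<bar>?k q s\<bar> <= K" for q
 proof -
  have "bounded ((%s. \<bar>poly (P q) s\<bar> + \<bar>?k q s\<bar>) ` {0..l})"
   by (intro compact_imp_bounded compact_continuous_image continuous_intros) auto
  then obtain K where "\<forall>s\<in>{0..l}. \<bar>poly (P q) s\<bar> + \<bar>?k q s\<bar> <= K" unfolding bounded_iff by auto
  then show ?thesis by (intro exI[of _ K]) (smt (verit))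
 qed
 define q1 q2 q3 :: "real poly" where q_def: "q1 = [:1:]" "q2 = [:0, 1:]" "q3 = [:0, 0, 0, 1:]"
 obtain K1 K2 K3 where K: "!!s. s \<in> {0..l} ==> \<bar>poly (P q1) s\<bar> <= K1 & \<bar>?k q1 s\<bar> <= K1"
  "!!s. s \<in> {0..l} ==> \<bar>poly (P q2) s\<bar> <= K2 & \<bar>?k q2 s\<bar> <= K2"
  "!!s. s \<in> {0..l} ==> \<bar>poly (P q3) s\<bar> <= K3 & \<bar>?k q3 s\<bar> <= K3"
  using Kex[of q1] Kex[of q2] Kex[of q3] by blast
 have "\<exists>C>0. \<forall>al R. (\<forall>t\<in>{a..e}. \<bar>X al t - al\<bar> <= R) --> motion al <= C * R"
 proof -
  define K where "K = \<bar>K1\<bar> + \<bar>K2\<bar> + \<bar>K3\<bar>"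
  define C3 where "C3 = 140 * 324 * K / l ^ 6"
  define C where "C = K * l * (324 * C3 + 1)"
  have K0: "0 <= K" by (simp add: K_def)
  have C30: "0 <= C3" using K0 l by (simp add: C3_def)
  have *: "motion al <= (C / l ^ 3 + (C + 3 * l\<^sup>2 * (C / l ^ 3)) / l ^ 3 + C3) * R"
   if R: "!!t. t \<in> {a..e} ==> \<bar>X al t - al\<bar> <= R" for al R
  proof -
   have R0: "0 <= R" using R[of a] e by simp
   have sl: "t - a \<in> {0..l}" if "t \<in> {a..e}" for t using that by (auto simp: l_def)
   have tab: "t \<in> {a..b}" if "t \<in> {a..e}" for t using that e by auto
   let ?D = "%q t. G al t * poly (P q) (t - a) + (X al t - al) * ?k q (t - a)"
   note T = test_identity[OF e P_def[unfolded l_def]]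
   have dk: "\<bar>(X al t - al) * ?k q3 (t - a)\<bar> <= R * K" if t: "t \<in> {a..e}" for t
    unfolding abs_mult using K(3)[OF sl[OF t]] R[OF t] R0 by (intro mult_mono) (auto simp: K_def)
   have G0: "G al a <= C3 * R"
   proof -
    define Q where "Q = [:0, 0, 0, 0, l ^ 3 / 4, -3 * l\<^sup>2 / 5, l / 2, -1 / 7:]"
    have Q': "pderiv Q = P q3" by (simp add: Q_def P_def q_def pderiv_pCons power3_eq_cube power2_eq_square)
    have Ql: "poly Q l = l ^ 7 / 140" by (simp add: Q_def algebra_simps eval_nat_numeral)
    have Qd: "((%t. poly Q (t - a)) has_real_derivative poly (P q3) (t - a)) (at t within {a..e})" for t
     using DERIV_chain2[OF poly_DERIV DERIV_diff[OF DERIV_ident DERIV_const], of Q] Q' by simp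
    let ?I = "%t. V' al t * poly (P q3) (t - a) - V al t * poly (pderiv (P q3)) (t - a)
     + (X al t - al) * poly (pderiv (pderiv (P q3))) (t - a) + (X al t - al) * poly (P q3) (t - a)"
    let ?J = "%t. ?I t - G al a / 324 * poly Q (t - a) + R * K * (t - a)"
    have Jd: "(?J has_real_derivative ?D q3 t - G al a / 324 * poly (P q3) (t - a) + R * K * (1 - 0)) (at t within {a..e})"
     if "t \<in> {a..e}" for t
     by (intro DERIV_add DERIV_diff DERIV_cmult Qd T(3) that DERIV_ident DERIV_const)
    have "?J a <= ?J e"
    proof (rule nondecreasing_within[OF Jd])
     fix t assume t: "t \<in> {a..e}"
     have p0: "0 <= poly (P q3) (t - a)" using sl[OF t] unfolding P_def q_def poly_mult by (auto intro!: mult_nonneg_nonneg)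
     have "G al a / 324 * poly (P q3) (t - a) <= G al t * poly (P q3) (t - a)"
      using G_comparable[OF tab[OF t] a_mem, of al] by (intro mult_right_mono p0) simp
     then show "0 <= ?D q3 t - G al a / 324 * poly (P q3) (t - a) + R * K * (1 - 0)" using dk[OF t] by (simp add: abs_le_iff)
    qed (use e in auto)
    moreover have "?I a = 0" "?I e = 0" unfolding T(1,2) by (simp_all add: q_def pderiv_pCons)
    moreover have "poly Q (a - a) = 0" by (simp add: Q_def)
    ultimately have "G al a / 324 * poly Q l <= R * K * l" by (simp add: l_def)
    then have "G al a / 324 * (l ^ 7 / 140) <= R * K * l" unfolding Ql .
    then have "G al a * l ^ 6 * l <= 140 * 324 * K * R * l" by (simp add: power_Suc[symmetric] mult_ac) (simp add: eval_nat_numeral mult_ac)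
    then have "G al a * l ^ 6 <= 140 * 324 * K * R" using l by simp
    then show ?thesis using l by (simp add: C3_def pos_le_divide_eq)
   qed
   have E: "\<bar>V' al a * (l ^ 3 * poly q 0) - V al a * (l ^ 3 * poly (pderiv q) 0 - 3 * l\<^sup>2 * poly q 0)\<bar> <= C * R"
    if q: "!!s. s \<in> {0..l} ==> \<bar>poly (P q) s\<bar> <= K & \<bar>?k q s\<bar> <= K" for q
   proof -
    have "norm (?D q t) <= K * (324 * C3 + 1) * R" if t: "t \<in> {a..e}" for t
    proof -
     have "G al t <= 324 * (C3 * R)" using G_comparable[OF a_mem tab[OF t], of al] G0 by linarith
     then have "\<bar>G al t * poly (P q) (t - a)\<bar> <= 324 * (C3 * R) * K"
      unfolding abs_mult using q[OF sl[OF t]] G_nonneg[where al=al and t=t] C30 R0 by (intro mult_mono) auto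
     moreover have "\<bar>(X al t - al) * ?k q (t - a)\<bar> <= R * K"
      unfolding abs_mult using q[OF sl[OF t]] R[OF t] R0 by (intro mult_mono) auto
     moreover have "K * (324 * C3 + 1) * R = 324 * (C3 * R) * K + R * K" by (simp add: algebra_simps)
     ultimately show ?thesis unfolding real_norm_def by linarith
    qed
    note B = this
    have "a \<in> {a..e}" "e \<in> {a..e}" using e by auto
    from field_differentiable_bound[OF _ T(3) B this] show ?thesis
     unfolding T(1,2) using e by (simp add: C_def l_def abs_minus_commute mult_ac)
   qed
   have "\<bar>V al a * l ^ 3\<bar> <= C * R" using E[of q2] K(2) by (fastforce simp: q_def K_def pderiv_pCons)
   then have V: "\<bar>V al a\<bar> <= C / l ^ 3 * R" using l by (simp add: abs_mult pos_le_divide_eq)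
   have "\<bar>V' al a * l ^ 3 + V al a * (3 * l\<^sup>2)\<bar> <= C * R" using E[of q1] K(1) by (fastforce simp: q_def K_def pderiv_pCons)
   moreover have "\<bar>V al a * (3 * l\<^sup>2)\<bar> <= C / l ^ 3 * R * (3 * l\<^sup>2)" unfolding abs_mult using V by (intro mult_mono) auto
   ultimately have "\<bar>V' al a * l ^ 3\<bar> <= (C + 3 * l\<^sup>2 * (C / l ^ 3)) * R" by (simp add: algebra_simps)
   then have "\<bar>V' al a\<bar> <= (C + 3 * l\<^sup>2 * (C / l ^ 3)) / l ^ 3 * R" using l by (simp add: abs_mult pos_le_divide_eq)
   with V G0 show ?thesis by (simp add: motion_def distrib_right)
  qed
  have "0 <= C" using K0 l C30 by (simp add: C_def)
  then have "0 < 1 + (C / l ^ 3 + (C + 3 * l\<^sup>2 * (C / l ^ 3)) / l ^ 3 + C3)" using l C30 by (intro add_pos_nonneg) auto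
  moreover have "motion al <= (1 + (C / l ^ 3 + (C + 3 * l\<^sup>2 * (C / l ^ 3)) / l ^ 3 + C3)) * R"
   if R: "\<forall>t\<in>{a..e}. \<bar>X al t - al\<bar> <= R" for al R
  proof -
   have "0 <= R" using bspec[OF R, of a] e by simp
   then show ?thesis using *[of al R] R by (simp add: distrib_right)
  qed
  ultimately show ?thesis by blast
 qed
 then obtain C where C: "0 < C" "!!al R. (\<forall>t\<in>{a..e}. \<bar>X al t - al\<bar> <= R) ==> motion al <= C * R" by blast
 have "\<exists>t\<in>{a..e}. 1 / C * motion al <= \<bar>X al t - al\<bar>" for al
 proof -
  have "continuous_on {a..e} (X al)" by (rule continuous_on_subset[OF flow_continuous]) (use e in auto)
  then have "\<exists>m\<in>{a..e}. \<forall>t\<in>{a..e}. \<bar>X al t - al\<bar> <= \<bar>X al m - al\<bar>"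
   using e by (intro continuous_attains_sup continuous_intros) auto
  then obtain m where m: "m \<in> {a..e}" "\<forall>t\<in>{a..e}. \<bar>X al t - al\<bar> <= \<bar>X al m - al\<bar>" by blast
  show ?thesis using C(2)[OF m(2)] C(1) m(1) by (intro bexI[of _ m]) (auto simp: divide_le_eq mult.commute)
 qed
 then show ?thesis using C(1) by (intro exI[of _ "1 / C"]) auto
qed

end

section \<open>The slope and its modulus of continuity\<close>

lemma powr_small:
 fixes dl K e :: real
 assumes dl: "0 < dl" and K: "0 <= K" and e: "0 < e"
 shows "\<exists>x0>0. \<forall>x. 0 <= x --> x <= x0 --> K * x powr dl <= e"
proof (intro exI[of _ "(e / (K + 1)) powr (1 / dl)"] conjI allI impI)
 show "0 < (e / (K + 1)) powr (1 / dl)" using e K by simp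
 fix x assume x: "0 <= x" "x <= (e / (K + 1)) powr (1 / dl)"
 have "x powr dl <= ((e / (K + 1)) powr (1 / dl)) powr dl" using x dl by (intro powr_mono2) auto
 also have "... = e / (K + 1)" using dl e K by (simp add: powr_powr)
 finally have "K * x powr dl <= (K + 1) * (e / (K + 1))" using K by (intro mult_mono) auto
 then show "K * x powr dl <= e" using K by simp
qed

context short_solution
begin

lemma F_derivative:
 assumes t: "t \<in> {a..b}"
 shows "(F al has_real_derivative uL u (X al t) t - (F al t)\<^sup>2) (at t within {a..b})"
proof -
 obtain W where W: "!!al t. t \<in> {a..b} ==> (W al has_real_derivative ux (uH u) (X al t) t - F al t * W al t) (at t within {a..b})"
  and vW: "!!al t f. t \<in> {a..b} ==> (\<forall>be. f (X be t) = V be t) ==> (f has_real_derivative W al t) (at (X al t))"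
  using transport_derivative[OF hfam_hil[OF dl u] u_Hball[OF a_mem] _ V_derivative] by (metis flow_start)
 have FW: "F al s = W al s" if s: "s \<in> {a..b}" for s
  by (rule DERIV_imp_deriv, rule vW[OF s]) simp
 have "(W al has_real_derivative uL u (X al t) t - (F al t)\<^sup>2) (at t within {a..b})"
  using W[OF t, of al] by (simp add: ux_uH[OF dl u t] FW[OF t, symmetric] power2_eq_square)
 then show ?thesis by (rule has_field_derivative_transform_within[OF _ zero_less_one t]) (simp add: FW)
qed

lemma F_bound: "t \<in> {a..b} ==> \<bar>F al t\<bar> <= M" by (rule Hball_deriv_bound[OF u_Hball])

lemma F_label_holder:
 assumes t: "t \<in> {a..b}"
 shows "\<bar>F al t - F be t\<bar> <= 4 / 3 * M * \<bar>al - be\<bar> powr dl"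
 using Hball_holder[OF u_Hball[OF t], of "X al t" "X be t"] mult_left_mono[OF flow_powr(1)[OF t, of al be] M0] by simp

text \<open>A bound for the oscillation of \<open>\<Lambda> u\<close> and of the slope between two characteristics bounds the
 change of the difference of the slopes.\<close>

lemma F_increment:
 assumes osc: "!!r. r \<in> {a..b} ==> \<bar>uL u (X al r) r - uL u (X be r) r\<bar> <= A"
  and F: "!!r. r \<in> {a..b} ==> \<bar>F al r - F be r\<bar> <= B" and s: "s \<in> {a..b}" and t: "t \<in> {a..b}"
 shows "\<bar>(F al t - F be t) - (F al s - F be s)\<bar> <= (A + 2 * M * B) * \<bar>t - s\<bar>"
proof -
 have d: "((%t. F al t - F be t) has_real_derivative (uL u (X al r) r - (F al r)\<^sup>2) - (uL u (X be r) r - (F be r)\<^sup>2)) (at r within {a..b})"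
  if "r \<in> {a..b}" for r by (intro DERIV_diff F_derivative that)
 have "norm ((uL u (X al r) r - (F al r)\<^sup>2) - (uL u (X be r) r - (F be r)\<^sup>2)) <= A + 2 * M * B" if r: "r \<in> {a..b}" for r
 proof -
  have "\<bar>(F al r)\<^sup>2 - (F be r)\<^sup>2\<bar> = \<bar>F al r + F be r\<bar> * \<bar>F al r - F be r\<bar>"
   by (simp add: abs_mult[symmetric] power2_eq_square algebra_simps)
  also have "... <= 2 * M * B" using F_bound[OF r, of al] F_bound[OF r, of be] M0 by (intro mult_mono F r) auto
  finally show ?thesis using osc[OF r] unfolding real_norm_def by linarith
 qed
 from field_differentiable_bound[OF _ d this t s] show ?thesis by simp
qed

definition slope_const :: real where "slope_const = (6 * Lam_const dl * M + 2 * M * M) * (4 / 3)"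

lemma slope_const_nonneg: "0 <= slope_const" using M0 Lam_const_pos[OF dl] by (simp add: slope_const_def)

lemma F_increment_holder:
 assumes s: "s \<in> {a..b}" and t: "t \<in> {a..b}"
 shows "\<bar>(F al t - F be t) - (F al s - F be s)\<bar> <= slope_const * \<bar>al - be\<bar> powr dl * \<bar>t - s\<bar>"
proof -
 define r where "r = \<bar>al - be\<bar> powr dl"
 have "\<bar>uL u (X al q) q - uL u (X be q) q\<bar> <= 6 * Lam_const dl * M * (4 / 3 * r)" if q: "q \<in> {a..b}" for q
  unfolding r_def using M0 Lam_const_pos[OF dl]
  by (intro order_trans[OF Lam_holder[OF dl u_Hball[OF q]]] mult_left_mono flow_powr(1)[OF q]) auto
 from F_increment[OF this F_label_holder s t] show ?thesis by (simp add: slope_const_def r_def algebra_simps)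
qed

text \<open>The slope is little-Hoelder on the label balls around \<open>\<alpha>\<close> whose radius is a fraction of
 the motion of the particle \<open>\<alpha>\<close>.\<close>

definition flat_near :: "real => real => real => bool" where
 "flat_near c kp t \<longleftrightarrow> (\<forall>al be ga. \<bar>be - al\<bar> <= kp * motion al --> \<bar>ga - al\<bar> <= kp * motion al -->
  \<bar>F be t - F ga t\<bar> <= c * \<bar>be - ga\<bar> powr dl)"

definition right_continuous_start :: bool where
 "right_continuous_start \<longleftrightarrow> (\<forall>et>0. \<exists>h>0. \<forall>t\<in>{a..b}. t <= a + h -->
  (\<forall>x y. \<bar>(ux u x t - ux u x a) - (ux u y t - ux u y a)\<bar> <= et * \<bar>x - y\<bar> powr dl))"

lemma telescoping_holder:
 fixes f :: "real => real"
 assumes h: "!!x y. \<bar>f x - f y\<bar> <= K * \<bar>x - y\<bar> powr dl" and \<sigma>: "\<sigma> = 1 \<or> \<sigma> = -1" and ep: "0 < ep"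
 shows "\<bar>\<Sum>k<n. f (x + \<sigma> * real k * ep) - f (x + \<sigma> * real k * ep + ep)\<bar> <= K * (real n * ep) powr dl"
 using \<sigma>
proof
 assume "\<sigma> = 1"
 moreover have "(\<Sum>k<n. f (x + real k * ep) - f (x + real k * ep + ep)) = f x - f (x + real n * ep)"
  by (induction n) (simp_all add: algebra_simps)
 ultimately show ?thesis using h[of x "x + real n * ep"] ep by simp
next
 assume "\<sigma> = -1"
 moreover have "(\<Sum>k<n. f (x - real k * ep) - f (x - real k * ep + ep)) = f (x + ep - real n * ep) - f (x + ep)"
  by (induction n) (simp_all add: algebra_simps)
 ultimately show ?thesis using h[of "x + ep - real n * ep" "x + ep"] ep by simp
qed

text \<open>Continuity of the slope in the Hoelder norm at the initial time means that
 \<open>f \<beta> - f (\<beta> + \<epsilon>)\<close> hardly changes while \<open>\<beta>\<close> moves with the flow. If the motion covers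
 \<open>n\<close> intervals of length \<open>\<epsilon>\<close>, the sum of \<open>n\<close> almost equal increments is at most
 \<open>M (n \<epsilon>)\<^sup>\<delta>\<close>, so that each of them is small compared with \<open>\<epsilon>\<^sup>\<delta>\<close>.\<close>

lemma flat_start:
 assumes rc: right_continuous_start and ab': "a < b" and et: "0 < et"
 shows "\<exists>kp>0. flat_near et kp a"
proof -
 let ?f = "%x. ux u x a"
 note f_holder = Hball_holder[OF u_Hball[OF a_mem]]
 from powr_small[OF dl(1) M0, of "et / 4"] et obtain x0 where x0: "0 < x0" "!!x. 0 <= x ==> x <= x0 ==> M * x powr dl <= et / 4" by auto
 obtain n :: nat where n: "0 < n" "M * real n powr (dl - 1) <= et / 2"
 proof -
  have "((%x. x powr (dl - 1)) \<longlongrightarrow> 0) at_top" using dl by (intro tendsto_neg_powr filterlim_ident) auto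
  then have "((%n. M * real n powr (dl - 1)) \<longlongrightarrow> M * 0) sequentially"
   by (intro tendsto_mult tendsto_const filterlim_compose[OF _ filterlim_real_sequentially])
  then have "\<forall>\<^sub>F n in sequentially. M * real n powr (dl - 1) < et / 2"
   by (rule order_tendstoD(2)) (use et in simp)
  with eventually_gt_at_top[of 0] have "\<forall>\<^sub>F n in sequentially. 0 < n & M * real n powr (dl - 1) <= et / 2"
   by eventually_elim simp
  then have "\<exists>n. 0 < n & M * real n powr (dl - 1) <= et / 2" by (rule eventually_happens'[OF sequentially_bot])
  then show ?thesis using that by blast
 qed
 define et1 where "et1 = et / 12"
 have "0 < et1" using et by (simp add: et1_def)
 note rc[unfolded right_continuous_start_def, THEN spec, THEN mp, OF this]
 then obtain h0 where h0: "0 < h0" "\<forall>t\<in>{a..b}. t <= a + h0 -->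
  (\<forall>x y. \<bar>(ux u x t - ux u x a) - (ux u y t - ux u y a)\<bar> <= et1 * \<bar>x - y\<bar> powr dl)" by blast
 define h where "h = min (min h0 (b - a)) (min (et / (8 * (slope_const + 1))) (x0 / (2 * (M + 1))))"
 have h: "0 < h" "h <= h0" "a + h <= b" "h <= et / (8 * (slope_const + 1))" "h <= x0 / (2 * (M + 1))"
  using h0 ab' et slope_const_nonneg x0 M0 by (auto simp: h_def min_def)
 have hM: "4 / 3 * M * h <= x0"
 proof -
  have "4 / 3 * M * h <= 2 * (M + 1) * h" using h(1) M0 by (intro mult_right_mono) auto
  also have "... <= x0" using h(5) M0 by (simp add: pos_le_divide_eq mult.commute)
  finally show ?thesis .
 qed
 have hS: "slope_const * h <= et / 8"
 proof -
  have "slope_const * h <= (slope_const + 1) * h" using h(1) by (intro mult_right_mono) auto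
  also have "... <= et / 8" using h(4) slope_const_nonneg by (simp add: pos_le_divide_eq mult_ac)
  finally show ?thesis .
 qed
 have move: "\<bar>(?f (X ga t) - ?f (X ga t + ep)) - (?f ga - ?f (ga + ep))\<bar> <= et / 2 * ep powr dl"
  if t: "t \<in> {a..a + h}" and ep: "0 < ep" for ga ep t
 proof -
  have tb: "t \<in> {a..b}" "t <= a + h0" using t h by auto
  define e where "e = ep powr dl"
  let ?be = "ga + ep"
  have "\<bar>(F ga t - F ?be t) - (?f ga - ?f ?be)\<bar> <= slope_const * e * (t - a)"
   using F_increment_holder[OF a_mem tb(1), of ga ?be] ep t by (simp add: e_def)
  also have "... <= slope_const * e * h" using slope_const_nonneg t by (intro mult_left_mono) (auto simp: e_def)
  also have "... <= et / 8 * e" using mult_right_mono[OF hS, of e] by (simp add: e_def mult_ac)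
  finally have 1: "\<bar>(F ga t - F ?be t) - (?f ga - ?f ?be)\<bar> <= et / 8 * e" .
  have "\<bar>(F ga t - ?f (X ga t)) - (F ?be t - ?f (X ?be t))\<bar> <= et1 * \<bar>X ga t - X ?be t\<bar> powr dl" by (rule h0(2)[rule_format, OF tb])
  also have "... <= et1 * (4 / 3 * e)" using flow_powr(1)[OF tb(1), of ga ?be] et ep by (intro mult_left_mono) (auto simp: et1_def e_def)
  finally have 2: "\<bar>(F ga t - ?f (X ga t)) - (F ?be t - ?f (X ?be t))\<bar> <= et / 9 * e" by (simp add: et1_def mult_ac)
  have "\<bar>X ?be t - (X ga t + ep)\<bar> <= 4 / 3 * M * ep * (t - a)"
   using flow_difference(2)[OF a_mem tb(1), of ?be ga] ep t by (simp add: algebra_simps)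
  also have "... <= 4 / 3 * M * ep * h" using M0 ep t by (intro mult_left_mono) auto
  finally have "\<bar>X ?be t - (X ga t + ep)\<bar> powr dl <= (4 / 3 * M * h * ep) powr dl" using dl by (intro powr_mono2) (auto simp: mult_ac)
  also have "... = (4 / 3 * M * h) powr dl * e" unfolding e_def by (rule powr_mult)
  finally have "\<bar>?f (X ?be t) - ?f (X ga t + ep)\<bar> <= M * ((4 / 3 * M * h) powr dl * e)"
   using M0 by (intro order_trans[OF f_holder] mult_left_mono) auto
  also have "... <= et / 4 * e"
   using mult_right_mono[OF x0(2)[of "4 / 3 * M * h"], of e] hM M0 h by (simp add: e_def mult_ac)
  finally have 3: "\<bar>?f (X ?be t) - ?f (X ga t + ep)\<bar> <= et / 4 * e" .
  have "0 <= et * e" using et by (simp add: e_def)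
  moreover have "et / 8 * e = 1 / 8 * (et * e)" "et / 9 * e = 1 / 9 * (et * e)" "et / 4 * e = 1 / 4 * (et * e)" "et / 2 * e = 1 / 2 * (et * e)" by simp_all
  ultimately show ?thesis using 1 2 3 unfolding e_def[symmetric] by linarith
 qed
 from displacement_ge_motion[of "a + h"] h obtain c where c: "0 < c"
  "!!al. \<exists>t\<in>{a..a + h}. c * motion al <= \<bar>X al t - al\<bar>" by auto
 define kp where "kp = c / (4 * real n)"
 have kp: "0 < kp" "4 * real n * kp = c" using c n by (auto simp: kp_def)
 have key: "\<bar>?f be - ?f (be + ep)\<bar> <= et * ep powr dl"
  if near: "\<bar>be - al\<bar> <= kp * motion al" and ep: "0 < ep" "ep <= 2 * (kp * motion al)" for al be ep
 proof -
  obtain t where t: "t \<in> {a..a + h}" "c * motion al <= \<bar>X al t - al\<bar>" using c(2) by blast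
  have tb: "t \<in> {a..b}" using t h by auto
  define m where "m = kp * motion al"
  have cm: "c * motion al = 4 * (real n * m)" using kp(2) by (simp add: m_def mult_ac)
  have "m <= real n * m" using n mult_right_mono[of 1 "real n" m] ep by (simp add: m_def)
  moreover have "\<bar>(X be t - X al t) - (be - al)\<bar> <= 1 / 3 * m" using flow_near_start[OF tb, of be al] near by (simp add: m_def)
  moreover have "real n * ep <= 2 * (real n * m)" using mult_left_mono[OF ep(2), of "real n"] by (simp add: m_def)
  moreover have "0 < m" using ep by (simp add: m_def)
  ultimately have far: "real n * ep <= \<bar>X be t - be\<bar>" using t(2) unfolding cm by linarith
  define \<sigma> :: real where "\<sigma> = (if be <= X be t then 1 else -1)"
  have \<sigma>: "\<sigma> = 1 \<or> \<sigma> = -1" "\<bar>X be t - be\<bar> = \<sigma> * (X be t - be)" "\<sigma> * \<sigma> = 1" by (auto simp: \<sigma>_def)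
  have step: "\<bar>(?f (be + \<sigma> * real k * ep) - ?f (be + \<sigma> * real k * ep + ep)) - (?f be - ?f (be + ep))\<bar> <= et / 2 * ep powr dl"
   if k: "k < n" for k
  proof -
   have "real k * ep <= real n * ep" using k ep by (intro mult_right_mono) auto
   then have le: "real k * ep <= \<sigma> * (X be t - be)" using far unfolding \<sigma>(2) by linarith
   have Xc: "continuous_on {a..t} (X be)" by (rule continuous_on_subset[OF flow_continuous]) (use tb in auto)
   have "\<exists>s\<ge>a. s <= t & \<sigma> * (X be s - be) = real k * ep"
   proof (rule IVT'[where f="%s. \<sigma> * (X be s - be)" and b=t and y="real k * ep", OF _ le])
    show "\<sigma> * (X be a - be) <= real k * ep" using ep by simp
    show "a <= t" using t by simp
    show "continuous_on {a..t} (%s. \<sigma> * (X be s - be))" by (intro continuous_intros Xc)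
   qed
   then obtain s where s: "a <= s" "s <= t" "\<sigma> * (X be s - be) = real k * ep" by blast
   have "\<sigma> * (\<sigma> * (X be s - be)) = X be s - be" using \<sigma>(1) by auto
   then have "X be s = be + \<sigma> * real k * ep" by (simp add: s(3) mult.assoc)
   then show ?thesis using move[of s ep be] s t ep by simp
  qed
  define g where "g = ?f be - ?f (be + ep)"
  let ?T = "%k. ?f (be + \<sigma> * real k * ep) - ?f (be + \<sigma> * real k * ep + ep)"
  have "\<bar>(\<Sum>k<n. ?T k) - real n * g\<bar> = \<bar>\<Sum>k<n. ?T k - g\<bar>" by (simp add: sum_subtractf)
  also have "... <= (\<Sum>k<n. et / 2 * ep powr dl)" using step by (intro order_trans[OF sum_abs] sum_mono) (auto simp: g_def)
  finally have "\<bar>(\<Sum>k<n. ?T k) - real n * g\<bar> <= real n * (et / 2 * ep powr dl)" by simp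
  moreover have "\<bar>\<Sum>k<n. ?T k\<bar> <= M * (real n * ep) powr dl" by (rule telescoping_holder[OF f_holder \<sigma>(1) ep(1)])
  moreover have "M * (real n * ep) powr dl <= real n * (et / 2 * ep powr dl)"
  proof -
   have "real n powr dl = real n * real n powr (dl - 1)" using n by (simp add: powr_diff)
   then have "M * (real n * ep) powr dl = real n * (M * real n powr (dl - 1) * ep powr dl)" using n ep by (simp add: powr_mult)
   also have "... <= real n * (et / 2 * ep powr dl)" using n by (intro mult_left_mono mult_right_mono) auto
   finally show ?thesis .
  qed
  ultimately have "\<bar>real n * g\<bar> <= real n * (et / 2 * ep powr dl) + real n * (et / 2 * ep powr dl)" by linarith
  also have "... = real n * (et * ep powr dl)" by (simp add: algebra_simps)
  finally show ?thesis using n by (simp add: abs_mult g_def)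
 qed
 have "flat_near et kp a"
  unfolding flat_near_def
 proof (intro allI impI)
  fix al be ga assume b: "\<bar>be - al\<bar> <= kp * motion al" "\<bar>ga - al\<bar> <= kp * motion al"
  consider "be < ga" | "ga < be" | "be = ga" by linarith
  then show "\<bar>F be a - F ga a\<bar> <= et * \<bar>be - ga\<bar> powr dl"
  proof cases
   case 1
   have "ga - be <= 2 * (kp * motion al)" using b by linarith
   then show ?thesis using key[OF b(1), of "ga - be"] 1 by simp
  next
   case 2
   have "be - ga <= 2 * (kp * motion al)" using b by linarith
   then show ?thesis using key[OF b(2), of "be - ga"] 2 by (simp add: abs_minus_commute)
  qed simp
 qed
 then show ?thesis using kp(1) by blast
qed

text \<open>One pass over the time interval halves the constant: by the two-scale estimate for
 \<open>\<Lambda>\<close>, the slope on a much smaller label ball only sees the flat part of the slope.\<close>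

lemma flat_step:
 assumes start: "!!et. 0 < et ==> \<exists>kp>0. flat_near et kp a" and ex: "\<exists>kp>0. \<forall>t\<in>{a..b}. flat_near c kp t"
  and c: "0 <= c" and et: "0 < et"
 shows "\<exists>kp>0. \<forall>t\<in>{a..b}. flat_near (c / 2 + et) kp t"
proof -
 define L where "L = Lam_const dl"
 have L: "0 < L" unfolding L_def by (rule Lam_const_pos[OF dl])
 define K where "K = M + 3 / 2 * c"
 have K: "0 <= K" "M <= K" "3 / 2 * c <= K" using M0 c by (simp_all add: K_def)
 from start[of "et / 2"] et obtain kp0 where kp0: "0 < kp0" "flat_near (et / 2) kp0 a" by auto
 from ex obtain kp where kp: "0 < kp" "!!t. t \<in> {a..b} ==> flat_near c kp t" by blast
 have "0 < 1 - dl" "0 <= 4 * L * K" "0 < et / 2" using dl L K et by auto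
 from powr_small[OF this] obtain x0 where x0: "0 < x0" "!!x. 0 <= x ==> x <= x0 ==> 4 * L * K * x powr (1 - dl) <= et / 2" by blast
 define \<theta> where "\<theta> = min 1 x0"
 have \<theta>: "0 < \<theta>" "\<theta> <= 1" "4 * L * K * \<theta> powr (1 - dl) <= et / 2" using x0 by (auto simp: \<theta>_def)
 define kp' where "kp' = min kp0 (kp * \<theta> / 8)"
 have kp': "0 < kp'" "kp' <= kp0" "kp' <= kp * \<theta> / 8" using kp0 kp \<theta> by (auto simp: kp'_def)
 have "kp * \<theta> <= kp * 1" using \<theta>(2) kp(1) by (intro mult_left_mono) auto
 then have kp8: "kp' <= kp / 8" using kp'(3) by linarith
 have main: "\<bar>F be t - F ga t\<bar> <= (c / 2 + et) * \<bar>be - ga\<bar> powr dl"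
  if t: "t \<in> {a..b}" and b: "\<bar>be - al\<bar> <= kp' * motion al" "\<bar>ga - al\<bar> <= kp' * motion al" and less: "be < ga" for t al be ga
 proof -
  define m where "m = motion al"
  define R where "R = \<bar>be - ga\<bar> powr dl"
  have R0: "0 <= R" by (simp add: R_def)
  have "0 < kp' * m" using b less by (simp add: m_def)
  then have m: "0 < m" using kp'(1) by (simp add: zero_less_mult_iff)
  have mono: "x * m <= y * m" if "x <= y" for x y using that m by simp
  define \<rho> where "\<rho> = kp * m / 3"
  have \<rho>: "0 < \<rho>" using kp m by (simp add: \<rho>_def)
  have F: "\<bar>F be s - F ga s\<bar> <= c * R" if s: "s \<in> {a..b}" for s
  proof -
   have "kp' * m <= kp * m" by (rule mono) (use kp8 kp in simp)
   then show ?thesis using kp(2)[OF s] b unfolding flat_near_def R_def m_def by (meson order_trans)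
  qed
  have osc: "\<bar>uL u (X be s) s - uL u (X ga s) s\<bar> <= (6 * L * c + et / 2) * R" if s: "s \<in> {a..b}" for s
  proof -
   define r where "r = X ga s - X be s"
   have r: "0 < r" using flow_mono[OF s less] by (simp add: r_def)
   have "r <= 4 / 3 * (2 * (kp' * m))" using flow_difference(1)[OF s s, of ga be] b less r by (simp add: r_def m_def)
   also have "... <= 4 / 3 * (2 * (kp * \<theta> / 8 * m))" by (intro mult_left_mono mono[OF kp'(3)]) auto
   also have "... = \<theta> * \<rho>" by (simp add: \<rho>_def)
   finally have r\<theta>: "r <= \<theta> * \<rho>" .
   have "\<theta> * \<rho> <= 1 * \<rho>" using \<theta>(2) \<rho> by (intro mult_right_mono) auto
   then have r\<rho>: "r <= \<rho>" using r\<theta> by linarith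
   have ts: "\<bar>ux u (x - z) s - ux u x s\<bar> <= two_scale dl (3 / 2 * c) K \<rho> z" if x: "X be s <= x" "x <= X be s + r" for x z
   proof -
    obtain ga' be' where l: "X ga' s = x" "X be' s = x - z" using flow_surj[OF s] by metis
    have "be <= ga'" using flow_mono[OF s, of ga' be] x(1) l(1) by (meson leD leI)
    moreover have "X ga' s <= X ga s" using x(2) l(1) by (simp add: r_def)
    then have "ga' <= ga" using flow_mono[OF s, of ga ga'] by (meson leD leI)
    ultimately have g: "\<bar>ga' - al\<bar> <= kp' * m" using b unfolding m_def by linarith
    have z: "\<bar>X be' s - X ga' s\<bar> = \<bar>z\<bar>" using l by simp
    show ?thesis
    proof (cases "\<bar>z\<bar> <= \<rho>")
     case True
     have "\<bar>be' - ga'\<bar> <= kp / 2 * m" using flow_lower[OF s, of be' ga'] z True by (simp add: \<rho>_def)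
     moreover have "kp' * m <= kp / 8 * m" by (rule mono[OF kp8])
     moreover have "0 < kp * m" using kp m by simp
     moreover have "kp / 8 * m = 1 / 8 * (kp * m)" "kp / 2 * m = 1 / 2 * (kp * m)" by simp_all
     ultimately have "\<bar>ga' - al\<bar> <= kp * m" "\<bar>be' - al\<bar> <= kp * m" using g by linarith+
     then have "\<bar>F be' s - F ga' s\<bar> <= c * \<bar>be' - ga'\<bar> powr dl" using kp(2)[OF s] unfolding flat_near_def m_def by blast
     also have "... <= c * (3 / 2 * \<bar>z\<bar> powr dl)" using flow_powr(2)[OF s, of be' ga'] c unfolding z by (intro mult_left_mono) auto
     finally show ?thesis using True by (simp add: two_scale_def l)
    next
     case False
     have "\<bar>ux u (x - z) s - ux u x s\<bar> <= M * \<bar>z\<bar> powr dl" using Hball_holder[OF u_Hball[OF s], of "x - z" x] by simp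
     also have "... <= K * \<bar>z\<bar> powr dl" using K(2) by (rule mult_right_mono) simp
     finally show ?thesis using False by (simp add: two_scale_def)
    qed
   qed
   have r1: "r * \<rho> powr (dl - 1) <= r powr dl * \<theta> powr (1 - dl)"
   proof -
    have "r * \<rho> powr (dl - 1) = r powr dl * (r powr (1 - dl) * \<rho> powr (dl - 1))"
     using r by (simp add: powr_add[symmetric] mult.assoc[symmetric])
    also have "... <= r powr dl * ((\<theta> * \<rho>) powr (1 - dl) * \<rho> powr (dl - 1))"
     using r r\<theta> dl by (intro mult_left_mono mult_right_mono powr_mono2) auto
    also have "... = r powr dl * \<theta> powr (1 - dl)" using \<rho> \<theta> by (simp add: powr_mult powr_add[symmetric] mult.assoc)
    finally show ?thesis .
   qed
   have c0: "0 <= 3 / 2 * c" using c by simp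
   from Lam_two_scale[where a="X be s", OF dl u_Hball[OF s] r r\<rho> c0 K(3) ts]
   have "\<bar>uL u (X ga s) s - uL u (X be s) s\<bar> <= 3 * L * (3 / 2 * c * r powr dl + K * (r * \<rho> powr (dl - 1)))"
    by (simp add: r_def L_def mult.assoc)
   also have "... <= 3 * L * (3 / 2 * c * r powr dl + K * (r powr dl * \<theta> powr (1 - dl)))"
    using r1 K(1) L by (intro mult_left_mono add_left_mono) auto
   also have "... = (9 / 2 * L * c + 3 / 4 * (4 * L * K * \<theta> powr (1 - dl))) * r powr dl" by (simp add: algebra_simps)
   also have "... <= (9 / 2 * L * c + 3 / 4 * (et / 2)) * r powr dl" by (intro mult_right_mono add_left_mono mult_left_mono \<theta>(3)) auto
   also have "... <= (9 / 2 * L * c + 3 / 4 * (et / 2)) * (4 / 3 * R)"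
    using flow_powr(1)[OF s, of ga be] r L c et by (intro mult_left_mono) (auto simp: r_def R_def abs_minus_commute)
   also have "... = (6 * L * c + et / 2) * R" by (simp add: algebra_simps)
   finally show ?thesis by (simp add: abs_minus_commute)
  qed
  have "\<bar>(F be t - F ga t) - (F be a - F ga a)\<bar> <= ((6 * L * c + et / 2) * R + 2 * M * (c * R)) * \<bar>t - a\<bar>"
   by (rule F_increment[OF osc F a_mem t])
  also have "... <= ((6 * L * c + et / 2) * R + 2 * M * (c * R)) * (b - a)"
   using t L c et R0 M0 by (intro mult_left_mono) auto
  also have "... = (b - a) * (6 * L + 2 * M) * (c * R) + (b - a) * (et / 2 * R)" by (simp add: algebra_simps)
  also have "... <= 1 / 2 * (c * R) + 1 * (et / 2 * R)"
   using length c R0 et by (intro add_mono mult_right_mono) (auto simp: L_def)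
  finally have 1: "\<bar>(F be t - F ga t) - (F be a - F ga a)\<bar> <= 1 / 2 * (c * R) + 1 * (et / 2 * R)" .
  have "kp' * m <= kp0 * m" by (rule mono[OF kp'(2)])
  then have "\<bar>F be a - F ga a\<bar> <= et / 2 * R" using kp0(2) b unfolding flat_near_def R_def m_def by (meson order_trans)
  moreover have "(c / 2 + et) * R = 1 / 2 * (c * R) + 1 * (et / 2 * R) + et / 2 * R" by (simp add: algebra_simps)
  ultimately show ?thesis using 1 unfolding R_def[symmetric] by linarith
 qed
 have "flat_near (c / 2 + et) kp' t" if t: "t \<in> {a..b}" for t
  unfolding flat_near_def
 proof (intro allI impI)
  fix al be ga assume b: "\<bar>be - al\<bar> <= kp' * motion al" "\<bar>ga - al\<bar> <= kp' * motion al"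
  consider "be < ga" | "ga < be" | "be = ga" by linarith
  then show "\<bar>F be t - F ga t\<bar> <= (c / 2 + et) * \<bar>be - ga\<bar> powr dl"
   using main[OF t b] main[OF t b(2,1)] by cases (auto simp: abs_minus_commute)
 qed
 then show ?thesis using kp'(1) by blast
qed

lemma flat_always:
 assumes rc: right_continuous_start and ab': "a < b" and et: "0 < et"
 shows "\<exists>kp>0. \<forall>t\<in>{a..b}. flat_near et kp t"
proof -
 have pow: "\<exists>kp>0. \<forall>t\<in>{a..b}. flat_near (4 / 3 * M * (1 / 2) ^ n + et / 2) kp t" for n
 proof (induction n)
  case 0
  have "\<bar>F be t - F ga t\<bar> <= (4 / 3 * M + et / 2) * \<bar>be - ga\<bar> powr dl" if "t \<in> {a..b}" for t be ga
   using F_label_holder[OF that, of be ga] et by (simp add: distrib_right add_increasing2)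
  then show ?case by (intro exI[of _ 1]) (simp add: flat_near_def)
 next
  case (Suc n)
  have "0 <= 4 / 3 * M * (1 / 2) ^ n + et / 2" "0 < et / 4" using M0 et by auto
  note * = flat_step[OF flat_start[OF rc ab'] Suc.IH this]
  have eq: "(4 / 3 * M * (1 / 2) ^ n + et / 2) / 2 + et / 4 = 4 / 3 * M * (1 / 2) ^ Suc n + et / 2" by (simp add: field_simps)
  show ?case using * unfolding eq .
 qed
 have "0 < et / 2 / (4 / 3 * M + 1)" using M0 et by simp
 from real_arch_pow_inv[OF this, of "1 / 2"] obtain n where n: "(1 / 2) ^ n < et / 2 / (4 / 3 * M + 1)" by auto
 have "4 / 3 * M * (1 / 2) ^ n <= (4 / 3 * M + 1) * (1 / 2) ^ n" by (intro mult_right_mono) auto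
 also have "... <= et / 2"
 proof -
  have p: "0 < 4 / 3 * M + 1" using M0 by simp
  show ?thesis using n unfolding pos_less_divide_eq[OF p] by (simp only: mult.commute less_imp_le)
 qed
 finally have le: "4 / 3 * M * (1 / 2) ^ n + et / 2 <= et" by simp
 have "flat_near et kp t" if "flat_near (4 / 3 * M * (1 / 2) ^ n + et / 2) kp t" for kp t
  using that mult_right_mono[OF le powr_ge_zero] unfolding flat_near_def by (meson order_trans)
 then show ?thesis using pow[of n] by blast
qed

text \<open>Continuity of the slope in the Hoelder norm at all times: pairs of particles that are close
 relative to their motion are covered by flatness, and for all others the displacement during a
 short time is small compared with their distance.\<close>

lemma slope_continuous:
 assumes rc: right_continuous_start and ab': "a < b" and t: "t \<in> {a..b}" and et: "0 < et"
 shows "\<exists>d>0. \<forall>t'\<in>{a..b}. \<bar>t' - t\<bar> < d --> (\<forall>x y. \<bar>(ux u x t' - ux u x t) - (ux u y t' - ux u y t)\<bar> <= et * \<bar>x - y\<bar> powr dl)"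
proof -
 define c where "c = et / 18"
 have c: "0 < c" using et by (simp add: c_def)
 obtain kp where kp: "0 < kp" "flat_near c kp t" using flat_always[OF rc ab' c] t by blast
 define kp' where "kp' = kp / 4"
 have kp': "0 < kp'" using kp by (simp add: kp'_def)
 have "0 < et / 12" using et by simp
 from powr_small[OF dl(1) M0 this] obtain x0 where x0: "0 < x0" "!!x. 0 <= x ==> x <= x0 ==> M * x powr dl <= et / 12" by blast
 define d where "d = min (min (kp / 6) (kp' * x0 / 2)) (et / (6 * (slope_const + 1)))"
 have d: "0 < d" "d <= kp / 6" "d <= kp' * x0 / 2" "d <= et / (6 * (slope_const + 1))"
 proof -
  show "0 < d" using kp kp' x0 et slope_const_nonneg by (auto simp: d_def)
 qed (unfold d_def, linarith+)
 have dS: "slope_const * d <= et / 6"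
 proof -
  have "slope_const * d <= (slope_const + 1) * d" using d(1) by (intro mult_right_mono) auto
  also have "... <= et / 6" using d(4) slope_const_nonneg by (simp add: pos_le_divide_eq mult_ac)
  finally show ?thesis .
 qed
 have "\<bar>(ux u x t' - ux u x t) - (ux u y t' - ux u y t)\<bar> <= et * \<bar>x - y\<bar> powr dl"
  if t': "t' \<in> {a..b}" and near: "\<bar>t' - t\<bar> < d" for t' x y
 proof -
  define \<tau> where "\<tau> = \<bar>t' - t\<bar>"
  have \<tau>: "0 <= \<tau>" "\<tau> <= d" using near by (auto simp: \<tau>_def)
  have M\<tau>: "M * \<tau> <= 1 / 4"
  proof -
   have "\<tau> <= b - a" using t t' unfolding \<tau>_def atLeastAtMost_iff by linarith
   then show ?thesis using mult_left_mono[of \<tau> "b - a" M] M0 short by linarith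
  qed
  obtain al be where l: "X al t' = x" "X be t' = y" using flow_surj[OF t'] by metis
  obtain al' be' where l': "X al' t = x" "X be' t = y" using flow_surj[OF t] by metis
  define r where "r = \<bar>al - be\<bar>"
  define R where "R = r powr dl"
  have R0: "0 <= R" "0 <= r" by (simp_all add: R_def r_def)
  have disp: "\<bar>X \<omega> t' - X \<omega> t\<bar> <= 2 * motion \<omega> * \<tau>" for \<omega>
  proof -
   have "norm (V \<omega> s) <= 2 * motion \<omega>" if "s \<in> {a..b}" for s using V_le_motion[OF that] by simp
   from field_differentiable_bound[OF _ flow_derivative this t' t] show ?thesis by (simp add: \<tau>_def)
  qed
  have first: "\<bar>(F al t' - F be t') - (F al t - F be t)\<bar> <= et / 6 * R"
  proof -
   have "slope_const * R * \<tau> <= slope_const * R * d" using \<tau> R0 slope_const_nonneg by (intro mult_left_mono) auto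
   also have "... <= et / 6 * R" using mult_right_mono[OF dS R0(1)] by (simp add: mult_ac)
   finally show ?thesis using F_increment_holder[OF t t', of al be] by (simp add: R_def r_def \<tau>_def)
  qed
  have second: "\<bar>(F al t - F al' t) - (F be t - F be' t)\<bar> <= et / 6 * R"
  proof (cases "\<exists>\<omega>. \<omega> \<in> {al, be} & r <= kp' * motion \<omega>")
   case True
   then obtain \<omega> where \<omega>: "\<omega> \<in> {al, be}" "r <= kp' * motion \<omega>" by blast
   define m where "m = motion \<omega>"
   have m0: "0 <= m" unfolding m_def by (rule motion_nonneg)
   have in_ball: "\<bar>\<zeta> - \<omega>\<bar> <= kp * m & \<bar>\<zeta>' - \<omega>\<bar> <= kp * m" if \<zeta>: "\<bar>\<zeta> - \<omega>\<bar> <= kp' * m" and "X \<zeta>' t = X \<zeta> t'" for \<zeta> \<zeta>'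
   proof -
    have "\<bar>(X \<zeta> t' - X \<omega> t') - (X \<zeta> t - X \<omega> t)\<bar> <= 4 / 3 * (M * \<tau> * \<bar>\<zeta> - \<omega>\<bar>)"
     using flow_difference(2)[OF t t', of \<zeta> \<omega>] by (simp add: \<tau>_def mult_ac)
    also have "... <= 4 / 3 * (1 / 4 * (kp' * m))" using M\<tau> \<zeta> M0 \<tau> by (intro mult_left_mono mult_mono) auto
    finally have "\<bar>(X \<zeta> t' - X \<omega> t') - (X \<zeta> t - X \<omega> t)\<bar> <= 1 / 3 * (kp' * m)" by simp
    moreover have "\<bar>X \<omega> t' - X \<omega> t\<bar> <= 2 * (m * (kp / 6))"
    proof -
     have "m * \<tau> <= m * (kp / 6)" using \<tau> d(2) m0 by (intro mult_left_mono) auto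
     moreover have "\<bar>X \<omega> t' - X \<omega> t\<bar> <= 2 * (m * \<tau>)" using disp[of \<omega>] by (simp add: m_def mult.assoc)
     ultimately show ?thesis by linarith
    qed
    moreover have eq: "kp' * m = 1 / 4 * (kp * m)" "m * (kp / 6) = 1 / 6 * (kp * m)" by (simp_all add: kp'_def)
    ultimately have "\<bar>X \<zeta> t' - X \<zeta> t\<bar> <= 5 / 12 * (kp * m)" unfolding eq by linarith
    moreover have "2 / 3 * \<bar>\<zeta>' - \<zeta>\<bar> <= \<bar>X \<zeta> t' - X \<zeta> t\<bar>" using flow_lower[OF t, of \<zeta>' \<zeta>] that(2) by simp
    moreover have "w <= 5 / 8 * q" if "y <= 5 / 12 * q" "2 / 3 * w <= y" for w y q :: real using that by linarith
    ultimately have "\<bar>\<zeta>' - \<zeta>\<bar> <= 5 / 8 * (kp * m)" by blast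
    moreover have "0 <= kp * m" using kp m0 by simp
    ultimately show ?thesis using \<zeta> unfolding eq by (intro conjI; linarith)
   qed
   have "\<bar>al - \<omega>\<bar> <= kp' * m" "\<bar>be - \<omega>\<bar> <= kp' * m" using \<omega> R0(2) unfolding m_def r_def by auto
   then have b: "\<bar>al - \<omega>\<bar> <= kp * m" "\<bar>al' - \<omega>\<bar> <= kp * m" "\<bar>be - \<omega>\<bar> <= kp * m" "\<bar>be' - \<omega>\<bar> <= kp * m"
    using in_ball[of al al'] in_ball[of be be'] l l' by auto
   have "\<bar>F al t - F be t\<bar> <= c * R" using kp(2) b(1,3) unfolding flat_near_def m_def R_def r_def by blast
   moreover have "\<bar>F al' t - F be' t\<bar> <= c * (2 * R)"
   proof -
    have "\<bar>al' - be'\<bar> <= 2 * r" using flow_lower[OF t, of al' be'] flow_difference(1)[OF t' t', of al be] by (simp add: l l' r_def)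
    then have "\<bar>al' - be'\<bar> powr dl <= (2 * r) powr dl" using dl by (intro powr_mono2) auto
    also have "... <= 2 * R" unfolding R_def by (rule powr_scale_le) (use R0 dl in auto)
    finally have "c * \<bar>al' - be'\<bar> powr dl <= c * (2 * R)" using c by (intro mult_left_mono) auto
    moreover have "\<bar>F al' t - F be' t\<bar> <= c * \<bar>al' - be'\<bar> powr dl" using kp(2) b(2,4) unfolding flat_near_def m_def by blast
    ultimately show ?thesis by linarith
   qed
   moreover have "et / 6 * R = c * R + c * (2 * R)" by (simp add: c_def)
   ultimately show ?thesis by linarith
  next
   case False
   have far: "\<bar>F \<omega> t - ux u (X \<omega> t') t\<bar> <= et / 12 * R" if "\<omega> \<in> {al, be}" for \<omega>
   proof -
    have "kp' * motion \<omega> <= r" using False that by (meson linear)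
    then have "motion \<omega> <= r / kp'" using kp' by (simp add: pos_le_divide_eq mult.commute)
    then have "motion \<omega> * \<tau> <= r / kp' * (kp' * x0 / 2)" using \<tau> d(3) R0 kp' by (intro mult_mono) auto
    then have "\<bar>X \<omega> t - X \<omega> t'\<bar> <= x0 * r" using disp[of \<omega>] kp' by (simp add: abs_minus_commute mult_ac)
    then have "\<bar>X \<omega> t - X \<omega> t'\<bar> powr dl <= (x0 * r) powr dl" using dl by (intro powr_mono2) auto
    also have "... = x0 powr dl * R" using x0 R0 by (simp add: powr_mult R_def)
    finally have "M * \<bar>X \<omega> t - X \<omega> t'\<bar> powr dl <= M * x0 powr dl * R" using M0 by (simp add: mult_left_mono mult.assoc)
    also have "... <= et / 12 * R" using x0 by (intro mult_right_mono R0) auto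
    finally show ?thesis using Hball_holder[OF u_Hball[OF t], of "X \<omega> t" "X \<omega> t'"] by linarith
   qed
   have "et / 6 * R = et / 12 * R + et / 12 * R" by simp
   moreover have "\<bar>F al t - F al' t\<bar> <= et / 12 * R" "\<bar>F be t - F be' t\<bar> <= et / 12 * R" using far[of al] far[of be] by (simp_all add: l l')
   ultimately show ?thesis by linarith
  qed
  have "\<bar>(ux u x t' - ux u x t) - (ux u y t' - ux u y t)\<bar> <= et / 6 * R + et / 6 * R"
  proof -
   have "(ux u x t' - ux u x t) - (ux u y t' - ux u y t) = ((F al t' - F be t') - (F al t - F be t)) + ((F al t - F al' t) - (F be t - F be' t))"
    unfolding l l' by simp
   then show ?thesis using first second by linarith
  qed
  also have "... = et / 3 * R" by simp
  also have "... <= et / 3 * (3 / 2 * \<bar>x - y\<bar> powr dl)"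
   using flow_powr(2)[OF t', of al be] et unfolding R_def r_def l by (intro mult_left_mono) auto
  also have "... <= et * \<bar>x - y\<bar> powr dl" using et by simp
  finally show ?thesis .
 qed
 then show ?thesis using d(1) by blast
qed

end

section \<open>Continuation of solutions\<close>

lemma bsol_mono: "bsol dl M a b u ==> M <= N ==> bsol dl N a b u"
 unfolding bsol_def using Hball_mono by blast

lemma bsol_norm_continuous:
 assumes dl: "0 < dl" "dl < 1" and N: "0 <= N" and ab: "a < b" "b - a <= short_time dl N" and u: "bsol dl (2 * N + 1) a b u"
  and start: "((%t. C1_holder_norm dl (%x. u x t - u x a)) \<longlongrightarrow> 0) (at a within {a..b})" and t: "t \<in> {a..b}"
 shows "((%r. C1_holder_norm dl (%x. u x r - u x t)) \<longlongrightarrow> 0) (at t within {a..b})"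
proof -
 define M where "M = 2 * N + 1"
 note ab_less = ab(1)
 have ab': "a <= b" using ab by simp
 note u = u[folded M_def]
 note st = short_time[OF dl N ab' ab(2), folded M_def]
 obtain X where X: "is_flow a b u X" by (rule flow_exists[OF dl ab' bsol_hfam[OF u]])
 have M1: "1 <= M" using N by (simp add: M_def)
 define L where "L = Lam_const dl"
 have "0 < 2 / (1 - dl)" "4 <= 4 / dl" using dl by (simp_all add: pos_le_divide_eq)
 then have L: "4 <= L" unfolding L_def Lam_const_def by linarith
 have LM: "L <= L * M" using M1 L by simp
 have e: "(b - a) * (8 * (1 + 6 * (L * M) + M * M)) <= 1"
 proof -
  have p: "0 < 8 * (1 + 6 * (L * M) + M * M)" using L LM M1 by (intro mult_pos_pos add_pos_nonneg) auto
  show ?thesis using ab(2) unfolding short_time_def M_def[symmetric] L_def[symmetric] mult.assoc[of 6] pos_le_divide_eq[OF p] .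
 qed
 have *: "(b - a) * x <= 1" if "x <= 8 * (1 + 6 * (L * M) + M * M)" for x
  using mult_left_mono[OF that, of "b - a"] ab' e by simp
 have "2 * M <= 1 + M * M" using zero_le_power2[of "M - 1"] by (simp add: power2_eq_square algebra_simps)
 moreover have "0 <= M * M" by simp
 ultimately have "32 <= 8 * (1 + 6 * (L * M) + M * M)" "2 * (6 * L + 2 * M) <= 8 * (1 + 6 * (L * M) + M * M)" using L LM unfolding distrib_left by linarith+
 note *[OF this(1)] *[OF this(2)]
 then have len: "b - a <= 1 / 32" "(b - a) * (6 * Lam_const dl + 2 * M) <= 1 / 2" unfolding L_def by (simp, simp add: algebra_simps)
 interpret short_solution dl M a b u X by unfold_locales (use dl ab' bsol_hfam[OF u] X st u len in auto)
 have C: "(%x. u x r) \<in> C1_holder dl" if "r \<in> {a..b}" for r using Hball_C1_holder(1)[OF u_Hball[OF that]] by simp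
 have D: "deriv (%x. u x r - u x q) = (%x. ux u x r - ux u x q)" if "r \<in> {a..b}" "q \<in> {a..b}" for r q
  by (rule deriv_diff_Hball[OF u_Hball[OF that(1)] u_Hball[OF that(2)]])
 have rc: right_continuous_start unfolding right_continuous_start_def
 proof (intro allI impI)
  fix et :: real assume et: "0 < et"
  have "\<forall>\<^sub>F t in at a within {a..b}. C1_holder_norm dl (%x. u x t - u x a) < et" by (rule order_tendstoD(2)[OF start et])
  then obtain d where d: "0 < d" "!!t. t \<in> {a..b} ==> t ~= a ==> dist t a < d ==> C1_holder_norm dl (%x. u x t - u x a) < et"
   unfolding eventually_at by blast
  have "\<bar>(ux u x t - ux u x a) - (ux u y t - ux u y a)\<bar> <= et * \<bar>x - y\<bar> powr dl" if t: "t \<in> {a..b}" "t <= a + d / 2" for t x y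
  proof (cases "t = a")
   case False
   have "C1_holder_norm dl (%x. u x t - u x a) <= et" using d(2)[OF t(1) False] d(1) t by (simp add: dist_real_def)
   from C1_holder_norm_bounds(3)[OF C1_holder_diff[OF C[OF t(1)] C[OF a_mem]] this] show ?thesis by (simp add: D[OF t(1) a_mem])
  qed (use et in simp)
  then show "\<exists>h>0. \<forall>t\<in>{a..b}. t <= a + h --> (\<forall>x y. \<bar>(ux u x t - ux u x a) - (ux u y t - ux u y a)\<bar> <= et * \<bar>x - y\<bar> powr dl)"
   using d(1) by (intro exI[of _ "d / 2"]) auto
 qed
 show ?thesis unfolding tendsto_iff
 proof (intro allI impI)
  fix e :: real assume e: "0 < e"
  then have e4: "0 < e / 4" by simp
  obtain d1 where d1: "0 < d1" "\<forall>r\<in>{a..b}. \<bar>r - t\<bar> < d1 --> (\<forall>x y. \<bar>(ux u x r - ux u x t) - (ux u y r - ux u y t)\<bar> <= e / 4 * \<bar>x - y\<bar> powr dl)"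
   using slope_continuous[OF rc ab_less t e4] by blast
  obtain d2 where d2: "0 < d2" "!!s x. s \<in> {a..b} ==> \<bar>s - t\<bar> < d2 ==> \<bar>u x s - u x t\<bar> <= e / 4 & \<bar>ux u x s - ux u x t\<bar> <= e / 4
    & \<bar>uH u x s - uH u x t\<bar> <= e / 4 & \<bar>uL u x s - uL u x t\<bar> <= e / 4"
   by (rule hfam_small[OF dl(1) bsol_hfam[OF sol] t e4], rule that, assumption, (blast | metis))
  have "dist (C1_holder_norm dl (%x. u x r - u x t)) 0 < e" if r: "r \<in> {a..b}" "\<bar>r - t\<bar> < min d1 d2" for r
  proof -
   have "C1_holder_norm dl (%x. u x r - u x t) <= e / 4 + e / 4 + e / 4"
    by (rule C1_holder_norm_le) (use r d1(2) d2(2)[OF r(1)] in \<open>simp_all add: D[OF r(1) t]\<close>)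
   moreover have "0 <= C1_holder_norm dl (%x. u x r - u x t)"
    using C1_holder_pointwise(4-6)[OF C1_holder_diff[OF C[OF r(1)] C[OF t]]] unfolding C1_holder_norm_def by linarith
   ultimately show ?thesis using e unfolding dist_real_def by linarith
  qed
  then show "\<forall>\<^sub>F r in at t within {a..b}. dist (C1_holder_norm dl (%x. u x r - u x t)) 0 < e"
   unfolding eventually_at using d1(1) d2(1) by (intro exI[of _ "min d1 d2"]) (auto simp: dist_real_def)
 qed
qed

text \<open>A solution whose norm is small compared with the remaining lifespan can be continued: the
 local solution started shortly before the end agrees with it by uniqueness and inherits the
 continuity in the Hoelder norm.\<close>

lemma solution_extends:
 assumes dl: "0 < dl" "dl < 1" and u: "burgers_hilbert_solution dl u0 (ereal T) u" and s: "0 <= s" "s < T"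
  and B: "(%x. u x s) \<in> Hball dl N" and time: "T - s < short_time dl N"
 shows "\<exists>S v. ereal T < S & burgers_hilbert_solution dl u0 S v & (\<forall>t\<in>time_interval (ereal T). \<forall>x. v x t = u x t)"
proof -
 define b where "b = s + short_time dl N"
 have b: "T < b" "s < b" "b - s <= short_time dl N" using time s by (auto simp: b_def)
 have sb: "s <= b" using b by simp
 have N: "0 <= N" by (rule Hball_nonneg[OF B])
 obtain w where w: "bsol dl (2 * N + 1) s b w" "!!x. w x s = u x s" using local_existence[OF dl B sb b(3)] by blast
 have TI: "time_interval (ereal r) = {0..<r}" for r by (auto simp: time_interval_def)
 have agree: "w x t = u x t" if t: "s <= t" "t < T" for x t
 proof -
  have "0 <= t" "ereal t < ereal T" using t s by auto
  then obtain K where K: "bsol dl K 0 t u" by (rule solution_bsol[OF dl u])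
  define R where "R = max K (2 * N + 1)"
  have "bsol dl R s t u" by (rule bsol_mono[OF bsol_subinterval[OF K]]) (use s in \<open>auto simp: R_def\<close>)
  moreover have "bsol dl R s t w" by (rule bsol_mono[OF bsol_subinterval[OF w(1)]]) (use t b in \<open>auto simp: R_def\<close>)
  ultimately show ?thesis using bsol_unique[OF dl, of R s t w u t x] w(2) t by simp
 qed
 define v where "v x t = (if t <= s then u x t else w x t)" for x t
 have vu: "v x t = u x t" if "t < T" for x t using agree[of t x] that by (simp add: v_def)
 have vw: "v x t = w x t" if "s <= t" for x t using w(2)[of x] that by (auto simp: v_def)
 have at1: "at r within {0..<b} = at r within {0..<T}" if "r < T" for r
  by (rule at_within_nhd[of _ "{..<T}"]) (use that b in auto)
 have at2: "at r within {0..<b} = at r within {s..b}" if "s < r" "r < b" for r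
  by (rule at_within_nhd[of _ "{s<..<b}"]) (use that s in auto)
 have slices: "\<forall>t\<in>{0..<T}. (%x. u x t) \<in> L2_space \<inter> C1_holder dl"
  and cont: "\<forall>q\<in>{0..<T}. ((%t. C1_holder_norm dl (%x. u x t - u x q)) \<longlongrightarrow> 0) (at q within {0..<T})"
  and init: "\<forall>x. u x 0 = u0 x"
  and pde: "\<forall>t\<in>{0..<T}. \<forall>x. ((%\<tau>. u x \<tau>) has_real_derivative
    hilbert_transform (%y. u y t) x - u x t * deriv (%y. u y t) x) (at t within {0..<T})"
  using u unfolding burgers_hilbert_solution_def TI by blast+
 have "((%t. C1_holder_norm dl (%x. w x t - w x s)) \<longlongrightarrow> 0) (at s within {s..b})"
 proof -
  have "((%t. C1_holder_norm dl (%x. u x t - u x s)) \<longlongrightarrow> 0) (at s within {s..<T})"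
   by (rule tendsto_within_subset[OF cont[rule_format]]) (use s in auto)
  then have "((%t. C1_holder_norm dl (%x. w x t - w x s)) \<longlongrightarrow> 0) (at s within {s..<T})"
   by (rule Lim_transform_eventually) (auto simp: eventually_at_filter agree s)
  moreover have "at s within {s..b} = at s within {s..<T}" by (rule at_within_nhd[of _ "{..<T}"]) (use s b in auto)
  ultimately show ?thesis by simp
 qed
 note wc = bsol_norm_continuous[OF dl N b(2,3) w(1) this]
 have "burgers_hilbert_solution dl u0 (ereal b) v"
  unfolding burgers_hilbert_solution_def TI
 proof (intro conjI ballI allI)
  show "0 < ereal b" using b s by simp
  show "v x 0 = u0 x" for x using init s by (simp add: v_def)
  fix t assume t: "t \<in> {0..<b}"
  consider "t < T" | "T <= t" by linarith
  note cases = this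
  have tw: "t \<in> {s..b}" if "T <= t" using that t s by auto
  have wH: "(%x. w x t) \<in> Hball dl (2 * N + 1)" if "T <= t" by (rule bsol_Hball[OF w(1) tw[OF that]])
  show "(%x. v x t) \<in> L2_space \<inter> C1_holder dl"
  proof (rule cases)
   assume "t < T" then show ?thesis using slices t by (simp add: vu)
  next
   assume "T <= t" then show ?thesis using Hball_C1_holder(1)[OF wH] s by (simp add: vw)
  qed
  show "((%r. C1_holder_norm dl (%x. v x r - v x t)) \<longlongrightarrow> 0) (at t within {0..<b})"
  proof (rule cases)
   assume T: "t < T"
   have "((%r. C1_holder_norm dl (%x. u x r - u x t)) \<longlongrightarrow> 0) (at t within {0..<T})" using cont t T by simp
   then show ?thesis unfolding at1[OF T]
    by (rule Lim_transform_eventually) (auto simp: eventually_at_filter vu T)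
  next
   assume T: "T <= t"
   have st: "s < t" "t < b" using T s t by auto
   show ?thesis unfolding at2[OF st]
    by (rule Lim_transform_eventually[OF wc[OF tw[OF T]]]) (use st in \<open>auto simp: eventually_at_filter vw\<close>)
  qed
  fix x
  show "((%\<tau>. v x \<tau>) has_real_derivative hilbert_transform (%y. v y t) x - v x t * deriv (%y. v y t) x) (at t within {0..<b})"
  proof (rule cases)
   assume T: "t < T"
   have tT: "t \<in> {0..<T}" using t T by simp
   have "((%\<tau>. v x \<tau>) has_real_derivative hilbert_transform (%y. u y t) x - u x t * deriv (%y. u y t) x) (at t within {0..<T})"
    by (rule has_field_derivative_transform_within[OF pde[rule_format, OF tT] zero_less_one tT]) (simp add: vu)
   then show ?thesis unfolding at1[OF T] by (simp add: vu T)
  next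
   assume T: "T <= t"
   have st: "s < t" "t < b" using T s t by auto
   interpret pv_bounded "%y. w y t" "12 * (2 * N + 1)" by (rule Hball_pv_bounded[OF wH[OF T]])
   have "((%\<tau>. v x \<tau>) has_real_derivative uH w x t - w x t * ux w x t) (at t within {s..b})"
    by (rule has_field_derivative_transform_within[OF bsol_derivative[OF w(1) tw[OF T]] zero_less_one tw[OF T]]) (simp add: vw)
   then show ?thesis unfolding at2[OF st] using st by (simp add: vw hilbert_transform_eq_hil[OF L2 int])
  qed
 qed
 then show ?thesis using b(1) vu by (intro exI[of _ "ereal b"] exI[of _ v]) (auto simp: TI)
qed

theorem theorem2p1:
 fixes \<delta> \<beta>0 :: real
  and u0 :: "real \<Rightarrow> real"
  and u :: "real \<Rightarrow> real \<Rightarrow> real"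
  and Tmax :: ereal
 assumes "0 < \<delta>" and "\<delta> < 1"
  and "u0 \<in> L2_space \<inter> C1_holder \<delta>"
  and "hilbert_transform u0 \<beta>0 > 0"
  and "u0 \<beta>0 \<ge> (32 * pi * (L2_norm u0)\<^sup>2) powr (1 / 3)"
  and "maximal_burgers_hilbert_solution \<delta> u0 Tmax u"
 shows "\<exists>T::real. Tmax = ereal T \<and>
     filterlim (\<lambda>t. C1_holder_norm \<delta> (\<lambda>x. u x t)) at_top (at_left T)"
proof -
 note \<delta> = assms(1,2)
 have u: "burgers_hilbert_solution \<delta> u0 Tmax u"
  and max: "\<not> (\<exists>S v. Tmax < S \<and> burgers_hilbert_solution \<delta> u0 S v \<and> (\<forall>t\<in>time_interval Tmax. \<forall>x. v x t = u x t))"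
  using assms(6) unfolding maximal_burgers_hilbert_solution_def by blast+
 have "Tmax \<noteq> \<infinity>" by (rule lifespan_finite[OF \<delta> assms(3-5) u])
 moreover have "0 < Tmax" using u unfolding burgers_hilbert_solution_def by blast
 ultimately obtain T where T: "Tmax = ereal T" "0 < T" by (cases Tmax) auto
 note u = u[unfolded T(1)]
 have "filterlim (\<lambda>t. C1_holder_norm \<delta> (\<lambda>x. u x t)) at_top (at_left T)"
 proof (rule ccontr)
  assume "\<not> ?thesis"
  then obtain Z where Z: "\<not> (\<forall>\<^sub>F t in at_left T. Z \<le> C1_holder_norm \<delta> (\<lambda>x. u x t))" unfolding filterlim_at_top by blast
  define N where "N = max Z (L2_norm u0)"
  have N: "0 \<le> N" using L2_norm_nonneg[of u0] unfolding N_def by linarith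
  have "0 < short_time \<delta> N" using short_time(1)[OF \<delta> N order.refl, of 0] N Lam_const_pos[OF \<delta>] by (simp add: short_time_def)
  then have "max 0 (T - short_time \<delta> N) < T" using T(2) by simp
  with Z obtain s where s: "max 0 (T - short_time \<delta> N) < s" "s < T" "C1_holder_norm \<delta> (\<lambda>x. u x s) < Z"
   unfolding eventually_at_left[OF T(2)] by (meson not_le)
  have s0: "0 \<le> s" "ereal s < ereal T" using s by auto
  have "(\<lambda>x. u x s) \<in> Hball \<delta> N"
  proof (rule Hball_of_norms)
   show "(\<lambda>x. u x s) \<in> L2_space \<inter> C1_holder \<delta>" by (rule solution_slice[OF \<delta> u]) (use s0 in \<open>simp add: time_interval_def\<close>)
   show "C1_holder_norm \<delta> (\<lambda>x. u x s) \<le> N" using s(3) by (simp add: N_def)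
   show "L2_norm (\<lambda>x. u x s) \<le> N" unfolding solution_L2_norm[OF \<delta> u s0] by (simp add: N_def)
  qed
  from solution_extends[OF \<delta> u s0(1) s(2) this] s(1) show False using max by (simp add: T(1))
 qed
 then show ?thesis using T(1) by blast
qed

end
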